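(* Assume $K_h^\star\neq\emptyset$ and let $\mathbf u_h^{rt}\in K_h^\star$ be the unique maximizer of $D_h^{rt}$ over $K_h^\star$. Then: (i) The minimization of $I_h^{cr}$ over $\mathcal S^{1,cr}(\mathcal T_h)$ is the Fenchel predual problem of the maximization of $D_h^{rt}$ over $\mathcal{RT}^0(\mathcal T_h)$, in the sense specified in the context. (ii) There exists a minimizer $p_h^{cr}\in K_h$ of $I_h^{cr}$, unique if $|\Gamma_D|>0$, and the discrete strong duality relation $I_h^{cr}(p_h^{cr})=D_h^{rt}(\mathbf u_h^{rt})$ holds. (iii) The following optimality conditions hold: $$\Pi_h\mathbf u_h^{rt}=-\mathbf K_h\nabla_hp_h^{cr},\qquad\langle\mathbf u_h^{rt}\cdot\mathbf n,\pi_hp_h^{cr}\rangle_{\Gamma_C}=\langle\beta_h,(\pi_hp_h^{cr})^+\rangle_{\Gamma_C}-\langle\alpha_h,(\pi_hp_h^{cr})^-\rangle_{\Gamma_C}.$$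
   Context: Setting. $\Omega\subset\mathbb R^d$, $d\in\{2,3\}$, is an open, bounded, polyhedral Lipschitz domain with outward unit normal $\mathbf n$; $\partial\Omega=\overline{\Gamma_D}\cup\overline{\Gamma_C}$ with $\Gamma_D,\Gamma_C$ relatively open and disjoint. Data: $f\in L^2(\Omega)$; $p_D\in H^{1/2}(\Gamma_D)$ (restrictions to $\Gamma_D$ of traces of $H^1(\Omega)$ functions); $\mathbf K:\Omega\to\mathbb R^{d\times d}$ measurable, symmetric, with $k_0|\xi|^2\le\xi^T\mathbf K(x)\xi\le k_1|\xi|^2$ for all $x,\xi$ and some $0<k_0<k_1$; $\alpha,\beta\in L^2(\Gamma_C)$ with $\alpha\le\beta$ a.e.; if $\Gamma_D=\emptyset$, then $\int_{\Gamma_C}\alpha\,ds\le\int_\Omega f\,dx\le\int_{\Gamma_C}\beta\,ds$. $(\cdot,\cdot)_\Omega$ and $\langle\cdot,\cdot\rangle_\omega$ denote $L^2$ inner products; $q^+=\max(0,q)$, $q^-=\max(0,-q)$. Mesh. $\mathcal T_h$ is a conforming simplicial triangulation of $\Omega$ with facets $\mathcal S_h$; every boundary facet is contained in exactly one of $\overline{\Gamma_D},\overline{\Gamma_C}$, and $\mathcal S_h^D,\mathcal S_h^C$ are the corresponding sets of boundary facets. $x_S$ is the barycenter of $S$. $\mathcal L^0(\mathcal T_h)$ is the space of elementwise constants; $\Pi_h$ and $\pi_h$ are the elementwise and facetwise $L^2$-projections onto constants (componentwise for vectors and matrices); $\nabla_h$ is the elementwise gradient. Spaces. $\mathcal{RT}^0(\mathcal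 T_h)=\{\mathbf v_h\in H(\mathrm{div};\Omega):\mathbf v_h|_T\in\mathbb P^0(T)^d\oplus\mathbf x\,\mathbb P^0(T)\ \forall T\in\mathcal T_h\}$ (lowest-order Raviart–Thomas). $\mathcal S^{1,cr}(\mathcal T_h)$ is the Crouzeix–Raviart space of elementwise affine functions continuous at barycenters of interior facets, with basis $\varphi_S$, $\varphi_S(x_{S'})=\delta_{S,S'}$. $\Pi_h^{cr}q=\sum_{S\in\mathcal S_h}\big(\tfrac1{|S|}\int_Sq\,ds\big)\varphi_S$ for $q\in H^1(\Omega)$. Discrete data. $\mathbf K_h=\Pi_h\mathbf K$, $f_h=\Pi_hf$, $\alpha_h=\pi_h\alpha$, $\beta_h=\pi_h\beta$, $p_D^h=\Pi_h^{cr}\widehat p_D$ with $\widehat p_D\in H^1(\Omega)$ any fixed function whose trace on $\Gamma_D$ is $p_D$. Admissible sets and energies. $$K_h^\star=\{\mathbf v_h\in\mathcal{RT}^0(\mathcal T_h):\mathrm{div}\,\mathbf v_h=f_h\text{ in }\Omega,\ \alpha_h\le\mathbf v_h\cdot\mathbf n\le\beta_h\text{ on every }S\in\mathcal S_h^C\},$$ $$K_h=\{q_h\in\mathcal S^{1,cr}(\mathcal T_h):q_h(x_S)=p_D^h(x_S)\ \forall S\in\mathcal S_h^D\}.$$ $D_h^{rt}(\mathbf v_h)=-\tfrac12\|\mathbf K_h^{-1/2}\Pi_h\mathbf v_h\|_{L^2(\Omega)}^2-\langle p_D^h,\mathbf v_h\cdot\mathbf n\rangle_{\Gamma_D}$ for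 $\mathbf v_h\in K_h^\star$ and $-\infty$ for $\mathbf v_h\in\mathcal{RT}^0(\mathcal T_h)\setminus K_h^\star$. For $q_h\in\mathcal S^{1,cr}(\mathcal T_h)$, $$I_h^{cr}(q_h)=\tfrac12\|\mathbf K_h^{1/2}\nabla_hq_h\|_{L^2(\Omega)}^2-(f_h,\Pi_hq_h)_\Omega+\langle\beta_h,(\pi_hq_h)^+\rangle_{\Gamma_C}-\langle\alpha_h,(\pi_hq_h)^-\rangle_{\Gamma_C}+I_{K_h}(q_h),$$ with $I_{K_h}=0$ on $K_h$ and $+\infty$ elsewhere. Fenchel predual (meaning of (i)). Write $I_h^{cr}(q_h)=G_h(\nabla_hq_h)+F_h(q_h)$ with $G_h(\mathbf z_h)=\tfrac12\|\mathbf K_h^{1/2}\mathbf z_h\|_{L^2(\Omega)}^2$ on $(\mathcal L^0(\mathcal T_h))^d$ and $F_h$ collecting the remaining terms. Let $G_h^*(\mathbf z_h)=\sup_{\mathbf w_h\in(\mathcal L^0(\mathcal T_h))^d}\{(\mathbf z_h,\mathbf w_h)_\Omega-G_h(\mathbf w_h)\}$ and $F_h^*(\nabla_h^*\mathbf z_h)=\sup_{q_h\in\mathcal S^{1,cr}(\mathcal T_h)}\{(\mathbf z_h,\nabla_hq_h)_\Omega-F_h(q_h)\}$. Statement (i) means that the Fenchel dual of minimizing $I_h^{cr}$, i.e. maximizing $\mathbf z_h\mapsto-G_h^*(-\mathbf z_h)-F_h^*(\nabla_h^*\mathbf z_h)$ over $(\mathcal L^0(\mathcal T_h))^d$, is the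 maximization of $D_h^{rt}$ under the identification $\mathbf z_h=\Pi_h\mathbf v_h$: for every $\mathbf z_h\in(\mathcal L^0(\mathcal T_h))^d$, $-G_h^*(-\mathbf z_h)-F_h^*(\nabla_h^*\mathbf z_h)=\sup\{D_h^{rt}(\mathbf v_h):\mathbf v_h\in\mathcal{RT}^0(\mathcal T_h),\ \Pi_h\mathbf v_h=\mathbf z_h\}$, with $\sup\emptyset=-\infty$. *)

theory Defs
  imports "HOL-Analysis.Analysis"
begin

subsection \<open>Domain, Sobolev spaces\<close>

definition lipschitz_boundary :: "'a::euclidean_space set \<Rightarrow> bool" where
  "lipschitz_boundary \<Omega> \<longleftrightarrow>
    (\<forall>x\<in>frontier \<Omega>. \<exists>e r \<gamma> L. norm e = 1 \<and> r > 0 \<and> L-lipschitz_on UNIV (\<gamma> :: 'a \<Rightarrow> real) \<and>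
      \<Omega> \<inter> ball x r = {y \<in> ball x r. y \<bullet> e > \<gamma> (y - (y \<bullet> e) *\<^sub>R e)})"

definition polyhedral_lipschitz_domain :: "'a::euclidean_space set \<Rightarrow> bool" where
  "polyhedral_lipschitz_domain \<Omega> \<longleftrightarrow>
    open \<Omega> \<and> connected \<Omega> \<and> \<Omega> \<noteq> {} \<and> bounded \<Omega> \<and> lipschitz_boundary \<Omega> \<and>
    (\<exists>\<P>. finite \<P> \<and> (\<forall>P\<in>\<P>. polytope P) \<and> closure \<Omega> = \<Union>\<P>)"

definition L2 :: "'a measure \<Rightarrow> ('a \<Rightarrow> 'b::{real_normed_vector,second_countable_topology}) \<Rightarrow> bool" where
  "L2 M g \<longleftrightarrow> g \<in> borel_measurable M \<and> integrable M (\<lambda>x. (norm (g x))\<^sup>2)"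

definition ip :: "'a::euclidean_space set \<Rightarrow> ('a \<Rightarrow> 'b::real_inner) \<Rightarrow> ('a \<Rightarrow> 'b) \<Rightarrow> real" where
  "ip \<Omega> g h = (LINT x|lebesgue_on \<Omega>. g x \<bullet> h x)"

definition grad :: "(real^'n \<Rightarrow> real) \<Rightarrow> real^'n \<Rightarrow> real^'n" where
  "grad q x = (\<chi> i. frechet_derivative q (at x) (axis i 1))"

definition C1 :: "(real^'n \<Rightarrow> real) set" where
  "C1 = {\<phi>. (\<forall>x. \<phi> differentiable (at x)) \<and> continuous_on UNIV (grad \<phi>)}"

definition test_functions :: "(real^'n) set \<Rightarrow> (real^'n \<Rightarrow> real) set" where
  "test_functions \<Omega> = {\<phi> \<in> C1. compact (closure {x. \<phi> x \<noteq> 0}) \<and> closure {x. \<phi> x \<noteq> 0} \<subseteq> \<Omega>}"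

definition has_weak_grad :: "(real^'n) set \<Rightarrow> (real^'n \<Rightarrow> real) \<Rightarrow> (real^'n \<Rightarrow> real^'n) \<Rightarrow> bool" where
  "has_weak_grad \<Omega> u g \<longleftrightarrow>
    (\<forall>\<phi>\<in>test_functions \<Omega>.
      (LINT x|lebesgue_on \<Omega>. u x *\<^sub>R grad \<phi> x) = - (LINT x|lebesgue_on \<Omega>. \<phi> x *\<^sub>R g x))"

definition has_weak_div :: "(real^'n) set \<Rightarrow> (real^'n \<Rightarrow> real^'n) \<Rightarrow> (real^'n \<Rightarrow> real) \<Rightarrow> bool" where
  "has_weak_div \<Omega> v g \<longleftrightarrow> (\<forall>\<phi>\<in>test_functions \<Omega>. ip \<Omega> v (grad \<phi>) = - ip \<Omega> g \<phi>)"

definition H1 :: "(real^'n) set \<Rightarrow> (real^'n \<Rightarrow> real) set" where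
  "H1 \<Omega> = {u. L2 (lebesgue_on \<Omega>) u \<and> (\<exists>g. L2 (lebesgue_on \<Omega>) g \<and> has_weak_grad \<Omega> u g)}"

definition Hdiv :: "(real^'n) set \<Rightarrow> (real^'n \<Rightarrow> real^'n) set" where
  "Hdiv \<Omega> = {v. L2 (lebesgue_on \<Omega>) v \<and> (\<exists>g. L2 (lebesgue_on \<Omega>) g \<and> has_weak_div \<Omega> v g)}"

subsection \<open>Meshes\<close>

definition conforming_mesh :: "(real^'n) set \<Rightarrow> (real^'n) set set \<Rightarrow> bool" where
  "conforming_mesh \<Omega> \<T> \<longleftrightarrow>
    triangulation \<T> \<and> (\<forall>T\<in>\<T>. int CARD('n) simplex T) \<and> \<Union>\<T> = closure \<Omega>"

definition mesh_facets :: "'a::euclidean_space set set \<Rightarrow> 'a set set" where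
  "mesh_facets \<T> = {S. \<exists>T\<in>\<T>. S facet_of T}"

definition bdry_facets :: "'a::euclidean_space set \<Rightarrow> 'a set set \<Rightarrow> 'a set set" where
  "bdry_facets \<Omega> \<T> = {S \<in> mesh_facets \<T>. S \<subseteq> frontier \<Omega>}"

definition bdry_facets_in :: "'a::euclidean_space set \<Rightarrow> 'a set set \<Rightarrow> 'a set \<Rightarrow> 'a set set" where
  "bdry_facets_in \<Omega> \<T> \<Gamma> = {S \<in> bdry_facets \<Omega> \<T>. S \<subseteq> closure \<Gamma>}"

definition barycenter :: "'a::euclidean_space set \<Rightarrow> 'a" where
  "barycenter S = (\<Sum>v | v extreme_point_of S. v) /\<^sub>R real (card {v. v extreme_point_of S})"

definition outer_normal :: "'a::euclidean_space set \<Rightarrow> 'a set \<Rightarrow> 'a" where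
  "outer_normal \<Omega> S = (THE \<nu>. norm \<nu> = 1 \<and> (\<forall>x\<in>S. \<forall>y\<in>S. \<nu> \<bullet> (x - y) = 0) \<and>
    (\<forall>x\<in>rel_interior S. \<exists>\<epsilon>>0. \<forall>t. 0 < t \<and> t < \<epsilon> \<longrightarrow>
        x - t *\<^sub>R \<nu> \<in> \<Omega> \<and> x + t *\<^sub>R \<nu> \<notin> closure \<Omega>))"

text \<open>
  The surface measure on a flat facet \<open>S\<close>: the measure of \<open>A \<subseteq> S\<close> is the volume of the right
  prism of height one over \<open>A\<close>, that is, the push-forward of Lebesgue measure on the prism over
  \<open>S\<close> under the orthogonal projection onto the hyperplane of \<open>S\<close>.  As for \<^const>\<open>lebesgue\<close>, the
  measure is completed, so that integrands need only make sense almost everywhere.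
\<close>

definition prism :: "'a::euclidean_space set \<Rightarrow> 'a set" where
  "prism S = (let \<nu> = (SOME \<nu>. norm \<nu> = 1 \<and> (\<forall>x\<in>S. \<forall>y\<in>S. \<nu> \<bullet> (x - y) = 0))
              in {x + t *\<^sub>R \<nu> | x t. x \<in> S \<and> 0 \<le> t \<and> t \<le> 1})"

definition facet_measure :: "'a::euclidean_space set \<Rightarrow> 'a measure" where
  "facet_measure S =
    completion (distr (restrict_space lborel (prism S)) borel (closest_point (affine hull S)))"

definition bdry_area :: "'a::euclidean_space set \<Rightarrow> 'a set set \<Rightarrow> 'a set \<Rightarrow> real" where
  "bdry_area \<Omega> \<T> \<Gamma> = (\<Sum>S\<in>bdry_facets \<Omega> \<T>. measure (facet_measure S) \<Gamma>)"

text \<open>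
  Functions on a part of the boundary are taken facet by facet: \<open>g S x\<close> is the value at \<open>x\<close> of
  the restriction to \<open>S\<close>.  Integrals over a boundary part \<open>\<Gamma>\<close> are sums over the boundary facets
  contained in \<open>closure \<Gamma>\<close>.
\<close>

definition facet_ip ::
    "'a::euclidean_space set set \<Rightarrow> ('a set \<Rightarrow> 'a \<Rightarrow> real) \<Rightarrow> ('a set \<Rightarrow> 'a \<Rightarrow> real) \<Rightarrow> real" where
  "facet_ip \<S> g h = (\<Sum>S\<in>\<S>. LINT x|facet_measure S. g S x * h S x)"

definition facet_mean :: "('a::euclidean_space \<Rightarrow> real) \<Rightarrow> 'a set \<Rightarrow> 'a \<Rightarrow> real" where
  "facet_mean g S x = (LINT s|facet_measure S. g s) / measure (facet_measure S) S"

text \<open>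
  The trace on a mesh facet (boundary or interior) of an \<open>H\<^sup>1\<close> function is the \<open>L\<^sup>2\<close> limit of the
  restrictions of \<open>C\<^sup>1\<close> functions converging to it in \<open>H\<^sup>1\<close>; it is determined up to null sets.
\<close>

definition has_facet_trace ::
    "(real^'n) set \<Rightarrow> (real^'n) set \<Rightarrow> (real^'n \<Rightarrow> real) \<Rightarrow> (real^'n \<Rightarrow> real) \<Rightarrow> bool" where
  "has_facet_trace \<Omega> S u g \<longleftrightarrow> L2 (lebesgue_on \<Omega>) u \<and> L2 (facet_measure S) g \<and>
    (\<exists>Du \<phi>. L2 (lebesgue_on \<Omega>) Du \<and> has_weak_grad \<Omega> u Du \<and> (\<forall>k::nat. \<phi> k \<in> C1) \<and>
      (\<lambda>k. LINT x|lebesgue_on \<Omega>. (\<phi> k x - u x)\<^sup>2) \<longlonglongrightarrow> 0 \<and>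
      (\<lambda>k. LINT x|lebesgue_on \<Omega>. (norm (grad (\<phi> k) x - Du x))\<^sup>2) \<longlonglongrightarrow> 0 \<and>
      (\<lambda>k. LINT x|facet_measure S. (\<phi> k x - g x)\<^sup>2) \<longlonglongrightarrow> 0)"

definition facet_trace :: "(real^'n) set \<Rightarrow> (real^'n) set \<Rightarrow> (real^'n \<Rightarrow> real) \<Rightarrow> real^'n \<Rightarrow> real" where
  "facet_trace \<Omega> S u = (SOME g. has_facet_trace \<Omega> S u g)"

subsection \<open>Elementwise polynomial functions\<close>

text \<open>
  Elementwise polynomial functions are classes modulo null sets.  Each class is represented by
  its member that is polynomial on the interior of every element and zero elsewhere, so that
  equality of functions is equality of classes.  Point values on the mesh skeleton, such as
  \<open>q\<^sub>h(x\<^sub>S)\<close> or \<open>v\<^sub>h \<cdot> n\<close>, are limits from the element interiors.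
\<close>

definition mesh_int :: "'a::euclidean_space set set \<Rightarrow> 'a set" where
  "mesh_int \<T> = (\<Union>T\<in>\<T>. interior T)"

definition skel_val :: "'a::euclidean_space set set \<Rightarrow> ('a \<Rightarrow> 'b::t2_space) \<Rightarrow> 'a \<Rightarrow> 'b" where
  "skel_val \<T> q x = Lim (at x within mesh_int \<T>) q"

definition elem_mean ::
    "'a::euclidean_space set set \<Rightarrow> ('a \<Rightarrow> 'b::{banach,second_countable_topology}) \<Rightarrow> 'a \<Rightarrow> 'b" where
  "elem_mean \<T> g x = (\<Sum>T\<in>\<T>. indicat_real (interior T) x *\<^sub>R
      ((LINT y|lebesgue_on (interior T). g y) /\<^sub>R measure lebesgue (interior T)))"

definition elem_grad :: "(real^'n) set set \<Rightarrow> (real^'n \<Rightarrow> real) \<Rightarrow> real^'n \<Rightarrow> real^'n" where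
  "elem_grad \<T> q x = (if x \<in> mesh_int \<T> then grad q x else 0)"

definition P0 :: "'a::euclidean_space set set \<Rightarrow> ('a \<Rightarrow> 'b::real_vector) set" where
  "P0 \<T> = {z. (\<forall>T\<in>\<T>. \<exists>c. \<forall>x\<in>interior T. z x = c) \<and> (\<forall>x. x \<notin> mesh_int \<T> \<longrightarrow> z x = 0)}"

definition RT0 :: "(real^'n) set \<Rightarrow> (real^'n) set set \<Rightarrow> (real^'n \<Rightarrow> real^'n) set" where
  "RT0 \<Omega> \<T> = {v \<in> Hdiv \<Omega>. (\<forall>T\<in>\<T>. \<exists>a b. \<forall>x\<in>interior T. v x = a + b *\<^sub>R x) \<and>
      (\<forall>x. x \<notin> mesh_int \<T> \<longrightarrow> v x = 0)}"

definition CR :: "(real^'n) set \<Rightarrow> (real^'n) set set \<Rightarrow> (real^'n \<Rightarrow> real) set" where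
  "CR \<Omega> \<T> = {q. (\<forall>T\<in>\<T>. \<exists>a b. \<forall>x\<in>interior T. q x = a + b \<bullet> x) \<and>
      (\<forall>x. x \<notin> mesh_int \<T> \<longrightarrow> q x = 0) \<and>
      (\<forall>S\<in>mesh_facets \<T> - bdry_facets \<Omega> \<T>. \<exists>l. (q \<longlongrightarrow> l) (at (barycenter S) within mesh_int \<T>))}"

definition cr_basis :: "(real^'n) set \<Rightarrow> (real^'n) set set \<Rightarrow> (real^'n) set \<Rightarrow> real^'n \<Rightarrow> real" where
  "cr_basis \<Omega> \<T> S = (THE \<phi>. \<phi> \<in> CR \<Omega> \<T> \<and>
      (\<forall>S'\<in>mesh_facets \<T>. skel_val \<T> \<phi> (barycenter S') = (if S' = S then 1 else 0)))"

definition cr_interpolant :: "(real^'n) set \<Rightarrow> (real^'n) set set \<Rightarrow> (real^'n \<Rightarrow> real) \<Rightarrow> real^'n \<Rightarrow> real" where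
  "cr_interpolant \<Omega> \<T> q x = (\<Sum>S\<in>mesh_facets \<T>.
      (LINT s|facet_measure S. facet_trace \<Omega> S q s) / measure (facet_measure S) S * cr_basis \<Omega> \<T> S x)"

definition normal_flux ::
    "(real^'n) set \<Rightarrow> (real^'n) set set \<Rightarrow> (real^'n \<Rightarrow> real^'n) \<Rightarrow> (real^'n) set \<Rightarrow> real^'n \<Rightarrow> real" where
  "normal_flux \<Omega> \<T> v S x = skel_val \<T> v x \<bullet> outer_normal \<Omega> S"

text \<open>\<open>\<pi>\<^sub>h q\<^sub>h\<close> on the boundary facets, and its positive and negative parts.\<close>

definition cr_facet_mean ::
    "(real^'n) set set \<Rightarrow> (real^'n \<Rightarrow> real) \<Rightarrow> (real^'n) set \<Rightarrow> real^'n \<Rightarrow> real" where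
  "cr_facet_mean \<T> q = facet_mean (skel_val \<T> q)"

definition pos_part :: "('b \<Rightarrow> 'a \<Rightarrow> real) \<Rightarrow> 'b \<Rightarrow> 'a \<Rightarrow> real" where
  "pos_part g S x = max 0 (g S x)"

definition neg_part :: "('b \<Rightarrow> 'a \<Rightarrow> real) \<Rightarrow> 'b \<Rightarrow> 'a \<Rightarrow> real" where
  "neg_part g S x = max 0 (- g S x)"

subsection \<open>Admissible sets and energies\<close>

text \<open>The positive semidefinite square root of a symmetric positive semidefinite matrix.\<close>

definition mat_sqrt :: "real^'n^'n \<Rightarrow> real^'n^'n" where
  "mat_sqrt A = (THE B. transpose B = B \<and> (\<forall>\<xi>. 0 \<le> \<xi> \<bullet> (B *v \<xi>)) \<and> B ** B = A)"

text \<open>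
  Arguments, throughout: \<open>\<S>\<^sub>D\<close>, \<open>\<S>\<^sub>C\<close> are the facets on the two boundary parts; \<open>Kh\<close>, \<open>fh\<close>, \<open>\<alpha>h\<close>,
  \<open>\<beta>h\<close>, \<open>ph\<close> are the discrete data.  The normal flux of an \<^const>\<open>RT0\<close> function is constant on the
  relative interior of a boundary facet; on lower-dimensional faces, where other elements may
  meet, \<^const>\<open>skel_val\<close> need not be meaningful.
\<close>

definition K_star where
  "K_star \<Omega> \<T> \<S>\<^sub>C fh \<alpha>h \<beta>h = {v \<in> RT0 \<Omega> \<T>. has_weak_div \<Omega> v fh \<and>
      (\<forall>S\<in>\<S>\<^sub>C. \<forall>x\<in>rel_interior S.
          \<alpha>h S x \<le> normal_flux \<Omega> \<T> v S x \<and> normal_flux \<Omega> \<T> v S x \<le> \<beta>h S x)}"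

definition K_cr where
  "K_cr \<Omega> \<T> \<S>\<^sub>D ph = {q \<in> CR \<Omega> \<T>.
      \<forall>S\<in>\<S>\<^sub>D. skel_val \<T> q (barycenter S) = skel_val \<T> ph (barycenter S)}"

definition D_rt :: "_ \<Rightarrow> _ \<Rightarrow> _ \<Rightarrow> _ \<Rightarrow> _ \<Rightarrow> _ \<Rightarrow> _ \<Rightarrow> _ \<Rightarrow> _ \<Rightarrow> (real^'n \<Rightarrow> real^'n) \<Rightarrow> ereal" where
  "D_rt \<Omega> \<T> \<S>\<^sub>D \<S>\<^sub>C Kh fh \<alpha>h \<beta>h ph v =
    (if v \<in> K_star \<Omega> \<T> \<S>\<^sub>C fh \<alpha>h \<beta>h
     then ereal (- 1/2 * (LINT x|lebesgue_on \<Omega>. (norm (matrix_inv (mat_sqrt (Kh x)) *v elem_mean \<T> v x))\<^sup>2)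
                 - facet_ip \<S>\<^sub>D (\<lambda>S. skel_val \<T> ph) (normal_flux \<Omega> \<T> v))
     else - \<infinity>)"

definition G_h :: "_ \<Rightarrow> _ \<Rightarrow> (real^'n \<Rightarrow> real^'n) \<Rightarrow> real" where
  "G_h \<Omega> Kh z = 1/2 * (LINT x|lebesgue_on \<Omega>. (norm (mat_sqrt (Kh x) *v z x))\<^sup>2)"

definition F_h :: "_ \<Rightarrow> _ \<Rightarrow> _ \<Rightarrow> _ \<Rightarrow> _ \<Rightarrow> _ \<Rightarrow> _ \<Rightarrow> _ \<Rightarrow> (real^'n \<Rightarrow> real) \<Rightarrow> ereal" where
  "F_h \<Omega> \<T> \<S>\<^sub>D \<S>\<^sub>C fh \<alpha>h \<beta>h ph q =
    ereal (- ip \<Omega> fh (elem_mean \<T> q)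
           + facet_ip \<S>\<^sub>C \<beta>h (pos_part (cr_facet_mean \<T> q))
           - facet_ip \<S>\<^sub>C \<alpha>h (neg_part (cr_facet_mean \<T> q)))
    + (if q \<in> K_cr \<Omega> \<T> \<S>\<^sub>D ph then 0 else \<infinity>)"

definition I_cr where
  "I_cr \<Omega> \<T> \<S>\<^sub>D \<S>\<^sub>C Kh fh \<alpha>h \<beta>h ph q =
    ereal (G_h \<Omega> Kh (elem_grad \<T> q)) + F_h \<Omega> \<T> \<S>\<^sub>D \<S>\<^sub>C fh \<alpha>h \<beta>h ph q"

definition G_conj where
  "G_conj \<Omega> \<T> Kh z = (SUP w\<in>P0 \<T>. ereal (ip \<Omega> z w - G_h \<Omega> Kh w))"

text \<open>\<open>F\<^sub>h\<^sup>*(\<nabla>\<^sub>h\<^sup>* z)\<close>, as a function of \<open>z\<close>.\<close>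

definition F_conj where
  "F_conj \<Omega> \<T> \<S>\<^sub>D \<S>\<^sub>C fh \<alpha>h \<beta>h ph z =
    (SUP q\<in>CR \<Omega> \<T>. ereal (ip \<Omega> z (elem_grad \<T> q)) - F_h \<Omega> \<T> \<S>\<^sub>D \<S>\<^sub>C fh \<alpha>h \<beta>h ph q)"

end

theory Submission
  imports Defs
begin

text \<open>
  Every object in the theorem is an elementwise polynomial, so the theorem is a statement about
  finitely many coefficients. A Crouzeix--Raviart function is determined by its values \<open>c\<^sub>S\<close> at
  the facet barycenters (\<open>CR_repr\<close>), and a Raviart--Thomas field with divergence \<open>f\<^sub>h\<close> by its
  element means \<open>\<zeta>\<^sub>T\<close>, because on \<open>T\<close> it is \<open>\<zeta>\<^sub>T + f\<^sub>T / d (x - x\<^sub>T)\<close> (\<open>K_star_iff\<close>). Let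
  \<open>R\<^sub>S(\<zeta>)\<close> be the sum, over the elements \<open>T\<close> at the facet \<open>S\<close>, of
  \<open>|T| (\<zeta>\<^sub>T \<bullet> \<nabla>\<phi>\<^sub>S + f\<^sub>T / (d + 1))\<close>. This is the total flux out of those elements through \<open>S\<close>:
  it vanishes at an interior facet exactly when the normal component does not jump, and on a
  boundary facet it is \<open>|S|\<close> times the normal component. By definition of \<open>R\<close>,
  \<open>(\<zeta>, \<nabla>\<^sub>h q) + (f\<^sub>h, \<Pi>\<^sub>h q)\<close> is the sum of \<open>c\<^sub>S R\<^sub>S(\<zeta>)\<close>, and for admissible \<open>c\<close> and \<open>\<zeta>\<close> this
  gives (\<open>duality_gap\<close>)

  \<open>I(c) - D(\<zeta>) = 1/2 \<Sum>\<^sub>T |T| |K\<^sup>1\<^sup>/\<^sup>2 \<nabla>c + K\<^sup>-\<^sup>1\<^sup>/\<^sup>2 \<zeta>|\<^sup>2 + \<Sum>\<^sub>S (\<psi>\<^sub>S(c\<^sub>S) - R\<^sub>S(\<zeta>) c\<^sub>S)\<close>,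

  where the last sum is over the contact facets, \<open>\<psi>\<^sub>S(t) = |S| (\<beta>\<^sub>S t\<^sup>+ - \<alpha>\<^sub>S t\<^sup>-)\<close>, and all
  summands are nonnegative. So \<open>D \<le> I\<close>, and equality means exactly the two optimality
  conditions. Varying one coefficient of a minimizer \<open>c\<close> at a time shows that \<open>\<zeta> = - K \<nabla>c\<close> is
  admissible and has no gap (\<open>minimizer_optimality\<close>); this is strong duality, and it makes \<open>\<zeta>\<close>
  the only maximizer. A minimizer exists (\<open>minimizer_exists\<close>): an admissible \<open>\<zeta>\<close> bounds the
  gradients on sublevel sets by the gap identity, the mesh is connected through facets, so that
  gradients control differences of coefficients (\<open>oscillation_bound\<close>), and if there is no
  Dirichlet facet, shifting all coefficients by a constant towards zero does not increase the
  energy. For the Fenchel conjugates one completes squares for \<open>G\<close> and varies single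
  coefficients for \<open>F\<close>: the supremum is finite exactly for admissible \<open>\<zeta>\<close> (\<open>F_conj_value\<close>).

  The analytic part is the description of Raviart--Thomas fields through fluxes, with the weak
  divergence tested by \<open>C\<^sup>1\<close> functions. The Gauss theorem on a simplex is replaced by the
  following device. The average of \<open>\<phi>\<close> over the facet opposite to a vertex \<open>p\<close> of \<open>T\<close> equals
  \<open>\<integral>\<^sub>T \<nabla>\<phi> \<bullet> (x - p) + d \<phi>\<close> up to the factor \<open>d |T|\<close>, so this volume integral serves as a
  definition (\<open>fmean\<close>). It depends only on the values of \<open>\<phi>\<close> on the facet
  (\<open>cone_integral_zero\<close>), and two elements with a common facet give the same number
  (\<open>fmean_shared_facet\<close>). An affine field of the above form is a linear combination of the
  fields \<open>x - p\<close>, hence integration by parts on \<open>T\<close> is linear algebra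
  (\<open>divergence_decomposition\<close>), and summing over the elements turns the weak divergence into a
  sum of fluxes times facet means (\<open>weak_divergence_identity\<close>). Bump functions centred in an
  element or in a facet single out one term. The surface measure enters only through
  \<open>|S| = d |T| |\<nabla>\<lambda>\<^sub>p|\<close> and the fact that an affine function has its barycenter value as mean
  over \<open>S\<close>; both come from reflections, shears and homotheties.
\<close>

section \<open>Lebesgue measure under affine maps\<close>

lemma nn_integral_lborel_translation:
  fixes h :: "'a::euclidean_space \<Rightarrow> ennreal"
  assumes [measurable]: "h \<in> borel_measurable borel"
  shows "(\<integral>\<^sup>+y. h (a + y) \<partial>lborel) = (\<integral>\<^sup>+y. h y \<partial>lborel)"
proof -
  have "lborel = distr lborel borel (\<lambda>x. a + x)"
    using lborel_affine[of 1 a] by (simp add: density_1)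
  then have "(\<integral>\<^sup>+y. h y \<partial>lborel) = (\<integral>\<^sup>+y. h y \<partial>(distr lborel borel (\<lambda>x. a + x)))" by simp
  also have "\<dots> = (\<integral>\<^sup>+y. h (a + y) \<partial>lborel)"
    by (rule nn_integral_distr) auto
  finally show ?thesis by simp
qed

text \<open>
  Integrating \<open>indicator X (x + y) * indicator B y\<close> over both variables, once in either order,
  and using invariance of the inner measure each time gives this symmetric form of the
  uniqueness of translation-invariant measures. For \<open>B\<close> the unit ball it says that \<open>M\<close> is a
  multiple of \<open>lborel\<close>.
\<close>
lemma translation_invariant_multiple_of_lborel:
  fixes M :: "'a::euclidean_space measure"
  assumes sets [measurable_cong]: "sets M = sets borel" and "sigma_finite_measure M"
    and trans: "\<And>a X. X \<in> sets borel \<Longrightarrow> emeasure M {x. x + a \<in> X} = emeasure M X"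
    and X [measurable]: "X \<in> sets borel" and B [measurable]: "B \<in> sets borel"
  shows "emeasure M X * emeasure lborel B = emeasure lborel X * emeasure M {x. - x \<in> B}"
proof -
  interpret M: sigma_finite_measure M by fact
  interpret pair_sigma_finite M "lborel :: 'a measure" ..
  have [simp]: "space M = UNIV" using sets_eq_imp_space_eq[OF sets] by simp
  have [simp]: "{x. x + y \<in> X} \<in> sets borel" "{x. y - x \<in> B} \<in> sets borel" for y :: 'a
    using measurable_sets[of "\<lambda>x. x + y" borel borel X] measurable_sets[of "\<lambda>x. y - x" borel borel B]
    by (auto simp: vimage_def)
  let ?k = "\<lambda>x y. indicator X (x + y) * indicator B y :: ennreal"
  have "(\<integral>\<^sup>+y. \<integral>\<^sup>+x. ?k x y \<partial>M \<partial>lborel) = (\<integral>\<^sup>+y. emeasure M X * indicator B y \<partial>lborel)"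
  proof (intro nn_integral_cong)
    fix y :: 'a
    have "(\<integral>\<^sup>+x. ?k x y \<partial>M) = (\<integral>\<^sup>+x. indicator {x. x + y \<in> X} x \<partial>M) * indicator B y"
      by (subst nn_integral_multc[symmetric]) (auto simp: indicator_def sets intro!: nn_integral_cong)
    also have "\<dots> = emeasure M X * indicator B y"
      by (subst nn_integral_indicator) (auto simp: sets trans)
    finally show "(\<integral>\<^sup>+x. ?k x y \<partial>M) = emeasure M X * indicator B y" .
  qed
  then have 1: "(\<integral>\<^sup>+y. \<integral>\<^sup>+x. ?k x y \<partial>M \<partial>lborel) = emeasure M X * emeasure lborel B"
    by (simp add: nn_integral_cmult)
  have 2: "(\<integral>\<^sup>+y. ?k x y \<partial>lborel) = (\<integral>\<^sup>+y. indicator X y * indicator B (y - x) \<partial>lborel)" for x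
    using nn_integral_lborel_translation[of "\<lambda>y. indicator X y * indicator B (y - x)" x] by simp
  have "(\<integral>\<^sup>+y. \<integral>\<^sup>+x. ?k x y \<partial>M \<partial>lborel) = (\<integral>\<^sup>+x. \<integral>\<^sup>+y. ?k x y \<partial>lborel \<partial>M)"
    by (rule Fubini') measurable
  also have "\<dots> = (\<integral>\<^sup>+x. \<integral>\<^sup>+y. indicator X y * indicator B (y - x) \<partial>lborel \<partial>M)"
    by (simp add: 2)
  also have "\<dots> = (\<integral>\<^sup>+y. \<integral>\<^sup>+x. indicator X y * indicator B (y - x) \<partial>M \<partial>lborel)"
    by (rule Fubini'[symmetric]) measurable
  also have "\<dots> = (\<integral>\<^sup>+y. indicator X y * emeasure M {x. - x \<in> B} \<partial>lborel)"
  proof (intro nn_integral_cong)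
    fix y :: 'a
    have "(\<integral>\<^sup>+x. indicator X y * indicator B (y - x) \<partial>M) = indicator X y * (\<integral>\<^sup>+x. indicator {x. y - x \<in> B} x \<partial>M)"
      by (subst nn_integral_cmult[symmetric]) (auto simp: indicator_def sets intro!: nn_integral_cong)
    also have "\<dots> = indicator X y * emeasure M {x. y - x \<in> B}"
      by (subst nn_integral_indicator) (auto simp: sets)
    also have "emeasure M {x. y - x \<in> B} = emeasure M {x. - x \<in> B}"
      using trans[of "{x. 0 - x \<in> B}" "- y"] by simp
    finally show "(\<integral>\<^sup>+x. indicator X y * indicator B (y - x) \<partial>M) = indicator X y * emeasure M {x. - x \<in> B}" .
  qed
  also have "\<dots> = emeasure lborel X * emeasure M {x. - x \<in> B}"
    by (simp add: nn_integral_multc)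
  finally show ?thesis using 1 by simp
qed

text \<open>
  The image of Lebesgue measure under an affine bijection is again invariant under translations,
  hence a multiple of it. The value of the factor is not computed: for the maps used below it
  follows from a symmetry, or cancels.
\<close>
lemma affine_bijection_scales_lborel:
  fixes f :: "'a::euclidean_space \<Rightarrow> 'a"
  assumes f: "linear f" "inj f"
  obtains c where "c > 0" "distr lborel borel (\<lambda>x. f x + t) = density lborel (\<lambda>_. ennreal c)"
proof -
  let ?A = "\<lambda>x. f x + t"
  let ?M = "distr lborel borel ?A"
  have bl: "bounded_linear f" using f by (simp add: linear_conv_bounded_linear)
  have cont: "continuous_on UNIV ?A"
    using bl by (intro continuous_intros linear_continuous_on)
  then have [measurable]: "?A \<in> borel_measurable borel" by (rule borel_measurable_continuous_onI)
  obtain g where g: "linear g" "g \<circ> f = id" "f \<circ> g = id"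
    using linear_injective_left_inverse[OF f] by (metis linear_inverse_left f(1))
  have gf: "g (f x) = x" "f (g x) = x" for x using g by (auto simp: fun_eq_iff)
  have M: "emeasure ?M X = emeasure lborel {x. ?A x \<in> X}" if "X \<in> sets borel" for X
    using that by (subst emeasure_distr) (auto simp: vimage_def)
  have fin: "emeasure ?M (ball 0 r) \<noteq> \<infinity>" for r
  proof -
    have "{x. ?A x \<in> ball 0 r} \<subseteq> g ` ((\<lambda>y. y - t) ` ball 0 r)"
    proof
      fix x assume "x \<in> {x. ?A x \<in> ball 0 r}"
      then show "x \<in> g ` ((\<lambda>y. y - t) ` ball 0 r)"
        by (intro image_eqI[of _ _ "f x"] image_eqI[of _ _ "f x + t"]) (auto simp: gf)
    qed
    moreover have "bounded (g ` ((\<lambda>y. y - t) ` ball 0 r))"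
      using g by (intro bounded_linear_image bounded_translation_minus) (auto simp: linear_conv_bounded_linear)
    ultimately have "bounded {x. ?A x \<in> ball 0 r}" by (rule bounded_subset[rotated])
    then have "emeasure lborel {x. ?A x \<in> ball 0 r} < \<infinity>" by (rule emeasure_bounded_finite)
    then show ?thesis using M[of "ball 0 r"] by simp
  qed
  have sf: "sigma_finite_measure ?M"
  proof
    show "\<exists>A. countable A \<and> A \<subseteq> sets ?M \<and> \<Union> A = space ?M \<and> (\<forall>a\<in>A. emeasure ?M a \<noteq> \<infinity>)"
    proof (intro exI[of _ "range (\<lambda>n::nat. ball 0 (real n))"] conjI ballI)
      show "\<Union> (range (\<lambda>n. ball 0 (real n))) = space ?M"
        by (auto simp: reals_Archimedean2)
      show "emeasure ?M a \<noteq> \<infinity>" if "a \<in> range (\<lambda>n::nat. ball 0 (real n))" for a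
        using that fin by blast
    qed auto
  qed
  have tr: "emeasure ?M {x. x + a \<in> X} = emeasure ?M X" if [measurable]: "X \<in> sets borel" for a X
  proof -
    have [measurable]: "{x. x + a \<in> X} \<in> sets borel" "{x. ?A x \<in> X} \<in> sets borel"
      using measurable_sets[of "\<lambda>x. x + a" borel borel X] measurable_sets[of ?A borel borel X]
      by (auto simp: vimage_def)
    have "emeasure ?M {x. x + a \<in> X} = emeasure lborel {x. g a + x \<in> {x. ?A x \<in> X}}"
      using f by (subst M) (auto simp: linear_add gf algebra_simps)
    also have "\<dots> = (\<integral>\<^sup>+y. indicator {x. g a + x \<in> {x. ?A x \<in> X}} y \<partial>lborel)"
      using measurable_sets[of "\<lambda>x. g a + x" borel borel "{x. ?A x \<in> X}"]
      by (subst nn_integral_indicator) (auto simp: vimage_def)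
    also have "\<dots> = (\<integral>\<^sup>+y. indicator {x. ?A x \<in> X} (g a + y) \<partial>lborel)"
      by (intro nn_integral_cong) (simp add: indicator_def)
    also have "\<dots> = emeasure lborel {x. ?A x \<in> X}"
      by (subst nn_integral_lborel_translation) (auto simp: borel_measurable_indicator)
    finally show ?thesis using M[of X] by simp
  qed
  let ?B = "ball 0 1 :: 'a set"
  have B: "{x. - x \<in> ?B} = ?B" by auto
  define c where "c = measure ?M ?B / measure lborel ?B"
  have lB: "measure lborel ?B > 0" "emeasure lborel ?B = ennreal (measure lborel ?B)"
    using emeasure_lborel_ball_finite[of "0::'a" 1] by (simp_all add: content_ball_pos emeasure_eq_ennreal_measure)
  have MB: "emeasure ?M ?B = ennreal (measure ?M ?B)"
    using fin[of 1] by (simp add: emeasure_eq_ennreal_measure)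
  have "emeasure ?M ?B \<noteq> 0"
  proof -
    have "open {x. ?A x \<in> ?B}"
      using open_vimage[OF open_ball cont, of 0 1] by (simp add: vimage_def)
    moreover have "g (- t) \<in> {x. ?A x \<in> ?B}" by (simp add: gf)
    ultimately have "\<not> negligible {x. ?A x \<in> ?B}" using open_not_negligible by blast
    moreover have "{x. ?A x \<in> ?B} \<in> sets borel"
      using \<open>open {x. ?A x \<in> ?B}\<close> by (rule borel_open)
    ultimately have "emeasure lborel {x. ?A x \<in> ?B} \<noteq> 0"
      by (auto simp: negligible_iff_null_sets null_sets_completion_iff null_sets_def)
    then show ?thesis using M[of ?B] by simp
  qed
  then have c: "c > 0" unfolding c_def using lB MB
    by (auto intro!: divide_pos_pos simp: less_le)
  have "emeasure ?M X = ennreal c * emeasure lborel X" if "X \<in> sets borel" for X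
  proof -
    have "emeasure ?M X * ennreal (measure lborel ?B) = emeasure lborel X * ennreal (measure ?M ?B)"
      using translation_invariant_multiple_of_lborel[OF _ sf tr that, of ?B] lB MB B by simp
    also have "measure ?M ?B = c * measure lborel ?B" using lB by (simp add: c_def)
    finally have "emeasure ?M X * ennreal (measure lborel ?B) = (ennreal c * emeasure lborel X) * ennreal (measure lborel ?B)"
      using c by (simp add: ennreal_mult mult_ac)
    then show ?thesis using lB ennreal_mult_cancel_left[of "ennreal (measure lborel ?B)"] by (simp add: mult.commute)
  qed
  then have "?M = density lborel (\<lambda>_. ennreal c)"
    by (intro measure_eqI) (auto simp: emeasure_density_const)
  with c that show ?thesis by blast
qed

lemma affine_integral_scale:
  fixes A :: "'a::euclidean_space \<Rightarrow> 'a"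
  assumes A: "A = (\<lambda>x. f x + t)" and f: "linear f" "inj f"
  obtains c where "c > 0"
    "\<And>(g :: 'a \<Rightarrow> real). g \<in> borel_measurable borel \<Longrightarrow> (LINT x|lborel. g (A x)) = c * (LINT x|lborel. g x)"
proof -
  obtain c where c: "c > 0" "distr lborel borel A = density lborel (\<lambda>_. ennreal c)"
    using affine_bijection_scales_lborel[OF f, of t] A by metis
  have [measurable]: "A \<in> borel_measurable borel" unfolding A
    using f by (intro borel_measurable_continuous_onI continuous_intros linear_continuous_on) (simp add: linear_conv_bounded_linear)
  have "(LINT x|lborel. g (A x)) = c * (LINT x|lborel. g x)" if [measurable]: "g \<in> borel_measurable borel" for g :: "'a \<Rightarrow> real"
  proof -
    have "(LINT x|lborel. g (A x)) = (LINT x|distr lborel borel A. g x)"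
      by (rule integral_distr[symmetric]) auto
    also have "\<dots> = (LINT x|lborel. c *\<^sub>R g x)" unfolding c(2)
      using c(1) by (subst integral_density) auto
    finally show ?thesis by simp
  qed
  with c that show ?thesis by blast
qed

text \<open>
  The map is an involution because \<open>n \<bullet> w = - 2\<close>, so its factor satisfies \<open>c\<^sup>2 = 1\<close>. Exchanging
  two vertices of a simplex while fixing the others is a map of this kind.
\<close>
lemma oblique_reflection_preserves_integral:
  fixes n w :: "'a::euclidean_space" and g :: "'a \<Rightarrow> real"
  assumes n: "n \<bullet> w = -2" and [measurable]: "g \<in> borel_measurable borel"
  shows "(LINT x|lborel. g (x + (n \<bullet> x + k) *\<^sub>R w)) = (LINT x|lborel. g x)"
proof -
  let ?A = "\<lambda>x. x + (n \<bullet> x + k) *\<^sub>R w"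
  let ?f = "\<lambda>x. x + (n \<bullet> x) *\<^sub>R w"
  have lin: "linear ?f" by (intro linearI) (auto simp: inner_add_right algebra_simps)
  have inv: "?A (?A x) = x" for x
    using n by (simp add: inner_add_right algebra_simps)
  have ff: "?f (?f x) = x" for x using n by (simp add: inner_add_right algebra_simps)
  have "inj ?f" by (rule inj_on_inverseI[of _ ?f]) (rule ff)
  have A: "?A = (\<lambda>x. ?f x + k *\<^sub>R w)" by (auto simp: algebra_simps)
  obtain c where c: "c > 0" "\<And>(g :: 'a \<Rightarrow> real). g \<in> borel_measurable borel \<Longrightarrow> (LINT x|lborel. g (?A x)) = c * (LINT x|lborel. g x)"
    using affine_integral_scale[OF A lin \<open>inj ?f\<close>] by metis
  \<comment> \<open>Apply the scaling twice to a ball; it has positive volume, which leaves \<open>c\<^sup>2 = 1\<close>.\<close>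
  let ?h = "indicat_real (ball (0::'a) 1)"
  have "(LINT x|lborel. ?h (?A (?A x))) = c * (c * (LINT x|lborel. ?h x))"
  proof -
    have "?A \<in> borel_measurable borel" by measurable
    then have "(\<lambda>x. ?h (?A x)) \<in> borel_measurable borel"
      by (rule measurable_compose) (auto simp: borel_measurable_indicator)
    then show ?thesis
      using c(2)[of "\<lambda>x. ?h (?A x)"] c(2)[of ?h] by (simp add: borel_measurable_indicator)
  qed
  moreover have "(LINT x|lborel. ?h x) > 0" using content_ball_pos[of 1 "0::'a"] by simp
  ultimately have "c * c = 1" unfolding inv by simp
  then have "c\<^sup>2 = 1" by (simp add: power2_eq_square)
  then have "c = 1" using c(1) by (simp add: power2_eq_1_iff)
  then show ?thesis using c(2)[of g] by simp
qed

text \<open>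
  A shear is the product of two oblique reflections with the same mirror hyperplane.
\<close>
lemma shear_preserves_integral:
  fixes n w :: "'a::euclidean_space" and g :: "'a \<Rightarrow> real"
  assumes n: "n \<bullet> w = 0" "n \<noteq> 0" and [measurable]: "g \<in> borel_measurable borel"
  shows "(LINT x|lborel. g (x + (n \<bullet> x + k) *\<^sub>R w)) = (LINT x|lborel. g x)"
proof -
  \<comment> \<open>The orthogonal reflection in the hyperplane \<open>n \<bullet> x + k = 0\<close>.\<close>
  define w2 where "w2 = (- 2 / (n \<bullet> n)) *\<^sub>R n"
  have w2: "n \<bullet> w2 = -2" using n by (simp add: w2_def)
  let ?B = "\<lambda>x. x + (n \<bullet> x + k) *\<^sub>R w2"
  have "(LINT x|lborel. g (x + (n \<bullet> x + k) *\<^sub>R w)) = (LINT x|lborel. g (?B (x + (n \<bullet> x + k) *\<^sub>R (w + w2))))"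
    using n w2 by (intro Bochner_Integration.integral_cong refl arg_cong[of _ _ g]) (simp add: inner_add_right algebra_simps)
  also have "\<dots> = (LINT x|lborel. g (?B x))"
    by (rule oblique_reflection_preserves_integral[of n "w + w2" "\<lambda>x. g (?B x)" k]) (use n w2 in \<open>auto simp: inner_add_right\<close>)
  also have "\<dots> = (LINT x|lborel. g x)"
    by (rule oblique_reflection_preserves_integral) (use w2 in auto)
  finally show ?thesis .
qed

section \<open>Square roots of positive definite matrices\<close>

lemma psd_Cauchy_Schwarz:
  fixes B :: "'a::real_inner \<Rightarrow> 'a"
  assumes lin: "linear B" and sym: "\<And>x y. x \<bullet> B y = B x \<bullet> y" and psd: "\<And>x. 0 \<le> x \<bullet> B x"
  shows "(x \<bullet> B y)\<^sup>2 \<le> (x \<bullet> B x) * (y \<bullet> B y)"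
proof -
  define a b c where "a = x \<bullet> B x" and "b = x \<bullet> B y" and "c = y \<bullet> B y"
  have yx: "y \<bullet> B x = b" using sym[of y x] by (simp add: b_def inner_commute)
  have q: "0 \<le> a + 2 * t * b + t\<^sup>2 * c" for t
  proof -
    have "0 \<le> (x + t *\<^sub>R y) \<bullet> B (x + t *\<^sub>R y)" by (rule psd)
    also have "\<dots> = a + t * b + t * (y \<bullet> B x) + t\<^sup>2 * c"
      using lin by (simp add: linear_add linear_scale inner_simps a_def b_def c_def power2_eq_square algebra_simps)
    finally show ?thesis by (simp add: yx algebra_simps)
  qed
  have "b\<^sup>2 \<le> a * c"
  proof (cases "c = 0")
    case True
    have "b = 0"
    proof (rule ccontr)
      assume "b \<noteq> 0"
      \<comment> \<open>An affine function of \<open>t\<close> that is bounded below has slope zero.\<close>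
      then show False using q[of "- (a + 1) / (2 * b)"] True by (simp add: field_simps)
    qed
    then show ?thesis using True by simp
  next
    case False
    then have c: "c > 0" using psd[of y] by (simp add: c_def)
    have "0 \<le> a - b\<^sup>2 / c" using q[of "- b / c"] c by (simp add: field_simps power2_eq_square)
    then show ?thesis using c by (simp add: field_simps)
  qed
  then show ?thesis by (simp add: a_def b_def c_def)
qed

lemma inner_matrix_vector_transpose: "x \<bullet> (A *v y) = (transpose A *v x) \<bullet> (y :: real^'n)"
  by (simp add: dot_lmul_matrix)

definition is_mat_sqrt :: "real^'n^'n \<Rightarrow> real^'n^'n \<Rightarrow> bool" where
  "is_mat_sqrt A B \<longleftrightarrow> transpose B = B \<and> (\<forall>\<xi>. 0 \<le> \<xi> \<bullet> (B *v \<xi>)) \<and> B ** B = A"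

lemma is_mat_sqrt_pos:
  assumes B: "is_mat_sqrt A B" and A: "\<And>\<xi>. \<xi> \<noteq> 0 \<Longrightarrow> 0 < \<xi> \<bullet> (A *v \<xi>)" and x: "x \<bullet> (B *v x) = 0"
  shows "x = 0"
proof (rule ccontr)
  assume "x \<noteq> 0"
  have "((B *v x) \<bullet> (B *v x))\<^sup>2 \<le> ((B *v x) \<bullet> (B *v (B *v x))) * (x \<bullet> (B *v x))"
  proof (rule psd_Cauchy_Schwarz)
    show "x \<bullet> (B *v y) = (B *v x) \<bullet> y" for x y
      using B inner_matrix_vector_transpose[of x B y] by (simp add: is_mat_sqrt_def)
    show "0 \<le> x \<bullet> (B *v x)" for x using B by (simp add: is_mat_sqrt_def del: dot_lmul_matrix)
  qed simp
  then have "B *v x = 0" using x by simp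
  then have "A *v x = 0" using B by (metis is_mat_sqrt_def matrix_vector_mul_assoc matrix_vector_mult_0_right)
  then show False using A[OF \<open>x \<noteq> 0\<close>] by simp
qed

text \<open>
  Let \<open>X = B - C\<close> and \<open>P = B + C\<close>. From \<open>B\<^sup>2 = C\<^sup>2\<close> one gets \<open>P X = - X P\<close>, so that \<open>X P X\<close> has
  trace zero. It is positive semidefinite, hence its diagonal vanishes, and then so does \<open>X\<close>,
  because the quadratic form of \<open>B\<close> is definite.
\<close>
lemma is_mat_sqrt_unique:
  fixes A :: "real^'n^'n"
  assumes B: "is_mat_sqrt A B" and C: "is_mat_sqrt A C" and A: "\<And>\<xi>. \<xi> \<noteq> 0 \<Longrightarrow> 0 < \<xi> \<bullet> (A *v \<xi>)"
  shows "B = C"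
proof -
  define X P where "X = B - C" and "P = B + C"
  have BC: "B *v (B *v x) = C *v (C *v x)" for x
    using B C by (simp add: is_mat_sqrt_def matrix_vector_mul_assoc)
  have "(P ** X) *v x = (0 - X ** P) *v x" for x
    by (simp add: matrix_vector_mul_assoc[symmetric] X_def P_def BC matrix_vector_mult_add_rdistrib
        matrix_vector_mult_diff_rdistrib matrix_vector_right_distrib matrix_vector_mult_diff_distrib del: diff_0)
  then have XP: "P ** X = 0 - X ** P" by (simp add: matrix_eq)
  have "((0 - X ** P) ** X) *v x = (0 - X ** (P ** X)) *v x" for x
    by (simp add: matrix_vector_mul_assoc[symmetric] matrix_vector_mult_diff_rdistrib del: diff_0)
  then have XPX: "(0 - X ** P) ** X = 0 - X ** (P ** X)" by (simp add: matrix_eq)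
  have "trace (X ** (P ** X)) = trace ((P ** X) ** X)" by (rule trace_mul_sym)
  also have "\<dots> = - trace (X ** (P ** X))" unfolding XP XPX by (simp add: trace_sub trace_def[of 0] del: diff_0)
  finally have tr0: "trace (X ** (P ** X)) = 0" by simp
  have symX: "transpose X = X" using B C by (simp add: X_def is_mat_sqrt_def transpose_def vec_eq_iff)
  \<comment> \<open>The diagonal of \<open>X P X\<close> consists of values of the form of \<open>P\<close>, as \<open>X\<close> is symmetric.\<close>
  have entry: "(X ** (P ** X)) $ i $ i = (X *v axis i 1) \<bullet> (P *v (X *v axis i 1))" for i
  proof -
    have "(X ** (P ** X)) $ i $ i = axis i 1 \<bullet> ((X ** (P ** X)) *v axis i 1)"
      by (simp add: matrix_vector_mult_basis column_def inner_axis' )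
    also have "\<dots> = axis i 1 \<bullet> (X *v (P *v (X *v axis i 1)))"
      by (simp add: matrix_vector_mul_assoc matrix_mul_assoc)
    also have "\<dots> = (X *v axis i 1) \<bullet> (P *v (X *v axis i 1))"
      by (subst inner_matrix_vector_transpose) (simp add: symX)
    finally show ?thesis .
  qed
  have P: "0 \<le> \<xi> \<bullet> (B *v \<xi>)" "0 \<le> \<xi> \<bullet> (C *v \<xi>)" for \<xi> using B C by (auto simp: is_mat_sqrt_def)
  have PP: "\<xi> \<bullet> (P *v \<xi>) = \<xi> \<bullet> (B *v \<xi>) + \<xi> \<bullet> (C *v \<xi>)" for \<xi>
    by (simp add: P_def matrix_vector_mult_add_rdistrib inner_simps)
  have nn: "0 \<le> (X ** (P ** X)) $ i $ i" for i unfolding entry PP using P by (simp add: add_nonneg_nonneg)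
  have "(X ** (P ** X)) $ i $ i = 0" for i
    using tr0 nn sum_nonneg_eq_0_iff[of UNIV "\<lambda>i. (X ** (P ** X)) $ i $ i"] by (auto simp: trace_def)
  then have "(X *v axis i 1) \<bullet> (B *v (X *v axis i 1)) = 0" for i
    using entry[of i] PP[of "X *v axis i 1"] P[of "X *v axis i 1"] by simp
  then have "X *v axis i 1 = 0" for i using is_mat_sqrt_pos[OF B A] by blast
  then have "X = 0" by (auto simp: vec_eq_iff matrix_vector_mult_basis column_def)
  then show ?thesis by (simp add: X_def)
qed

text \<open>
  For a positive semidefinite operator the quadratic form controls the norm: apply the
  Cauchy--Schwarz inequality of the form \<open>x \<bullet> R y\<close> to \<open>x\<close> and \<open>R x\<close>.
\<close>
lemma symmetric_norm_bound:
  fixes R :: "'a::real_inner \<Rightarrow> 'a"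
  assumes lin: "linear R" and sym: "\<And>x y. x \<bullet> R y = R x \<bullet> y" and psd: "\<And>x. 0 \<le> x \<bullet> R x"
    and bd: "\<And>x. x \<bullet> R x \<le> r * (norm x)\<^sup>2"
  shows "norm (R x) \<le> r * norm x"
proof (cases "R x = 0")
  case True
  then show ?thesis using bd[of x] psd[of x]
    by (cases "x = 0") (auto simp: zero_le_mult_iff)
next
  case False
  have "(norm (R x))\<^sup>2 * (norm (R x))\<^sup>2 = (R x \<bullet> R x)\<^sup>2"
    by (metis power2_norm_eq_inner power2_eq_square)
  also have "\<dots> \<le> (R x \<bullet> R (R x)) * (x \<bullet> R x)"
    by (rule psd_Cauchy_Schwarz[OF lin sym psd])
  also have "\<dots> \<le> (r * (norm (R x))\<^sup>2) * (r * (norm x)\<^sup>2)"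
    using bd psd by (intro mult_mono) (auto intro: order_trans[OF psd bd])
  finally have "(norm (R x))\<^sup>2 \<le> (r * norm x)\<^sup>2"
    using False by (simp add: power2_eq_square mult_ac)
  moreover have "0 \<le> r * norm x"
  proof -
    have "0 \<le> r * (norm x)\<^sup>2" using bd[of x] psd[of x] by linarith
    then show ?thesis by (cases "x = 0") (auto simp: zero_le_mult_iff)
  qed
  ultimately show ?thesis by (rule power2_le_imp_le)
qed

text \<open>
  With \<open>Y\<close> solving \<open>Y = (R + Y\<^sup>2) / 2\<close> one has \<open>(1 - Y)\<^sup>2 = 1 - R\<close>. The right-hand side is a
  contraction on the symmetric operators of norm at most \<open>1 - sqrt (1 - r)\<close>, the scalar solution
  of the same equation.
\<close>
lemma contraction_square_root:
  fixes R :: "'a::{euclidean_space} \<Rightarrow>\<^sub>L 'a"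
  assumes sym: "\<And>x y. x \<bullet> R y = R x \<bullet> y" and nr: "norm R \<le> r" and r: "0 \<le> r" "r < 1"
  obtains Y where "\<And>x y. x \<bullet> blinfun_apply Y y = Y x \<bullet> y" "norm Y < 1" "R + (Y o\<^sub>L Y) = 2 *\<^sub>R Y"
proof -
  define y where "y = 1 - sqrt (1 - r)"
  have "(sqrt (1 - r))\<^sup>2 = 1 - r" using r by simp
  then have y: "0 \<le> y" "y < 1" "(r + y\<^sup>2) / 2 = y"
    using r by (auto simp: y_def power2_diff)
  define S where "S = {Y :: 'a \<Rightarrow>\<^sub>L 'a. norm Y \<le> y} \<inter> (\<Inter>x. \<Inter>z. {Y. x \<bullet> blinfun_apply Y z = Y x \<bullet> z})"
  define \<Phi> where "\<Phi> Y = (1/2) *\<^sub>R (R + (Y o\<^sub>L Y))" for Y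
  have "closed {Y :: 'a \<Rightarrow>\<^sub>L 'a. x \<bullet> blinfun_apply Y z = Y x \<bullet> z}" for x z
    by (intro closed_Collect_eq continuous_intros)
  moreover have "closed {Y :: 'a \<Rightarrow>\<^sub>L 'a. norm Y \<le> y}"
    by (intro closed_Collect_le continuous_intros)
  ultimately have "closed S" unfolding S_def by (intro closed_Int closed_INT ballI) auto
  then have comp: "complete S" by (simp add: complete_eq_closed)
  have "\<exists>!Y\<in>S. \<Phi> Y = Y"
  proof (rule Banach_fix[OF comp _ y(1,2)])
    have "0 \<in> S" using y by (simp add: S_def)
    then show "S \<noteq> {}" by blast
    show "\<Phi> ` S \<subseteq> S"
    proof safe
      fix Y assume Y: "Y \<in> S"
      have "norm (\<Phi> Y) \<le> (norm R + norm (Y o\<^sub>L Y)) / 2"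
        unfolding \<Phi>_def by (simp add: norm_triangle_ineq)
      also have "norm (Y o\<^sub>L Y) \<le> norm Y * norm Y" by (rule norm_blinfun_compose)
      also have "\<dots> \<le> y * y" using Y y by (intro mult_mono) (auto simp: S_def)
      finally have "norm (\<Phi> Y) \<le> y" using nr y(3) by (simp add: power2_eq_square)
      moreover have "x \<bullet> blinfun_apply (\<Phi> Y) z = \<Phi> Y x \<bullet> z" for x z
      proof -
        have s: "x \<bullet> blinfun_apply Y z = Y x \<bullet> z" for x z using Y by (auto simp: S_def)
        show ?thesis by (simp add: \<Phi>_def blinfun.bilinear_simps inner_simps sym s)
      qed
      ultimately show "\<Phi> Y \<in> S" by (auto simp: S_def)
    qed
    show "dist (\<Phi> Y) (\<Phi> Z) \<le> y * dist Y Z" if "Y \<in> S" "Z \<in> S" for Y Z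
    proof -
      have "\<Phi> Y - \<Phi> Z = (1/2) *\<^sub>R ((Y o\<^sub>L (Y - Z)) + ((Y - Z) o\<^sub>L Z))"
        by (rule blinfun_eqI) (simp add: \<Phi>_def blinfun.bilinear_simps algebra_simps)
      then have "norm (\<Phi> Y - \<Phi> Z) \<le> (norm (Y o\<^sub>L (Y - Z)) + norm ((Y - Z) o\<^sub>L Z)) / 2"
        by (simp add: norm_triangle_ineq)
      also have "\<dots> \<le> (norm Y * norm (Y - Z) + norm (Y - Z) * norm Z) / 2"
        using norm_blinfun_compose[of Y "Y - Z"] norm_blinfun_compose[of "Y - Z" Z] by simp
      also have "\<dots> \<le> (y * norm (Y - Z) + norm (Y - Z) * y) / 2"
        using that y by (intro divide_right_mono add_mono mult_mono) (auto simp: S_def)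
      finally show ?thesis by (simp add: dist_norm)
    qed
  qed
  then obtain Y where Y: "Y \<in> S" "\<Phi> Y = Y" by auto
  have "R + (Y o\<^sub>L Y) = 2 *\<^sub>R Y" by (subst (3) Y(2)[symmetric]) (simp add: \<Phi>_def)
  then show ?thesis using Y y by (intro that[of Y]) (auto simp: S_def)
qed

text \<open>
  Scaling by \<open>1 / k1\<close> writes \<open>A / k1\<close> as \<open>1 - R\<close> with \<open>0 \<le> R \<le> 1 - k0 / k1\<close>; then
  \<open>sqrt k1 (1 - Y)\<close> is the root, with \<open>Y\<close> from the contraction argument. It is positive because
  \<open>norm Y < 1\<close>.
\<close>
lemma is_mat_sqrt_exists:
  fixes A :: "real^'n^'n"
  assumes sym: "transpose A = A" and k: "0 < k0" "k0 \<le> k1"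
    and bd: "\<And>\<xi>. k0 * (norm \<xi>)\<^sup>2 \<le> \<xi> \<bullet> (A *v \<xi>)" "\<And>\<xi>. \<xi> \<bullet> (A *v \<xi>) \<le> k1 * (norm \<xi>)\<^sup>2"
  shows "\<exists>B. is_mat_sqrt A B"
proof -
  have k1: "k1 > 0" using k by simp
  define f where "f x = x - (1 / k1) *\<^sub>R (A *v x)" for x
  have lin: "linear f" unfolding f_def by (intro linearI) (auto simp: matrix_vector_right_distrib algebra_simps)
  define R where "R = Blinfun f"
  have R: "blinfun_apply R = f" unfolding R_def
    using lin by (intro bounded_linear_Blinfun_apply) (simp add: linear_conv_bounded_linear)
  have fsym: "x \<bullet> f y = f x \<bullet> y" for x y
    using inner_matrix_vector_transpose[of x A y] sym by (simp add: f_def inner_simps)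
  define r where "r = 1 - k0 / k1"
  have r: "0 \<le> r" "r < 1" using k k1 by (auto simp: r_def)
  have fq: "x \<bullet> f x = (norm x)\<^sup>2 - (x \<bullet> (A *v x)) / k1" for x
    by (simp add: f_def inner_simps power2_norm_eq_inner)
  have "norm (f x) \<le> r * norm x" for x
  proof (rule symmetric_norm_bound[OF lin fsym])
    show "0 \<le> x \<bullet> f x" for x using bd(2)[of x] k1 by (simp add: fq divide_le_eq mult.commute)
    show "x \<bullet> f x \<le> r * (norm x)\<^sup>2" for x
      using bd(1)[of x] k1 by (simp add: fq r_def field_simps)
  qed
  then have "norm R \<le> r" using r by (intro norm_blinfun_bound) (auto simp: R)
  then obtain Y where Y: "\<And>x y. x \<bullet> blinfun_apply Y y = Y x \<bullet> y" "norm Y < 1" "R + (Y o\<^sub>L Y) = 2 *\<^sub>R Y"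
    using contraction_square_root[of R r] r fsym R by metis
  define h where "h x = sqrt k1 *\<^sub>R (x - blinfun_apply Y x)" for x
  have hl: "linear h" unfolding h_def by (intro linearI) (auto simp: blinfun.bilinear_simps algebra_simps)
  have hv: "matrix h *v x = h x" for x using matrix_vector_mul(2)[OF hl] by (rule fun_cong)
  have hsym: "x \<bullet> h y = h x \<bullet> y" for x y by (simp add: h_def inner_simps Y(1))
  have hh: "h (h x) = A *v x" for x
  proof -
    have "f x + Y (Y x) = 2 *\<^sub>R Y x" using arg_cong[OF Y(3), of "\<lambda>Z. blinfun_apply Z x"]
      by (simp add: blinfun.bilinear_simps R)
    then have "k1 *\<^sub>R (x - 2 *\<^sub>R Y x + Y (Y x)) = A *v x"
      using k1 by (simp add: f_def algebra_simps)
    moreover have "h (h x) = (sqrt k1 * sqrt k1) *\<^sub>R (x - 2 *\<^sub>R Y x + Y (Y x))"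
      by (simp add: h_def blinfun.bilinear_simps algebra_simps scaleR_2)
    ultimately show ?thesis using k1 by simp
  qed
  have "is_mat_sqrt A (matrix h)" unfolding is_mat_sqrt_def
  proof (intro conjI allI)
    have "(transpose (matrix h) *v x) \<bullet> y = (matrix h *v x) \<bullet> y" for x y
      using inner_matrix_vector_transpose[of x "matrix h" y] hsym by (simp add: hv)
    then have "transpose (matrix h) *v x = matrix h *v x" for x by (metis vector_eq_rdot)
    then show "transpose (matrix h) = matrix h" by (simp add: matrix_eq)
    show "matrix h ** matrix h = A" by (simp add: matrix_eq matrix_vector_mul_assoc[symmetric] hv hh)
    show "0 \<le> \<xi> \<bullet> (matrix h *v \<xi>)" for \<xi>
    proof -
      have "\<xi> \<bullet> Y \<xi> \<le> norm \<xi> * norm (Y \<xi>)" by (rule norm_cauchy_schwarz)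
      also have "norm (Y \<xi>) \<le> 1 * norm \<xi>"
        using norm_blinfun[of Y \<xi>] mult_right_mono[of "norm Y" 1 "norm \<xi>"] Y(2) by simp
      then have "norm \<xi> * norm (Y \<xi>) \<le> norm \<xi> * (1 * norm \<xi>)" by (intro mult_left_mono) auto
      finally show ?thesis using k1 by (simp add: hv h_def inner_simps power2_norm_eq_inner[symmetric] power2_eq_square)
    qed
  qed
  then show ?thesis by blast
qed

lemma mat_sqrt_properties:
  fixes A :: "real^'n^'n"
  assumes sym: "transpose A = A" and k: "0 < k0" "k0 \<le> k1"
    and bd: "\<And>\<xi>. k0 * (norm \<xi>)\<^sup>2 \<le> \<xi> \<bullet> (A *v \<xi>)" "\<And>\<xi>. \<xi> \<bullet> (A *v \<xi>) \<le> k1 * (norm \<xi>)\<^sup>2"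
  defines "N \<equiv> mat_sqrt A"
  shows "x \<bullet> (N *v y) = (N *v x) \<bullet> y" "N *v (N *v x) = A *v x"
    "N *v (matrix_inv N *v x) = x" "matrix_inv N *v (N *v x) = x"
proof -
  have pos: "0 < \<xi> \<bullet> (A *v \<xi>)" if "\<xi> \<noteq> 0" for \<xi> using bd(1)[of \<xi>] k that
    by (meson dual_order.strict_trans1 mult_pos_pos zero_less_norm_iff zero_less_power)
  have "\<exists>!B. is_mat_sqrt A B" using is_mat_sqrt_exists[OF sym k bd] is_mat_sqrt_unique[OF _ _ pos] by blast
  then have N: "is_mat_sqrt A N" unfolding N_def mat_sqrt_def is_mat_sqrt_def[abs_def] by (rule theI')
  show "x \<bullet> (N *v y) = (N *v x) \<bullet> y"
    using N by (simp add: inner_matrix_vector_transpose is_mat_sqrt_def)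
  show "N *v (N *v x) = A *v x" using N by (simp add: matrix_vector_mul_assoc is_mat_sqrt_def)
  have "inj ((*v) N)"
  proof (rule injI)
    fix x y assume "N *v x = N *v y"
    then have "N *v (x - y) = 0" by (simp add: matrix_vector_mult_diff_distrib)
    then show "x = y" using is_mat_sqrt_pos[OF N pos, of "x - y"] by simp
  qed
  then have "invertible N" using invertible_left_inverse matrix_left_invertible_injective by blast
  then have "N ** matrix_inv N = mat 1" "matrix_inv N ** N = mat 1"
    unfolding invertible_def matrix_inv_def by (metis (mono_tags, lifting) someI_ex)+
  then show "N *v (matrix_inv N *v x) = x" "matrix_inv N *v (N *v x) = x"
    by (simp_all add: matrix_vector_mul_assoc)
qed

section \<open>Barycentric coordinates on a simplex\<close>

definition verts :: "'a::euclidean_space set \<Rightarrow> 'a set" where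
  "verts T = {v. v extreme_point_of T}"

text \<open>
  The gradient of the barycentric coordinate \<open>bary T p\<close> that is one at the vertex \<open>p\<close> and zero
  at the others; it exists and is unique for a simplex of full dimension.
\<close>
definition bgrad :: "'a::euclidean_space set \<Rightarrow> 'a \<Rightarrow> 'a" where
  "bgrad T p = (SOME g. \<forall>r\<in>verts T - {p}. g \<bullet> (p - r) = 1)"

definition bary :: "'a::euclidean_space set \<Rightarrow> 'a \<Rightarrow> 'a \<Rightarrow> real" where
  "bary T p x = 1 + bgrad T p \<bullet> (x - p)"

definition opp :: "'a::euclidean_space set \<Rightarrow> 'a \<Rightarrow> 'a set" where
  "opp T p = convex hull (verts T - {p})"

lemma verts_convex_hull: "\<not> affine_dependent C \<Longrightarrow> verts (convex hull C) = C"
  by (simp add: verts_def extreme_point_of_convex_hull_affine_independent)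

lemma bary_diff: "bary T p y - bary T p x = bgrad T p \<bullet> (y - x)"
  by (simp add: bary_def inner_simps)

lemma bary_add: "bary T p (x + h) = bary T p x + bgrad T p \<bullet> h"
  by (simp add: bary_def inner_simps)

lemma bary_from_0: "bary T p h = bary T p 0 + bgrad T p \<bullet> h"
  using bary_add[of T p 0 h] by simp

lemma bary_eq: "bary T p x = bgrad T p \<bullet> x + (1 - bgrad T p \<bullet> p)"
  by (simp add: bary_def inner_simps)

lemma continuous_on_bary [continuous_intros]: "continuous_on A (bary T p)"
  unfolding bary_def by (intro continuous_intros)

lemma bary_measurable [measurable]: "bary T p \<in> borel_measurable borel"
  by (intro borel_measurable_continuous_onI continuous_on_bary)

locale full_simplex =
  fixes T :: "'a::euclidean_space set"
  assumes simplex: "int DIM('a) simplex T"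
begin

abbreviation "V \<equiv> verts T"

lemma V: "finite V" "card V = Suc DIM('a)" "\<not> affine_dependent V" "convex hull V = T"
proof -
  obtain C where C: "\<not> affine_dependent C" "int (card C) = int DIM('a) + 1" "T = convex hull C"
    using simplex by (auto simp: simplex_def)
  have "V = C" using C verts_convex_hull by simp
  with C show "card V = Suc DIM('a)" "\<not> affine_dependent V" "convex hull V = T" by auto
  then show "finite V" using card.infinite by force
qed

lemma other_vertex: obtains q where "q \<in> V" "q \<noteq> p"
proof -
  have "\<not> V \<subseteq> {p}"
    using V(1,2) card_mono[of "{p}" V] DIM_positive[where 'a='a] by auto
  then show ?thesis using that by blast
qed

text \<open>
  The edges \<open>p - r\<close> from \<open>p\<close> are linearly independent, so that some functional is one on all of
  them, and every functional is an inner product.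
\<close>
lemma bgrad_works:
  assumes p: "p \<in> V" and r: "r \<in> V" "r \<noteq> p"
  shows "bgrad T p \<bullet> (p - r) = 1"
proof -
  have "independent ((\<lambda>x. - p + x) ` (V - {p}))"
    using affine_dependent_iff_dependent2[OF p] V(3) by simp
  then obtain f :: "'a \<Rightarrow> real" where f: "linear f" "\<forall>x\<in>(\<lambda>x. - p + x) ` (V - {p}). f x = -1"
    using linear_independent_extend[of _ "\<lambda>_. -1 :: real"] by blast
  have "adjoint f 1 \<bullet> (p - r) = 1" if "r \<in> V - {p}" for r
  proof -
    have "(- p + r) \<bullet> adjoint f 1 = f (- p + r) \<bullet> 1" by (rule adjoint_works[OF f(1)])
    also have "\<dots> = -1" using f(2) that by auto
    finally show ?thesis by (simp add: inner_simps inner_commute)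
  qed
  then have "\<exists>g. \<forall>r\<in>V - {p}. g \<bullet> (p - r) = 1" by blast
  then have "\<forall>r\<in>V - {p}. bgrad T p \<bullet> (p - r) = 1" unfolding bgrad_def by (rule someI_ex)
  then show ?thesis using r by blast
qed

lemma bary_vertex: "p \<in> V \<Longrightarrow> r \<in> V \<Longrightarrow> bary T p r = (if r = p then 1 else 0)"
  using bgrad_works[of p r] by (auto simp: bary_def inner_simps)

lemma bary_combination:
  assumes "p \<in> V" "(\<Sum>r\<in>V. u r) = 1"
  shows "bary T p (\<Sum>r\<in>V. u r *\<^sub>R r) = u p"
proof -
  have "bary T p (\<Sum>r\<in>V. u r *\<^sub>R r) = (\<Sum>r\<in>V. u r * (bgrad T p \<bullet> r)) + (\<Sum>r\<in>V. u r) * (1 - bgrad T p \<bullet> p)"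
    by (simp add: bary_eq inner_sum_right assms(2))
  also have "\<dots> = (\<Sum>r\<in>V. u r * bary T p r)"
    by (simp add: bary_eq sum_distrib_right sum.distrib distrib_left)
  also have "\<dots> = (\<Sum>r\<in>V. if r = p then u r else 0)"
    using assms(1) by (intro sum.cong) (auto simp: bary_vertex)
  also have "\<dots> = u p" using assms(1) V(1) by simp
  finally show ?thesis .
qed

lemma combination:
  obtains u where "(\<Sum>r\<in>V. u r) = 1" "(\<Sum>r\<in>V. u r *\<^sub>R r) = x"
proof -
  have "x \<in> affine hull V" using affine_independent_span_eq[OF V(3)] V(2) by simp
  then show ?thesis using that V(1) by (auto simp: affine_hull_finite)
qed

lemma sum_bary: "(\<Sum>p\<in>V. bary T p x) = 1" and sum_bary_scaleR: "(\<Sum>p\<in>V. bary T p x *\<^sub>R p) = x"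
proof -
  obtain u where u: "(\<Sum>r\<in>V. u r) = 1" "(\<Sum>r\<in>V. u r *\<^sub>R r) = x" by (rule combination)
  then have "p \<in> V \<Longrightarrow> bary T p x = u p" for p using bary_combination by metis
  then show "(\<Sum>p\<in>V. bary T p x) = 1" "(\<Sum>p\<in>V. bary T p x *\<^sub>R p) = x" using u by simp_all
qed

lemma sum_bgrad: "(\<Sum>p\<in>V. bgrad T p) = 0"
proof -
  have "(\<Sum>p\<in>V. bgrad T p) \<bullet> h = 0" for h
    using sum_bary[of h] sum_bary[of 0] unfolding bary_from_0[of _ _ h] by (simp add: sum.distrib inner_sum_left)
  then show ?thesis by (metis inner_eq_zero_iff)
qed

text \<open>
  Barycentric interpolation reproduces affine maps; its linear part is the identity.
\<close>
lemma sum_bgrad_scaleR: "(\<Sum>p\<in>V. (bgrad T p \<bullet> h) *\<^sub>R p) = h"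
  using sum_bary_scaleR[of h] sum_bary_scaleR[of 0] unfolding bary_from_0[of _ _ h]
  by (simp add: scaleR_left_distrib sum.distrib)

lemma bary_inject: "(\<And>p. p \<in> V \<Longrightarrow> bary T p x = bary T p y) \<Longrightarrow> x = y"
  using sum_bary_scaleR[of x] sum_bary_scaleR[of y]
  by (metis (no_types, lifting) sum.cong)

lemma bgrad_nonzero: "p \<in> V \<Longrightarrow> bgrad T p \<noteq> 0"
proof -
  assume p: "p \<in> V"
  obtain q where "q \<in> V" "q \<noteq> p" by (rule other_vertex)
  then show ?thesis using bgrad_works[OF p, of q] by auto
qed

lemma mem_iff: "x \<in> T \<longleftrightarrow> (\<forall>p\<in>V. 0 \<le> bary T p x)"
proof
  assume "x \<in> T"
  then have "x \<in> convex hull V" using V(4) by simp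
  then obtain u where "\<forall>r\<in>V. 0 \<le> u r" "(\<Sum>r\<in>V. u r) = 1" "(\<Sum>r\<in>V. u r *\<^sub>R r) = x"
    unfolding convex_hull_finite[OF V(1)] by blast
  then show "\<forall>p\<in>V. 0 \<le> bary T p x" using bary_combination by metis
next
  assume "\<forall>p\<in>V. 0 \<le> bary T p x"
  then have "x \<in> convex hull V"
    unfolding convex_hull_finite[OF V(1)] using sum_bary[of x] sum_bary_scaleR[of x]
    by (intro CollectI exI[of _ "\<lambda>q. bary T q x"] conjI) auto
  then show "x \<in> T" using V by simp
qed

lemma vertex_in: "p \<in> V \<Longrightarrow> p \<in> T" using V(4) hull_subset[of V convex] by auto

lemma compact: "compact T" and convex: "convex T"
  using V(1,4) by (metis finite_imp_compact_convex_hull) (metis V(4) convex_convex_hull)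

lemma closed: "closed T" and bounded: "bounded T"
  using compact by (auto simp: compact_imp_closed compact_imp_bounded)

lemma bary_le_1: assumes "x \<in> T" "p \<in> V" shows "bary T p x \<le> 1"
  using member_le_sum[of p V "\<lambda>p. bary T p x"] V(1) assms mem_iff sum_bary[of x] by auto

lemma opp_mem_iff: assumes p: "p \<in> V" shows "x \<in> opp T p \<longleftrightarrow> x \<in> T \<and> bary T p x = 0"
proof
  assume "x \<in> opp T p"
  then obtain u where u: "\<forall>r\<in>V - {p}. 0 \<le> u r" "sum u (V - {p}) = 1" "(\<Sum>r\<in>V - {p}. u r *\<^sub>R r) = x"
    using convex_hull_finite[of "V - {p}"] V(1) by (auto simp: opp_def)
  let ?u = "u(p := 0)"
  have s: "(\<Sum>r\<in>V. ?u r) = 1" "(\<Sum>r\<in>V. ?u r *\<^sub>R r) = x"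
    using u p V(1) by (auto simp: sum.remove[OF V(1) p] intro!: sum.cong)
  have "\<forall>r\<in>V. 0 \<le> ?u r" using u by auto
  then have "x \<in> T" using s V convex_hull_finite[OF V(1)] by blast
  then show "x \<in> T \<and> bary T p x = 0" using bary_combination[OF p s(1)] s(2) by simp
next
  assume x: "x \<in> T \<and> bary T p x = 0"
  have "sum (\<lambda>q. bary T q x) (V - {p}) = 1" "(\<Sum>q\<in>V - {p}. bary T q x *\<^sub>R q) = x"
    using sum_bary[of x] sum_bary_scaleR[of x] x by (simp_all add: sum.remove[OF V(1) p])
  then show "x \<in> opp T p"
    unfolding opp_def convex_hull_finite[OF finite_Diff[OF V(1)]] using x
    by (intro CollectI exI[of _ "\<lambda>q. bary T q x"] conjI) (auto simp: mem_iff)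
qed

text \<open>
  A point with positive coordinates stays inside under small moves. Conversely, a coordinate
  that vanishes at a point of \<open>T\<close> becomes negative after a small step against its gradient.
\<close>
lemma interior_iff: "x \<in> interior T \<longleftrightarrow> (\<forall>p\<in>V. 0 < bary T p x)"
proof
  assume x: "x \<in> interior T"
  show "\<forall>p\<in>V. 0 < bary T p x"
  proof (rule ccontr)
    assume "\<not> (\<forall>p\<in>V. 0 < bary T p x)"
    then obtain p where p: "p \<in> V" "bary T p x \<le> 0" by force
    obtain e where e: "e > 0" "ball x e \<subseteq> T" using x by (auto simp: mem_interior)
    define g where "g = bgrad T p"
    define t where "t = e / (2 * norm g)"
    have g: "norm g > 0" using bgrad_nonzero[OF p(1)] by (simp add: g_def)
    have "x + (- t) *\<^sub>R g \<in> ball x e" using g e(1) by (simp add: dist_norm t_def)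
    then have "0 \<le> bary T p (x + (- t) *\<^sub>R g)" using e(2) mem_iff p by blast
    moreover have "t * (g \<bullet> g) > 0" using g e(1) by (simp add: t_def)
    ultimately show False using p(2) bary_add[of T p x "(- t) *\<^sub>R g"] by (simp add: g_def)
  qed
next
  assume *: "\<forall>p\<in>V. 0 < bary T p x"
  have "open (\<Inter>p\<in>V. {y. 0 < bary T p y})"
    using V(1) by (intro open_INT ballI open_Collect_less continuous_intros) auto
  moreover have "(\<Inter>p\<in>V. {y. 0 < bary T p y}) \<subseteq> T" using mem_iff by (auto simp: less_imp_le)
  ultimately show "x \<in> interior T" using * by (intro interiorI[of "\<Inter>p\<in>V. {y. 0 < bary T p y}"]) auto
qed

lemma rel_interior_opp_iff:
  assumes p: "p \<in> V"
  shows "x \<in> rel_interior (opp T p) \<longleftrightarrow> bary T p x = 0 \<and> (\<forall>q\<in>V - {p}. 0 < bary T q x)"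
proof -
  have nd: "\<not> affine_dependent (V - {p})" using V(3) by (metis affine_independent_Diff)
  have E: "rel_interior (opp T p) = {y. \<exists>u. (\<forall>x\<in>V - {p}. 0 < u x) \<and> sum u (V - {p}) = 1 \<and> (\<Sum>x\<in>V - {p}. u x *\<^sub>R x) = y}"
    unfolding opp_def by (rule rel_interior_convex_hull_explicit[OF nd])
  show ?thesis
  proof
    assume "x \<in> rel_interior (opp T p)"
    then obtain u where u: "\<forall>r\<in>V - {p}. 0 < u r" "sum u (V - {p}) = 1" "(\<Sum>r\<in>V - {p}. u r *\<^sub>R r) = x"
      using E by auto
    let ?u = "u(p := 0)"
    have s: "(\<Sum>r\<in>V. ?u r) = 1" "(\<Sum>r\<in>V. ?u r *\<^sub>R r) = x"
      using u p V(1) by (auto simp: sum.remove[OF V(1) p] intro!: sum.cong)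
    show "bary T p x = 0 \<and> (\<forall>q\<in>V - {p}. 0 < bary T q x)"
      using bary_combination[OF _ s(1)] u(1) p unfolding s(2) by auto
  next
    assume x: "bary T p x = 0 \<and> (\<forall>q\<in>V - {p}. 0 < bary T q x)"
    have "sum (\<lambda>q. bary T q x) (V - {p}) = 1" "(\<Sum>q\<in>V - {p}. bary T q x *\<^sub>R q) = x"
      using sum_bary[of x] sum_bary_scaleR[of x] x by (simp_all add: sum.remove[OF V(1) p])
    then show "x \<in> rel_interior (opp T p)"
      unfolding E using x by (intro CollectI exI[of _ "\<lambda>q. bary T q x"] conjI) auto
  qed
qed

lemma facet_iff: "S facet_of T \<longleftrightarrow> (\<exists>p\<in>V. S = opp T p)"
proof -
  have "opp T p \<noteq> {}" for p
  proof -
    obtain q where "q \<in> V" "q \<noteq> p" by (rule other_vertex)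
    then show ?thesis using hull_subset[of "V - {p}" convex] by (auto simp: opp_def)
  qed
  then show ?thesis using facet_of_convex_hull_affine_independent[OF V(3), of S] V(4)
    unfolding opp_def by metis
qed

lemma verts_opp: "p \<in> V \<Longrightarrow> verts (opp T p) = V - {p}"
  unfolding opp_def by (intro verts_convex_hull affine_independent_Diff V(3))

lemma opp_inject: "p \<in> V \<Longrightarrow> q \<in> V \<Longrightarrow> opp T p = opp T q \<longleftrightarrow> p = q"
  using verts_opp[of p] verts_opp[of q] by auto

lemma barycenter_eq: "barycenter A = (\<Sum>v\<in>verts A. v) /\<^sub>R real (card (verts A))"
  by (simp add: barycenter_def verts_def)

lemma bary_barycenter: "q \<in> V \<Longrightarrow> bary T q (barycenter T) = 1 / (real DIM('a) + 1)"
proof -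
  assume q: "q \<in> V"
  have "barycenter T = (\<Sum>r\<in>V. (1 / (real DIM('a) + 1)) *\<^sub>R r)"
    by (simp add: barycenter_eq V(2) scaleR_sum_right inverse_eq_divide add.commute)
  moreover have "(\<Sum>r\<in>V. 1 / (real DIM('a) + 1)) = 1" using V(2) by simp
  ultimately show ?thesis using bary_combination[OF q, of "\<lambda>_. 1 / (real DIM('a) + 1)"] by simp
qed

lemma bary_barycenter_opp:
  assumes p: "p \<in> V" and q: "q \<in> V"
  shows "bary T q (barycenter (opp T p)) = (if q = p then 0 else 1 / real DIM('a))"
proof -
  let ?u = "\<lambda>r. if r = p then 0 else 1 / real DIM('a)"
  have c: "card (V - {p}) = DIM('a)" using V p by simp
  have "(\<Sum>r\<in>V. ?u r *\<^sub>R r) = (\<Sum>r\<in>V - {p}. (1 / real DIM('a)) *\<^sub>R r)"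
    using p V(1) by (simp add: sum.remove[OF V(1) p])
  then have 1: "barycenter (opp T p) = (\<Sum>r\<in>V. ?u r *\<^sub>R r)"
    using c p by (simp add: barycenter_eq verts_opp scaleR_sum_right inverse_eq_divide)
  have "(\<Sum>r\<in>V. ?u r) = 1" using c by (simp add: sum.remove[OF V(1) p])
  then show ?thesis unfolding 1 using bary_combination[OF q, of ?u] by simp
qed

lemma barycenter_in_rel_interior: "p \<in> V \<Longrightarrow> barycenter (opp T p) \<in> rel_interior (opp T p)"
  by (simp add: rel_interior_opp_iff bary_barycenter_opp)

lemma barycenter_in_interior: "barycenter T \<in> interior T"
  by (simp add: interior_iff bary_barycenter add_pos_nonneg)

text \<open>
  The vectors orthogonal to a facet form a line, spanned by the gradient of the opposite
  coordinate. This identifies the unit normals of the facet.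
\<close>
lemma orthogonal_to_facet:
  assumes p: "p \<in> V" and q: "q \<in> V" "q \<noteq> p"
    and w: "\<And>r r'. r \<in> V - {p} \<Longrightarrow> r' \<in> V - {p} \<Longrightarrow> w \<bullet> (r - r') = 0"
  shows "w = (w \<bullet> (p - q)) *\<^sub>R bgrad T p"
proof -
  have "w \<bullet> h = ((w \<bullet> (p - q)) *\<^sub>R bgrad T p) \<bullet> h" for h
  proof -
    have "w \<bullet> h = (\<Sum>r\<in>V. (bgrad T r \<bullet> h) * (w \<bullet> r))"
      using arg_cong[OF sum_bgrad_scaleR[of h], of "\<lambda>x. w \<bullet> x"] by (simp add: inner_sum_right)
    also have "\<dots> = (\<Sum>r\<in>V. (bgrad T r \<bullet> h) * (w \<bullet> r)) - (\<Sum>r\<in>V. bgrad T r) \<bullet> h * (w \<bullet> q)"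
      by (simp add: sum_bgrad)
    also have "\<dots> = (\<Sum>r\<in>V. (bgrad T r \<bullet> h) * (w \<bullet> (r - q)))"
      by (simp add: inner_sum_left sum_distrib_right sum_subtractf inner_diff_right right_diff_distrib)
    also have "\<dots> = (\<Sum>r\<in>V. if r = p then (bgrad T p \<bullet> h) * (w \<bullet> (p - q)) else 0)"
      using w[of _ q] q by (intro sum.cong) auto
    also have "\<dots> = (bgrad T p \<bullet> h) * (w \<bullet> (p - q))" using p V(1) by simp
    finally show ?thesis by simp
  qed
  then show ?thesis by (metis vector_eq_rdot)
qed

lemma bgrad_orthogonal: "p \<in> V \<Longrightarrow> x \<in> opp T p \<Longrightarrow> y \<in> opp T p \<Longrightarrow> bgrad T p \<bullet> (x - y) = 0"
  using bary_diff[of T p x y] by (simp add: opp_mem_iff)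

lemma measure_pos: "measure lborel T > 0"
proof -
  have "emeasure lborel T \<noteq> 0"
  proof
    assume "emeasure lborel T = 0"
    then have "negligible T" using closed by (auto simp: negligible_iff_null_sets null_sets_completion_iff null_sets_def)
    then have "negligible (interior T)" using interior_subset negligible_subset by blast
    then show False using barycenter_in_interior open_interior open_not_negligible by blast
  qed
  moreover have "emeasure lborel T \<noteq> \<infinity>" using emeasure_bounded_finite[OF bounded] by simp
  ultimately show ?thesis by (simp add: measure_def enn2real_positive_iff top.not_eq_extremum zero_less_iff_neq_zero)
qed

lemma T_borel [measurable]: "T \<in> sets borel" using closed by (rule borel_closed)

lemma set_integrable_continuous:
  fixes g :: "'a \<Rightarrow> 'b::{banach,second_countable_topology}"
  shows "continuous_on T g \<Longrightarrow> set_integrable lborel T g"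
  unfolding set_integrable_def by (rule borel_integrable_compact[OF compact])

text \<open>
  The affine map that exchanges \<open>p\<close> and \<open>q\<close> and fixes the other vertices is an oblique
  reflection of \<open>T\<close> onto itself. Hence all \<open>d + 1\<close> coordinates have the same integral, and they
  add up to one.
\<close>
lemma integral_bary: assumes p: "p \<in> V" shows "(LINT x:T|lborel. bary T p x) = measure lborel T / (real DIM('a) + 1)"
proof -
  have eq: "(LINT x:T|lborel. bary T q x) = (LINT x:T|lborel. bary T p x)" if q: "q \<in> V" for q
  proof (cases "q = p")
    case False
    define n w k where "n = bgrad T q - bgrad T p" and "w = p - q" and "k = bary T q 0 - bary T p 0"
    let ?B = "\<lambda>x. x + (n \<bullet> x + k) *\<^sub>R w"
    have n: "n \<bullet> w = -2" using bgrad_works[of p q] bgrad_works[of q p] p q False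
      by (simp add: n_def w_def inner_simps)
    have nk: "n \<bullet> x + k = bary T q x - bary T p x" for x
      by (simp add: n_def k_def bary_def inner_simps)
    have wb: "bgrad T r \<bullet> w = (if r = p then 1 else if r = q then -1 else 0)" if "r \<in> V" for r
      unfolding w_def bary_diff[symmetric] using bary_vertex[OF that p] bary_vertex[OF that q] False by auto
    have B: "bary T r (?B x) = (if r = p then bary T q x else if r = q then bary T p x else bary T r x)" if "r \<in> V" for r x
      using wb[OF that] by (auto simp: bary_add nk)
    have BT1: "?B x \<in> T" if "x \<in> T" for x
      unfolding mem_iff
    proof
      fix r assume r: "r \<in> V"
      show "0 \<le> bary T r (?B x)" unfolding B[OF r] using that p q r by (auto simp: mem_iff)
    qed
    have BB: "?B (?B x) = x" for x using n by (simp add: inner_add_right algebra_simps)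
    have BT: "?B x \<in> T \<longleftrightarrow> x \<in> T" for x using BT1[of x] BT1[of "?B x"] unfolding BB by blast
    have "(LINT x:T|lborel. bary T p x) = (LINT x|lborel. indicator T (?B x) * bary T p (?B x))"
      unfolding set_lebesgue_integral_def
      by (subst oblique_reflection_preserves_integral[OF n, of "\<lambda>x. indicator T x * bary T p x" k]) auto
    also have "\<dots> = (LINT x|lborel. indicator T x *\<^sub>R bary T q x)"
      using B[OF p] BT by (simp add: indicator_def)
    finally show ?thesis by (simp add: set_lebesgue_integral_def)
  qed simp
  have "(\<Sum>q\<in>V. LINT x:T|lborel. bary T q x) = (LINT x:T|lborel. (\<Sum>q\<in>V. bary T q x))"
    unfolding set_lebesgue_integral_def scaleR_sum_right
    by (rule Bochner_Integration.integral_sum[symmetric])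
      (use set_integrable_continuous[OF continuous_on_bary] in \<open>simp add: set_integrable_def\<close>)
  also have "\<dots> = measure lborel T" using sum_bary by (simp add: set_lebesgue_integral_def)
  finally show ?thesis using eq V(2) by (simp add: field_simps)
qed

lemma integral_affine: "(LINT x:T|lborel. a + b \<bullet> x) = measure lborel T * (a + b \<bullet> barycenter T)"
proof -
  have e: "a + b \<bullet> x = (\<Sum>q\<in>V. bary T q x * (a + b \<bullet> q))" for x
  proof -
    have "(\<Sum>q\<in>V. bary T q x * (a + b \<bullet> q)) = (\<Sum>q\<in>V. bary T q x) * a + b \<bullet> (\<Sum>q\<in>V. bary T q x *\<^sub>R q)"
      by (simp add: distrib_left sum.distrib sum_distrib_right inner_sum_right)
    then show ?thesis using sum_bary[of x] sum_bary_scaleR[of x] by simp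
  qed
  have "(LINT x:T|lborel. a + b \<bullet> x) = (LINT x|lborel. (\<Sum>q\<in>V. (indicator T x *\<^sub>R bary T q x) * (a + b \<bullet> q)))"
    unfolding set_lebesgue_integral_def by (subst e) (simp add: sum_distrib_left mult_ac)
  also have "\<dots> = (\<Sum>q\<in>V. (LINT x:T|lborel. bary T q x) * (a + b \<bullet> q))"
    unfolding set_lebesgue_integral_def
    by (subst Bochner_Integration.integral_sum)
      (use set_integrable_continuous[OF continuous_on_bary] in \<open>auto simp: set_integrable_def\<close>)
  also have "\<dots> = measure lborel T * (\<Sum>q\<in>V. bary T q (barycenter T) * (a + b \<bullet> q))"
    by (simp add: integral_bary bary_barycenter sum_distrib_left)
  also have "\<dots> = measure lborel T * (a + b \<bullet> barycenter T)" by (subst e) simp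
  finally show ?thesis .
qed

end

section \<open>Convex duality between facet coefficients and element vectors\<close>

text \<open>
  First-order optimality: divide by \<open>t\<close> and let \<open>t\<close> tend to zero.
\<close>
lemma nonneg_of_quadratic_lower_bound:
  fixes a q \<delta> :: real
  assumes "\<delta> > 0" and "\<And>t. 0 < t \<Longrightarrow> t < \<delta> \<Longrightarrow> 0 \<le> t * a + t\<^sup>2 * q"
  shows "0 \<le> a"
proof (rule ccontr)
  assume "\<not> 0 \<le> a"
  then have a: "a < 0" by simp
  define t where "t = min (\<delta> / 2) (- a / (2 * (\<bar>q\<bar> + 1)))"
  have t: "0 < t" "t < \<delta>" using a assms(1) by (auto simp: t_def field_simps add_pos_nonneg)
  have "t * q \<le> t * (\<bar>q\<bar> + 1)" using t by (intro mult_left_mono) auto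
  also have "\<dots> \<le> - a / (2 * (\<bar>q\<bar> + 1)) * (\<bar>q\<bar> + 1)" by (intro mult_right_mono) (auto simp: t_def)
  also have "\<dots> = - a / 2" by (simp add: field_simps add_pos_nonneg)
  finally have "a + t * q < 0" using a by linarith
  then have "t * (a + t * q) < 0" using t by (simp add: mult_less_0_iff)
  then show False using assms(2)[OF t] by (simp add: power2_eq_square algebra_simps)
qed

lemma norm_add_scaleR_squared:
  "(norm (u + t *\<^sub>R v))\<^sup>2 = (norm u)\<^sup>2 + 2 * t * (u \<bullet> v) + t\<^sup>2 * (norm v)\<^sup>2" for u v :: "'a::real_inner"
  unfolding power2_norm_eq_inner by (simp add: inner_simps inner_commute power2_eq_square algebra_simps)

lemma compact_Pi_UNIV:
  fixes K :: "'a \<Rightarrow> 'b::topological_space set"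
  assumes "\<And>i. compact (K i)"
  shows "compact (Pi UNIV K)"
proof -
  have "compactin (product_topology (\<lambda>_. euclidean) UNIV) (PiE UNIV K)"
    using assms by (simp add: compactin_PiE)
  then show ?thesis by (simp add: PiE_UNIV_domain euclidean_product_topology)
qed

text \<open>
  The finite-dimensional content of the theorem. Elements \<open>e \<in> E\<close> of volume \<open>\<omega> e\<close> carry vectors,
  facets carry scalars; facets are interior (\<open>I\<close>), Dirichlet (\<open>SD\<close>) or contact (\<open>SC\<close>) facets.
  \<open>l e S\<close> is the gradient on \<open>e\<close> of the basis function of \<open>S\<close>, \<open>N e\<close> is the square root of the
  coefficient matrix and \<open>M e\<close> its inverse, \<open>m S\<close> is the load at \<open>S\<close>, and \<open>a\<close>, \<open>b\<close>, \<open>pD\<close> are the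
  boundary data, with the facet area included in \<open>a\<close> and \<open>b\<close>. By \<open>const\<close>, constants have zero
  gradient, and \<open>conn\<close> is a discrete Poincare inequality, which expresses that the mesh is
  connected.
\<close>
locale finite_duality =
  fixes E :: "'e set" and I SD SC :: "'f set" and \<omega> :: "'e \<Rightarrow> real"
    and l :: "'e \<Rightarrow> 'f \<Rightarrow> 'v::euclidean_space" and N M :: "'e \<Rightarrow> 'v \<Rightarrow> 'v"
    and m a b pD :: "'f \<Rightarrow> real"
  assumes finE: "finite E" and finI: "finite I" and finD: "finite SD" and finC: "finite SC"
    and disj: "I \<inter> SD = {}" "I \<inter> SC = {}" "SD \<inter> SC = {}"
    and ne: "I \<union> SD \<union> SC \<noteq> {}"
    and \<omega>: "\<And>e. e \<in> E \<Longrightarrow> \<omega> e > 0"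
    and linN: "\<And>e. e \<in> E \<Longrightarrow> linear (N e)" and linM: "\<And>e. e \<in> E \<Longrightarrow> linear (M e)"
    and NM: "\<And>e x. e \<in> E \<Longrightarrow> N e (M e x) = x" and MN: "\<And>e x. e \<in> E \<Longrightarrow> M e (N e x) = x"
    and symN: "\<And>e x y. e \<in> E \<Longrightarrow> x \<bullet> N e y = N e x \<bullet> y"
    and const: "\<And>e. e \<in> E \<Longrightarrow> (\<Sum>S\<in>I \<union> SD \<union> SC. l e S) = 0"
    and conn: "\<exists>C. \<forall>c. \<forall>S\<in>I \<union> SD \<union> SC. \<forall>S'\<in>I \<union> SD \<union> SC.
        \<bar>c S - c S'\<bar> \<le> C * (\<Sum>e\<in>E. norm (\<Sum>S\<in>I \<union> SD \<union> SC. c S *\<^sub>R l e S))"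
begin

abbreviation "F \<equiv> I \<union> SD \<union> SC"

lemma finF: "finite F" using finI finD finC by simp

text \<open>
  For a coefficient vector \<open>c\<close> and an element field \<open>z\<close>: \<open>L e c\<close> is the gradient of \<open>c\<close> on \<open>e\<close>,
  \<open>R z S\<close> the net flux at \<open>S\<close> of the field with means \<open>z\<close> and the given divergence, \<open>J\<close> and
  \<open>dual_value\<close> are the primal and dual energies on the admissible \<open>c\<close> (\<open>cfeas\<close>) and \<open>z\<close>
  (\<open>zfeas\<close>).
\<close>
definition "L e c = (\<Sum>S\<in>F. c S *\<^sub>R l e S)"
definition "R z S = (\<Sum>e\<in>E. \<omega> e * (z e \<bullet> l e S)) + m S"
definition "\<psi> S t = b S * max 0 t - a S * max 0 (- t)"
definition "J c = (\<Sum>e\<in>E. \<omega> e * (norm (N e (L e c)))\<^sup>2) / 2 - (\<Sum>S\<in>F. m S * c S) + (\<Sum>S\<in>SC. \<psi> S (c S))"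
definition "cfeas c \<longleftrightarrow> (\<forall>S\<in>SD. c S = pD S)"
definition "zfeas z \<longleftrightarrow> (\<forall>S\<in>I. R z S = 0) \<and> (\<forall>S\<in>SC. a S \<le> R z S \<and> R z S \<le> b S)"
definition "dual_value z = - (\<Sum>e\<in>E. \<omega> e * (norm (M e (z e)))\<^sup>2) / 2 - (\<Sum>S\<in>SD. pD S * R z S)"
definition "minimizer c \<longleftrightarrow> cfeas c \<and> (\<forall>c'. cfeas c' \<longrightarrow> J c \<le> J c')"

lemma sum_F: "(\<Sum>S\<in>F. h S) = (\<Sum>S\<in>I. h S) + (\<Sum>S\<in>SD. h S) + (\<Sum>S\<in>SC. h S)" for h :: "'f \<Rightarrow> real"
  using disj finI finD finC by (subst sum.union_disjoint; auto)+

lemma summation_by_parts: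
  "(\<Sum>e\<in>E. \<omega> e * (z e \<bullet> L e c)) + (\<Sum>S\<in>F. m S * c S) = (\<Sum>S\<in>F. c S * R z S)"
proof -
  have "(\<Sum>e\<in>E. \<omega> e * (z e \<bullet> L e c)) = (\<Sum>e\<in>E. \<Sum>S\<in>F. c S * (\<omega> e * (z e \<bullet> l e S)))"
    by (simp add: L_def inner_sum_right sum_distrib_left mult_ac)
  also have "\<dots> = (\<Sum>S\<in>F. \<Sum>e\<in>E. c S * (\<omega> e * (z e \<bullet> l e S)))" by (rule sum.swap)
  finally show ?thesis by (simp add: R_def sum.distrib distrib_left sum_distrib_left mult_ac)
qed

lemma psi_ge: "a S \<le> r \<Longrightarrow> r \<le> b S \<Longrightarrow> r * t \<le> \<psi> S t"
  by (cases "t \<ge> 0") (auto simp: \<psi>_def max_def mult_right_mono mult_right_mono_neg)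

text \<open>
  Complete the square in the element terms. The mixed term is \<open>L e c \<bullet> z e\<close>, and summation by
  parts moves it to the facets, where interior facets contribute nothing and Dirichlet facets
  cancel.
\<close>
lemma duality_gap:
  assumes c: "cfeas c" and z: "zfeas z"
  shows "J c - dual_value z = (\<Sum>e\<in>E. \<omega> e * (norm (N e (L e c) + M e (z e)))\<^sup>2) / 2 + (\<Sum>S\<in>SC. \<psi> S (c S) - R z S * c S)"
proof -
  have "(\<Sum>e\<in>E. \<omega> e * (norm (N e (L e c) + M e (z e)))\<^sup>2)
      = (\<Sum>e\<in>E. \<omega> e * (norm (N e (L e c)))\<^sup>2 + \<omega> e * (norm (M e (z e)))\<^sup>2 + 2 * (\<omega> e * (z e \<bullet> L e c)))"
  proof (intro sum.cong refl)
    fix e assume e: "e \<in> E"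
    have "N e (L e c) \<bullet> M e (z e) = z e \<bullet> L e c"
      using symN[OF e, of "L e c" "M e (z e)"] NM[OF e] by (simp add: inner_commute)
    then show "\<omega> e * (norm (N e (L e c) + M e (z e)))\<^sup>2 =
      \<omega> e * (norm (N e (L e c)))\<^sup>2 + \<omega> e * (norm (M e (z e)))\<^sup>2 + 2 * (\<omega> e * (z e \<bullet> L e c))"
      by (simp add: power2_norm_eq_inner inner_simps inner_commute algebra_simps)
  qed
  also have "\<dots> = (\<Sum>e\<in>E. \<omega> e * (norm (N e (L e c)))\<^sup>2) + (\<Sum>e\<in>E. \<omega> e * (norm (M e (z e)))\<^sup>2)
       + 2 * (\<Sum>e\<in>E. \<omega> e * (z e \<bullet> L e c))" by (simp add: sum.distrib sum_distrib_left)
  finally have 1: "(\<Sum>e\<in>E. \<omega> e * (norm (N e (L e c) + M e (z e)))\<^sup>2) = \<dots>" .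
  have "(\<Sum>S\<in>F. c S * R z S) = (\<Sum>S\<in>SD. pD S * R z S) + (\<Sum>S\<in>SC. R z S * c S)"
    using c z by (subst sum_F) (simp add: cfeas_def zfeas_def mult.commute)
  with summation_by_parts[of z c]
  show ?thesis unfolding 1 J_def dual_value_def by (simp add: sum_subtractf field_simps)
qed

lemma weak_duality: assumes "cfeas c" "zfeas z" shows "dual_value z \<le> J c"
proof -
  have "0 \<le> (\<Sum>e\<in>E. \<omega> e * (norm (N e (L e c) + M e (z e)))\<^sup>2) / 2"
    using \<omega> by (intro divide_nonneg_nonneg sum_nonneg mult_nonneg_nonneg) (auto simp: less_imp_le)
  moreover have "0 \<le> (\<Sum>S\<in>SC. \<psi> S (c S) - R z S * c S)"
    using assms by (intro sum_nonneg) (auto simp: zfeas_def intro: psi_ge)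
  ultimately show ?thesis using duality_gap[OF assms] by linarith
qed

text \<open>
  Both sums in the gap have nonnegative terms, so all of these vanish.
\<close>
lemma zero_gap:
  assumes "cfeas c" "zfeas z" "J c \<le> dual_value z"
  shows "\<forall>e\<in>E. z e = - N e (N e (L e c))" "\<forall>S\<in>SC. \<psi> S (c S) = R z S * c S"
proof -
  have 1: "0 \<le> \<omega> e * (norm (N e (L e c) + M e (z e)))\<^sup>2" if "e \<in> E" for e using \<omega>[OF that] by simp
  have 2: "0 \<le> \<psi> S (c S) - R z S * c S" if "S \<in> SC" for S
    using assms that by (auto simp: zfeas_def intro: psi_ge)
  have 3: "0 \<le> (\<Sum>e\<in>E. \<omega> e * (norm (N e (L e c) + M e (z e)))\<^sup>2)"
    "0 \<le> (\<Sum>S\<in>SC. \<psi> S (c S) - R z S * c S)" using 1 2 by (auto intro: sum_nonneg)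
  with duality_gap[OF assms(1,2)] assms(3)
  have 4: "(\<Sum>e\<in>E. \<omega> e * (norm (N e (L e c) + M e (z e)))\<^sup>2) = 0"
    "(\<Sum>S\<in>SC. \<psi> S (c S) - R z S * c S) = 0" by linarith+
  show "\<forall>S\<in>SC. \<psi> S (c S) = R z S * c S" using 4(2) 2 finC by (simp add: sum_nonneg_eq_0_iff)
  show "\<forall>e\<in>E. z e = - N e (N e (L e c))"
  proof
    fix e assume e: "e \<in> E"
    then have "\<omega> e * (norm (N e (L e c) + M e (z e)))\<^sup>2 = 0"
      using 4(1) 1 finE sum_nonneg_eq_0_iff[of E "\<lambda>e. \<omega> e * (norm (N e (L e c) + M e (z e)))\<^sup>2"] by blast
    then have "M e (z e) = - N e (L e c)" using \<omega>[OF e] by (simp add: add_eq_0_iff)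
    then have "N e (M e (z e)) = - N e (N e (L e c))" using linN[OF e] by (simp add: linear_neg)
    then show "z e = - N e (N e (L e c))" using NM[OF e] by simp
  qed
qed

lemma L_upd: assumes "S \<in> F" shows "L e (c(S := c S + t)) = L e c + t *\<^sub>R l e S"
proof -
  have "L e (c(S := c S + t)) = (\<Sum>S'\<in>F. c S' *\<^sub>R l e S' + (if S' = S then t *\<^sub>R l e S else 0))"
    unfolding L_def by (intro sum.cong) (auto simp: algebra_simps)
  then show ?thesis using assms finF by (simp add: sum.distrib L_def)
qed

text \<open>
  Apart from the convex contact term, the energy is quadratic in each coefficient. Its slope is
  \<open>- R z S\<close> for \<open>z = - N (N (L c))\<close>, the flux of the field that belongs to \<open>c\<close>.
\<close>
lemma J_upd:
  assumes S: "S \<in> I \<union> SC"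
  shows "J (c(S := c S + t)) - J c = - t * R (\<lambda>e. - N e (N e (L e c))) S
     + t\<^sup>2 * ((\<Sum>e\<in>E. \<omega> e * (norm (N e (l e S)))\<^sup>2) / 2) + (if S \<in> SC then \<psi> S (c S + t) - \<psi> S (c S) else 0)"
proof -
  have SF: "S \<in> F" using S by auto
  have "(\<Sum>e\<in>E. \<omega> e * (norm (N e (L e (c(S := c S + t)))))\<^sup>2)
    = (\<Sum>e\<in>E. \<omega> e * (norm (N e (L e c)))\<^sup>2 + 2 * t * (\<omega> e * (N e (N e (L e c)) \<bullet> l e S)) + t\<^sup>2 * (\<omega> e * (norm (N e (l e S)))\<^sup>2))"
  proof (intro sum.cong refl)
    fix e assume e: "e \<in> E"
    have "N e (L e c) \<bullet> N e (l e S) = N e (N e (L e c)) \<bullet> l e S" by (rule symN[OF e])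
    then show "\<omega> e * (norm (N e (L e (c(S := c S + t)))))\<^sup>2 =
      \<omega> e * (norm (N e (L e c)))\<^sup>2 + 2 * t * (\<omega> e * (N e (N e (L e c)) \<bullet> l e S)) + t\<^sup>2 * (\<omega> e * (norm (N e (l e S)))\<^sup>2)"
      unfolding L_upd[OF SF] linear_add[OF linN[OF e]] linear_scale[OF linN[OF e]] norm_add_scaleR_squared
      by (simp add: algebra_simps)
  qed
  then have 1: "(\<Sum>e\<in>E. \<omega> e * (norm (N e (L e (c(S := c S + t)))))\<^sup>2) =
     (\<Sum>e\<in>E. \<omega> e * (norm (N e (L e c)))\<^sup>2) + 2 * t * (\<Sum>e\<in>E. \<omega> e * (N e (N e (L e c)) \<bullet> l e S))
      + t\<^sup>2 * (\<Sum>e\<in>E. \<omega> e * (norm (N e (l e S)))\<^sup>2)"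
    by (simp add: sum.distrib sum_distrib_left)
  have "(\<Sum>S'\<in>F. m S' * (c(S := c S + t)) S') = (\<Sum>S'\<in>F. m S' * c S' + (if S' = S then t * m S else 0))"
    by (intro sum.cong) (auto simp: algebra_simps)
  then have 2: "(\<Sum>S'\<in>F. m S' * (c(S := c S + t)) S') = (\<Sum>S'\<in>F. m S' * c S') + t * m S"
    using SF finF by (simp add: sum.distrib)
  have "(\<Sum>S'\<in>SC. \<psi> S' ((c(S := c S + t)) S')) = (\<Sum>S'\<in>SC. \<psi> S' (c S') + (if S' = S then \<psi> S (c S + t) - \<psi> S (c S) else 0))"
    by (intro sum.cong) auto
  then have 3: "(\<Sum>S'\<in>SC. \<psi> S' ((c(S := c S + t)) S')) = (\<Sum>S'\<in>SC. \<psi> S' (c S')) + (if S \<in> SC then \<psi> S (c S + t) - \<psi> S (c S) else 0)"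
    using finC by (simp add: sum.distrib)
  show ?thesis unfolding J_def 1 2 3 R_def by (simp add: sum_negf field_simps)
qed

text \<open>
  Zero slope in an interior coefficient is flux balance. In a contact coefficient the one-sided
  slopes of \<open>\<psi> S\<close> are \<open>b S\<close> and \<open>a S\<close>, which gives both the bounds on the flux and
  complementarity; then nothing is left of the gap.
\<close>
lemma minimizer_optimality:
  assumes c: "minimizer c" and ab: "\<And>S. S \<in> SC \<Longrightarrow> a S \<le> b S"
  defines "z \<equiv> \<lambda>e. - N e (N e (L e c))"
  shows "zfeas z" "J c = dual_value z"
proof -
  define q where "q S = (\<Sum>e\<in>E. \<omega> e * (norm (N e (l e S)))\<^sup>2) / 2" for S
  have var: "0 \<le> - t * R z S + t\<^sup>2 * q S + (if S \<in> SC then \<psi> S (c S + t) - \<psi> S (c S) else 0)"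
    if S: "S \<in> I \<union> SC" for S t
  proof -
    have "cfeas (c(S := c S + t))" using c S disj by (auto simp: minimizer_def cfeas_def)
    then have "J c \<le> J (c(S := c S + t))" using c by (simp add: minimizer_def)
    then show ?thesis using J_upd[OF S, of c t] by (simp add: z_def q_def)
  qed
  have RI: "R z S = 0" if "S \<in> I" for S
  proof -
    have [simp]: "S \<notin> SC" using that disj by auto
    have "0 \<le> - R z S"
      by (rule nonneg_of_quadratic_lower_bound[of 1 _ "q S"]) (use var[of S] that in auto)
    moreover have "0 \<le> R z S"
      by (rule nonneg_of_quadratic_lower_bound[of 1 _ "q S"]) (use var[of S "- t" for t] that in auto)
    ultimately show ?thesis by simp
  qed
  have RC: "a S \<le> R z S \<and> R z S \<le> b S \<and> \<psi> S (c S) = R z S * c S" if S: "S \<in> SC" for S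
  proof -
    \<comment> \<open>The four one-sided slopes; a step is restricted to the interval where \<open>\<psi> S\<close> is
      affine.\<close>
    have up: "0 \<le> b S - R z S" if "c S \<ge> 0"
    proof (rule nonneg_of_quadratic_lower_bound[of 1 _ "q S"])
      fix t :: real assume "0 < t" "t < 1"
      then show "0 \<le> t * (b S - R z S) + t\<^sup>2 * q S"
        using var[of S t] S that by (simp add: \<psi>_def max_def algebra_simps split: if_splits)
    qed auto
    have um: "0 \<le> R z S - b S" if "c S > 0"
    proof (rule nonneg_of_quadratic_lower_bound[of "c S" _ "q S"])
      fix t :: real assume "0 < t" "t < c S"
      then show "0 \<le> t * (R z S - b S) + t\<^sup>2 * q S"
        using var[of S "- t"] S by (simp add: \<psi>_def algebra_simps)
    qed (use that in auto)
    have dm: "0 \<le> R z S - a S" if "c S \<le> 0"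
    proof (rule nonneg_of_quadratic_lower_bound[of 1 _ "q S"])
      fix t :: real assume "0 < t" "t < 1"
      then show "0 \<le> t * (R z S - a S) + t\<^sup>2 * q S"
        using var[of S "- t"] S that by (simp add: \<psi>_def max_def algebra_simps split: if_splits)
    qed auto
    have du: "0 \<le> a S - R z S" if "c S < 0"
    proof (rule nonneg_of_quadratic_lower_bound[of "- c S" _ "q S"])
      fix t :: real assume "0 < t" "t < - c S"
      then show "0 \<le> t * (a S - R z S) + t\<^sup>2 * q S"
        using var[of S t] S that by (simp add: \<psi>_def max_def algebra_simps)
    qed (use that in auto)
    consider "c S > 0" | "c S = 0" | "c S < 0" by linarith
    then show ?thesis
      using up um dm du ab[OF S] by cases (auto simp: \<psi>_def)
  qed
  show zf: "zfeas z" using RI RC by (auto simp: zfeas_def)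
  have "cfeas c" using c by (simp add: minimizer_def)
  moreover have "N e (L e c) + M e (z e) = 0" if "e \<in> E" for e
    using MN[OF that] linM[OF that] by (simp add: z_def linear_neg)
  ultimately show "J c = dual_value z" using duality_gap[OF _ zf, of c] RC by simp
qed

lemma L_shift: "e \<in> E \<Longrightarrow> L e (\<lambda>S. c S - s) = L e c"
  using const[of e] by (simp add: L_def scaleR_left_diff_distrib sum_subtractf scaleR_sum_right[symmetric])

lemma J_continuous: "continuous_on UNIV J"
proof -
  have "continuous_on UNIV (\<lambda>c. N e (L e c))" if "e \<in> E" for e
  proof -
    have "continuous_on UNIV (L e)" unfolding L_def
      by (intro continuous_intros continuous_on_product_coordinates)
    moreover have "bounded_linear (N e)" using linN[OF that] by (simp add: linear_conv_bounded_linear)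
    ultimately show ?thesis using bounded_linear.continuous_on[of "N e" UNIV "L e"] by blast
  qed
  then show ?thesis unfolding J_def \<psi>_def
    by (intro continuous_on_add continuous_on_diff continuous_on_divide continuous_on_sum continuous_on_mult
        continuous_on_power continuous_on_norm continuous_on_const continuous_on_max continuous_on_minus
        continuous_on_product_coordinates) auto
qed

text \<open>
  Test the gap identity with one fixed admissible \<open>z0\<close>: on a sublevel set of \<open>J\<close> the gap is
  bounded, hence so is each square in it.
\<close>
lemma sublevel_gradient_bound:
  assumes z: "zfeas z0"
  obtains G where "\<And>c. cfeas c \<Longrightarrow> J c \<le> j \<Longrightarrow> (\<Sum>e\<in>E. norm (L e c)) \<le> G"
proof -
  define k where "k = j - dual_value z0 "
  have "\<exists>G. \<forall>c. cfeas c \<and> J c \<le> j \<longrightarrow> norm (L e c) \<le> G" if e: "e \<in> E" for e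
  proof -
    obtain B where B: "\<And>x. norm (M e x) \<le> norm x * B" "B > 0"
      using linM[OF e] by (metis bounded_linear.pos_bounded linear_conv_bounded_linear)
    have "norm (L e c) \<le> (sqrt (2 * k / \<omega> e) + norm (M e (z0 e))) * B" if c: "cfeas c" "J c \<le> j" for c
    proof -
      have "0 \<le> (\<Sum>S\<in>SC. \<psi> S (c S) - R z0 S * c S)"
        using z by (intro sum_nonneg) (auto simp: zfeas_def intro: psi_ge)
      then have "(\<Sum>e\<in>E. \<omega> e * (norm (N e (L e c) + M e (z0 e)))\<^sup>2) \<le> 2 * k"
        using duality_gap[OF c(1) z] c(2) by (simp add: k_def)
      moreover have "\<omega> e * (norm (N e (L e c) + M e (z0 e)))\<^sup>2 \<le> (\<Sum>e\<in>E. \<omega> e * (norm (N e (L e c) + M e (z0 e)))\<^sup>2)"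
        using e finE \<omega> by (intro member_le_sum) (auto simp: less_imp_le)
      ultimately have "(norm (N e (L e c) + M e (z0 e)))\<^sup>2 \<le> 2 * k / \<omega> e"
        using \<omega>[OF e] by (simp add: field_simps)
      then have 1: "norm (N e (L e c) + M e (z0 e)) \<le> sqrt (2 * k / \<omega> e)" by (rule real_le_rsqrt)
      have "norm (N e (L e c)) \<le> norm (N e (L e c) + M e (z0 e)) + norm (M e (z0 e))"
        using norm_triangle_ineq4[of "N e (L e c) + M e (z0 e)" "M e (z0 e)"] by simp
      then have "norm (N e (L e c)) \<le> sqrt (2 * k / \<omega> e) + norm (M e (z0 e))" using 1 by linarith
      then have "norm (N e (L e c)) * B \<le> (sqrt (2 * k / \<omega> e) + norm (M e (z0 e))) * B" using B(2) by simp
      then show ?thesis using B(1)[of "N e (L e c)"] MN[OF e] by simp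
    qed
    then show ?thesis by blast
  qed
  then obtain G where "\<forall>e\<in>E. \<forall>c. cfeas c \<and> J c \<le> j \<longrightarrow> norm (L e c) \<le> G e" by metis
  then show ?thesis by (intro that[of "\<Sum>e\<in>E. G e"] sum_mono) auto
qed

text \<open>
  By the oscillation bound, a low-energy \<open>c\<close> is bounded as soon as one coefficient is. A
  Dirichlet facet provides one. Without Dirichlet facets, if some coefficient is large then all
  have the same sign, and the shift that brings them close to zero keeps the gradient while
  \<open>\<psi> S t - R z0 S * t\<close> does not grow, since this is nonnegative and positively homogeneous in
  \<open>t\<close>.
\<close>
lemma bounded_competitor:
  assumes z: "zfeas z0"
  obtains B where "\<And>c. cfeas c \<Longrightarrow> \<exists>c'. cfeas c' \<and> J c' \<le> J c \<and> (\<forall>S\<in>F. \<bar>c' S\<bar> \<le> B)"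
proof -
  define c0 where "c0 S = (if S \<in> SD then pD S else 0)" for S
  have c0: "cfeas c0" by (simp add: c0_def cfeas_def)
  obtain G where G: "\<And>c. cfeas c \<Longrightarrow> J c \<le> J c0 \<Longrightarrow> (\<Sum>e\<in>E. norm (L e c)) \<le> G"
    using sublevel_gradient_bound[OF z] by metis
  obtain C where C: "\<And>c S S'. S \<in> F \<Longrightarrow> S' \<in> F \<Longrightarrow> \<bar>c S - c S'\<bar> \<le> C * (\<Sum>e\<in>E. norm (L e c))"
    using conn unfolding L_def by blast
  define \<rho> where "\<rho> = \<bar>C\<bar> * \<bar>G\<bar>"
  have osc: "\<bar>c S - c S'\<bar> \<le> \<rho>" if "cfeas c" "J c \<le> J c0" "S \<in> F" "S' \<in> F" for c S S'
  proof -
    have "C * (\<Sum>e\<in>E. norm (L e c)) \<le> \<bar>C\<bar> * \<bar>G\<bar>"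
      using G[OF that(1,2)] by (intro mult_mono) (auto intro: sum_nonneg)
    then show ?thesis using C[OF that(3,4), of c] by (simp add: \<rho>_def)
  qed
  have \<rho>: "\<rho> \<ge> 0" by (simp add: \<rho>_def)
  \<comment> \<open>A reference facet, Dirichlet whenever possible.\<close>
  obtain S0 where S0: "S0 \<in> F" "SD \<noteq> {} \<Longrightarrow> S0 \<in> SD" using ne by auto
  define B where "B = Max ((\<lambda>S. \<bar>c0 S\<bar>) ` F) + \<bar>pD S0\<bar> + 2 * \<rho>"
  have c0B: "\<bar>c0 S\<bar> \<le> Max ((\<lambda>S. \<bar>c0 S\<bar>) ` F)" if "S \<in> F" for S using that finF by (intro Max_ge) auto
  have M0: "0 \<le> Max ((\<lambda>S. \<bar>c0 S\<bar>) ` F)" using c0B[OF S0(1)] by linarith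
  have psi_shift: "\<psi> S (t - s) - R z0 S * (t - s) \<le> \<psi> S t - R z0 S * t"
    if "S \<in> SC" "(0 \<le> s \<and> s \<le> t) \<or> (t \<le> s \<and> s \<le> 0)" for S s t
  proof -
    have ab: "a S \<le> R z0 S" "R z0 S \<le> b S" using z that by (auto simp: zfeas_def)
    have "\<psi> S s - R z0 S * s \<ge> 0" using psi_ge[OF ab, of s] by simp
    moreover have "\<psi> S t = \<psi> S (t - s) + \<psi> S s" using that(2) by (auto simp: \<psi>_def max_def algebra_simps)
    ultimately show ?thesis by (simp add: algebra_simps)
  qed
  have "\<exists>c'. cfeas c' \<and> J c' \<le> J c \<and> (\<forall>S\<in>F. \<bar>c' S\<bar> \<le> B)" if c: "cfeas c" for c
  proof (cases "J c \<le> J c0")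
    case False
    have "\<bar>c0 S\<bar> \<le> B" if "S \<in> F" for S using c0B[OF that] \<rho> unfolding B_def by linarith
    then show ?thesis using c0 False by (intro exI[of _ c0]) auto
  next
    case True
    note osc = osc[OF c True]
    show ?thesis
    proof (cases "SD \<noteq> {} \<or> \<bar>c S0\<bar> \<le> \<rho>")
      case True
      then have "\<bar>c S0\<bar> \<le> \<bar>pD S0\<bar> + \<rho>"
      proof
        assume "SD \<noteq> {}"
        then have "c S0 = pD S0" using S0(2) c by (simp add: cfeas_def)
        then show ?thesis using \<rho> by simp
      qed simp
      then have "\<bar>c S\<bar> \<le> B" if "S \<in> F" for S
        using osc[OF that S0(1)] M0 \<rho> unfolding B_def by linarith
      then show ?thesis using c by blast
    next
      case False
      then have SD: "SD = {}" by simp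
      \<comment> \<open>The shift leaves the reference coefficient at \<open>\<plusminus> \<rho>\<close>, so that by the oscillation
        bound no coefficient changes sign.\<close>
      define s where "s = (if c S0 > 0 then c S0 - \<rho> else c S0 + \<rho>)"
      define c' where "c' = (\<lambda>S. c S - s)"
      have c': "cfeas c'" unfolding cfeas_def using SD by blast
      have "\<bar>c' S\<bar> \<le> B" if "S \<in> F" for S
        using osc[OF that S0(1)] M0 \<rho> False unfolding B_def c'_def s_def by (auto split: if_splits)
      moreover have "(0 \<le> s \<and> s \<le> c S) \<or> (c S \<le> s \<and> s \<le> 0)" if "S \<in> F" for S
        using osc[OF that S0(1)] \<rho> False unfolding s_def by (auto split: if_splits)
      then have "(\<Sum>S\<in>SC. \<psi> S (c' S) - R z0 S * c' S) \<le> (\<Sum>S\<in>SC. \<psi> S (c S) - R z0 S * c S)"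
        unfolding c'_def by (intro sum_mono psi_shift) auto
      moreover have "L e c' = L e c" if "e \<in> E" for e unfolding c'_def by (rule L_shift[OF that])
      then have "(\<Sum>e\<in>E. \<omega> e * (norm (N e (L e c') + M e (z0 e)))\<^sup>2) = (\<Sum>e\<in>E. \<omega> e * (norm (N e (L e c) + M e (z0 e)))\<^sup>2)"
        by (intro sum.cong) auto
      ultimately have "J c' \<le> J c" using duality_gap[OF c z] duality_gap[OF c' z] by linarith
      with c' \<open>\<And>S. S \<in> F \<Longrightarrow> \<bar>c' S\<bar> \<le> B\<close> show ?thesis by blast
    qed
  qed
  then show ?thesis using that by blast
qed

text \<open>
  The coefficients bounded by the competitor bound form a compact box in the product topology.
  Outside the facets, where coefficients have no influence, they are set to zero.
\<close>
lemma minimizer_exists: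
  assumes z: "zfeas z0"
  obtains c where "minimizer c"
proof -
  obtain B where B: "\<And>c. cfeas c \<Longrightarrow> \<exists>c'. cfeas c' \<and> J c' \<le> J c \<and> (\<forall>S\<in>F. \<bar>c' S\<bar> \<le> B)"
    using bounded_competitor[OF z] by metis
  define K where "K = Pi UNIV (\<lambda>S. if S \<in> SD then {pD S} else if S \<in> F then {-\<bar>B\<bar>..\<bar>B\<bar>} else {0})"
  have "compact K" unfolding K_def by (intro compact_Pi_UNIV) auto
  moreover have "(\<lambda>S. if S \<in> SD then pD S else 0) \<in> K" by (auto simp: K_def)
  ultimately obtain c where c: "c \<in> K" "\<And>c'. c' \<in> K \<Longrightarrow> J c \<le> J c'"
    using continuous_attains_inf[of K J] continuous_on_subset[OF J_continuous] by blast
  have "cfeas c" using c(1) by (auto simp: K_def cfeas_def split: if_splits)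
  moreover have "J c \<le> J c'" if c': "cfeas c'" for c'
  proof -
    obtain c2 where c2: "cfeas c2" "J c2 \<le> J c'" "\<forall>S\<in>F. \<bar>c2 S\<bar> \<le> B" using B[OF c'] by blast
    define c3 where "c3 S = (if S \<in> F then c2 S else 0)" for S
    have "\<bar>c2 S\<bar> \<le> \<bar>B\<bar>" if "S \<in> F" for S using c2(3) that by (meson abs_ge_self order_trans)
    then have "c3 \<in> K" using c2(1) by (auto simp: K_def c3_def cfeas_def abs_le_iff minus_le_iff)
    moreover have "J c3 = J c2"
    proof -
      have "L e c3 = L e c2" for e unfolding L_def by (intro sum.cong) (auto simp: c3_def)
      then show ?thesis unfolding J_def by (auto simp: c3_def intro!: arg_cong2[of _ _ _ _ "(+)"] sum.cong)
    qed
    ultimately show ?thesis using c(2)[of c3] c2(2) by simp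
  qed
  ultimately show ?thesis using that by (auto simp: minimizer_def)
qed

text \<open>
  Two minimizers belong to the same dual field, hence have the same gradient, so that their
  difference has no oscillation; it vanishes at a Dirichlet facet.
\<close>
lemma minimizer_unique:
  assumes c: "minimizer c" "minimizer c'" and z: "zfeas z0" and SD: "SD \<noteq> {}"
  shows "\<forall>S\<in>F. c S = c' S"
proof -
  have ab: "a S \<le> b S" if "S \<in> SC" for S using z that by (force simp: zfeas_def)
  have "J c' = J c" using c by (meson minimizer_def order_antisym)
  have cf: "cfeas c" "cfeas c'" using c by (auto simp: minimizer_def)
  \<comment> \<open>The field of \<open>c\<close> has no gap with \<open>c'\<close> either, because the energies agree.\<close>
  have "- N e (N e (L e c)) = - N e (N e (L e c'))" if "e \<in> E" for e
    using zero_gap(1)[OF cf(2) minimizer_optimality(1)[OF c(1) ab]] minimizer_optimality(2)[OF c(1) ab]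
      \<open>J c' = J c\<close> that by auto
  then have "M e (M e (N e (N e (L e c)))) = M e (M e (N e (N e (L e c'))))" if "e \<in> E" for e using that by auto
  then have "L e c = L e c'" if "e \<in> E" for e using that MN by auto
  then have "L e (\<lambda>S. c S - c' S) = 0" if "e \<in> E" for e
    using that by (simp add: L_def scaleR_left_diff_distrib sum_subtractf)
  then have 0: "(\<Sum>e\<in>E. norm (L e (\<lambda>S. c S - c' S))) = 0" by simp
  obtain S0 where S0: "S0 \<in> SD" using SD by auto
  then have "c S0 = c' S0" using cf by (simp add: cfeas_def)
  moreover obtain C where C: "\<And>c S S'. S \<in> F \<Longrightarrow> S' \<in> F \<Longrightarrow> \<bar>c S - c S'\<bar> \<le> C * (\<Sum>e\<in>E. norm (L e c))"
    using conn unfolding L_def by blast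
  ultimately show ?thesis using C[of _ S0 "\<lambda>S. c S - c' S"] S0 0 by fastforce
qed

text \<open>
  Young's inequality on each element; the conjugate of \<open>|N w|\<^sup>2 / 2\<close> is \<open>|M z|\<^sup>2 / 2\<close>.
\<close>
lemma conjugate_bound:
  "(\<Sum>e\<in>E. \<omega> e * (- z e \<bullet> w e)) - (\<Sum>e\<in>E. \<omega> e * (norm (N e (w e)))\<^sup>2) / 2 \<le> (\<Sum>e\<in>E. \<omega> e * (norm (M e (z e)))\<^sup>2) / 2"
proof -
  have "\<omega> e * (- z e \<bullet> w e) - \<omega> e * (norm (N e (w e)))\<^sup>2 / 2 \<le> \<omega> e * (norm (M e (z e)))\<^sup>2 / 2" if e: "e \<in> E" for e
  proof -
    have "M e (z e) \<bullet> N e (w e) = z e \<bullet> w e" using symN[OF e, of "M e (z e)" "w e"] NM[OF e] by simp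
    then have "(norm (M e (z e) + N e (w e)))\<^sup>2 = (norm (M e (z e)))\<^sup>2 + (norm (N e (w e)))\<^sup>2 + 2 * (z e \<bullet> w e)"
      by (simp add: power2_norm_eq_inner inner_simps inner_commute)
    then have "- (z e \<bullet> w e) - (norm (N e (w e)))\<^sup>2 / 2 \<le> (norm (M e (z e)))\<^sup>2 / 2"
      using zero_le_power2[of "norm (M e (z e) + N e (w e))"] by linarith
    from mult_left_mono[OF this less_imp_le[OF \<omega>[OF e]]] show ?thesis by (simp add: algebra_simps)
  qed
  then have "(\<Sum>e\<in>E. \<omega> e * (- z e \<bullet> w e) - \<omega> e * (norm (N e (w e)))\<^sup>2 / 2) \<le> (\<Sum>e\<in>E. \<omega> e * (norm (M e (z e)))\<^sup>2 / 2)"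
    by (rule sum_mono)
  then show ?thesis by (simp add: sum_subtractf sum_divide_distrib)
qed

lemma conjugate_attained:
  "(\<Sum>e\<in>E. \<omega> e * (- z e \<bullet> (- M e (M e (z e))))) - (\<Sum>e\<in>E. \<omega> e * (norm (N e (- M e (M e (z e)))))\<^sup>2) / 2
    = (\<Sum>e\<in>E. \<omega> e * (norm (M e (z e)))\<^sup>2) / 2"
proof -
  have e1: "z e \<bullet> M e (M e (z e)) = (norm (M e (z e)))\<^sup>2" if e: "e \<in> E" for e
    using symN[OF e, of "M e (z e)" "M e (M e (z e))"] NM[OF e] by (simp add: power2_norm_eq_inner)
  have e2: "norm (N e (- M e (M e (z e)))) = norm (M e (z e))" if e: "e \<in> E" for e
    using linear_neg[OF linN[OF e]] NM[OF e] by simp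
  have "(\<Sum>e\<in>E. \<omega> e * (- z e \<bullet> (- M e (M e (z e))))) = (\<Sum>e\<in>E. \<omega> e * (norm (M e (z e)))\<^sup>2)"
    by (intro sum.cong refl) (simp add: e1)
  moreover have "(\<Sum>e\<in>E. \<omega> e * (norm (N e (- M e (M e (z e)))))\<^sup>2) = (\<Sum>e\<in>E. \<omega> e * (norm (M e (z e)))\<^sup>2)"
    by (intro sum.cong refl) (simp add: e2)
  ultimately show ?thesis by simp
qed

text \<open>
  The function of \<open>c\<close> whose supremum over admissible \<open>c\<close> is the conjugate of the facet part of
  \<open>J\<close>, after summation by parts. It is a sum of functions of single coefficients, so that the
  competitors \<open>clift S t\<close>, which vanish on all other facets without Dirichlet data, detect a
  violated constraint on \<open>z\<close> at \<open>S\<close>.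
\<close>
definition "H z c = (\<Sum>S\<in>F. c S * R z S) - (\<Sum>S\<in>SC. \<psi> S (c S))"
definition "clift S t = (\<lambda>S'. if S' \<in> SD then pD S' else if S' = S then t else 0)"

lemma H_le: assumes "zfeas z" "cfeas c" shows "H z c \<le> (\<Sum>S\<in>SD. pD S * R z S)"
proof -
  have "(\<Sum>S\<in>SC. c S * R z S) \<le> (\<Sum>S\<in>SC. \<psi> S (c S))"
  proof (rule sum_mono)
    fix S assume "S \<in> SC"
    then show "c S * R z S \<le> \<psi> S (c S)" using assms(1) psi_ge[of S "R z S" "c S"] by (simp add: zfeas_def mult.commute)
  qed
  moreover have "(\<Sum>S\<in>I. c S * R z S) = 0" using assms(1) by (simp add: zfeas_def)
  moreover have "(\<Sum>S\<in>SD. c S * R z S) = (\<Sum>S\<in>SD. pD S * R z S)" using assms(2) by (simp add: cfeas_def)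
  ultimately show ?thesis unfolding H_def sum_F by linarith
qed

lemma H_clift:
  assumes S: "S \<in> I \<union> SC"
  shows "H z (clift S t) = (\<Sum>S\<in>SD. pD S * R z S) + t * R z S - (if S \<in> SC then \<psi> S t else 0)" "cfeas (clift S t)"
proof -
  show "cfeas (clift S t)" by (simp add: cfeas_def clift_def)
  have nD: "S \<notin> SD" using S disj by auto
  have psi0: "\<psi> S' 0 = 0" for S' by (simp add: \<psi>_def)
  have i: "(\<Sum>S'\<in>I. clift S t S' * R z S') = (\<Sum>S'\<in>I. if S' = S then t * R z S else 0)"
    using disj by (intro sum.cong) (auto simp: clift_def)
  have d: "(\<Sum>S'\<in>SD. clift S t S' * R z S') = (\<Sum>S\<in>SD. pD S * R z S)" by (simp add: clift_def)
  have c: "(\<Sum>S'\<in>SC. clift S t S' * R z S') = (\<Sum>S'\<in>SC. if S' = S then t * R z S else 0)"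
    using disj by (intro sum.cong) (auto simp: clift_def)
  have p: "(\<Sum>S'\<in>SC. \<psi> S' (clift S t S')) = (\<Sum>S'\<in>SC. if S' = S then \<psi> S t else 0)"
    using disj nD by (intro sum.cong) (auto simp: clift_def psi0)
  show "H z (clift S t) = (\<Sum>S\<in>SD. pD S * R z S) + t * R z S - (if S \<in> SC then \<psi> S t else 0)"
    unfolding H_def sum_F i d c p using S disj finI finC by auto
qed

lemma H_attained: assumes "zfeas z" obtains c where "cfeas c" "H z c = (\<Sum>S\<in>SD. pD S * R z S)"
proof -
  define c where "c S = (if S \<in> SD then pD S else 0)" for S
  have "(\<Sum>S\<in>I. c S * R z S) = 0" "(\<Sum>S\<in>SC. c S * R z S) = 0" "(\<Sum>S\<in>SC. \<psi> S (c S)) = 0"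
    using disj by (auto simp: c_def \<psi>_def intro!: sum.neutral)
  moreover have "(\<Sum>S\<in>SD. c S * R z S) = (\<Sum>S\<in>SD. pD S * R z S)" by (simp add: c_def)
  ultimately have "H z c = (\<Sum>S\<in>SD. pD S * R z S)" unfolding H_def sum_F by simp
  moreover have "cfeas c" by (simp add: c_def cfeas_def)
  ultimately show ?thesis using that by blast
qed

text \<open>
  If \<open>R z S\<close> violates its constraint, \<open>H\<close> grows linearly along a ray in the coefficient of \<open>S\<close>:
  in the direction of the sign of \<open>R z S\<close> on an interior facet; on a contact facet in the
  negative direction if the flux is below \<open>a S\<close>, in the positive one if it is above \<open>b S\<close>.
\<close>
lemma H_unbounded: assumes nz: "\<not> zfeas z" shows "\<exists>c. cfeas c \<and> B \<le> H z c"
proof -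
  define d where "d = (\<Sum>S\<in>SD. pD S * R z S)"
  \<comment> \<open>The increment over the Dirichlet part that is needed to reach \<open>B\<close>.\<close>
  define b' where "b' = max 0 (B - d)"
  have b': "b' \<ge> 0" "d + b' \<ge> B" by (auto simp: b'_def)
  have "\<exists>S\<in>I \<union> SC. \<exists>t. t * R z S - (if S \<in> SC then \<psi> S t else 0) = b'"
  proof -
    consider S where "S \<in> I" "R z S \<noteq> 0" | S where "S \<in> SC" "R z S < a S" | S where "S \<in> SC" "b S < R z S"
      using nz by (auto simp: zfeas_def not_le)
    then show ?thesis
    proof cases
      case 1
      then show ?thesis using disj by (intro bexI[of _ S] exI[of _ "b' / R z S"]) auto
    next
      case 2
      define t where "t = b' / (a S - R z S)"
      have "t \<ge> 0" using 2 b' by (simp add: t_def)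
      then have "\<psi> S (- t) = - (a S * t)" by (simp add: \<psi>_def max_def)
      moreover have "t * (a S - R z S) = b'" using 2 by (simp add: t_def)
      ultimately have "(- t) * R z S - \<psi> S (- t) = b'" by (simp add: algebra_simps)
      then show ?thesis using 2 by (intro bexI[of _ S] exI[of _ "- t"]) auto
    next
      case 3
      define t where "t = b' / (R z S - b S)"
      have "t \<ge> 0" using 3 b' by (simp add: t_def)
      then have "\<psi> S t = b S * t" by (simp add: \<psi>_def max_def)
      moreover have "t * (R z S - b S) = b'" using 3 by (simp add: t_def)
      ultimately have "t * R z S - \<psi> S t = b'" by (simp add: algebra_simps)
      then show ?thesis using 3 by (intro bexI[of _ S] exI[of _ t]) auto
    qed
  qed
  then obtain S t where S: "S \<in> I \<union> SC" "t * R z S - (if S \<in> SC then \<psi> S t else 0) = b'" by blast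
  have "H z (clift S t) = d + b'" using H_clift(1)[OF S(1), of z t] S(2) by (simp add: d_def)
  then show ?thesis using H_clift(2)[OF S(1)] b'(2) by (intro exI[of _ "clift S t"]) auto
qed

end

section \<open>Facet means as volume integrals\<close>

text \<open>
  A \<open>C\<^sup>1\<close> function with its gradient as an explicit second argument, in any Euclidean space.
\<close>
definition C1_pair :: "('a::euclidean_space \<Rightarrow> real) \<Rightarrow> ('a \<Rightarrow> 'a) \<Rightarrow> bool" where
  "C1_pair \<phi> D \<longleftrightarrow> (\<forall>x. (\<phi> has_derivative (\<lambda>h. D x \<bullet> h)) (at x)) \<and> continuous_on UNIV D"

lemma C1_pair_continuous: "C1_pair \<phi> D \<Longrightarrow> continuous_on A \<phi>"
  unfolding C1_pair_def
  by (meson continuous_at_imp_continuous_on has_derivative_continuous)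

lemma C1_pair_grad_continuous: "C1_pair \<phi> D \<Longrightarrow> continuous_on A D"
  unfolding C1_pair_def by (meson continuous_on_subset subset_UNIV)

lemma C1_pair_measurable:
  assumes "C1_pair \<phi> D"
  shows "\<phi> \<in> borel_measurable borel" "D \<in> borel_measurable borel"
  using C1_pair_continuous[OF assms] C1_pair_grad_continuous[OF assms]
  by (auto intro: borel_measurable_continuous_onI)

lemma C1_pair_diff:
  assumes "C1_pair \<phi> D" "C1_pair \<psi> E" shows "C1_pair (\<lambda>x. \<phi> x - \<psi> x) (\<lambda>x. D x - E x)"
proof -
  have "((\<lambda>x. \<phi> x - \<psi> x) has_derivative (\<lambda>h. (D x - E x) \<bullet> h)) (at x)" for x
    using has_derivative_diff[of \<phi> "\<lambda>h. D x \<bullet> h" "at x" \<psi> "\<lambda>h. E x \<bullet> h"] assms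
    by (simp add: C1_pair_def inner_diff_left)
  then show ?thesis using assms unfolding C1_pair_def by (auto intro: continuous_on_diff)
qed

lemma C1_pair_compose_affine:
  assumes "C1_pair \<phi> D"
  shows "C1_pair (\<lambda>x. \<phi> (x + (g \<bullet> x + k) *\<^sub>R w)) (\<lambda>x. D (x + (g \<bullet> x + k) *\<^sub>R w) + (D (x + (g \<bullet> x + k) *\<^sub>R w) \<bullet> w) *\<^sub>R g)"
proof -
  let ?A = "\<lambda>x. x + (g \<bullet> x + k) *\<^sub>R w"
  have "((\<lambda>x. \<phi> (?A x)) has_derivative (\<lambda>h. (D (?A x) + (D (?A x) \<bullet> w) *\<^sub>R g) \<bullet> h)) (at x)" for x
  proof -
    have A: "(?A has_derivative (\<lambda>h. h + (g \<bullet> h) *\<^sub>R w)) (at x)"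
      by (auto intro!: derivative_eq_intros)
    have "(\<phi> has_derivative (\<lambda>h. D (?A x) \<bullet> h)) (at (?A x))" using assms by (simp add: C1_pair_def)
    from has_derivative_compose[OF A this] show ?thesis
      by (rule has_derivative_eq_rhs) (auto simp: inner_simps algebra_simps)
  qed
  moreover have "continuous_on UNIV (\<lambda>x. D (?A x))"
    by (rule continuous_on_compose2[OF C1_pair_grad_continuous[OF assms, of UNIV]]) (auto intro!: continuous_intros)
  ultimately show ?thesis unfolding C1_pair_def by (auto intro!: continuous_intros)
qed

lemma homothety_integral:
  fixes g :: "'a::euclidean_space \<Rightarrow> real"
  assumes [measurable]: "g \<in> borel_measurable borel" and c: "c > 0"
  shows "(LINT y|lborel. g y) = c ^ DIM('a) * (LINT x|lborel. g (t + c *\<^sub>R x))"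
proof -
  have "(LINT y|lborel. g y) = (LINT y|density (distr lborel borel (\<lambda>x. t + c *\<^sub>R x)) (\<lambda>_. ennreal (\<bar>c\<bar> ^ DIM('a))). g y)"
    using lborel_affine[of c t] c by simp
  also have "\<dots> = (LINT y|distr lborel borel (\<lambda>x. t + c *\<^sub>R x). c ^ DIM('a) *\<^sub>R g y)"
    using c by (subst integral_density) auto
  also have "\<dots> = c ^ DIM('a) * (LINT x|lborel. g (t + c *\<^sub>R x))"
    by (subst integral_distr) auto
  finally show ?thesis .
qed

text \<open>
  Squaring makes the positive part continuously differentiable; this is the smoothness that bump
  functions need here.
\<close>
lemma has_real_derivative_pos_part_squared:
  "((\<lambda>t::real. (max 0 t)\<^sup>2) has_real_derivative 2 * max 0 t) (at t)"
proof (cases "t = 0")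
  case True
  have "(\<lambda>h::real. (max 0 h)\<^sup>2 / h) \<midarrow>0\<rightarrow> 0"
  proof (rule Lim_null_comparison)
    show "\<forall>\<^sub>F h in at 0. norm ((max 0 h)\<^sup>2 / h) \<le> \<bar>h\<bar>" for h :: real
      by (intro always_eventually allI) (auto simp: max_def power2_eq_square)
    show "(\<lambda>h::real. \<bar>h\<bar>) \<midarrow>0\<rightarrow> 0" using tendsto_rabs[OF tendsto_ident_at, of "0::real" UNIV] by simp
  qed
  then show ?thesis by (simp add: DERIV_def True)
next
  case False
  then consider "t > 0" | "t < 0" by linarith
  then show ?thesis
  proof cases
    case 1
    have "((\<lambda>t::real. t\<^sup>2) has_real_derivative 2 * max 0 t) (at t)"
      using 1 by (auto intro!: derivative_eq_intros)
    then show ?thesis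
      by (rule has_field_derivative_transform_within_open[of _ _ _ "{0<..}"]) (use 1 in auto)
  next
    case 2
    have "((\<lambda>t::real. 0) has_real_derivative 2 * max 0 t) (at t)" using 2 by simp
    then show ?thesis
      by (rule has_field_derivative_transform_within_open[of _ _ _ "{..<0}"]) (use 2 in auto)
  qed
qed

lemma C1_pair_pos_part_squared:
  assumes "C1_pair P Q"
  shows "C1_pair (\<lambda>x. (max 0 (P x))\<^sup>2) (\<lambda>x. (2 * max 0 (P x)) *\<^sub>R Q x)"
proof -
  have "((\<lambda>x. (max 0 (P x))\<^sup>2) has_derivative (\<lambda>h. ((2 * max 0 (P x)) *\<^sub>R Q x) \<bullet> h)) (at x)" for x
  proof -
    have "(P has_derivative (\<lambda>h. Q x \<bullet> h)) (at x)" using assms by (simp add: C1_pair_def)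
    moreover have "((\<lambda>t::real. (max 0 t)\<^sup>2) has_derivative (\<lambda>h. 2 * max 0 (P x) * h)) (at (P x))"
      using has_real_derivative_pos_part_squared by (simp add: has_field_derivative_def)
    ultimately show ?thesis using has_derivative_compose[of P _ x UNIV] by fastforce
  qed
  moreover have "continuous_on UNIV (\<lambda>x. (2 * max 0 (P x)) *\<^sub>R Q x)"
    by (intro continuous_intros C1_pair_continuous[OF assms] C1_pair_grad_continuous[OF assms])
  ultimately show ?thesis unfolding C1_pair_def by blast
qed

definition bump :: "'a::euclidean_space \<Rightarrow> real \<Rightarrow> 'a \<Rightarrow> real" where
  "bump x0 r x = (max 0 (r\<^sup>2 - (norm (x - x0))\<^sup>2))\<^sup>2"

lemma C1_pair_bump: "\<exists>D. C1_pair (bump x0 r) D"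
proof -
  have "C1_pair (\<lambda>x. r\<^sup>2 - (norm (x - x0))\<^sup>2) (\<lambda>x. (-2) *\<^sub>R (x - x0))"
    unfolding C1_pair_def power2_norm_eq_inner
    by (auto intro!: derivative_eq_intros continuous_intros simp: inner_commute)
  then show ?thesis unfolding bump_def[abs_def] using C1_pair_pos_part_squared by blast
qed

lemma bump_zero: "r \<le> norm (x - x0) \<Longrightarrow> 0 \<le> r \<Longrightarrow> bump x0 r x = 0"
  by (simp add: bump_def max_def power_mono)

lemma bump_pos: "norm (x - x0) < r \<Longrightarrow> bump x0 r x > 0"
  using power_strict_mono[of "norm (x - x0)" r 2] by (simp add: bump_def max_def)

lemma bump_nonneg: "bump x0 r x \<ge> 0"
  by (simp add: bump_def)

lemma (in full_simplex) integral_pos: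
  fixes f :: "'a \<Rightarrow> real"
  assumes f: "continuous_on T f" and nn: "\<And>x. x \<in> T \<Longrightarrow> 0 \<le> f x" and x0: "x0 \<in> T" "f x0 > 0"
  shows "(LINT x:T|lborel. f x) > 0"
proof (rule ccontr)
  assume "\<not> (LINT x:T|lborel. f x) > 0"
  moreover have "(LINT x:T|lborel. f x) \<ge> 0"
    unfolding set_lebesgue_integral_def by (rule Bochner_Integration.integral_nonneg) (auto simp: indicator_def nn)
  ultimately have 0: "(LINT x|lborel. indicator T x *\<^sub>R f x) = 0" by (simp add: set_lebesgue_integral_def)
  have "AE x in lborel. indicator T x *\<^sub>R f x = 0"
    using set_integrable_continuous[OF f] 0 unfolding set_integrable_def
    by (subst (asm) integral_nonneg_eq_0_iff_AE) (auto simp: indicator_def nn)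
  moreover have "open (f -` {0<..} \<inter> interior T)"
    using continuous_on_subset[OF f interior_subset] open_interior
    by (metis (no_types) Int_commute continuous_on_open_vimage open_greaterThan)
  moreover have "f -` {0<..} \<inter> interior T \<noteq> {}"
  proof -
    have "closure (interior T) = T"
      using convex_closure_interior[OF convex] barycenter_in_interior closed by auto
    then have x0c: "x0 \<in> closure (interior T)" using x0 by simp
    obtain e where e: "e > 0" "\<And>y. y \<in> T \<Longrightarrow> dist y x0 < e \<Longrightarrow> dist (f y) (f x0) < f x0"
      using f x0 unfolding continuous_on_iff by blast
    obtain y where y: "y \<in> interior T" "dist y x0 < e" using x0c e(1) by (auto simp: closure_approachable)
    then have "dist (f y) (f x0) < f x0" using e(2) interior_subset by blast
    then have "f y > 0" by (auto simp: dist_real_def abs_less_iff)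
    then show ?thesis using y by auto
  qed
  ultimately have "\<not> negligible (f -` {0<..} \<inter> interior T)" "open (f -` {0<..} \<inter> interior T)"
    "AE x in lborel. indicator T x *\<^sub>R f x = 0"
    using open_not_negligible by auto
  moreover have "AE x in lborel. x \<notin> f -` {0<..} \<inter> interior T"
    using \<open>AE x in lborel. indicator T x *\<^sub>R f x = 0\<close> interior_subset[of T]
    by (auto simp: indicator_def split: if_splits)
  ultimately show False
    by (subst (asm) AE_iff_null_sets[symmetric]) (auto simp: negligible_iff_null_sets null_sets_completion_iff)
qed

text \<open>
  By the Gauss theorem this is the average of \<open>\<phi>\<close> over the facet opposite to \<open>p\<close>: the field
  \<open>\<phi> (x - p)\<close> has divergence \<open>D x \<bullet> (x - p) + d \<phi> x\<close>, is tangential to the facets through \<open>p\<close>,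
  and its normal component on the opposite facet is \<open>\<phi>\<close> times the height \<open>d |T| / |S|\<close>.
\<close>
definition fmean :: "'a::euclidean_space set \<Rightarrow> 'a \<Rightarrow> ('a \<Rightarrow> real) \<Rightarrow> ('a \<Rightarrow> 'a) \<Rightarrow> real" where
  "fmean T p \<phi> D = (LINT x:T|lborel. D x \<bullet> (x - p) + real DIM('a) * \<phi> x) / (real DIM('a) * measure lborel T)"

context full_simplex
begin

lemma cone_integrable:
  "C1_pair \<phi> D \<Longrightarrow> set_integrable lborel T (\<lambda>x. D x \<bullet> (x - p) + real DIM('a) * \<phi> x)"
  by (intro set_integrable_continuous continuous_intros C1_pair_continuous C1_pair_grad_continuous)

lemma homothety_mem:
  assumes p: "p \<in> V" and s: "0 < s" "s \<le> 1"
  shows "p + s *\<^sub>R (x - p) \<in> T \<and> 1 - s \<le> bary T p (p + s *\<^sub>R (x - p)) \<longleftrightarrow> x \<in> T"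
proof -
  have b: "bary T q (p + s *\<^sub>R (x - p)) = (if q = p then 1 - s + s * bary T p x else s * bary T q x)" if "q \<in> V" for q
    using bary_vertex[OF that p] by (simp add: bary_add bary_diff[symmetric] right_diff_distrib)
  have "(\<forall>q\<in>V. 0 \<le> bary T q (p + s *\<^sub>R (x - p))) \<and> 0 \<le> s * bary T p x \<longleftrightarrow> (\<forall>q\<in>V. 0 \<le> s * bary T q x)"
    using s b p by (auto simp: add_nonneg_nonneg)
  then show ?thesis unfolding mem_iff using b[OF p] s by (simp add: zero_le_mult_iff)
qed

text \<open>
  The homothety with centre \<open>p\<close> and ratio \<open>s\<close> maps \<open>T\<close> onto the part of \<open>T\<close> cut off near \<open>p\<close>.
\<close>
lemma scaled_integral:
  assumes p: "p \<in> V" and s: "0 < s" "s \<le> 1" and [measurable]: "\<phi> \<in> borel_measurable borel"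
  shows "s ^ DIM('a) * (LINT x:T|lborel. \<phi> (p + s *\<^sub>R (x - p))) = (LINT x:{x\<in>T. 1 - s \<le> bary T p x}|lborel. \<phi> x)"
proof -
  have "(LINT x:{x\<in>T. 1 - s \<le> bary T p x}|lborel. \<phi> x)
     = s ^ DIM('a) * (LINT x|lborel. indicator {x\<in>T. 1 - s \<le> bary T p x} ((p - s *\<^sub>R p) + s *\<^sub>R x) *\<^sub>R \<phi> ((p - s *\<^sub>R p) + s *\<^sub>R x))"
    unfolding set_lebesgue_integral_def
    by (rule homothety_integral[of "\<lambda>x. indicator {x\<in>T. 1 - s \<le> bary T p x} x *\<^sub>R \<phi> x"]) (use s in auto)
  also have "(p - s *\<^sub>R p) + s *\<^sub>R x = p + s *\<^sub>R (x - p)" for x by (simp add: algebra_simps)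
  then have "(LINT x|lborel. indicator {x\<in>T. 1 - s \<le> bary T p x} ((p - s *\<^sub>R p) + s *\<^sub>R x) *\<^sub>R \<phi> ((p - s *\<^sub>R p) + s *\<^sub>R x))
    = (LINT x|lborel. indicator {x\<in>T. 1 - s \<le> bary T p x} (p + s *\<^sub>R (x - p)) *\<^sub>R \<phi> (p + s *\<^sub>R (x - p)))"
    by (simp only:)
  also have "\<dots> = (LINT x:T|lborel. \<phi> (p + s *\<^sub>R (x - p)))"
    unfolding set_lebesgue_integral_def using homothety_mem[OF p s]
    by (intro Bochner_Integration.integral_cong refl) (auto simp: indicator_def)
  finally show ?thesis by simp
qed

text \<open>
  The integrand is the derivative at \<open>s = 1\<close> of \<open>s\<^sup>d \<phi> (p + s (x - p))\<close>, whose integral over \<open>T\<close>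
  is that of \<open>\<phi>\<close> over the shrunken copy of \<open>T\<close>. So the difference quotient is the integral of
  \<open>\<phi>\<close> over the slab of relative width \<open>\<epsilon>\<close> next to the facet, divided by \<open>\<epsilon>\<close>. There \<open>\<phi>\<close> is of
  order \<open>\<epsilon>\<close>, as it vanishes on the facet, and the volume of the slab is of order \<open>\<epsilon>\<close> too.
\<close>
lemma cone_integral_zero:
  assumes p: "p \<in> V" and C1: "C1_pair \<phi> D" and zero: "\<And>x. x \<in> opp T p \<Longrightarrow> \<phi> x = 0"
  shows "(LINT x:T|lborel. D x \<bullet> (x - p) + real DIM('a) * \<phi> x) = 0"
proof -
  let ?d = "real DIM('a)"
  note [measurable] = C1_pair_measurable[OF C1]
  have pT: "p \<in> T" by (rule vertex_in[OF p])
  obtain L where L: "\<And>x. x \<in> T \<Longrightarrow> norm (D x) \<le> L" "L > 0"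
    using compact_continuous_image[OF C1_pair_grad_continuous[OF C1] compact, THEN compact_imp_bounded]
    unfolding bounded_pos by auto
  obtain M where M: "\<And>x. x \<in> T \<Longrightarrow> \<bar>\<phi> x\<bar> \<le> M" "M > 0"
    using compact_continuous_image[OF C1_pair_continuous[OF C1] compact, THEN compact_imp_bounded]
    unfolding bounded_pos by auto
  obtain \<Delta> where \<Delta>0: "\<Delta> > 0" "\<forall>x\<in>T. norm x \<le> \<Delta>" using bounded unfolding bounded_pos by auto
  have \<Delta>: "norm (x - y) \<le> 2 * \<Delta>" if "x \<in> T" "y \<in> T" for x y
    using norm_triangle_ineq4[of x y] bspec[OF \<Delta>0(2) that(1)] bspec[OF \<Delta>0(2) that(2)] by linarith
  have Lip: "\<bar>\<phi> x - \<phi> y\<bar> \<le> L * norm (x - y)" if "x \<in> T" "y \<in> T" for x y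
  proof -
    have "norm (\<phi> x - \<phi> y) \<le> L * norm (x - y)"
    proof (rule differentiable_bound[OF convex _ _ that])
      show "(\<phi> has_derivative (\<lambda>h. D z \<bullet> h)) (at z within T)" for z
        using C1 by (auto simp: C1_pair_def intro: has_derivative_at_withinI)
      show "onorm (\<lambda>h. D z \<bullet> h) \<le> L" if "z \<in> T" for z
      proof (rule onorm_bound)
        show "norm (D z \<bullet> h) \<le> L * norm h" for h
          using Cauchy_Schwarz_ineq2[of "D z" h] mult_right_mono[OF L(1)[OF that], of "norm h"] by simp
      qed (use L in auto)
    qed
    then show ?thesis by simp
  qed
  define \<epsilon> where "\<epsilon> k = 1 / (real k + 2)" for k
  have \<epsilon>: "0 < \<epsilon> k" "\<epsilon> k \<le> 1/2" for k by (auto simp: \<epsilon>_def field_simps)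
  have \<epsilon>0: "\<epsilon> \<longlonglongrightarrow> 0"
    using LIMSEQ_ignore_initial_segment[OF lim_1_over_n, of 2] by (simp add: \<epsilon>_def[abs_def] add.commute)
  define y where "y k x = p + (1 - \<epsilon> k) *\<^sub>R (x - p)" for k x
  \<comment> \<open>The difference quotient at \<open>s = 1 - \<epsilon> k\<close> of \<open>s\<^sup>d \<phi> (p + s (x - p))\<close>.\<close>
  define F where "F k x = (\<phi> x - (1 - \<epsilon> k) ^ DIM('a) * \<phi> (y k x)) / \<epsilon> k" for k x
  have [measurable]: "y k \<in> borel_measurable borel" for k unfolding y_def by measurable
  have [measurable]: "F k \<in> borel_measurable borel" for k unfolding F_def by measurable
  \<comment> \<open>Bernoulli's inequality bounds the volume of the slab and the second part of the
    quotient.\<close>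
  have bern: "0 \<le> (1 - \<epsilon> k) ^ DIM('a)" "1 - (1 - \<epsilon> k) ^ DIM('a) \<le> ?d * \<epsilon> k" "(1 - \<epsilon> k) ^ DIM('a) \<le> 1" for k
    using Bernoulli_inequality[of "- \<epsilon> k" "DIM('a)"] \<epsilon>[of k] by (auto intro!: power_le_one)
  have yT: "y k x \<in> T" if "x \<in> T" for k x
    using homothety_mem[OF p, of "1 - \<epsilon> k" x] \<epsilon>[of k] that by (simp add: y_def)
  define W where "W = L * (2 * \<Delta>) + ?d * M"
  have FW: "\<bar>F k x\<bar> \<le> W" if x: "x \<in> T" for k x
  proof -
    have "x - y k x = \<epsilon> k *\<^sub>R (x - p)" by (simp add: y_def algebra_simps)
    then have "\<bar>\<phi> x - \<phi> (y k x)\<bar> \<le> L * (\<epsilon> k * norm (x - p))"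
      using Lip[OF x yT[OF x], of k] \<epsilon>[of k] by simp
    also have "\<dots> \<le> L * (\<epsilon> k * (2 * \<Delta>))" using \<Delta>[OF x pT] L \<epsilon>[of k] by (intro mult_left_mono) auto
    finally have 1: "\<bar>\<phi> x - \<phi> (y k x)\<bar> \<le> L * (\<epsilon> k * (2 * \<Delta>))" .
    have "\<bar>(1 - (1 - \<epsilon> k) ^ DIM('a)) * \<phi> (y k x)\<bar> \<le> (?d * \<epsilon> k) * M"
      unfolding abs_mult using bern[of k] M(1)[OF yT[OF x], of k] by (intro mult_mono) auto
    then have "\<bar>\<phi> x - (1 - \<epsilon> k) ^ DIM('a) * \<phi> (y k x)\<bar> \<le> W * \<epsilon> k"
      using 1 unfolding W_def by (simp add: algebra_simps abs_le_iff)
    then show ?thesis using \<epsilon>[of k] by (simp add: F_def abs_divide divide_le_eq)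
  qed
  have lim: "(\<lambda>k. F k x) \<longlonglongrightarrow> D x \<bullet> (x - p) + ?d * \<phi> x" for x
  proof -
    let ?h = "\<lambda>s. s ^ DIM('a) * \<phi> (p + s *\<^sub>R (x - p))"
    have "((\<lambda>s. p + s *\<^sub>R (x - p)) has_derivative (\<lambda>t. t *\<^sub>R (x - p))) (at 1)"
      by (auto intro!: derivative_eq_intros)
    moreover have "(\<phi> has_derivative (\<lambda>h. D x \<bullet> h)) (at (p + 1 *\<^sub>R (x - p)))" using C1 by (simp add: C1_pair_def)
    ultimately have "((\<lambda>s. \<phi> (p + s *\<^sub>R (x - p))) has_derivative (\<lambda>t. D x \<bullet> (t *\<^sub>R (x - p)))) (at 1)"
      by (rule has_derivative_compose)
    then have "((\<lambda>s. \<phi> (p + s *\<^sub>R (x - p))) has_real_derivative D x \<bullet> (x - p)) (at 1)"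
      unfolding has_field_derivative_def by (rule has_derivative_eq_rhs) auto
    then have "(?h has_real_derivative ?d * \<phi> x + D x \<bullet> (x - p)) (at 1)"
      by (auto intro!: derivative_eq_intros)
    then have "((\<lambda>s. (?h s - ?h 1) / (s - 1)) \<longlongrightarrow> ?d * \<phi> x + D x \<bullet> (x - p)) (at 1)"
      by (simp add: has_field_derivative_iff)
    moreover have "filterlim (\<lambda>k. 1 - \<epsilon> k) (at 1) sequentially"
    proof (rule filterlim_atI)
      show "(\<lambda>k. 1 - \<epsilon> k) \<longlonglongrightarrow> 1" using tendsto_diff[OF tendsto_const \<epsilon>0, of 1] by simp
      show "\<forall>\<^sub>F k in sequentially. 1 - \<epsilon> k \<noteq> 1" using \<epsilon>(1) by (auto simp: less_le)
    qed
    ultimately have "(\<lambda>k. (?h (1 - \<epsilon> k) - ?h 1) / ((1 - \<epsilon> k) - 1)) \<longlonglongrightarrow> ?d * \<phi> x + D x \<bullet> (x - p)"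
      by (rule filterlim_compose)
    moreover have "(?h (1 - \<epsilon> k) - ?h 1) / ((1 - \<epsilon> k) - 1) = F k x" for k
      using \<epsilon>(1)[of k] by (simp add: F_def y_def field_simps)
    ultimately show ?thesis by (simp add: add.commute)
  qed
  have int: "integrable lborel (\<lambda>x. indicator T x *\<^sub>R W)"
    using set_integrable_continuous[of "\<lambda>_. W"] by (simp add: set_integrable_def)
  have lim1: "(\<lambda>k. LINT x:T|lborel. F k x) \<longlonglongrightarrow> (LINT x:T|lborel. D x \<bullet> (x - p) + ?d * \<phi> x)"
    unfolding set_lebesgue_integral_def
  proof (rule integral_dominated_convergence[OF _ _ int])
    show "AE x in lborel. (\<lambda>k. indicat_real T x *\<^sub>R F k x) \<longlonglongrightarrow> indicat_real T x *\<^sub>R (D x \<bullet> (x - p) + ?d * \<phi> x)"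
      using lim by (intro AE_I2 tendsto_intros)
    show "AE x in lborel. norm (indicat_real T x *\<^sub>R F k x) \<le> indicat_real T x *\<^sub>R W" for k
      using FW by (intro AE_I2) (auto simp: indicator_def)
  qed measurable
  \<comment> \<open>The same integrals, evaluated by scaling, reduce to an integral over the slab at the
    facet.\<close>
  have bound: "\<bar>LINT x:T|lborel. F k x\<bar> \<le> \<epsilon> k * (?d * L * (2 * \<Delta>) * measure lborel T)" for k
  proof -
    let ?s = "1 - \<epsilon> k"
    let ?Ts = "{x\<in>T. 1 - ?s \<le> bary T p x}"
    have s: "0 < ?s" "?s \<le> 1" using \<epsilon>[of k] by auto
    have \<phi>i: "set_integrable lborel T \<phi>" "set_integrable lborel T (\<lambda>x. \<phi> (y k x))" "set_integrable lborel T (\<lambda>x. 1 :: real)"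
      unfolding y_def
      by (auto intro!: set_integrable_continuous C1_pair_continuous[OF C1] continuous_on_compose2[OF C1_pair_continuous[OF C1, of UNIV]] continuous_intros)
    have [measurable]: "?Ts \<in> sets borel" by measurable
    have \<phi>s: "set_integrable lborel ?Ts \<phi>" "set_integrable lborel ?Ts (\<lambda>x. 1 :: real)"
      by (rule set_integrable_subset[OF \<phi>i(1)]; auto) (rule set_integrable_subset[OF \<phi>i(3)]; auto)
    have "(LINT x:T|lborel. F k x) = (1 / \<epsilon> k) * (LINT x|lborel. indicator T x *\<^sub>R \<phi> x - ?s ^ DIM('a) * (indicator T x *\<^sub>R \<phi> (y k x)))"
      unfolding set_lebesgue_integral_def F_def
      by (subst integral_mult_right_zero[symmetric]) (auto intro!: Bochner_Integration.integral_cong simp: field_simps)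
    also have "\<dots> = (1 / \<epsilon> k) * ((LINT x:T|lborel. \<phi> x) - ?s ^ DIM('a) * (LINT x:T|lborel. \<phi> (y k x)))"
      unfolding set_lebesgue_integral_def using \<phi>i
      by (subst Bochner_Integration.integral_diff) (auto simp: set_integrable_def)
    also have "?s ^ DIM('a) * (LINT x:T|lborel. \<phi> (y k x)) = (LINT x:?Ts|lborel. \<phi> x)"
      unfolding y_def by (rule scaled_integral[OF p s]) measurable
    also have "(LINT x:T|lborel. \<phi> x) - (LINT x:?Ts|lborel. \<phi> x) = (LINT x|lborel. indicator T x *\<^sub>R \<phi> x - indicator ?Ts x *\<^sub>R \<phi> x)"
      unfolding set_lebesgue_integral_def using \<phi>i(1) \<phi>s(1)
      by (subst Bochner_Integration.integral_diff) (auto simp: set_integrable_def)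
    finally have 1: "(LINT x:T|lborel. F k x) = (1 / \<epsilon> k) * (LINT x|lborel. indicator T x *\<^sub>R \<phi> x - indicator ?Ts x *\<^sub>R \<phi> x)" .
    have slab: "\<bar>\<phi> x\<bar> \<le> L * (\<epsilon> k * (2 * \<Delta>))" if x: "x \<in> T" "x \<notin> ?Ts" for x
    proof -
      define l where "l = bary T p x"
      have l: "0 \<le> l" "l < \<epsilon> k" "l < 1" using x p \<epsilon>[of k] by (auto simp: l_def mem_iff)
      define z where "z = p + (1 / (1 - l)) *\<^sub>R (x - p)"
      have xz: "x = p + (1 - l) *\<^sub>R (z - p)" using l by (simp add: z_def)
      have zT: "z \<in> T" using homothety_mem[OF p, of "1 - l" z] x(1) l unfolding xz[symmetric] by (simp add: l_def)
      have "bary T p x = bary T p p + (1 - l) * (bary T p z - bary T p p)"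
        by (subst xz) (simp add: bary_add bary_diff)
      then have "(1 - l) * bary T p z = 0" using bary_vertex[OF p p] by (simp add: l_def algebra_simps)
      then have "z \<in> opp T p" using l zT by (simp add: opp_mem_iff[OF p])
      then have "\<bar>\<phi> x\<bar> \<le> L * norm (x - z)" using Lip[OF x(1) zT] zero by simp
      also have "x - z = (- l) *\<^sub>R (z - p)" by (subst xz) (simp add: algebra_simps)
      also have "L * norm ((- l) *\<^sub>R (z - p)) \<le> L * (\<epsilon> k * (2 * \<Delta>))"
        using \<Delta>[OF zT pT] l L by (auto intro!: mult_mono)
      finally show ?thesis .
    qed
    have "\<bar>LINT x|lborel. indicator T x *\<^sub>R \<phi> x - indicator ?Ts x *\<^sub>R \<phi> x\<bar>
       \<le> (LINT x|lborel. \<bar>indicator T x *\<^sub>R \<phi> x - indicator ?Ts x *\<^sub>R \<phi> x\<bar>)"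
      by (rule integral_abs_bound)
    also have "\<dots> \<le> (LINT x|lborel. (L * (\<epsilon> k * (2 * \<Delta>))) * (indicator T x *\<^sub>R 1 - indicator ?Ts x *\<^sub>R 1))"
    proof (rule integral_mono)
      show "\<bar>indicator T x *\<^sub>R \<phi> x - indicator ?Ts x *\<^sub>R \<phi> x\<bar> \<le> (L * (\<epsilon> k * (2 * \<Delta>))) * (indicator T x *\<^sub>R 1 - indicator ?Ts x *\<^sub>R 1)" for x
        using slab[of x] by (auto simp: indicator_def)
    qed (use \<phi>i(1,3) \<phi>s in \<open>auto simp: set_integrable_def intro!: Bochner_Integration.integrable_diff integrable_abs integrable_mult_right\<close>)
    also have "\<dots> = (L * (\<epsilon> k * (2 * \<Delta>))) * ((LINT x:T|lborel. 1) - (LINT x:?Ts|lborel. 1))"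
      using \<phi>i(3) \<phi>s(2) unfolding set_lebesgue_integral_def set_integrable_def
      by (subst integral_mult_right_zero) (subst Bochner_Integration.integral_diff, auto)
    also have "(LINT x:?Ts|lborel. 1) = ?s ^ DIM('a) * (LINT x:T|lborel. 1)"
      using scaled_integral[OF p s, of "\<lambda>_. 1"] by simp
    also have "(LINT x:T|lborel. 1) - ?s ^ DIM('a) * (LINT x:T|lborel. (1::real)) = (1 - ?s ^ DIM('a)) * measure lborel T"
      by (simp add: set_lebesgue_integral_def algebra_simps)
    also have "(L * (\<epsilon> k * (2 * \<Delta>))) * ((1 - ?s ^ DIM('a)) * measure lborel T) \<le> (L * (\<epsilon> k * (2 * \<Delta>))) * ((?d * \<epsilon> k) * measure lborel T)"
      using bern[of k] L \<epsilon>[of k] \<Delta>0 by (intro mult_left_mono mult_right_mono) auto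
    finally have "\<bar>LINT x|lborel. indicator T x *\<^sub>R \<phi> x - indicator ?Ts x *\<^sub>R \<phi> x\<bar>
       \<le> (L * (\<epsilon> k * (2 * \<Delta>))) * ((?d * \<epsilon> k) * measure lborel T)" .
    then show ?thesis unfolding 1 using \<epsilon>[of k] by (simp add: abs_mult field_simps)
  qed
  have "(\<lambda>k. LINT x:T|lborel. F k x) \<longlonglongrightarrow> 0"
  proof (rule tendsto_rabs_zero_cancel, rule tendsto_sandwich[of "\<lambda>_. 0"])
    show "(\<lambda>k. \<epsilon> k * (?d * L * (2 * \<Delta>) * measure lborel T)) \<longlonglongrightarrow> 0"
      using tendsto_mult_right[OF \<epsilon>0, of "?d * L * (2 * \<Delta>) * measure lborel T"] by simp
  qed (use bound in auto)
  then show ?thesis using lim1 LIMSEQ_unique by blast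
qed

lemma fmean_cong:
  assumes p: "p \<in> V" and C1: "C1_pair \<phi> D" "C1_pair \<psi> E" and eq: "\<And>x. x \<in> opp T p \<Longrightarrow> \<phi> x = \<psi> x"
  shows "fmean T p \<phi> D = fmean T p \<psi> E"
proof -
  have "(LINT x:T|lborel. (D x - E x) \<bullet> (x - p) + real DIM('a) * (\<phi> x - \<psi> x)) = 0"
    by (rule cone_integral_zero[OF p C1_pair_diff[OF C1]]) (simp add: eq)
  moreover have "(LINT x:T|lborel. (D x - E x) \<bullet> (x - p) + real DIM('a) * (\<phi> x - \<psi> x))
     = (LINT x:T|lborel. D x \<bullet> (x - p) + real DIM('a) * \<phi> x) - (LINT x:T|lborel. E x \<bullet> (x - p) + real DIM('a) * \<psi> x)"
    using cone_integrable[OF C1(1), of p] cone_integrable[OF C1(2), of p]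
    by (subst set_integral_diff(2)[symmetric]) (auto simp: algebra_simps inner_diff_left)
  ultimately show ?thesis by (simp add: fmean_def)
qed

lemma fmean_zero:
  assumes p: "p \<in> V" and C1: "C1_pair \<phi> D" and eq: "\<And>x. x \<in> opp T p \<Longrightarrow> \<phi> x = 0"
  shows "fmean T p \<phi> D = 0"
  using cone_integral_zero[OF assms] by (simp add: fmean_def)

text \<open>
  Only the values on the facet matter, so that the bump may be replaced by the function that
  agrees with it there and is homogeneous of degree four about \<open>p\<close>. For that function the Euler
  relation makes the integrand \<open>(4 + d) \<psi>\<close>, which is nonnegative and positive at \<open>x0\<close>.
\<close>
lemma fmean_bump_pos:
  assumes p: "p \<in> V" and x0: "x0 \<in> opp T p" and r: "r > 0" and C1: "C1_pair (bump x0 r) D"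
  shows "fmean T p (bump x0 r) D > 0"
proof -
  \<comment> \<open>As \<open>s\<close> grows linearly from zero at \<open>p\<close> to one on the facet, \<open>P\<close> is
    \<open>s\<^sup>2 (r\<^sup>2 - |p + (x - p) / s - x0|\<^sup>2)\<close>: the radial extension of \<open>r\<^sup>2 - |x - x0|\<^sup>2\<close> from the
    facet, of degree two, written without division.\<close>
  define g where "g = bgrad T p"
  define s where "s x = - (g \<bullet> (x - p))" for x
  define w where "w x = x - p + s x *\<^sub>R (p - x0)" for x
  define P where "P x = r\<^sup>2 * (s x)\<^sup>2 - w x \<bullet> w x" for x
  define Q where "Q x = (- 2 * r\<^sup>2 * s x) *\<^sub>R g - 2 *\<^sub>R w x + (2 * (w x \<bullet> (p - x0))) *\<^sub>R g" for x
  have sb: "s x = 1 - bary T p x" for x by (simp add: s_def g_def bary_def)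
  have sd: "(s has_derivative (\<lambda>h. - (g \<bullet> h))) (at x)" for x
    unfolding s_def by (auto intro!: derivative_eq_intros)
  have wd: "(w has_derivative (\<lambda>h. h - (g \<bullet> h) *\<^sub>R (p - x0))) (at x)" for x
    unfolding w_def by (auto intro!: derivative_eq_intros sd)
  have "(P has_derivative (\<lambda>h. Q x \<bullet> h)) (at x)" for x
    unfolding P_def
    by (rule has_derivative_eq_rhs, (rule derivative_intros sd wd)+)
      (auto simp: Q_def fun_eq_iff inner_simps inner_commute algebra_simps)
  moreover have "continuous_on UNIV Q"
    unfolding Q_def w_def s_def by (intro continuous_intros)
  ultimately have PQ: "C1_pair P Q" by (simp add: C1_pair_def)
  define \<psi> where "\<psi> x = (max 0 (P x))\<^sup>2" for x
  define E where "E x = (2 * max 0 (P x)) *\<^sub>R Q x" for x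
  have \<psi>E: "C1_pair \<psi> E" unfolding \<psi>_def[abs_def] E_def[abs_def] by (rule C1_pair_pos_part_squared[OF PQ])
  \<comment> \<open>The Euler relation for functions homogeneous of degree two about \<open>p\<close>.\<close>
  have "Q x \<bullet> (x - p) = 2 * P x" for x
  proof -
    have "x - p = w x - s x *\<^sub>R (p - x0)" by (simp add: w_def)
    then have "w x \<bullet> (x - p) = w x \<bullet> w x - s x * (w x \<bullet> (p - x0))" by (simp add: inner_simps)
    moreover have "g \<bullet> (x - p) = - s x" by (simp add: s_def)
    ultimately show ?thesis by (simp add: Q_def P_def inner_left_distrib inner_diff_left power2_eq_square)
  qed
  then have E4: "E x \<bullet> (x - p) = 4 * \<psi> x" for x
    by (simp add: E_def \<psi>_def max_def power2_eq_square)
  have "fmean T p (bump x0 r) D = fmean T p \<psi> E"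
  proof (rule fmean_cong[OF p C1 \<psi>E])
    fix x assume "x \<in> opp T p"
    then have "s x = 1" by (simp add: sb opp_mem_iff[OF p])
    then show "bump x0 r x = \<psi> x" by (simp add: bump_def \<psi>_def P_def w_def power2_norm_eq_inner)
  qed
  also have "\<dots> > 0"
  proof -
    have "s x0 = 1" using x0 by (simp add: sb opp_mem_iff[OF p])
    then have "\<psi> x0 > 0" using r by (simp add: \<psi>_def P_def w_def)
    then have "(LINT x:T|lborel. E x \<bullet> (x - p) + real DIM('a) * \<psi> x) > 0"
      using x0 opp_mem_iff[OF p] unfolding E4
      by (intro integral_pos[of _ x0] continuous_intros C1_pair_continuous[OF \<psi>E])
        (auto simp: \<psi>_def intro!: add_pos_pos)
    then show ?thesis using measure_pos by (simp add: fmean_def)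
  qed
  finally show ?thesis .
qed

text \<open>
  Integration by parts on one element for an affine field with divergence \<open>\<gamma>\<close>. The field is the
  combination of the fields \<open>x - p\<close>, over the vertices \<open>p\<close>, with the weights
  \<open>\<gamma> / (d (d + 1)) - \<nabla>\<lambda>\<^sub>p \<bullet> \<zeta>\<close>, and each of these contributes one facet mean.
\<close>
lemma divergence_decomposition:
  fixes \<zeta> :: 'a
  assumes C1: "C1_pair \<phi> D"
  shows "(LINT x:T|lborel. (\<zeta> + (\<gamma> / real DIM('a)) *\<^sub>R (x - barycenter T)) \<bullet> D x + \<gamma> * \<phi> x)
    = (\<Sum>p\<in>V. measure lborel T * (\<gamma> / (real DIM('a) + 1) - real DIM('a) * (bgrad T p \<bullet> \<zeta>)) * fmean T p \<phi> D)"
proof -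
  let ?d = "real DIM('a)"
  \<comment> \<open>The weights are chosen to sum to \<open>\<gamma> / d\<close> and to reproduce the field.\<close>
  define c where "c p = \<gamma> / (?d * (?d + 1)) - bgrad T p \<bullet> \<zeta>" for p
  have sc: "(\<Sum>p\<in>V. c p) = \<gamma> / ?d"
  proof -
    have "(\<Sum>p\<in>V. c p) = (?d + 1) * (\<gamma> / (?d * (?d + 1)))"
      using V(2) sum_bgrad by (simp add: c_def sum_subtractf inner_sum_left[symmetric] add.commute)
    moreover have "?d + 1 \<noteq> 0" by linarith
    ultimately show ?thesis by simp
  qed
  have bT: "(\<Sum>p\<in>V. p) = (?d + 1) *\<^sub>R barycenter T"
  proof -
    have "1 + ?d \<noteq> 0" by linarith
    then show ?thesis using V(2) by (simp add: barycenter_eq add.commute)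
  qed
  have "(\<Sum>p\<in>V. c p *\<^sub>R p) = (\<gamma> / ?d) *\<^sub>R barycenter T - \<zeta>"
  proof -
    have "(\<Sum>p\<in>V. c p *\<^sub>R p) = (\<gamma> / (?d * (?d + 1))) *\<^sub>R (\<Sum>p\<in>V. p) - (\<Sum>p\<in>V. (bgrad T p \<bullet> \<zeta>) *\<^sub>R p)"
      by (simp add: c_def scaleR_left_diff_distrib sum_subtractf scaleR_sum_right)
    also have "(\<gamma> / (?d * (?d + 1))) *\<^sub>R (\<Sum>p\<in>V. p) = (\<gamma> / ?d) *\<^sub>R barycenter T"
    proof -
      have "?d + 1 \<noteq> 0" by linarith
      then show ?thesis unfolding bT by simp
    qed
    finally show ?thesis by (simp add: sum_bgrad_scaleR)
  qed
  then have dec: "(\<Sum>p\<in>V. c p *\<^sub>R (x - p)) = \<zeta> + (\<gamma> / ?d) *\<^sub>R (x - barycenter T)" for x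
    using sc by (simp add: scaleR_diff_right sum_subtractf scaleR_sum_left[symmetric] algebra_simps)
  have "(\<Sum>p\<in>V. c p * (D x \<bullet> (x - p) + ?d * \<phi> x)) = (\<zeta> + (\<gamma> / ?d) *\<^sub>R (x - barycenter T)) \<bullet> D x + \<gamma> * \<phi> x" for x
  proof -
    have "(\<Sum>p\<in>V. c p * (D x \<bullet> (x - p) + ?d * \<phi> x)) = D x \<bullet> (\<Sum>p\<in>V. c p *\<^sub>R (x - p)) + (\<Sum>p\<in>V. c p) * (?d * \<phi> x)"
      by (simp add: distrib_left sum.distrib inner_sum_right sum_distrib_right)
    then show ?thesis unfolding dec sc by (simp add: inner_commute)
  qed
  then have "(LINT x:T|lborel. (\<zeta> + (\<gamma> / ?d) *\<^sub>R (x - barycenter T)) \<bullet> D x + \<gamma> * \<phi> x)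
    = (LINT x|lborel. (\<Sum>p\<in>V. c p * (indicator T x *\<^sub>R (D x \<bullet> (x - p) + ?d * \<phi> x))))"
    unfolding set_lebesgue_integral_def
    by (intro Bochner_Integration.integral_cong refl) (simp add: sum_distrib_left[symmetric] indicator_def)
  also have "\<dots> = (\<Sum>p\<in>V. c p * (LINT x:T|lborel. D x \<bullet> (x - p) + ?d * \<phi> x))"
    unfolding set_lebesgue_integral_def using cone_integrable[OF C1]
    by (subst Bochner_Integration.integral_sum) (auto simp: set_integrable_def)
  also have "\<dots> = (\<Sum>p\<in>V. measure lborel T * (\<gamma> / (?d + 1) - ?d * (bgrad T p \<bullet> \<zeta>)) * fmean T p \<phi> D)"
  proof (intro sum.cong refl)
    fix p assume "p \<in> V"
    have "\<gamma> / (?d + 1) - ?d * (bgrad T p \<bullet> \<zeta>) = ?d * c p" by (simp add: c_def right_diff_distrib)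
    then show "c p * (LINT x:T|lborel. D x \<bullet> (x - p) + ?d * \<phi> x)
      = measure lborel T * (\<gamma> / (?d + 1) - ?d * (bgrad T p \<bullet> \<zeta>)) * fmean T p \<phi> D"
      using measure_pos by (simp add: fmean_def)
  qed
  finally show ?thesis .
qed

end

text \<open>
  The affine map that fixes the common facet and takes \<open>p\<close> to \<open>p'\<close> maps \<open>T\<close> onto \<open>T'\<close>. Pulling
  \<open>\<phi>\<close> back does not change it on the facet, and the volume factor of the map cancels in the
  quotient.
\<close>
lemma fmean_shared_facet:
  fixes T T' :: "'a::euclidean_space set"
  assumes "full_simplex T" "full_simplex T'" and p: "p \<in> verts T" and p': "p' \<in> verts T'"
    and opp: "opp T p = opp T' p'" and C1: "C1_pair \<phi> D"
  shows "fmean T p \<phi> D = fmean T' p' \<phi> D"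
proof -
  interpret T: full_simplex T by fact
  interpret T': full_simplex T' by fact
  note [measurable] = C1_pair_measurable[OF C1]
  have VV: "verts T - {p} = verts T' - {p'}" using T.verts_opp[OF p] T'.verts_opp[OF p'] opp by simp
  define g k where "g = bgrad T p" and "k = bary T p 0"
  define A where "A x = x + (g \<bullet> x + k) *\<^sub>R (p' - p)" for x
  have gk: "g \<bullet> x + k = bary T p x" for x by (simp add: g_def k_def bary_def inner_simps)
  \<comment> \<open>The new coordinates of \<open>A x\<close> are the old ones of \<open>x\<close>, with \<open>p'\<close> in place of \<open>p\<close>.\<close>
  have bA: "bary T' q (A x) = (if q = p' then bary T p x else bary T q x)" if "q \<in> verts T'" for q x
  proof -
    let ?u = "\<lambda>q. if q = p' then bary T p x else bary T q x"
    have "(\<Sum>q\<in>verts T'. ?u q) = bary T p x + (\<Sum>q\<in>verts T - {p}. bary T q x)"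
      using VV by (simp add: sum.remove[OF T'.V(1) p'])
    also have "\<dots> = 1" using T.sum_bary[of x] by (simp add: sum.remove[OF T.V(1) p])
    finally have 1: "(\<Sum>q\<in>verts T'. ?u q) = 1" .
    have "(\<Sum>q\<in>verts T'. ?u q *\<^sub>R q) = bary T p x *\<^sub>R p' + (\<Sum>q\<in>verts T - {p}. bary T q x *\<^sub>R q)"
      using VV by (simp add: sum.remove[OF T'.V(1) p'])
    also have "(\<Sum>q\<in>verts T - {p}. bary T q x *\<^sub>R q) = x - bary T p x *\<^sub>R p"
      using T.sum_bary_scaleR[of x] by (simp add: sum.remove[OF T.V(1) p] algebra_simps)
    finally have 2: "(\<Sum>q\<in>verts T'. ?u q *\<^sub>R q) = A x"
      unfolding A_def gk by (simp only: scaleR_right_diff_distrib) (simp add: algebra_simps)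
    show ?thesis using T'.bary_combination[OF that 1] unfolding 2 .
  qed
  have bA': "bary T' p' (A x) = bary T p x" for x using bA[OF p'] by simp
  have bA2: "bary T' q (A x) = bary T q x" if "q \<in> verts T - {p}" for q x
    using bA[of q x] VV that by auto
  have AT: "A x \<in> T' \<longleftrightarrow> x \<in> T" for x
  proof -
    have "(\<forall>q\<in>verts T'. 0 \<le> bary T' q (A x)) \<longleftrightarrow> 0 \<le> bary T' p' (A x) \<and> (\<forall>q\<in>verts T' - {p'}. 0 \<le> bary T' q (A x))"
      using p' by auto
    also have "\<dots> \<longleftrightarrow> 0 \<le> bary T p x \<and> (\<forall>q\<in>verts T - {p}. 0 \<le> bary T q x)"
      unfolding VV[symmetric] bA' using bA2 by auto
    also have "\<dots> \<longleftrightarrow> (\<forall>q\<in>verts T. 0 \<le> bary T q x)" using p by auto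
    finally show ?thesis by (simp add: T.mem_iff T'.mem_iff)
  qed
  have A_inj: "x = y" if "A x = A y" for x y
    by (rule T.bary_inject) (metis bA' bA2 that Diff_iff singletonD)
  define f where "f x = x + (g \<bullet> x) *\<^sub>R (p' - p)" for x
  have Af: "A = (\<lambda>x. f x + k *\<^sub>R (p' - p))" by (auto simp: A_def f_def algebra_simps)
  have "linear f" unfolding f_def by (intro linearI) (auto simp: inner_add_right algebra_simps)
  moreover have "inj f" by (rule injI) (metis A_inj Af)
  ultimately obtain c where c: "c > 0"
    "\<And>(g :: 'a \<Rightarrow> real). g \<in> borel_measurable borel \<Longrightarrow> (LINT x|lborel. g (A x)) = c * (LINT x|lborel. g x)"
    using affine_integral_scale[OF Af] by metis
  define D2 where "D2 x = D (A x) + (D (A x) \<bullet> (p' - p)) *\<^sub>R g" for x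
  have C2: "C1_pair (\<lambda>x. \<phi> (A x)) D2" unfolding A_def[abs_def] D2_def[abs_def] by (rule C1_pair_compose_affine[OF C1])
  have 0: "fmean T p \<phi> D = fmean T p (\<lambda>x. \<phi> (A x)) D2"
    by (rule T.fmean_cong[OF p C1 C2]) (simp add: A_def gk T.opp_mem_iff[OF p])
  have "(LINT x:T|lborel. D2 x \<bullet> (x - p) + real DIM('a) * \<phi> (A x))
     = (LINT x|lborel. indicator T' (A x) * (D (A x) \<bullet> (A x - p') + real DIM('a) * \<phi> (A x)))"
    unfolding set_lebesgue_integral_def
  proof (intro Bochner_Integration.integral_cong refl)
    fix x
    have "A x - p' = (x - p) + (g \<bullet> (x - p)) *\<^sub>R (p' - p)"
      unfolding A_def gk by (simp add: bary_def g_def algebra_simps)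
    then have "D (A x) \<bullet> (A x - p') = D2 x \<bullet> (x - p)"
      by (simp add: D2_def inner_left_distrib inner_right_distrib)
    then show "indicator T x *\<^sub>R (D2 x \<bullet> (x - p) + real DIM('a) * \<phi> (A x)) =
       indicator T' (A x) * (D (A x) \<bullet> (A x - p') + real DIM('a) * \<phi> (A x))"
      using AT[of x] by (simp add: indicator_def)
  qed
  also have "\<dots> = c * (LINT x|lborel. indicator T' x * (D x \<bullet> (x - p') + real DIM('a) * \<phi> x))"
    by (rule c(2)) measurable
  finally have 1: "fmean T p \<phi> D = c * (LINT x:T'|lborel. D x \<bullet> (x - p') + real DIM('a) * \<phi> x) / (real DIM('a) * measure lborel T)"
    unfolding 0 by (simp add: fmean_def set_lebesgue_integral_def)
  have "indicat_real T' (A x) = indicat_real T x" for x using AT[of x] by (simp add: indicator_def)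
  then have "measure lborel T = (LINT x|lborel. indicator T' (A x))" by simp
  also have "\<dots> = c * measure lborel T'" by (subst c(2)) auto
  finally show ?thesis unfolding 1 using c(1) by (simp add: fmean_def)
qed

section \<open>The surface measure of a facet\<close>

lemma slope_of_complement_power:
  "(\<lambda>k. (1 - (1 - c / real (Suc k)) ^ n) * (real (Suc k) / c)) \<longlonglongrightarrow> real n" if "c > 0"
proof -
  have "((\<lambda>s::real. s ^ n) has_real_derivative real n) (at 1)" by (auto intro!: derivative_eq_intros)
  then have "((\<lambda>s::real. (s ^ n - 1 ^ n) / (s - 1)) \<longlongrightarrow> real n) (at 1)" by (simp add: has_field_derivative_iff)
  moreover have "filterlim (\<lambda>k. 1 - c / real (Suc k)) (at 1) sequentially"
  proof (rule filterlim_atI)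
    have "(\<lambda>k. c * inverse (real (Suc k))) \<longlonglongrightarrow> c * 0" by (intro tendsto_intros LIMSEQ_inverse_real_of_nat)
    then have "(\<lambda>k. c / real (Suc k)) \<longlonglongrightarrow> 0" by (simp add: divide_inverse)
    then show "(\<lambda>k. 1 - c / real (Suc k)) \<longlonglongrightarrow> 1" using tendsto_diff[OF tendsto_const, of _ 0 _ 1] by simp
    show "\<forall>\<^sub>F k in sequentially. 1 - c / real (Suc k) \<noteq> 1" using that by auto
  qed
  ultimately have "(\<lambda>k. ((1 - c / real (Suc k)) ^ n - 1 ^ n) / ((1 - c / real (Suc k)) - 1)) \<longlonglongrightarrow> real n"
    by (rule filterlim_compose)
  moreover have "((1 - c / real (Suc k)) ^ n - 1 ^ n) / ((1 - c / real (Suc k)) - 1) = (1 - (1 - c / real (Suc k)) ^ n) * (real (Suc k) / c)" for k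
    using that by (simp add: field_simps)
  ultimately show ?thesis by simp
qed

context full_simplex
begin

text \<open>
  The orthogonal projection onto the hyperplane of the facet opposite to \<open>p\<close>.
\<close>
definition "hproj p x = x - (bary T p x / (bgrad T p \<bullet> bgrad T p)) *\<^sub>R bgrad T p"

lemma bgrad_sq_pos: "p \<in> V \<Longrightarrow> bgrad T p \<bullet> bgrad T p > 0"
  using bgrad_nonzero by simp

lemma bary_hproj_self: "p \<in> V \<Longrightarrow> bary T p (hproj p x) = 0"
  using bgrad_sq_pos[of p] bary_add[of T p x "(- (bary T p x / (bgrad T p \<bullet> bgrad T p))) *\<^sub>R bgrad T p"]
  by (simp add: hproj_def)

lemma hproj_fix: "bary T p x = 0 \<Longrightarrow> hproj p x = x"
  by (simp add: hproj_def)

lemma hproj_add: "hproj p (x + h) = hproj p x + (h - ((bgrad T p \<bullet> h) / (bgrad T p \<bullet> bgrad T p)) *\<^sub>R bgrad T p)"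
  unfolding hproj_def bary_add by (simp add: add_divide_distrib scaleR_left_distrib)

lemma hproj_shift: "p \<in> V \<Longrightarrow> hproj p (x + t *\<^sub>R bgrad T p) = hproj p x"
  using bgrad_sq_pos[of p] by (simp add: hproj_add)

lemma hproj_add_tangent: "bgrad T p \<bullet> h = 0 \<Longrightarrow> hproj p (x + h) = hproj p x + h"
  by (simp add: hproj_add)

lemma continuous_on_hproj [continuous_intros]: "continuous_on A (hproj p)"
  unfolding hproj_def[abs_def] divide_inverse by (intro continuous_intros)

lemma hproj_measurable [measurable]: "hproj p \<in> borel_measurable borel"
  by (intro borel_measurable_continuous_onI continuous_on_hproj)

lemma affine_hull_opp: assumes p: "p \<in> V" shows "affine hull (opp T p) = {x. bary T p x = 0}"
proof
  have "affine {x. bary T p x = 0}"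
    using affine_hyperplane[of "bgrad T p" "bgrad T p \<bullet> p - 1"] by (simp add: bary_eq algebra_simps)
  then show "affine hull (opp T p) \<subseteq> {x. bary T p x = 0}"
    using opp_mem_iff[OF p] by (intro hull_minimal) auto
  show "{x. bary T p x = 0} \<subseteq> affine hull (opp T p)"
  proof
    fix x assume "x \<in> {x. bary T p x = 0}"
    then have "sum (\<lambda>q. bary T q x) (V - {p}) = 1" "(\<Sum>q\<in>V - {p}. bary T q x *\<^sub>R q) = x"
      using sum_bary[of x] sum_bary_scaleR[of x] by (simp_all add: sum.remove[OF V(1) p])
    then have "x \<in> affine hull (V - {p})"
      unfolding affine_hull_finite[OF finite_Diff[OF V(1)]] by (intro CollectI exI[of _ "\<lambda>q. bary T q x"] conjI)
    then show "x \<in> affine hull (opp T p)" by (simp add: opp_def)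
  qed
qed

lemma closest_point_hproj: assumes p: "p \<in> V" shows "closest_point (affine hull (opp T p)) x = hproj p x"
proof (rule closest_point_unique[symmetric])
  show "convex (affine hull (opp T p))" "closed (affine hull (opp T p))"
    by (simp_all add: affine_imp_convex)
  show "hproj p x \<in> affine hull (opp T p)" by (simp add: affine_hull_opp[OF p] bary_hproj_self[OF p])
  show "\<forall>z\<in>affine hull (opp T p). dist x (hproj p x) \<le> dist x z"
  proof
    fix z assume z: "z \<in> affine hull (opp T p)"
    define t where "t = bary T p x / (bgrad T p \<bullet> bgrad T p)"
    have xh: "x - hproj p x = t *\<^sub>R bgrad T p" by (simp add: hproj_def t_def)
    have "bgrad T p \<bullet> (hproj p x - z) = 0"
      using z bary_diff[of T p "hproj p x" z] by (simp add: affine_hull_opp[OF p] bary_hproj_self[OF p])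
    then have "orthogonal (x - hproj p x) (hproj p x - z)" by (simp add: xh orthogonal_def)
    then have "(norm (x - hproj p x + (hproj p x - z)))\<^sup>2 = (norm (x - hproj p x))\<^sup>2 + (norm (hproj p x - z))\<^sup>2"
      by (rule norm_add_Pythagorean)
    then have "(norm (x - hproj p x))\<^sup>2 \<le> (norm (x - z))\<^sup>2" by simp
    then show "dist x (hproj p x) \<le> dist x z" unfolding dist_norm by (rule power2_le_imp_le) simp
  qed
qed

text \<open>
  A right prism over the facet; its height is measured by the coordinate \<open>bary T p\<close>.
\<close>
definition "slab p a b = {x. hproj p x \<in> opp T p \<and> a \<le> bary T p x \<and> bary T p x < b}"

lemma opp_closed: "p \<in> V \<Longrightarrow> closed (opp T p)"
  unfolding opp_def using V(1) by (intro compact_imp_closed finite_imp_compact_convex_hull) auto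

lemma slab_borel [measurable]: assumes p: "p \<in> V" shows "slab p a b \<in> sets borel"
proof -
  have [measurable]: "opp T p \<in> sets borel" using opp_closed[OF p] by (rule borel_closed)
  show ?thesis unfolding slab_def by measurable
qed

lemma slab_bounded: assumes p: "p \<in> V" shows "bounded (slab p a b)"
proof -
  have "bounded (opp T p)" using opp_mem_iff[OF p] bounded bounded_subset by blast
  then obtain B where B: "\<And>x. x \<in> opp T p \<Longrightarrow> norm x \<le> B" by (auto simp: bounded_iff)
  let ?g = "bgrad T p"
  have "norm x \<le> B + (\<bar>a\<bar> + \<bar>b\<bar>) / (?g \<bullet> ?g) * norm ?g" if "x \<in> slab p a b" for x
  proof -
    have "x = hproj p x + (bary T p x / (?g \<bullet> ?g)) *\<^sub>R ?g" by (simp add: hproj_def)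
    then have "norm x \<le> norm (hproj p x) + \<bar>bary T p x / (?g \<bullet> ?g)\<bar> * norm ?g"
      by (metis norm_scaleR norm_triangle_ineq)
    also have "\<dots> \<le> B + (\<bar>a\<bar> + \<bar>b\<bar>) / (?g \<bullet> ?g) * norm ?g"
      using that B bgrad_sq_pos[OF p]
      by (intro add_mono mult_right_mono) (auto simp: slab_def abs_divide intro!: divide_right_mono)
    finally show ?thesis .
  qed
  then show ?thesis unfolding bounded_iff by blast
qed

lemma slab_integrable: "p \<in> V \<Longrightarrow> integrable lborel (indicat_real (slab p a b))"
  using emeasure_bounded_finite[OF slab_bounded] by (intro integrable_real_indicator) auto

lemma slab_translate:
  assumes p: "p \<in> V"
  shows "measure lborel (slab p (a + t) (b + t)) = measure lborel (slab p a b)"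
proof -
  let ?g = "bgrad T p"
  define w where "w = (t / (?g \<bullet> ?g)) *\<^sub>R ?g"
  have "x + w \<in> slab p (a + t) (b + t) \<longleftrightarrow> x \<in> slab p a b" for x
    using bgrad_sq_pos[OF p] unfolding slab_def w_def by (simp add: hproj_shift[OF p] bary_add)
  then have e: "indicat_real (slab p (a + t) (b + t)) (w + 1 *\<^sub>R x) = indicat_real (slab p a b) x" for x
    by (simp add: indicator_def add.commute[of w x])
  have "measure lborel (slab p (a + t) (b + t)) = (LINT x|lborel. indicat_real (slab p (a + t) (b + t)) x)" by simp
  also have "\<dots> = (LINT x|lborel. indicat_real (slab p (a + t) (b + t)) (w + 1 *\<^sub>R x))"
    by (subst homothety_integral[of _ 1 w]) (use p in auto)
  also have "\<dots> = measure lborel (slab p a b)" unfolding e by simp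
  finally show ?thesis .
qed

lemma slab_multiple:
  assumes p: "p \<in> V" and t: "t \<ge> 0"
  shows "measure lborel (slab p 0 (real k * t)) = real k * measure lborel (slab p 0 t)"
proof (induction k)
  case 0
  have "slab p 0 0 = {}" by (auto simp: slab_def)
  then show ?case by simp
next
  case (Suc k)
  have fm: "slab p a b \<in> fmeasurable lborel" for a b
    using slab_borel[OF p] emeasure_bounded_finite[OF slab_bounded[OF p]] by (auto simp: fmeasurable_def)
  have "slab p 0 (real (Suc k) * t) = slab p 0 (real k * t) \<union> slab p (0 + real k * t) (t + real k * t)"
    using t by (auto simp: slab_def algebra_simps) (smt (verit) mult_nonneg_nonneg of_nat_0_le_iff)
  moreover have "slab p 0 (real k * t) \<inter> slab p (0 + real k * t) (t + real k * t) = {}"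
    by (auto simp: slab_def)
  ultimately have "measure lborel (slab p 0 (real (Suc k) * t)) =
      measure lborel (slab p 0 (real k * t)) + measure lborel (slab p (0 + real k * t) (t + real k * t))"
    using measure_Un2[OF fm[of 0 "real k * t"] fm[of "0 + real k * t" "t + real k * t"]]
    by (simp add: Diff_triv Int_commute)
  then show ?case using Suc.IH slab_translate[OF p, of 0 "real k * t" t] by (simp add: algebra_simps)
qed

text \<open>
  The part \<open>bary T p < e\<close> of \<open>T\<close> has volume \<open>(1 - (1 - e)\<^sup>d) |T|\<close>. A shear along the facet moves
  the apex over the barycenter of the facet; the sheared part then lies in the right prism of
  the same height, and contains a copy of it shrunk by \<open>1 - e\<close> towards that barycenter.
\<close>
lemma thin_slab_bounds:
  assumes p: "p \<in> V" and e: "0 < e" "e < 1"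
  shows "(1 - (1 - e) ^ DIM('a)) * measure lborel T \<le> measure lborel (slab p 0 e)"
    "(1 - e) ^ DIM('a) * measure lborel (slab p 0 e) \<le> (1 - (1 - e) ^ DIM('a)) * measure lborel T"
proof -
  let ?g = "bgrad T p"
  define y0 where "y0 = barycenter (opp T p)"
  have y0: "bary T p y0 = 0" "\<And>q. q \<in> V \<Longrightarrow> 0 \<le> bary T q y0"
    unfolding y0_def using bary_barycenter_opp[OF p] p by auto
  \<comment> \<open>Tangential to the facet: \<open>p + w\<close> is the point over the barycenter \<open>y0\<close> at the height of
    \<open>p\<close>.\<close>
  define w where "w = y0 + (1 / (?g \<bullet> ?g)) *\<^sub>R ?g - p"
  have gyp: "?g \<bullet> (y0 - p) = -1" using y0(1) by (simp add: bary_def)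
  have gw: "?g \<bullet> w = 0" using gyp bgrad_sq_pos[OF p] by (simp add: w_def inner_simps)
  define Te where "Te = {x\<in>T. bary T p x < e}"
  have [measurable]: "Te \<in> sets borel" unfolding Te_def by measurable
  note [measurable] = slab_borel[OF p]
  define A where "A x = x + bary T p x *\<^sub>R w" for x
  have shear: "(LINT x|lborel. h (x + (s * bary T p x) *\<^sub>R w)) = (LINT x|lborel. h x)"
    if [measurable]: "h \<in> borel_measurable borel" for h :: "'a \<Rightarrow> real" and s
  proof (cases "s = 0")
    case False
    have "(s *\<^sub>R ?g) \<bullet> x + s * bary T p 0 = s * bary T p x" for x by (subst (2) bary_from_0) (simp add: algebra_simps)
    then show ?thesis
      using shear_preserves_integral[of "s *\<^sub>R ?g" w h "s * bary T p 0"] gw False bgrad_nonzero[OF p] by simp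
  qed simp
  have bq: "bary T q (u + l *\<^sub>R (y0 - p)) = bary T q u + l * bary T q y0" if "q \<in> V - {p}" for q u l
    using bary_vertex[of q p] that p bary_diff[of T q y0 p] by (auto simp: bary_add)
  have Tint: "integrable lborel (indicat_real Te)"
    using bounded_subset[OF bounded, of Te] emeasure_bounded_finite[of Te]
    by (intro integrable_real_indicator) (auto simp: Te_def)
  have vol: "measure lborel Te = (1 - (1 - e) ^ DIM('a)) * measure lborel T"
  proof -
    let ?Ts = "{x\<in>T. 1 - (1 - e) \<le> bary T p x}"
    have [measurable]: "?Ts \<in> sets borel" by measurable
    have fm: "?Ts \<in> fmeasurable lborel" "Te \<in> fmeasurable lborel"
      using bounded_subset[OF bounded, of Te] bounded_subset[OF bounded, of ?Ts] emeasure_bounded_finite[of Te] emeasure_bounded_finite[of ?Ts]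
      by (auto simp: fmeasurable_def Te_def)
    have "T = ?Ts \<union> Te" "?Ts \<inter> Te = {}" by (auto simp: Te_def)
    then have "measure lborel T = measure lborel ?Ts + measure lborel Te"
      using measure_Un2[OF fm] by (simp add: Diff_triv Int_commute)
    moreover have "measure lborel ?Ts = (1 - e) ^ DIM('a) * measure lborel T"
      using scaled_integral[OF p, of "1 - e" "\<lambda>_. 1"] e by (simp add: set_lebesgue_integral_def)
    ultimately show ?thesis by (simp add: algebra_simps)
  qed
  have slab_of_Te: "A x \<in> slab p 0 e" if "x \<in> Te" for x
  proof -
    define l where "l = bary T p x"
    have l: "0 \<le> l" "l < e" using that p by (auto simp: Te_def l_def mem_iff)
    have bA: "bary T p (A x) = l" using gw by (simp add: A_def bary_add l_def)
    have "hproj p (A x) = x + l *\<^sub>R (y0 - p)"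
      unfolding hproj_def bA by (simp add: A_def w_def l_def[symmetric] algebra_simps)
    moreover have "bary T p (x + l *\<^sub>R (y0 - p)) = 0" using gyp by (simp add: bary_add l_def)
    moreover have "0 \<le> bary T q (x + l *\<^sub>R (y0 - p))" if q: "q \<in> V - {p}" for q
      using bq[OF q] \<open>x \<in> Te\<close> q l y0(2)[of q] by (simp add: Te_def mem_iff)
    ultimately have "hproj p (A x) \<in> opp T p" unfolding opp_mem_iff[OF p] mem_iff by (metis Diff_iff order_refl singletonD)
    then show ?thesis using l bA by (simp add: slab_def)
  qed
  have le1: "indicat_real Te (y + (- 1 * bary T p y) *\<^sub>R w) \<le> indicat_real (slab p 0 e) y" for y
  proof -
    have "bary T p (y + (- 1 * bary T p y) *\<^sub>R w) = bary T p y"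
      using gw bary_add[of T p y "(- 1 * bary T p y) *\<^sub>R w"] by simp
    then have "A (y + (- 1 * bary T p y) *\<^sub>R w) = y" by (simp add: A_def)
    then show ?thesis using slab_of_Te[of "y + (- 1 * bary T p y) *\<^sub>R w"] by (auto simp: indicator_def)
  qed
  have "measure lborel Te = (LINT y|lborel. indicat_real Te (y + (- 1 * bary T p y) *\<^sub>R w))"
    using shear[of "indicat_real Te" "- 1"] by simp
  also have "\<dots> \<le> (LINT y|lborel. indicat_real (slab p 0 e) y)"
    by (rule integral_mono'[OF slab_integrable[OF p] le1]) simp
  finally show "(1 - (1 - e) ^ DIM('a)) * measure lborel T \<le> measure lborel (slab p 0 e)" using vol by simp
  \<comment> \<open>The inverse of the homothety about \<open>y0\<close> with ratio \<open>1 - e\<close>.\<close>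
  define hi where "hi y = y0 + (1 / (1 - e)) *\<^sub>R (y - y0)" for y
  have [measurable]: "hi \<in> borel_measurable borel" unfolding hi_def by measurable
  have le2: "indicat_real (slab p 0 e) (hi (z + (1 * bary T p z) *\<^sub>R w)) \<le> indicat_real Te z" for z
  proof (cases "hi (A z) \<in> slab p 0 e")
    case True
    define x l where "x = hi (A z)" and "l = bary T p z"
    have Az: "A z = y0 + (1 - e) *\<^sub>R (x - y0)" using e by (simp add: x_def hi_def)
    have bAz: "bary T p (A z) = l" using gw by (simp add: A_def bary_add l_def)
    have "bary T p (A z) = (1 - e) * bary T p x"
      unfolding Az bary_add using y0(1) bary_diff[of T p x y0] by simp
    then have lx: "l = (1 - e) * bary T p x" using bAz by simp
    have x: "0 \<le> bary T p x" "bary T p x < e" "hproj p x \<in> opp T p" using True by (auto simp: slab_def x_def)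
    have l: "0 \<le> l" "l < e" using x e mult_strict_mono[of "1 - e" 1 "bary T p x" e] unfolding lx by (auto simp: mult_nonneg_nonneg)
    define u where "u = y0 + (1 - e) *\<^sub>R (hproj p x - y0)"
    have "u = A z - (l / (?g \<bullet> ?g)) *\<^sub>R ?g"
      unfolding u_def Az hproj_def lx by (simp add: algebra_simps)
    then have z: "z = u + (- l) *\<^sub>R (y0 - p)" by (simp add: A_def w_def l_def[symmetric] algebra_simps)
    have "0 \<le> bary T q z" if q: "q \<in> V - {p}" for q
    proof -
      have "bary T q u = e * bary T q y0 + (1 - e) * bary T q (hproj p x)"
        unfolding u_def bary_add inner_scaleR_right bary_diff[symmetric] by (simp add: algebra_simps)
      then have "bary T q z = (e - l) * bary T q y0 + (1 - e) * bary T q (hproj p x)"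
        unfolding z bq[OF q] by (simp add: algebra_simps)
      moreover have "0 \<le> bary T q (hproj p x)" using x(3) q by (auto simp: opp_mem_iff[OF p] mem_iff)
      ultimately show ?thesis using l e y0(2)[of q] q by simp
    qed
    then have "z \<in> Te" unfolding Te_def mem_iff using l by (auto simp: l_def)
    then show ?thesis by (simp add: indicator_def)
  qed (simp add: A_def)
  have "(1 - e) ^ DIM('a) * measure lborel (slab p 0 e) = (1 - e) ^ DIM('a) * (LINT x|lborel. indicat_real (slab p 0 e) (hi (y0 - (1 - e) *\<^sub>R y0 + (1 - e) *\<^sub>R x)))"
  proof -
    have "hi (y0 - (1 - e) *\<^sub>R y0 + (1 - e) *\<^sub>R x) = x" for x
    proof -
      have "y0 - (1 - e) *\<^sub>R y0 + (1 - e) *\<^sub>R x - y0 = (1 - e) *\<^sub>R (x - y0)" by (simp add: algebra_simps)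
      then show ?thesis using e by (simp add: hi_def)
    qed
    then show ?thesis by simp
  qed
  also have "\<dots> = (LINT y|lborel. indicat_real (slab p 0 e) (hi y))"
    using e by (intro homothety_integral[symmetric]) auto
  also have "\<dots> = (LINT z|lborel. indicat_real (slab p 0 e) (hi (z + (1 * bary T p z) *\<^sub>R w)))"
    by (rule shear[symmetric]) measurable
  also have "\<dots> \<le> (LINT z|lborel. indicat_real Te z)"
    by (rule integral_mono'[OF Tint le2]) simp
  finally show "(1 - e) ^ DIM('a) * measure lborel (slab p 0 e) \<le> (1 - (1 - e) ^ DIM('a)) * measure lborel T"
    using vol by simp
qed

text \<open>
  Cut the slab into \<open>k\<close> thin ones of equal volume and let \<open>k\<close> tend to infinity. After
  multiplication by \<open>k\<close> both bounds for thin slabs have the same limit, which the derivative of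
  \<open>1 - (1 - e)\<^sup>d\<close> at \<open>e = 0\<close> provides.
\<close>
lemma slab_volume:
  assumes p: "p \<in> V" and c: "c > 0"
  shows "measure lborel (slab p 0 c) = c * real DIM('a) * measure lborel T"
proof -
  define e where "e k = c / real (Suc k)" for k
  define r where "r k = (1 - (1 - e k) ^ DIM('a)) * (real (Suc k) / c)" for k
  have r: "r \<longlonglongrightarrow> real DIM('a)" unfolding r_def e_def by (rule slope_of_complement_power[OF c])
  have e0: "e \<longlonglongrightarrow> 0"
  proof -
    have "(\<lambda>k. c * inverse (real (Suc k))) \<longlonglongrightarrow> c * 0" by (intro tendsto_intros LIMSEQ_inverse_real_of_nat)
    then show ?thesis by (simp add: e_def[abs_def] divide_inverse)
  qed
  have e1: "\<forall>\<^sub>F k in sequentially. 0 < e k \<and> e k < 1"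
    using order_tendstoD(2)[OF e0, of 1] c by (auto elim!: eventually_mono simp: e_def)
  let ?P = "measure lborel (slab p 0 c)"
  have P: "?P = real (Suc k) * measure lborel (slab p 0 (e k))" for k
    using slab_multiple[OF p, of "e k" "Suc k"] c by (simp add: e_def)
  have up: "c * measure lborel T * r k \<le> ?P" and lo: "(1 - e k) ^ DIM('a) * ?P \<le> c * measure lborel T * r k"
    if "0 < e k" "e k < 1" for k
  proof -
    have rk: "c * measure lborel T * r k = real (Suc k) * ((1 - (1 - e k) ^ DIM('a)) * measure lborel T)"
      using c by (simp add: r_def)
    show "c * measure lborel T * r k \<le> ?P"
      unfolding rk P[of k] by (intro mult_left_mono thin_slab_bounds(1)[OF p that]) simp
    have "(1 - e k) ^ DIM('a) * ?P = real (Suc k) * ((1 - e k) ^ DIM('a) * measure lborel (slab p 0 (e k)))"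
      unfolding P[of k] by simp
    also have "\<dots> \<le> c * measure lborel T * r k"
      unfolding rk by (intro mult_left_mono thin_slab_bounds(2)[OF p that]) simp
    finally show "(1 - e k) ^ DIM('a) * ?P \<le> c * measure lborel T * r k" .
  qed
  have lim: "(\<lambda>k. c * measure lborel T * r k) \<longlonglongrightarrow> c * measure lborel T * real DIM('a)"
    by (intro tendsto_intros r)
  have "c * measure lborel T * real DIM('a) \<le> ?P"
    by (rule tendsto_upperbound[OF lim]) (use e1 up in \<open>auto elim: eventually_mono\<close>)
  moreover have "(\<lambda>k. (1 - e k) ^ DIM('a) * ?P) \<longlonglongrightarrow> (1 - 0) ^ DIM('a) * ?P"
    by (intro tendsto_intros e0)
  then have "(1 - 0) ^ DIM('a) * ?P \<le> c * measure lborel T * real DIM('a)"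
    by (rule tendsto_le[OF sequentially_bot lim]) (use e1 lo in \<open>auto elim: eventually_mono\<close>)
  ultimately show ?thesis by (simp add: algebra_simps)
qed

text \<open>
  The prism is built on an unspecified one of the two unit normals. The sign of \<open>\<sigma>\<close> records
  which, and on either side the height one corresponds to \<open>norm (bgrad T p)\<close> in the coordinate
  \<open>bary T p\<close>.
\<close>
lemma prism_eq:
  assumes p: "p \<in> V" and dim: "DIM('a) \<ge> 2"
  obtains \<sigma> where "\<bar>\<sigma>\<bar> = norm (bgrad T p)"
    "prism (opp T p) = {x. hproj p x \<in> opp T p \<and> 0 \<le> bary T p x / \<sigma> \<and> bary T p x / \<sigma> \<le> 1}"
proof -
  let ?g = "bgrad T p" and ?S = "opp T p"
  let ?n = "\<lambda>\<nu>. norm \<nu> = 1 \<and> (\<forall>x\<in>?S. \<forall>y\<in>?S. \<nu> \<bullet> (x - y) = 0)"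
  have "?n ((1 / norm ?g) *\<^sub>R ?g)" using bgrad_nonzero[OF p] bgrad_orthogonal[OF p] by simp
  then have n: "?n (SOME \<nu>. ?n \<nu>)" by (rule someI)
  define \<nu> where "\<nu> = (SOME \<nu>. ?n \<nu>)"
  obtain q where q: "q \<in> V" "q \<noteq> p" by (rule other_vertex)
  define \<kappa> where "\<kappa> = \<nu> \<bullet> (p - q)"
  have VS: "V - {p} \<subseteq> ?S" unfolding opp_def by (rule hull_subset)
  have \<nu>: "\<nu> = \<kappa> *\<^sub>R ?g" unfolding \<kappa>_def
    by (rule orthogonal_to_facet[OF p q]) (use n VS in \<open>auto simp: \<nu>_def[symmetric]\<close>)
  have k: "\<bar>\<kappa>\<bar> * norm ?g = 1" using n unfolding \<nu>_def[symmetric] \<nu> by simp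
  define \<sigma> where "\<sigma> = \<kappa> * (?g \<bullet> ?g)"
  have "\<bar>\<sigma>\<bar> = (\<bar>\<kappa>\<bar> * norm ?g) * norm ?g"
    by (simp add: \<sigma>_def abs_mult power2_norm_eq_inner[symmetric] power2_eq_square)
  then have \<sigma>: "\<bar>\<sigma>\<bar> = norm ?g" using k by simp
  have \<sigma>0: "\<sigma> \<noteq> 0" using \<sigma> bgrad_nonzero[OF p] by auto
  have "prism ?S = {x + t *\<^sub>R \<nu> | x t. x \<in> ?S \<and> 0 \<le> t \<and> t \<le> 1}"
    by (simp add: prism_def \<nu>_def Let_def)
  also have "\<dots> = {x. hproj p x \<in> ?S \<and> 0 \<le> bary T p x / \<sigma> \<and> bary T p x / \<sigma> \<le> 1}"
  proof safe
    fix y t assume y: "y \<in> ?S" and t: "0 \<le> t" "t \<le> (1::real)"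
    have b: "bary T p y = 0" using y opp_mem_iff[OF p] by blast
    have e: "y + t *\<^sub>R \<nu> = y + (t * \<kappa>) *\<^sub>R ?g" by (simp add: \<nu>)
    have "hproj p (y + t *\<^sub>R \<nu>) = y" unfolding e hproj_shift[OF p] using hproj_fix[OF b] .
    then show "hproj p (y + t *\<^sub>R \<nu>) \<in> ?S" using y by simp
    have "bary T p (y + t *\<^sub>R \<nu>) = t * \<sigma>" unfolding e by (simp add: bary_add b \<sigma>_def)
    then show "0 \<le> bary T p (y + t *\<^sub>R \<nu>) / \<sigma>" "bary T p (y + t *\<^sub>R \<nu>) / \<sigma> \<le> 1" using t \<sigma>0 by auto
  next
    fix x assume x: "hproj p x \<in> ?S" "0 \<le> bary T p x / \<sigma>" "bary T p x / \<sigma> \<le> 1"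
    have "\<kappa> \<noteq> 0" using k by auto
    then have "x = hproj p x + (bary T p x / \<sigma>) *\<^sub>R \<nu>" by (simp add: hproj_def \<nu> \<sigma>_def)
    with x show "\<exists>y t. x = y + t *\<^sub>R \<nu> \<and> y \<in> ?S \<and> 0 \<le> t \<and> t \<le> 1" by blast
  qed
  finally show ?thesis using \<sigma> that by blast
qed

text \<open>
  The height of \<open>T\<close> over the facet is \<open>1 / norm (bgrad T p)\<close>, so this is the cone formula
  \<open>|T| = height * area / d\<close>.
\<close>
definition "facet_area p = real DIM('a) * measure lborel T * norm (bgrad T p)"

lemma facet_area_pos: "p \<in> V \<Longrightarrow> facet_area p > 0"
  using measure_pos bgrad_nonzero by (simp add: facet_area_def)

lemma prism_borel: assumes p: "p \<in> V" and dim: "DIM('a) \<ge> 2" shows "prism (opp T p) \<in> sets borel"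
proof -
  have [measurable]: "opp T p \<in> sets borel" using opp_closed[OF p] by (rule borel_closed)
  obtain \<sigma> where "\<bar>\<sigma>\<bar> = norm (bgrad T p)" "prism (opp T p) = {x. hproj p x \<in> opp T p \<and> 0 \<le> bary T p x / \<sigma> \<and> bary T p x / \<sigma> \<le> 1}"
    by (rule prism_eq[OF assms])
  then show ?thesis by simp
qed

lemma hproj_prism:
  assumes p: "p \<in> V" and dim: "DIM('a) \<ge> 2" and x: "x \<in> prism (opp T p)"
  shows "hproj p x \<in> opp T p"
proof -
  obtain \<sigma> where "\<bar>\<sigma>\<bar> = norm (bgrad T p)" "prism (opp T p) = {x. hproj p x \<in> opp T p \<and> 0 \<le> bary T p x / \<sigma> \<and> bary T p x / \<sigma> \<le> 1}"
    by (rule prism_eq[OF assms(1,2)])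
  then show ?thesis using x by blast
qed

lemma negligible_bary: assumes p: "p \<in> V" shows "negligible {x. bary T p x = c}"
proof -
  have "{x. bary T p x = c} = {x. bgrad T p \<bullet> x = c - (1 - bgrad T p \<bullet> p)}" by (auto simp: bary_eq)
  then show ?thesis using negligible_hyperplane[of "bgrad T p"] bgrad_nonzero[OF p] by simp
qed

lemma prism_volume:
  assumes p: "p \<in> V" and dim: "DIM('a) \<ge> 2"
  shows "measure lborel (prism (opp T p)) = facet_area p" "bounded (prism (opp T p))"
proof -
  let ?c = "norm (bgrad T p)"
  obtain \<sigma> where \<sigma>: "\<bar>\<sigma>\<bar> = ?c"
    "prism (opp T p) = {x. hproj p x \<in> opp T p \<and> 0 \<le> bary T p x / \<sigma> \<and> bary T p x / \<sigma> \<le> 1}"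
    by (rule prism_eq[OF assms])
  have c: "?c > 0" using bgrad_nonzero[OF p] by simp
  have "\<exists>a b. b - a = ?c \<and> (\<forall>x. 0 \<le> bary T p x / \<sigma> \<and> bary T p x / \<sigma> \<le> 1 \<longleftrightarrow> a \<le> bary T p x \<and> bary T p x \<le> b)"
  proof (cases "\<sigma> > 0")
    case True
    then show ?thesis using \<sigma>(1) by (intro exI[of _ 0] exI[of _ ?c]) (auto simp: zero_le_divide_iff divide_le_eq)
  next
    case False
    then show ?thesis using \<sigma>(1) c by (intro exI[of _ "- ?c"] exI[of _ 0]) (auto simp: zero_le_divide_iff divide_le_eq)
  qed
  then obtain a b where ab: "b - a = ?c"
    "\<And>x. 0 \<le> bary T p x / \<sigma> \<and> bary T p x / \<sigma> \<le> 1 \<longleftrightarrow> a \<le> bary T p x \<and> bary T p x \<le> b" by blast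
  \<comment> \<open>The prism is closed at the top and the slab is not; the difference is a null set.\<close>
  have P: "prism (opp T p) = slab p a b \<union> (prism (opp T p) \<inter> {x. bary T p x = b})"
    unfolding \<sigma>(2) ab(2) slab_def using ab(1) c by auto
  have "prism (opp T p) \<subseteq> slab p a (b + 1)" unfolding \<sigma>(2) ab(2) slab_def by auto
  then show bd: "bounded (prism (opp T p))" using slab_bounded[OF p] bounded_subset by blast
  have [measurable]: "prism (opp T p) \<in> sets borel" by (rule prism_borel[OF assms])
  have "{x. bary T p x = b} \<in> null_sets lborel"
    using negligible_bary[OF p, of b] by (simp add: negligible_iff_null_sets null_sets_completion_iff)
  then have N: "prism (opp T p) \<inter> {x. bary T p x = b} \<in> null_sets lborel"
    by (rule null_set_Int1) simp
  have "measure lborel (prism (opp T p)) = measure lborel (slab p a b)"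
    by (subst P) (rule measure_Un_null_set[OF _ N], use slab_borel[OF p] in simp)
  also have "\<dots> = measure lborel (slab p 0 ?c)" using slab_translate[OF p, of 0 a ?c] ab(1) by (simp add: algebra_simps)
  also have "\<dots> = facet_area p" using slab_volume[OF p c] by (simp add: facet_area_def mult_ac)
  finally show "measure lborel (prism (opp T p)) = facet_area p" .
qed

lemma prism_hproj_invariant:
  assumes p: "p \<in> V" and dim: "DIM('a) \<ge> 2"
    and h: "bgrad T p \<bullet> h = 0" and S: "hproj p x + h \<in> opp T p \<longleftrightarrow> hproj p x \<in> opp T p"
  shows "x + h \<in> prism (opp T p) \<longleftrightarrow> x \<in> prism (opp T p)"
proof -
  obtain \<sigma> where "\<bar>\<sigma>\<bar> = norm (bgrad T p)" and \<sigma>: "prism (opp T p) = {x. hproj p x \<in> opp T p \<and> 0 \<le> bary T p x / \<sigma> \<and> bary T p x / \<sigma> \<le> 1}"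
    by (rule prism_eq[OF assms(1,2)])
  show ?thesis unfolding \<sigma> using S h by (simp add: hproj_add_tangent bary_add)
qed

text \<open>
  The tangential part of \<open>bgrad T q\<close> on the facet opposite to \<open>p\<close>.
\<close>
definition "facet_grad p q = bgrad T q - ((bgrad T q \<bullet> bgrad T p) / (bgrad T p \<bullet> bgrad T p)) *\<^sub>R bgrad T p"

lemma bary_hproj_affine:
  shows "bary T q (hproj p x) = facet_grad p q \<bullet> x + bary T q (hproj p 0)"
proof -
  have "hproj p x = hproj p 0 + (x - ((bgrad T p \<bullet> x) / (bgrad T p \<bullet> bgrad T p)) *\<^sub>R bgrad T p)"
    using hproj_add[of p 0 x] by simp
  then show ?thesis by (simp add: bary_add facet_grad_def inner_simps inner_commute)
qed

text \<open>
  As for the simplex itself: exchanging two vertices of the facet is an oblique reflection that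
  maps the prism onto itself, so the \<open>d\<close> coordinates on the facet have equal integrals.
\<close>
lemma facet_centroid:
  assumes p: "p \<in> V" and dim: "DIM('a) \<ge> 2" and q: "q \<in> V - {p}"
  shows "(LINT x:prism (opp T p)|lborel. bary T q (hproj p x)) = facet_area p / real DIM('a)"
    "set_integrable lborel (prism (opp T p)) (\<lambda>x. bary T q (hproj p x))"
proof -
  let ?P = "prism (opp T p)"
  have [measurable]: "?P \<in> sets borel" by (rule prism_borel[OF p dim])
  have int: "set_integrable lborel ?P (\<lambda>x. bary T r (hproj p x))" if r: "r \<in> V" for r
    unfolding set_integrable_def
  proof (rule integrableI_bounded_set_indicator[where B=1])
    show "emeasure lborel ?P < \<infinity>" by (rule emeasure_bounded_finite[OF prism_volume(2)[OF p dim]])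
    show "AE x in lborel. x \<in> ?P \<longrightarrow> norm (bary T r (hproj p x)) \<le> 1"
    proof (intro AE_I2 impI)
      fix x assume "x \<in> ?P"
      then have "hproj p x \<in> T" using hproj_prism[OF p dim] opp_mem_iff[OF p] by blast
      then show "norm (bary T r (hproj p x)) \<le> 1" using bary_le_1[OF _ r] mem_iff r by (auto simp: abs_le_iff)
    qed
  qed auto
  have eq: "(LINT x:?P|lborel. bary T r (hproj p x)) = (LINT x:?P|lborel. bary T q (hproj p x))" if r: "r \<in> V - {p}" for r
  proof (cases "r = q")
    case False
    define n w k where "n = facet_grad p r - facet_grad p q" and "w = q - r"
      and "k = bary T r (hproj p 0) - bary T q (hproj p 0)"
    let ?B = "\<lambda>x. x + (n \<bullet> x + k) *\<^sub>R w"
    have gw: "bgrad T p \<bullet> w = 0" using bary_diff[of T p q r] bary_vertex p q r by (auto simp: w_def)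
    have wb: "bgrad T s \<bullet> w = (if s = q then 1 else if s = r then -1 else 0)" if s: "s \<in> V" for s
      unfolding w_def bary_diff[symmetric] using bary_vertex[OF s, of q] bary_vertex[OF s, of r] q r False by auto
    have n: "n \<bullet> w = -2" using wb[of q] wb[of r] q r False gw by (simp add: n_def facet_grad_def inner_simps)
    have nk: "n \<bullet> x + k = bary T r (hproj p x) - bary T q (hproj p x)" for x
      by (subst (1 2) bary_hproj_affine) (simp add: n_def k_def inner_simps)
    have hB: "hproj p (?B x) = hproj p x + (n \<bullet> x + k) *\<^sub>R w" for x
      using gw by (simp add: hproj_add_tangent)
    have B: "bary T s (hproj p (?B x)) = (if s = q then bary T r (hproj p x) else if s = r then bary T q (hproj p x) else bary T s (hproj p x))"
      if "s \<in> V" for s x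
      using wb[OF that] unfolding hB by (auto simp: bary_add nk)
    have BS1: "hproj p (?B x) \<in> opp T p" if "hproj p x \<in> opp T p" for x
      unfolding opp_mem_iff[OF p] mem_iff
    proof (intro conjI ballI)
      fix s assume s: "s \<in> V"
      show "0 \<le> bary T s (hproj p (?B x))" unfolding B[OF s] using that q r s by (auto simp: opp_mem_iff[OF p] mem_iff)
    qed (rule bary_hproj_self[OF p])
    have BB: "?B (?B x) = x" for x using n by (simp add: inner_add_right algebra_simps)
    have "hproj p (?B x) \<in> opp T p \<longleftrightarrow> hproj p x \<in> opp T p" for x using BS1[of x] BS1[of "?B x"] unfolding BB by blast
    then have BP: "?B x \<in> ?P \<longleftrightarrow> x \<in> ?P" for x
      unfolding hB by (intro prism_hproj_invariant[OF p dim]) (simp_all add: gw)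
    have "(LINT x:?P|lborel. bary T q (hproj p x)) = (LINT x|lborel. indicator ?P (?B x) * bary T q (hproj p (?B x)))"
      unfolding set_lebesgue_integral_def
      by (subst oblique_reflection_preserves_integral[OF n, of "\<lambda>x. indicator ?P x * bary T q (hproj p x)" k]) auto
    also have "\<dots> = (LINT x|lborel. indicator ?P x *\<^sub>R bary T r (hproj p x))"
      using B[of q] q BP by (simp add: indicator_def)
    finally show ?thesis by (simp add: set_lebesgue_integral_def)
  qed simp
  have "(\<Sum>r\<in>V - {p}. LINT x:?P|lborel. bary T r (hproj p x)) = (LINT x:?P|lborel. (\<Sum>r\<in>V - {p}. bary T r (hproj p x)))"
    unfolding set_lebesgue_integral_def scaleR_sum_right
    by (rule Bochner_Integration.integral_sum[symmetric]) (use int in \<open>auto simp: set_integrable_def\<close>)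
  also have "(\<Sum>r\<in>V - {p}. bary T r (hproj p x)) = 1" for x
    using sum_bary[of "hproj p x"] bary_hproj_self[OF p, of x] by (simp add: sum.remove[OF V(1) p])
  then have "(LINT x:?P|lborel. (\<Sum>r\<in>V - {p}. bary T r (hproj p x))) = facet_area p"
    using prism_volume(1)[OF p dim] by (simp add: set_lebesgue_integral_def)
  finally have "real (card (V - {p})) * (LINT x:?P|lborel. bary T q (hproj p x)) = facet_area p"
    using eq by simp
  moreover have "card (V - {p}) = DIM('a)" using V p by simp
  ultimately show "(LINT x:?P|lborel. bary T q (hproj p x)) = facet_area p / real DIM('a)" by (simp add: field_simps)
  show "set_integrable lborel ?P (\<lambda>x. bary T q (hproj p x))" using int q by blast
qed

lemma prism_integral_affine:
  assumes p: "p \<in> V" and dim: "DIM('a) \<ge> 2"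
  shows "(LINT x:prism (opp T p)|lborel. a + b \<bullet> hproj p x) = facet_area p * (a + b \<bullet> barycenter (opp T p))"
proof -
  let ?P = "prism (opp T p)"
  have e: "a + b \<bullet> y = (\<Sum>q\<in>V - {p}. bary T q y * (a + b \<bullet> q))" if "bary T p y = 0" for y
  proof -
    have s: "(\<Sum>q\<in>V - {p}. bary T q y) = 1" "(\<Sum>q\<in>V - {p}. bary T q y *\<^sub>R q) = y"
      using sum_bary[of y] sum_bary_scaleR[of y] that by (simp_all add: sum.remove[OF V(1) p])
    have "(\<Sum>q\<in>V - {p}. bary T q y * (a + b \<bullet> q)) = (\<Sum>q\<in>V - {p}. bary T q y) * a + b \<bullet> (\<Sum>q\<in>V - {p}. bary T q y *\<^sub>R q)"
      by (simp add: distrib_left sum.distrib sum_distrib_right inner_sum_right)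
    then show ?thesis using s by simp
  qed
  have "(LINT x:?P|lborel. a + b \<bullet> hproj p x) = (LINT x|lborel. (\<Sum>q\<in>V - {p}. (indicator ?P x *\<^sub>R bary T q (hproj p x)) * (a + b \<bullet> q)))"
    unfolding set_lebesgue_integral_def by (subst e[OF bary_hproj_self[OF p]]) (simp add: sum_distrib_left mult_ac)
  also have "\<dots> = (\<Sum>q\<in>V - {p}. (LINT x:?P|lborel. bary T q (hproj p x)) * (a + b \<bullet> q))"
    unfolding set_lebesgue_integral_def
    by (subst Bochner_Integration.integral_sum) (use facet_centroid(2)[OF p dim] in \<open>auto simp: set_integrable_def\<close>)
  also have "\<dots> = facet_area p * (\<Sum>q\<in>V - {p}. bary T q (barycenter (opp T p)) * (a + b \<bullet> q))"
    using p by (simp add: facet_centroid(1)[OF p dim] bary_barycenter_opp sum_distrib_left)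
  also have "\<dots> = facet_area p * (a + b \<bullet> barycenter (opp T p))"
    using p by (subst e) (auto simp: bary_barycenter_opp)
  finally show ?thesis .
qed

lemma facet_measure_eq:
  assumes p: "p \<in> V"
  shows "facet_measure (opp T p) = completion (distr (restrict_space lborel (prism (opp T p))) borel (hproj p))"
proof -
  have "closest_point (affine hull (opp T p)) = hproj p" using closest_point_hproj[OF p] by auto
  then show ?thesis by (simp add: facet_measure_def)
qed

lemma rel_interior_borel: "p \<in> V \<Longrightarrow> rel_interior (opp T p) \<in> sets borel"
proof -
  assume p: "p \<in> V"
  have "rel_interior (opp T p) = {x. bary T p x = 0} \<inter> (\<Inter>q\<in>V - {p}. {x. 0 < bary T q x})"
    using rel_interior_opp_iff[OF p] by auto
  moreover have "{x. bary T p x = 0} \<inter> (\<Inter>q\<in>V - {p}. {x. 0 < bary T q x}) \<in> sets borel"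
    using V(1) other_vertex[of p] by (intro sets.Int sets.finite_INT) auto
  ultimately show ?thesis by simp
qed

text \<open>
  The relative boundary lies in the zero sets of the other coordinates. Pulled back to the prism
  these are hyperplanes; for \<open>d \<ge> 2\<close> the coordinates are not constant on the facet.
\<close>
lemma AE_facet_rel_interior:
  assumes p: "p \<in> V" and dim: "DIM('a) \<ge> 2"
  shows "AE x in facet_measure (opp T p). x \<in> rel_interior (opp T p)"
proof -
  let ?P = "prism (opp T p)"
  have [measurable]: "?P \<in> sets borel" "rel_interior (opp T p) \<in> sets borel"
    using prism_borel[OF p dim] rel_interior_borel[OF p] by auto
  have N: "AE x in lborel. bary T q (hproj p x) \<noteq> 0" if q: "q \<in> V - {p}" for q
  proof -
    have "p \<noteq> q" using q by auto
    then have "\<not> V \<subseteq> {p, q}" using V(2) dim card_mono[of "{p, q}" V] by auto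
    then obtain r where r: "r \<in> V" "r \<noteq> p" "r \<noteq> q" by auto
    have "bgrad T p \<bullet> (q - r) = 0" using bary_diff[of T p q r] bary_vertex p q r by auto
    moreover have "bgrad T q \<bullet> (q - r) = 1" using bgrad_works q r by auto
    ultimately have "facet_grad p q \<bullet> (q - r) = 1" by (simp add: facet_grad_def inner_diff_left)
    then have "facet_grad p q \<noteq> 0" by auto
    then have "negligible {x. facet_grad p q \<bullet> x = - bary T q (hproj p 0)}" by (simp add: negligible_hyperplane)
    moreover have "{x. facet_grad p q \<bullet> x = - bary T q (hproj p 0)} = {x. bary T q (hproj p x) = 0}"
      by (subst bary_hproj_affine) (auto simp: algebra_simps)
    ultimately have "{x. bary T q (hproj p x) = 0} \<in> null_sets lborel"
      by (simp add: negligible_iff_null_sets null_sets_completion_iff)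
    then show ?thesis using AE_not_in by fastforce
  qed
  have "AE x in lborel. \<forall>q\<in>V - {p}. bary T q (hproj p x) \<noteq> 0"
    using N V(1) by (intro AE_finite_allI) auto
  then have "AE x in lborel. x \<in> ?P \<longrightarrow> hproj p x \<in> rel_interior (opp T p)"
  proof eventually_elim
    case (elim x)
    show ?case
    proof
      assume "x \<in> ?P"
      then have "hproj p x \<in> opp T p" by (rule hproj_prism[OF p dim])
      then show "hproj p x \<in> rel_interior (opp T p)"
        using elim by (auto simp: rel_interior_opp_iff[OF p] opp_mem_iff[OF p] mem_iff less_le)
    qed
  qed
  then have "AE x in restrict_space lborel ?P. hproj p x \<in> rel_interior (opp T p)"
    by (subst AE_restrict_space_iff) auto
  then have "AE x in distr (restrict_space lborel ?P) borel (hproj p). x \<in> rel_interior (opp T p)"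
    by (subst AE_distr_iff) (auto intro: measurable_restrict_space1)
  then show ?thesis unfolding facet_measure_eq[OF p] by (rule AE_completion)
qed

lemma facet_integral_affine:
  assumes p: "p \<in> V" and dim: "DIM('a) \<ge> 2"
    and h: "\<And>x. x \<in> rel_interior (opp T p) \<Longrightarrow> h x = a + b \<bullet> x"
  shows "(LINT x|facet_measure (opp T p). h x) = facet_area p * (a + b \<bullet> barycenter (opp T p))"
proof -
  let ?P = "prism (opp T p)"
  have [measurable]: "?P \<in> sets borel" using prism_borel[OF p dim] .
  let ?N = "distr (restrict_space lborel ?P) borel (hproj p)"
  have ae: "AE x in facet_measure (opp T p). h x = a + b \<bullet> x"
    using AE_facet_rel_interior[OF p dim] by eventually_elim (rule h)
  have m: "(\<lambda>x. a + b \<bullet> x) \<in> borel_measurable ?N" by simp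
  have mc: "(\<lambda>x. a + b \<bullet> x) \<in> borel_measurable (facet_measure (opp T p))"
    unfolding facet_measure_eq[OF p] by (rule measurable_completion[OF m])
  have mh: "h \<in> borel_measurable (facet_measure (opp T p))"
  proof (rule measurableI)
    fix A :: "real set" assume A: "A \<in> sets borel"
    let ?M = "facet_measure (opp T p)"
    have s: "(\<lambda>x. a + b \<bullet> x) -` A \<inter> space ?M \<in> sets ?M" by (rule measurable_sets[OF mc A])
    have e: "AE x in ?M. x \<in> (\<lambda>x. a + b \<bullet> x) -` A \<inter> space ?M \<longleftrightarrow> x \<in> h -` A \<inter> space ?M"
      using ae by eventually_elim simp
    have "complete_measure ?M"
      unfolding facet_measure_def by (rule completion.complete_measure_axioms)
    from complete_measure.in_sets_AE[OF this e s] show "h -` A \<inter> space ?M \<in> sets ?M" by simp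
  qed simp
  have "(LINT x|facet_measure (opp T p). h x) = (LINT x|facet_measure (opp T p). a + b \<bullet> x)"
    by (rule integral_cong_AE[OF mh mc ae])
  also have "\<dots> = (LINT x|?N. a + b \<bullet> x)"
    unfolding facet_measure_eq[OF p] by (rule integral_completion[OF m])
  also have "\<dots> = (LINT x|restrict_space lborel ?P. a + b \<bullet> hproj p x)"
    by (rule integral_distr) (auto intro: measurable_restrict_space1)
  also have "\<dots> = (LINT x:?P|lborel. a + b \<bullet> hproj p x)"
    unfolding set_lebesgue_integral_def by (rule integral_restrict_space) simp
  also have "\<dots> = facet_area p * (a + b \<bullet> barycenter (opp T p))" by (rule prism_integral_affine[OF p dim])
  finally show ?thesis .
qed

lemma measure_facet_measure:
  assumes p: "p \<in> V" and dim: "DIM('a) \<ge> 2"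
  shows "measure (facet_measure (opp T p)) (opp T p) = facet_area p"
    "opp T p \<inter> A = {} \<Longrightarrow> measure (facet_measure (opp T p)) A = 0"
proof -
  let ?M = "facet_measure (opp T p)"
  have sub: "rel_interior (opp T p) \<subseteq> opp T p" by (rule rel_interior_subset)
  have "opp T p \<in> sets borel" using opp_closed[OF p] by (rule borel_closed)
  then have S: "opp T p \<in> sets ?M" unfolding facet_measure_eq[OF p] by simp
  have "(LINT x|?M. indicat_real (opp T p) x) = facet_area p * (1 + 0 \<bullet> barycenter (opp T p))"
    using sub by (intro facet_integral_affine[OF p dim]) auto
  then show "measure ?M (opp T p) = facet_area p" by (simp add: facet_measure_def)
  show "measure ?M A = 0" if "opp T p \<inter> A = {}"
  proof (cases "A \<in> sets ?M")
    case True
    have "AE x in ?M. x \<notin> A" using AE_facet_rel_interior[OF p dim] by eventually_elim (use that sub in auto)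
    then have "emeasure ?M A = 0" using True by (subst (asm) AE_iff_measurable[OF True]) (auto dest: sets.sets_into_space)
    then show ?thesis by (simp add: measure_def)
  qed (simp add: measure_notin_sets)
qed

end

section \<open>The mesh and its facets\<close>

text \<open>
  Below the graph, arbitrarily close to a boundary point, there are open sets that do not meet
  \<open>\<Omega>\<close>; so no boundary point is interior to the closure. This excludes slit domains, so that the
  relative interior of a facet with elements on both sides is inside \<open>\<Omega>\<close>.
\<close>
lemma lipschitz_boundary_interior_closure:
  fixes \<Omega> :: "'a::euclidean_space set"
  assumes "open \<Omega>" and lip: "lipschitz_boundary \<Omega>"
  shows "interior (closure \<Omega>) = \<Omega>"
proof
  show "\<Omega> \<subseteq> interior (closure \<Omega>)" using \<open>open \<Omega>\<close> closure_subset by (rule interior_maximal[rotated])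
  show "interior (closure \<Omega>) \<subseteq> \<Omega>"
  proof (rule ccontr)
    assume "\<not> interior (closure \<Omega>) \<subseteq> \<Omega>"
    then obtain x where x: "x \<in> interior (closure \<Omega>)" "x \<notin> \<Omega>" by blast
    then have "x \<in> frontier \<Omega>" using interior_subset interior_open[OF \<open>open \<Omega>\<close>] by (auto simp: frontier_def)
    then obtain e r \<gamma> L where e: "norm e = 1" "r > 0" "L-lipschitz_on UNIV (\<gamma> :: 'a \<Rightarrow> real)"
      and \<Omega>: "\<Omega> \<inter> ball x r = {y \<in> ball x r. y \<bullet> e > \<gamma> (y - (y \<bullet> e) *\<^sub>R e)}"
      using lip unfolding lipschitz_boundary_def by blast
    have ee: "e \<bullet> e = 1" using e(1) by (simp add: norm_eq_1)
    obtain d where d: "d > 0" "ball x d \<subseteq> closure \<Omega>" using x(1) by (auto simp: mem_interior)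
    define t where "t = min r d / 2"
    have t: "0 < t" "t < r" "t < d" using d e(2) by (auto simp: t_def)
    \<comment> \<open>A step in direction \<open>- e\<close> goes strictly below the graph, and stays there under small
      perturbation.\<close>
    define y where "y = x - t *\<^sub>R e"
    let ?U = "{z \<in> ball x r. z \<bullet> e < \<gamma> (z - (z \<bullet> e) *\<^sub>R e)}"
    have "continuous_on UNIV \<gamma>" using e(3) by (rule lipschitz_on_continuous_on)
    then have "continuous_on UNIV (\<lambda>z. \<gamma> (z - (z \<bullet> e) *\<^sub>R e))"
      by (rule continuous_on_compose2) (auto intro!: continuous_intros)
    then have "open {z. z \<bullet> e < \<gamma> (z - (z \<bullet> e) *\<^sub>R e)}" by (intro open_Collect_less continuous_intros)
    then have "open (ball x r \<inter> {z. z \<bullet> e < \<gamma> (z - (z \<bullet> e) *\<^sub>R e)})" by (intro open_Int) auto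
    then have U: "open ?U" by (simp add: Int_def)
    have ye: "y \<bullet> e = x \<bullet> e - t" using ee by (simp add: y_def inner_simps)
    have "y - (y \<bullet> e) *\<^sub>R e = x - (x \<bullet> e) *\<^sub>R e" unfolding ye by (simp add: y_def algebra_simps)
    moreover have "x \<bullet> e \<le> \<gamma> (x - (x \<bullet> e) *\<^sub>R e)" using \<Omega> x(2) e(2) by force
    ultimately have "y \<bullet> e < \<gamma> (y - (y \<bullet> e) *\<^sub>R e)" using t(1) unfolding ye[symmetric] by (simp only: ye)
    then have "y \<in> ?U" using t e(1) by (simp add: y_def dist_norm)
    moreover have "?U \<inter> \<Omega> = {}" using \<Omega> by force
    ultimately have "y \<notin> closure \<Omega>" using open_Int_closure_eq_empty[OF U] by blast
    moreover have "y \<in> ball x d" using t e(1) by (simp add: y_def dist_norm)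
    ultimately show False using d(2) by blast
  qed
qed

lemma (in full_simplex) interior_nonempty: "interior T \<noteq> {}"
  using barycenter_in_interior by blast

lemma (in full_simplex) closure_interior: "closure (interior T) = T"
  using convex_closure_interior[OF convex interior_nonempty] closed by simp

lemma (in full_simplex) aff_dim_T: "aff_dim T = int DIM('a)"
  using aff_dim_nonempty_interior[OF interior_nonempty] .

lemma (in full_simplex) facet_mem: "S facet_of T \<Longrightarrow> x \<in> rel_interior S \<Longrightarrow> x \<in> T"
  using facet_of_imp_subset rel_interior_subset by blast

text \<open>
  The normal form of elementwise functions. The value zero on the mesh skeleton makes equality
  of functions the same as equality of all branches.
\<close>
definition pw :: "'a::euclidean_space set set \<Rightarrow> ('a set \<Rightarrow> 'a \<Rightarrow> 'b::real_vector) \<Rightarrow> 'a \<Rightarrow> 'b" where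
  "pw \<T> F x = (\<Sum>T\<in>\<T>. indicat_real (interior T) x *\<^sub>R F T x)"

locale mesh =
  fixes \<Omega> :: "(real^'n) set" and \<T> :: "(real^'n) set set"
  assumes dim: "CARD('n) \<ge> 2" and opn: "open \<Omega>" and con: "connected \<Omega>" and ne: "\<Omega> \<noteq> {}"
    and bdd: "bounded \<Omega>" and reg: "interior (closure \<Omega>) = \<Omega>" and mesh: "conforming_mesh \<Omega> \<T>"
begin

lemma fin: "finite \<T>" and cover: "\<Union>\<T> = closure \<Omega>"
  using mesh by (auto simp: conforming_mesh_def triangulation_def)

lemma face: "T \<in> \<T> \<Longrightarrow> T' \<in> \<T> \<Longrightarrow> T \<inter> T' face_of T"
  using mesh unfolding conforming_mesh_def triangulation_def by blast

lemma element_simplex: "T \<in> \<T> \<Longrightarrow> full_simplex T"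
  using mesh by (simp add: conforming_mesh_def full_simplex_def)

lemma DIM2: "DIM(real^'n) \<ge> 2" using dim by simp

lemma interior_subset_Omega: "T \<in> \<T> \<Longrightarrow> interior T \<subseteq> \<Omega>"
  using cover reg by (metis Union_upper interior_mono)

lemma interior_disjoint:
  assumes T: "T \<in> \<T>" and T': "T' \<in> \<T>" and x: "x \<in> interior T" "x \<in> T'"
  shows "T = T'"
proof -
  interpret T: full_simplex T by (rule element_simplex[OF T])
  interpret T': full_simplex T' by (rule element_simplex[OF T'])
  have "x \<in> rel_interior T" using x(1) rel_interior_nonempty_interior[of T] by auto
  then have TT': "T \<subseteq> T'"
    using subset_of_face_of[OF face[OF T T'], of T] x interior_subset by blast
  have "x \<in> interior T'" using x(1) interior_mono[OF TT'] by blast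
  then have "x \<in> rel_interior T'" using rel_interior_nonempty_interior[of T'] by auto
  then have "T' \<subseteq> T"
    using subset_of_face_of[OF face[OF T' T], of T'] x interior_subset by blast
  with TT' show ?thesis by simp
qed

lemma mesh_int_iff: "x \<in> mesh_int \<T> \<longleftrightarrow> (\<exists>T\<in>\<T>. x \<in> interior T)" by (auto simp: mesh_int_def)

lemma mesh_int_Omega: "mesh_int \<T> \<subseteq> \<Omega>" using interior_subset_Omega by (auto simp: mesh_int_def)

lemma pw_in: "T \<in> \<T> \<Longrightarrow> x \<in> interior T \<Longrightarrow> pw \<T> F x = F T x"
proof -
  assume T: "T \<in> \<T>" and x: "x \<in> interior T"
  have "pw \<T> F x = (\<Sum>T'\<in>\<T>. if T' = T then F T x else 0)"
    unfolding pw_def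
  proof (intro sum.cong refl)
    fix T' assume T': "T' \<in> \<T>"
    show "indicat_real (interior T') x *\<^sub>R F T' x = (if T' = T then F T x else 0)"
      using interior_disjoint[OF T T' x] x interior_subset[of T'] by (auto simp: indicator_def)
  qed
  then show ?thesis using T fin by simp
qed

lemma pw_out: "x \<notin> mesh_int \<T> \<Longrightarrow> pw \<T> F x = 0"
  unfolding pw_def by (intro sum.neutral) (auto simp: mesh_int_def indicator_def)

lemma pw_eqI: "(\<And>T x. T \<in> \<T> \<Longrightarrow> x \<in> interior T \<Longrightarrow> q x = F T x) \<Longrightarrow> (\<And>x. x \<notin> mesh_int \<T> \<Longrightarrow> q x = 0) \<Longrightarrow> q = pw \<T> F"
  by (rule ext) (metis mesh_int_iff pw_in pw_out)

lemma pw_cong: "(\<And>T x. T \<in> \<T> \<Longrightarrow> x \<in> interior T \<Longrightarrow> F T x = G T x) \<Longrightarrow> pw \<T> F = pw \<T> G"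
  by (intro pw_eqI) (auto simp: pw_in pw_out)

lemma pw_eq_iff: "pw \<T> F = pw \<T> G \<longleftrightarrow> (\<forall>T\<in>\<T>. \<forall>x\<in>interior T. F T x = G T x)"
  by (metis pw_cong pw_in)

lemma interior_integral:
  fixes h :: "real^'n \<Rightarrow> 'b::{banach,second_countable_topology}"
  assumes T: "T \<in> \<T>" and h: "set_integrable lborel T h"
  shows "(LINT x|lborel. indicat_real (interior T) x *\<^sub>R h x) = (LINT x:T|lborel. h x)"
    "integrable lborel (\<lambda>x. indicat_real (interior T) x *\<^sub>R h x)"
proof -
  interpret full_simplex T by (rule element_simplex[OF T])
  have "negligible (frontier T)" by (rule negligible_convex_frontier[OF convex])
  then have N: "frontier T \<in> null_sets lborel" by (simp add: negligible_iff_null_sets null_sets_completion_iff)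
  have ae: "AE x in lborel. x \<notin> frontier T" by (rule AE_not_in[OF N])
  have ae2: "AE x in lborel. indicat_real (interior T) x *\<^sub>R h x = indicat_real T x *\<^sub>R h x"
    using ae by eventually_elim (use closed interior_subset[of T] in \<open>auto simp: indicator_def frontier_def\<close>)
  have hm: "(\<lambda>x. indicat_real T x *\<^sub>R h x) \<in> borel_measurable lborel" and hi: "integrable lborel (\<lambda>x. indicat_real T x *\<^sub>R h x)"
    using h unfolding set_integrable_def by auto
  have "indicat_real (interior T) \<in> borel_measurable lborel" by (rule borel_measurable_indicator) simp
  from borel_measurable_scaleR[OF this hm]
  have "(\<lambda>x. indicat_real (interior T) x *\<^sub>R (indicat_real T x *\<^sub>R h x)) \<in> borel_measurable lborel" .
  moreover have "(\<lambda>x. indicat_real (interior T) x *\<^sub>R (indicat_real T x *\<^sub>R h x)) = (\<lambda>x. indicat_real (interior T) x *\<^sub>R h x)"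
    using interior_subset[of T] by (intro ext) (auto simp: indicator_def)
  ultimately have m: "(\<lambda>x. indicat_real (interior T) x *\<^sub>R h x) \<in> borel_measurable lborel" by metis
  show "integrable lborel (\<lambda>x. indicat_real (interior T) x *\<^sub>R h x)"
    using integrable_cong_AE[OF m hm ae2] hi by blast
  show "(LINT x|lborel. indicat_real (interior T) x *\<^sub>R h x) = (LINT x:T|lborel. h x)"
    unfolding set_lebesgue_integral_def by (rule integral_cong_AE[OF m hm ae2])
qed

lemma lebesgue_on_integral:
  fixes h :: "real^'n \<Rightarrow> 'b::{banach,second_countable_topology}"
  assumes U: "open U" and h: "(\<lambda>x. indicat_real U x *\<^sub>R h x) \<in> borel_measurable borel"
  shows "(LINT x|lebesgue_on U. h x) = (LINT x|lborel. indicat_real U x *\<^sub>R h x)"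
proof -
  have "(LINT x|lebesgue_on U. h x) = (LINT x|lebesgue. indicat_real U x *\<^sub>R h x)"
    using U by (intro integral_restrict_space) simp
  also have "\<dots> = (LINT x|lborel. indicat_real U x *\<^sub>R h x)"
    using h by (intro integral_completion) simp
  finally show ?thesis .
qed

lemma interior_mean_integral:
  fixes h :: "real^'n \<Rightarrow> 'b::{banach,second_countable_topology}"
  assumes T: "T \<in> \<T>" and h: "set_integrable lborel T h" and eq: "\<And>x. x \<in> interior T \<Longrightarrow> g x = h x"
  shows "(LINT x|lebesgue_on (interior T). g x) = (LINT x:T|lborel. h x)"
proof -
  have e: "(\<lambda>x. indicat_real (interior T) x *\<^sub>R g x) = (\<lambda>x. indicat_real (interior T) x *\<^sub>R h x)"
    by (intro ext) (auto simp: indicator_def eq)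
  have "(\<lambda>x. indicat_real (interior T) x *\<^sub>R h x) \<in> borel_measurable borel"
    using interior_integral(2)[OF T h] by auto
  then have "(LINT x|lebesgue_on (interior T). g x) = (LINT x|lborel. indicat_real (interior T) x *\<^sub>R g x)"
    by (intro lebesgue_on_integral) (simp_all only: e open_interior)
  then show ?thesis unfolding e interior_integral(1)[OF T h] .
qed

lemma measure_interior: "T \<in> \<T> \<Longrightarrow> measure lebesgue (interior T) = measure lborel T"
proof -
  assume T: "T \<in> \<T>"
  interpret full_simplex T by (rule element_simplex[OF T])
  have "set_integrable lborel T (\<lambda>x. 1 :: real)" by (intro set_integrable_continuous continuous_intros)
  from interior_integral(1)[OF T this] show ?thesis by (simp add: set_lebesgue_integral_def)
qed

lemma pw_integral:
  fixes h :: "real^'n \<Rightarrow> 'b::{banach,second_countable_topology}"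
  assumes int: "\<And>T. T \<in> \<T> \<Longrightarrow> set_integrable lborel T (F T)"
    and eq: "\<And>T x. T \<in> \<T> \<Longrightarrow> x \<in> interior T \<Longrightarrow> h x = F T x" and zero: "\<And>x. x \<notin> mesh_int \<T> \<Longrightarrow> h x = 0"
  shows "(LINT x|lebesgue_on \<Omega>. h x) = (\<Sum>T\<in>\<T>. LINT x:T|lborel. F T x)" "integrable (lebesgue_on \<Omega>) h"
    "h \<in> borel_measurable borel"
proof -
  have h: "h = (\<lambda>x. \<Sum>T\<in>\<T>. indicat_real (interior T) x *\<^sub>R F T x)"
    using pw_eqI[of h F] eq zero by (auto simp: pw_def)
  have i: "integrable lborel h" unfolding h
    by (intro Bochner_Integration.integrable_sum interior_integral(2) int)
  then show m: "h \<in> borel_measurable borel" by auto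
  have Om: "(\<lambda>x. indicat_real \<Omega> x *\<^sub>R h x) = h"
    using mesh_int_Omega zero by (auto simp: indicator_def fun_eq_iff)
  have "(LINT x|lebesgue_on \<Omega>. h x) = (LINT x|lborel. h x)"
    using lebesgue_on_integral[OF opn, of h] m unfolding Om by simp
  also have "\<dots> = (\<Sum>T\<in>\<T>. LINT x:T|lborel. F T x)"
    unfolding h by (subst Bochner_Integration.integral_sum) (auto intro: interior_integral int sum.cong)
  finally show "(LINT x|lebesgue_on \<Omega>. h x) = (\<Sum>T\<in>\<T>. LINT x:T|lborel. F T x)" .
  have "integrable lebesgue h" using i by (simp add: integrable_completion m)
  then show "integrable (lebesgue_on \<Omega>) h"
    using opn by (subst integrable_restrict_space) (simp_all add: Om)
qed

definition "els S = {T \<in> \<T>. S facet_of T}"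

lemma els_facet: "T \<in> els S \<Longrightarrow> T \<in> \<T>" "T \<in> els S \<Longrightarrow> S facet_of T" by (auto simp: els_def)

lemma mesh_facets_iff: "S \<in> mesh_facets \<T> \<longleftrightarrow> els S \<noteq> {}" by (auto simp: mesh_facets_def els_def)

lemma mesh_facets_eq: "mesh_facets \<T> = (\<Union>T\<in>\<T>. opp T ` verts T)"
proof -
  have "S facet_of T \<longleftrightarrow> S \<in> opp T ` verts T" if "T \<in> \<T>" for S T
    using full_simplex.facet_iff[OF element_simplex[OF that]] by auto
  then show ?thesis by (auto simp: mesh_facets_def)
qed

lemma finite_mesh_facets: "finite (mesh_facets \<T>)"
  unfolding mesh_facets_eq using fin full_simplex.V(1)[OF element_simplex] by auto

lemma els_opp: "T \<in> els S \<longleftrightarrow> T \<in> \<T> \<and> (\<exists>p\<in>verts T. S = opp T p)"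
  using full_simplex.facet_iff[OF element_simplex] by (auto simp: els_def)

text \<open>
  The intersection with \<open>T'\<close> is a face of \<open>T\<close> that contains a relative interior point of \<open>S\<close>,
  hence all of \<open>S\<close>.
\<close>
lemma facet_of_containing:
  assumes T: "T \<in> els S" and x: "x \<in> rel_interior S" and T': "T' \<in> \<T>" "x \<in> T'"
  shows "T' \<in> els S"
proof -
  have T1: "T \<in> \<T>" "S facet_of T" using T by (auto simp: els_def)
  then have S: "S face_of T" "S \<noteq> {}" "aff_dim S = aff_dim T - 1" by (auto simp: facet_of_def)
  have "S \<subseteq> T" using S(1) by (rule face_of_imp_subset)
  have "S \<subseteq> T \<inter> T'"
    using subset_of_face_of[OF face[OF T1(1) T'(1)] \<open>S \<subseteq> T\<close>] x T'(2) rel_interior_subset \<open>S \<subseteq> T\<close> by blast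
  then have "S face_of (T \<inter> T')" using face_of_subset[OF S(1)] by blast
  moreover have "(T \<inter> T') face_of T'" using face[OF T'(1) T1(1)] by (simp add: Int_commute)
  ultimately have "S face_of T'" by (rule face_of_trans)
  moreover have "aff_dim T = aff_dim T'"
    using full_simplex.aff_dim_T[OF element_simplex] T1(1) T'(1) by simp
  ultimately show ?thesis using S T'(1) by (auto simp: els_def facet_of_def)
qed

lemma facet_neighbourhood:
  assumes T: "T \<in> els S" and x: "x \<in> rel_interior S"
  obtains e where "e > 0" "\<And>T'. T' \<in> \<T> \<Longrightarrow> T' \<inter> ball x e \<noteq> {} \<Longrightarrow> T' \<in> els S"
proof -
  let ?U = "\<Union>{T' \<in> \<T>. T' \<notin> els S}"
  have "closed ?U" using fin full_simplex.closed[OF element_simplex] by (intro closed_Union) auto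
  moreover have "x \<notin> ?U" using facet_of_containing[OF T x] by blast
  ultimately have "open (- ?U)" "x \<in> - ?U" by (simp_all add: open_Compl)
  then obtain e where "e > 0" "ball x e \<subseteq> - ?U" by (rule openE)
  then show ?thesis using that by blast
qed

text \<open>
  If the two gradients pointed to the same side of the common facet, the interiors of the
  elements would overlap near the barycenter of the facet.
\<close>
lemma opposite_elements:
  assumes T: "T \<in> \<T>" "p \<in> verts T" and T': "T' \<in> \<T>" "p' \<in> verts T'" and eq: "opp T p = opp T' p'" and ne: "T \<noteq> T'"
  obtains \<kappa> where "\<kappa> > 0" "bgrad T' p' = (- \<kappa>) *\<^sub>R bgrad T p" "\<And>y. bary T' p' y = - \<kappa> * bary T p y"
proof -
  interpret T: full_simplex T by (rule element_simplex[OF T(1)])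
  interpret T': full_simplex T' by (rule element_simplex[OF T'(1)])
  have VV: "verts T - {p} = verts T' - {p'}" using T.verts_opp[OF T(2)] T'.verts_opp[OF T'(2)] eq by simp
  obtain q where q: "q \<in> verts T" "q \<noteq> p" by (rule T.other_vertex)
  define c where "c = bgrad T' p' \<bullet> (p - q)"
  have sub: "verts T - {p} \<subseteq> opp T p" unfolding opp_def by (rule hull_subset)
  have g: "bgrad T' p' = c *\<^sub>R bgrad T p" unfolding c_def
  proof (rule T.orthogonal_to_facet[OF T(2) q])
    show "bgrad T' p' \<bullet> (r - r') = 0" if "r \<in> verts T - {p}" "r' \<in> verts T - {p}" for r r'
      using T'.bgrad_orthogonal[OF T'(2), of r r'] sub that eq by auto
  qed
  define x where "x = barycenter (opp T p)"
  have xr: "x \<in> rel_interior (opp T p)" unfolding x_def by (rule T.barycenter_in_rel_interior[OF T(2)])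
  have b0: "bary T p x = 0" "bary T' p' x = 0" and bpos: "\<And>r. r \<in> verts T - {p} \<Longrightarrow> 0 < bary T r x" "\<And>r. r \<in> verts T' - {p'} \<Longrightarrow> 0 < bary T' r x"
    using xr T.rel_interior_opp_iff[OF T(2), of x] T'.rel_interior_opp_iff[OF T'(2), of x] eq by auto
  have b: "bary T' p' y = c * bary T p y" for y
    using bary_diff[of T' p' y x] bary_diff[of T p y x] b0 by (simp add: g)
  have c0: "c \<noteq> 0" using g T'.bgrad_nonzero[OF T'(2)] by auto
  \<comment> \<open>With \<open>c > 0\<close> a small step from the facet along \<open>bgrad T p\<close> enters the interior of both
    elements.\<close>
  have "\<not> c > 0"
  proof
    assume c: "c > 0"
    have "open (\<Inter>r\<in>verts T - {p}. {y. 0 < bary T r y})" "open (\<Inter>r\<in>verts T' - {p'}. {y. 0 < bary T' r y})"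
      using T.V(1) T'.V(1) by (intro open_INT ballI open_Collect_less continuous_intros; simp)+
    then have "open ((\<Inter>r\<in>verts T - {p}. {y. 0 < bary T r y}) \<inter> (\<Inter>r\<in>verts T' - {p'}. {y. 0 < bary T' r y}))" (is "open ?O")
      by (rule open_Int)
    moreover have "x \<in> ?O" using bpos by auto
    ultimately obtain e where e: "e > 0" "ball x e \<subseteq> ?O" by (rule openE)
    define g where "g = bgrad T p"
    define y where "y = x + (e / (2 * norm g)) *\<^sub>R g"
    have g0: "norm g > 0" using T.bgrad_nonzero[OF T(2)] by (simp add: g_def)
    have "y \<in> ball x e" using e g0 by (simp add: y_def dist_norm)
    then have yO: "y \<in> ?O" using e by blast
    have "bary T p y > 0" using b0 g0 e by (simp add: y_def bary_add g_def[symmetric])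
    moreover from this have "bary T' p' y > 0" using b c by simp
    ultimately have "y \<in> interior T" "y \<in> interior T'"
      using yO unfolding T.interior_iff T'.interior_iff by auto
    then show False using interior_disjoint[OF T(1) T'(1)] interior_subset ne by blast
  qed
  then have "c < 0" using c0 by simp
  then show ?thesis using that[of "- c"] g b by simp
qed

text \<open>
  Three elements at one facet would lie pairwise on opposite sides of it.
\<close>
lemma two_elements:
  assumes "T1 \<in> els S" "T2 \<in> els S" "T1 \<noteq> T2" "T3 \<in> els S"
  shows "T3 = T1 \<or> T3 = T2"
proof (rule ccontr)
  assume n: "\<not> ?thesis"
  obtain p1 p2 p3 where p: "T1 \<in> \<T>" "T2 \<in> \<T>" "T3 \<in> \<T>" "p1 \<in> verts T1" "p2 \<in> verts T2" "p3 \<in> verts T3"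
    "S = opp T1 p1" "S = opp T2 p2" "S = opp T3 p3"
    using assms unfolding els_opp by blast
  interpret T1: full_simplex T1 by (rule element_simplex[OF p(1)])
  obtain a where a: "a > 0" "bgrad T2 p2 = (- a) *\<^sub>R bgrad T1 p1"
    using opposite_elements[OF p(1,4) p(2,5)] p assms(3) by metis
  obtain b where b: "b > 0" "bgrad T3 p3 = (- b) *\<^sub>R bgrad T1 p1"
    using opposite_elements[OF p(1,4) p(3,6)] p n by metis
  obtain c where c: "c > 0" "bgrad T3 p3 = (- c) *\<^sub>R bgrad T2 p2"
    using opposite_elements[OF p(2,5) p(3,6)] p n by metis
  have "(- b) *\<^sub>R bgrad T1 p1 = (c * a) *\<^sub>R bgrad T1 p1" using a b c by simp
  then have "- b = c * a" using T1.bgrad_nonzero[OF p(4)] by (metis scaleR_right_imp_eq)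
  moreover have "c * a > 0" using a c by simp
  ultimately show False using b by linarith
qed

text \<open>
  Two elements on opposite sides fill a neighbourhood of every relative interior point of the
  facet, and such a point belongs to \<open>\<Omega>\<close> because \<open>\<Omega>\<close> is the interior of its closure.
\<close>
lemma shared_facet_interior:
  assumes "T1 \<in> els S" "T2 \<in> els S" "T1 \<noteq> T2"
  shows "rel_interior S \<subseteq> \<Omega>"
proof
  fix x assume x: "x \<in> rel_interior S"
  obtain p p' where p: "T1 \<in> \<T>" "T2 \<in> \<T>" "p \<in> verts T1" "p' \<in> verts T2" "S = opp T1 p" "S = opp T2 p'"
    using assms unfolding els_opp by blast
  interpret T: full_simplex T1 by (rule element_simplex[OF p(1)])
  interpret T': full_simplex T2 by (rule element_simplex[OF p(2)])
  obtain a where a: "a > 0" "\<And>y. bary T2 p' y = - a * bary T1 p y"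
    using opposite_elements[OF p(1,3) p(2,4)] p assms(3) by metis
  have "open ((\<Inter>r\<in>verts T1 - {p}. {y. 0 < bary T1 r y}) \<inter> (\<Inter>r\<in>verts T2 - {p'}. {y. 0 < bary T2 r y}))" (is "open ?O")
    using T.V(1) T'.V(1) by (intro open_Int open_INT ballI open_Collect_less continuous_intros) auto
  moreover have "x \<in> ?O" using x T.rel_interior_opp_iff[OF p(3), of x] T'.rel_interior_opp_iff[OF p(4), of x] p by auto
  moreover have "?O \<subseteq> closure \<Omega>"
  proof
    fix y assume y: "y \<in> ?O"
    have "y \<in> T1 \<or> y \<in> T2"
    proof (cases "bary T1 p y \<ge> 0")
      case True
      then have "0 \<le> bary T1 r y" if "r \<in> verts T1" for r
        using y that by (cases "r = p") (auto simp: less_imp_le)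
      then have "y \<in> T1" by (simp add: T.mem_iff)
      then show ?thesis ..
    next
      case False
      then have "bary T2 p' y \<ge> 0" using a by (simp add: mult_nonneg_nonpos)
      then have "0 \<le> bary T2 r y" if "r \<in> verts T2" for r
        using y that by (cases "r = p'") (auto simp: less_imp_le)
      then have "y \<in> T2" by (simp add: T'.mem_iff)
      then show ?thesis ..
    qed
    then show "y \<in> closure \<Omega>" using cover p(1,2) by blast
  qed
  ultimately have "x \<in> interior (closure \<Omega>)" by (meson interiorI)
  then show "x \<in> \<Omega>" using reg by simp
qed

text \<open>
  Near a relative interior point of \<open>S\<close> the closed domain coincides with \<open>T\<close>, and the point is
  not interior to \<open>T\<close>.
\<close>
lemma single_element_boundary:
  assumes els: "els S = {T}"
  shows "S \<subseteq> frontier \<Omega>"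
proof -
  obtain p where p: "T \<in> \<T>" "p \<in> verts T" "S = opp T p" using els els_opp[of T S] by auto
  interpret T: full_simplex T by (rule element_simplex[OF p(1)])
  have "rel_interior S \<subseteq> frontier \<Omega>"
  proof
    fix x assume x: "x \<in> rel_interior S"
    obtain e where e: "e > 0" "\<And>T'. T' \<in> \<T> \<Longrightarrow> T' \<inter> ball x e \<noteq> {} \<Longrightarrow> T' \<in> els S"
      using facet_neighbourhood[of T S x] els x by blast
    have cl: "closure \<Omega> \<inter> ball x e \<subseteq> T"
    proof
      fix y assume "y \<in> closure \<Omega> \<inter> ball x e"
      then obtain T' where "T' \<in> \<T>" "y \<in> T'" "y \<in> ball x e" using cover by auto
      then have "T' \<in> els S" using e(2)[of T'] by blast
      then show "y \<in> T" using els \<open>y \<in> T'\<close> by simp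
    qed
    have b: "bary T p x = 0" using x p(3) T.rel_interior_opp_iff[OF p(2)] by simp
    have "x \<notin> interior (closure \<Omega>)"
    proof
      assume "x \<in> interior (closure \<Omega>)"
      then have "x \<in> interior (closure \<Omega>) \<inter> ball x e" using e(1) by simp
      moreover have "interior (closure \<Omega>) \<inter> ball x e \<subseteq> interior T"
        using cl interior_subset by (intro interior_maximal open_Int) auto
      ultimately have "x \<in> interior T" by blast
      then show False using b p(2) unfolding T.interior_iff by force
    qed
    moreover have "x \<in> closure \<Omega>" using x p cover T.opp_mem_iff[OF p(2)] rel_interior_subset by blast
    ultimately show "x \<in> frontier \<Omega>" using reg opn by (simp add: frontier_def interior_open)
  qed
  then have "closure (rel_interior S) \<subseteq> frontier \<Omega>" by (simp add: closure_minimal)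
  moreover have "closure (rel_interior S) = closure S"
    by (rule convex_closure_rel_interior) (simp add: p(3) opp_def)
  ultimately show ?thesis using closure_subset by blast
qed

lemma bdry_facet_element:
  assumes S: "S \<in> bdry_facets \<Omega> \<T>"
  obtains T p where "els S = {T}" "T \<in> \<T>" "p \<in> verts T" "S = opp T p"
proof -
  have S': "S \<in> mesh_facets \<T>" "S \<subseteq> frontier \<Omega>" using S by (auto simp: bdry_facets_def)
  then obtain T where T: "T \<in> els S" using mesh_facets_iff by blast
  obtain p where p: "T \<in> \<T>" "p \<in> verts T" "S = opp T p" using T unfolding els_opp by blast
  interpret T: full_simplex T by (rule element_simplex[OF p(1)])
  have "T' = T" if "T' \<in> els S" for T'
  proof (rule ccontr)
    assume "T' \<noteq> T"
    then have "rel_interior S \<subseteq> \<Omega>" by (rule shared_facet_interior[OF that T])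
    moreover have "barycenter S \<in> rel_interior S" using T.barycenter_in_rel_interior p by simp
    moreover have "frontier \<Omega> \<inter> \<Omega> = {}" using opn by (auto simp: frontier_def interior_open)
    ultimately show False using S'(2) rel_interior_subset by blast
  qed
  then have "els S = {T}" using T by blast
  then show ?thesis using that p by blast
qed

lemma interior_facet_elements:
  assumes S: "S \<in> mesh_facets \<T> - bdry_facets \<Omega> \<T>"
  obtains T1 T2 where "els S = {T1, T2}" "T1 \<noteq> T2" "rel_interior S \<subseteq> \<Omega>"
proof -
  obtain T where T: "T \<in> els S" using S mesh_facets_iff by blast
  have "els S \<noteq> {T}" using single_element_boundary[of S T] S by (auto simp: bdry_facets_def)
  then obtain T' where T': "T' \<in> els S" "T' \<noteq> T" using T by blast
  then have "els S = {T, T'}" using two_elements[OF T T'(1)] T by blast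
  moreover have "rel_interior S \<subseteq> \<Omega>" using shared_facet_interior[OF T'(1) T T'(2)] .
  ultimately show ?thesis using that T'(2) by metis
qed

lemma bdry_local:
  assumes els: "els S = {T}" and x: "x \<in> rel_interior S"
  obtains e where "e > 0" "\<And>y. y \<in> ball x e \<Longrightarrow> y \<in> closure \<Omega> \<longleftrightarrow> y \<in> T" "\<And>y. y \<in> ball x e \<Longrightarrow> y \<in> \<Omega> \<longleftrightarrow> y \<in> interior T"
proof -
  have T: "T \<in> \<T>" using els by (auto simp: els_def)
  obtain e where e: "e > 0" "\<And>T'. T' \<in> \<T> \<Longrightarrow> T' \<inter> ball x e \<noteq> {} \<Longrightarrow> T' \<in> els S"
    using facet_neighbourhood[of T S x] els x by blast
  have cl: "y \<in> closure \<Omega> \<longleftrightarrow> y \<in> T" if y: "y \<in> ball x e" for y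
  proof
    assume "y \<in> closure \<Omega>"
    then obtain T' where "T' \<in> \<T>" "y \<in> T'" using cover by auto
    then have "T' \<in> els S" using e(2)[of T'] y by blast
    then show "y \<in> T" using els \<open>y \<in> T'\<close> by simp
  qed (use cover T in blast)
  have "y \<in> \<Omega> \<longleftrightarrow> y \<in> interior T" if y: "y \<in> ball x e" for y
  proof
    assume "y \<in> \<Omega>"
    then have "y \<in> \<Omega> \<inter> ball x e" using y by simp
    moreover have "\<Omega> \<inter> ball x e \<subseteq> interior T"
      using cl closure_subset[of \<Omega>] opn by (intro interior_maximal open_Int) auto
    ultimately show "y \<in> interior T" by blast
  qed (use interior_subset_Omega[OF T] in blast)
  with e(1) cl show ?thesis using that by blast
qed

lemma outer_normal_eq:
  assumes els: "els S = {T}" and p: "p \<in> verts T" "S = opp T p"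
  shows "outer_normal \<Omega> S = (- 1 / norm (bgrad T p)) *\<^sub>R bgrad T p"
proof -
  have T: "T \<in> \<T>" using els by (auto simp: els_def)
  interpret T: full_simplex T by (rule element_simplex[OF T])
  let ?g = "bgrad T p"
  define \<nu> where "\<nu> = (- 1 / norm ?g) *\<^sub>R ?g"
  have g: "norm ?g > 0" using T.bgrad_nonzero[OF p(1)] by simp
  let ?P = "\<lambda>\<nu>. norm \<nu> = 1 \<and> (\<forall>x\<in>S. \<forall>y\<in>S. \<nu> \<bullet> (x - y) = 0) \<and>
    (\<forall>x\<in>rel_interior S. \<exists>\<epsilon>>0. \<forall>t. 0 < t \<and> t < \<epsilon> \<longrightarrow> x - t *\<^sub>R \<nu> \<in> \<Omega> \<and> x + t *\<^sub>R \<nu> \<notin> closure \<Omega>)"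
  have g\<nu>: "?g \<bullet> \<nu> = - norm ?g" using g by (simp add: \<nu>_def power2_norm_eq_inner[symmetric] power2_eq_square)
  have nn: "norm \<nu> = 1" using g by (simp add: \<nu>_def)
  have ev: "\<exists>\<epsilon>>0. \<forall>t. 0 < t \<and> t < \<epsilon> \<longrightarrow> x - t *\<^sub>R \<nu> \<in> \<Omega> \<and> x + t *\<^sub>R \<nu> \<notin> closure \<Omega>"
    if x: "x \<in> rel_interior S" for x
  proof -
    have bx: "bary T p x = 0" "\<And>q. q \<in> verts T - {p} \<Longrightarrow> 0 < bary T q x"
      using x T.rel_interior_opp_iff[OF p(1)] p(2) by auto
    obtain e where e: "e > 0" "\<And>y. y \<in> ball x e \<Longrightarrow> y \<in> closure \<Omega> \<longleftrightarrow> y \<in> T" "\<And>y. y \<in> ball x e \<Longrightarrow> y \<in> \<Omega> \<longleftrightarrow> y \<in> interior T"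
      using bdry_local[OF els x] by metis
    have "open (\<Inter>r\<in>verts T - {p}. {y. 0 < bary T r y})"
      using T.V(1) by (intro open_INT ballI open_Collect_less continuous_intros) auto
    then obtain e' where e': "e' > 0" "ball x e' \<subseteq> (\<Inter>r\<in>verts T - {p}. {y. 0 < bary T r y})"
      using bx(2) by (elim openE[of _ x]) auto
    show ?thesis
    proof (intro exI[of _ "min e e'"] conjI allI impI)
      show "min e e' > 0" using e e' by simp
      fix t assume t: "0 < t \<and> t < min e e'"
      have m: "x - t *\<^sub>R \<nu> \<in> ball x e" "x - t *\<^sub>R \<nu> \<in> ball x e'" "x + t *\<^sub>R \<nu> \<in> ball x e"
        using t nn by (auto simp: dist_norm)
      have "bary T p (x - t *\<^sub>R \<nu>) = t * norm ?g"
        using bary_add[of T p x "- (t *\<^sub>R \<nu>)"] bx g\<nu> by simp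
      then have b1: "bary T p (x - t *\<^sub>R \<nu>) > 0" using t g by simp
      have "bary T p (x + t *\<^sub>R \<nu>) = - (t * norm ?g)"
        using bary_add[of T p x "t *\<^sub>R \<nu>"] bx g\<nu> by simp
      then have "bary T p (x + t *\<^sub>R \<nu>) < 0" using t g by simp
      then have "x + t *\<^sub>R \<nu> \<notin> T" using p(1) by (force simp: T.mem_iff)
      moreover have "x - t *\<^sub>R \<nu> \<in> (\<Inter>r\<in>verts T - {p}. {y. 0 < bary T r y})" using e'(2) m(2) by blast
      then have "0 < bary T r (x - t *\<^sub>R \<nu>)" if "r \<in> verts T" for r
        using b1 that by (cases "r = p") auto
      then have "x - t *\<^sub>R \<nu> \<in> interior T" by (simp add: T.interior_iff)
      ultimately show "x - t *\<^sub>R \<nu> \<in> \<Omega>" "x + t *\<^sub>R \<nu> \<notin> closure \<Omega>"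
        using e(2)[OF m(3)] e(3)[OF m(1)] by auto
    qed
  qed
  have P: "?P \<nu>" using nn ev T.bgrad_orthogonal[OF p(1)] p(2) by (auto simp: \<nu>_def)
  \<comment> \<open>A unit vector orthogonal to the facet is \<open>\<nu>\<close> or \<open>- \<nu>\<close>; the latter points inwards.\<close>
  have uniq: "\<mu> = \<nu>" if \<mu>: "?P \<mu>" for \<mu>
  proof -
    obtain q where q: "q \<in> verts T" "q \<noteq> p" by (rule T.other_vertex)
    define c where "c = \<mu> \<bullet> (p - q)"
    have sub: "verts T - {p} \<subseteq> S" unfolding p(2) opp_def by (rule hull_subset)
    have "\<mu> = c *\<^sub>R ?g" unfolding c_def
      by (rule T.orthogonal_to_facet[OF p(1) q]) (use \<mu> sub in blast)
    then have \<mu>c: "\<mu> = (- c * norm ?g) *\<^sub>R \<nu>" using g by (simp add: \<nu>_def)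
    then have "\<bar>- c * norm ?g\<bar> = 1" using \<mu> nn by (metis mult.right_neutral norm_scaleR)
    then consider "- c * norm ?g = 1" | "- c * norm ?g = - 1" by linarith
    then show ?thesis
    proof cases
      case 1
      then show ?thesis using \<mu>c by simp
    next
      case 2
      then have m: "\<mu> = - \<nu>" using \<mu>c by simp
      let ?x = "barycenter S"
      have x: "?x \<in> rel_interior S" using T.barycenter_in_rel_interior p by simp
      obtain a where a: "a > 0" "\<And>t. 0 < t \<Longrightarrow> t < a \<Longrightarrow> ?x - t *\<^sub>R \<nu> \<in> \<Omega>" using ev[OF x] by blast
      obtain b where b: "b > 0" "\<And>t. 0 < t \<Longrightarrow> t < b \<Longrightarrow> ?x + t *\<^sub>R \<mu> \<notin> closure \<Omega>" using \<mu> x by blast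
      have "?x - (min a b / 2) *\<^sub>R \<nu> \<in> \<Omega>" using a b by (intro a(2)) auto
      moreover have "?x + (min a b / 2) *\<^sub>R \<mu> \<notin> closure \<Omega>" using a b by (intro b(2)) auto
      ultimately show ?thesis using m closure_subset[of \<Omega>] by auto
    qed
  qed
  have "(THE \<nu>. ?P \<nu>) = \<nu>" using P uniq by (rule the_equality)
  then show ?thesis by (simp add: outer_normal_def \<nu>_def)
qed

text \<open>
  Near the relative interior of a facet only the elements at this facet are seen; if their
  branches agree at \<open>x\<close>, the elementwise function has a limit there.
\<close>
lemma pw_limit:
  fixes F :: "(real^'n) set \<Rightarrow> real^'n \<Rightarrow> 'b::real_normed_vector"
  assumes S: "S \<in> mesh_facets \<T>" and x: "x \<in> rel_interior S"
    and cont: "\<And>T. T \<in> els S \<Longrightarrow> isCont (F T) x" and l: "\<And>T. T \<in> els S \<Longrightarrow> F T x = l"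
  shows "(pw \<T> F \<longlongrightarrow> l) (at x within mesh_int \<T>)" "skel_val \<T> (pw \<T> F) x = l"
proof -
  obtain T where T: "T \<in> els S" using S mesh_facets_iff by blast
  then have T1: "T \<in> \<T>" "S facet_of T" by (auto simp: els_def)
  interpret T: full_simplex T by (rule element_simplex[OF T1(1)])
  obtain r where r: "r > 0" "\<And>T'. T' \<in> \<T> \<Longrightarrow> T' \<inter> ball x r \<noteq> {} \<Longrightarrow> T' \<in> els S"
    using facet_neighbourhood[OF T x] by metis
  have fe: "finite (els S)" using fin by (simp add: els_def)
  show lim: "(pw \<T> F \<longlongrightarrow> l) (at x within mesh_int \<T>)"
  proof (rule tendstoI)
    fix e :: real assume e: "e > 0"
    have "\<forall>\<^sub>F y in at x within mesh_int \<T>. \<forall>T'\<in>els S. dist (F T' y) l < e"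
    proof (rule eventually_ball_finite[OF fe], rule)
      fix T' assume T': "T' \<in> els S"
      have "(F T' \<longlongrightarrow> F T' x) (at x within mesh_int \<T>)" using continuous_at_imp_continuous_at_within[OF cont[OF T']] by (simp add: continuous_within)
      then show "\<forall>\<^sub>F y in at x within mesh_int \<T>. dist (F T' y) l < e" using l[OF T'] tendstoD[OF _ e] by fastforce
    qed
    moreover have "\<forall>\<^sub>F y in at x within mesh_int \<T>. y \<in> ball x r \<and> y \<in> mesh_int \<T>"
      using r(1) by (auto simp: eventually_at dist_commute intro!: exI[of _ r])
    ultimately show "\<forall>\<^sub>F y in at x within mesh_int \<T>. dist (pw \<T> F y) l < e"
    proof eventually_elim
      case (elim y)
      then obtain T' where T': "T' \<in> \<T>" "y \<in> interior T'" by (auto simp: mesh_int_def)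
      then have "T' \<in> els S" using elim r(2)[of T'] interior_subset by blast
      then have "dist (F T' y) l < e" using elim by blast
      then show ?case unfolding pw_in[OF T'] .
    qed
  qed
  have "x \<in> closure (interior T)" using T.closure_interior T.facet_mem[OF T1(2) x] by simp
  moreover have "x \<notin> interior T"
  proof -
    obtain p where p: "p \<in> verts T" "S = opp T p" using T unfolding els_opp by blast
    then have "bary T p x = 0" using x T.rel_interior_opp_iff by blast
    then show ?thesis using p T.interior_iff by force
  qed
  ultimately have "x islimpt interior T" by (simp add: closure_def)
  then have "x islimpt mesh_int \<T>" by (rule islimpt_subset) (use T1(1) in \<open>auto simp: mesh_int_def\<close>)
  then have "\<not> trivial_limit (at x within mesh_int \<T>)" by (simp add: trivial_limit_within)
  then show "skel_val \<T> (pw \<T> F) x = l" unfolding skel_val_def using lim by (rule tendsto_Lim)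
qed

lemma pw_limit_unique:
  fixes F :: "(real^'n) set \<Rightarrow> real^'n \<Rightarrow> 'b::real_normed_vector"
  assumes T: "T \<in> els S" and x: "x \<in> rel_interior S" and cont: "isCont (F T) x"
    and lim: "(pw \<T> F \<longlongrightarrow> l) (at x within mesh_int \<T>)"
  shows "F T x = l"
proof -
  have T1: "T \<in> \<T>" "S facet_of T" using T by (auto simp: els_def)
  interpret T: full_simplex T by (rule element_simplex[OF T1(1)])
  have "x \<in> closure (interior T)" using T.closure_interior T.facet_mem[OF T1(2) x] by simp
  moreover have "x \<notin> interior T"
  proof -
    obtain p where p: "p \<in> verts T" "S = opp T p" using T unfolding els_opp by blast
    then have "bary T p x = 0" using x T.rel_interior_opp_iff by blast
    then show ?thesis using p T.interior_iff by force
  qed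
  ultimately have "x islimpt interior T" by (simp add: closure_def)
  then have nt: "\<not> trivial_limit (at x within interior T)" by (simp add: trivial_limit_within)
  have "(pw \<T> F \<longlongrightarrow> l) (at x within interior T)"
    by (rule tendsto_within_subset[OF lim]) (use T1(1) in \<open>auto simp: mesh_int_def\<close>)
  moreover have "(F T \<longlongrightarrow> F T x) (at x within interior T)" using continuous_at_imp_continuous_at_within[OF cont] by (simp add: continuous_within)
  then have "(pw \<T> F \<longlongrightarrow> F T x) (at x within interior T)"
    by (rule Lim_transform_eventually) (auto simp: eventually_at pw_in[OF T1(1)] intro!: exI[of _ 1])
  ultimately show ?thesis using tendsto_unique[OF nt] by blast
qed

definition "adj = {(A, B). A \<in> \<T> \<and> B \<in> \<T> \<and> (\<exists>S. S facet_of A \<and> S facet_of B)}"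

text \<open>
  Otherwise the elements reachable from \<open>T0\<close> and the others cover \<open>\<Omega>\<close> by two closed sets, which
  meet in the connected set \<open>\<Omega>\<close>. Near a common point choose \<open>x\<close> and \<open>y\<close> inside elements of
  either class. Elements of different classes share no facet, so that they meet in faces of
  dimension at most \<open>d - 2\<close>; the cones from \<open>x\<close> over these are null sets. For \<open>y\<close> outside of
  them the segment from \<open>x\<close> to \<open>y\<close> never passes from one class to the other, although it is
  connected.
\<close>
lemma elements_connected:
  assumes T0: "T0 \<in> \<T>" and T: "T \<in> \<T>"
  shows "(T0, T) \<in> adj\<^sup>*"
proof (rule ccontr)
  assume nT: "(T0, T) \<notin> adj\<^sup>*"
  define C where "C = {A \<in> \<T>. (T0, A) \<in> adj\<^sup>*}"
  define U1 U2 where "U1 = \<Union>C" and "U2 = \<Union>(\<T> - C)"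
  have cl: "closed U1" "closed U2" unfolding U1_def U2_def C_def
    using fin full_simplex.closed[OF element_simplex] by (intro closed_Union; auto)+
  have noadj: "(A, A') \<notin> adj" if "A \<in> C" "A' \<in> \<T> - C" for A A'
    using that by (auto simp: C_def intro: rtrancl_into_rtrancl)
  have "\<Omega> \<subseteq> U1 \<union> U2"
  proof
    fix x assume "x \<in> \<Omega>"
    then obtain T' where "T' \<in> \<T>" "x \<in> T'" using cover closure_subset[of \<Omega>] by blast
    then show "x \<in> U1 \<union> U2" by (cases "T' \<in> C") (auto simp: U1_def U2_def)
  qed
  moreover have "U1 \<inter> \<Omega> \<noteq> {}"
  proof -
    have "T0 \<in> C" using T0 by (simp add: C_def)
    then show ?thesis using full_simplex.interior_nonempty[OF element_simplex[OF T0]] interior_subset_Omega[OF T0] interior_subset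
      unfolding U1_def by blast
  qed
  moreover have "U2 \<inter> \<Omega> \<noteq> {}"
  proof -
    have "T \<in> \<T> - C" using T nT by (simp add: C_def)
    then show ?thesis using full_simplex.interior_nonempty[OF element_simplex[OF T]] interior_subset_Omega[OF T] interior_subset
      unfolding U2_def by blast
  qed
  ultimately obtain z where z: "z \<in> U1" "z \<in> U2" "z \<in> \<Omega>"
    using con cl unfolding connected_closed by blast
  obtain A B where A: "A \<in> C" "z \<in> A" and B: "B \<in> \<T> - C" "z \<in> B" using z by (auto simp: U1_def U2_def)
  have AT: "A \<in> \<T>" "B \<in> \<T>" using A B by (auto simp: C_def)
  obtain e where e: "e > 0" "ball z e \<subseteq> \<Omega>" using opn z(3) by (rule openE)
  have "interior A \<inter> ball z e \<noteq> {}"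
    using A(2) full_simplex.closure_interior[OF element_simplex[OF AT(1)]] e(1) open_Int_closure_eq_empty[of "ball z e" "interior A"]
    by (metis Int_commute IntI centre_in_ball empty_iff open_ball)
  then obtain x where x: "x \<in> interior A" "x \<in> ball z e" by blast
  have Bne: "interior B \<inter> ball z e \<noteq> {}"
    using B(2) full_simplex.closure_interior[OF element_simplex[OF AT(2)]] e(1) open_Int_closure_eq_empty[of "ball z e" "interior B"]
    by (metis Int_commute IntI centre_in_ball empty_iff open_ball)
  have low: "aff_dim (insert x (P \<inter> Q)) < int DIM(real^'n)" if P: "P \<in> C" and Q: "Q \<in> \<T> - C" for P Q
  proof -
    have PQ: "P \<in> \<T>" "Q \<in> \<T>" using P Q by (auto simp: C_def)
    have f: "P \<inter> Q face_of P" "P \<inter> Q face_of Q" using face[OF PQ] face[OF PQ(2,1)] by (simp_all add: Int_commute)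
    have dP: "aff_dim P = int DIM(real^'n)" "aff_dim Q = int DIM(real^'n)"
      using full_simplex.aff_dim_T[OF element_simplex] PQ by auto
    have "aff_dim (P \<inter> Q) \<le> int DIM(real^'n) - 2"
    proof (cases "P \<inter> Q = {}")
      case True
      then show ?thesis using DIM2 by simp
    next
      case False
      have "P \<inter> Q \<noteq> P"
      proof
        assume "P \<inter> Q = P"
        then have "interior P \<subseteq> Q" using interior_subset by blast
        then have "P = Q" using full_simplex.interior_nonempty[OF element_simplex[OF PQ(1)]] interior_disjoint[OF PQ] by blast
        then show False using P Q by blast
      qed
      then have "aff_dim (P \<inter> Q) < aff_dim P"
        using f(1) full_simplex.convex[OF element_simplex[OF PQ(1)]] by (intro face_of_aff_dim_lt) auto
      moreover have "aff_dim (P \<inter> Q) \<noteq> int DIM(real^'n) - 1"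
      proof
        assume "aff_dim (P \<inter> Q) = int DIM(real^'n) - 1"
        then have "(P \<inter> Q) facet_of P" "(P \<inter> Q) facet_of Q" using f False dP by (auto simp: facet_of_def)
        then show False using noadj[OF P Q] PQ unfolding adj_def by blast
      qed
      ultimately show ?thesis using dP by linarith
    qed
    then show ?thesis using aff_dim_insert[of x "P \<inter> Q"] by (auto split: if_splits)
  qed
  \<comment> \<open>The affine hulls of \<open>x\<close> and the pairwise intersections have dimension less than \<open>d\<close>.\<close>
  define bad where "bad = (\<Union>(P, Q)\<in>C \<times> (\<T> - C). affine hull (insert x (P \<inter> Q)))"
  have "negligible bad" unfolding bad_def
  proof (rule negligible_Union)
    show "finite ((\<lambda>(P, Q). affine hull (insert x (P \<inter> Q))) ` (C \<times> (\<T> - C)))" using fin by (auto simp: C_def)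
    fix H assume "H \<in> (\<lambda>(P, Q). affine hull (insert x (P \<inter> Q))) ` (C \<times> (\<T> - C))"
    then obtain P Q where PQ: "P \<in> C" "Q \<in> \<T> - C" "H = affine hull (insert x (P \<inter> Q))" by auto
    have "aff_dim H < int DIM(real^'n)" using low[OF PQ(1,2)] PQ(3) by (simp add: aff_dim_affine_hull)
    then have "interior H = {}" using aff_dim_nonempty_interior[of H] by force
    moreover have "convex H" using PQ(3) by (simp add: affine_imp_convex)
    ultimately show "negligible H" using negligible_convex_interior by blast
  qed
  moreover have "\<not> negligible (interior B \<inter> ball z e)" using open_not_negligible[OF _ Bne] by (simp add: open_Int)
  ultimately have "\<not> interior B \<inter> ball z e \<subseteq> bad" by (metis negligible_subset)
  then obtain y where y: "y \<in> interior B" "y \<in> ball z e" "y \<notin> bad" by blast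
  let ?L = "closed_segment x y"
  have "?L \<subseteq> ball z e" using x y by (simp add: closed_segment_subset)
  then have L: "?L \<subseteq> U1 \<union> U2" using e \<open>\<Omega> \<subseteq> U1 \<union> U2\<close> by blast
  moreover have "U1 \<inter> ?L \<noteq> {}" using x(1) A(1) interior_subset by (auto simp: U1_def)
  moreover have "U2 \<inter> ?L \<noteq> {}" using y(1) B(1) interior_subset by (auto simp: U2_def)
  ultimately obtain w where w: "w \<in> U1" "w \<in> U2" "w \<in> ?L"
    using connected_segment[of x y] cl unfolding connected_closed by blast
  obtain P Q where PQ: "P \<in> C" "Q \<in> \<T> - C" "w \<in> P" "w \<in> Q" using w by (auto simp: U1_def U2_def)
  have "w \<noteq> x"
  proof
    assume "w = x"
    then have "A = Q" using interior_disjoint[OF AT(1), of Q x] x PQ by auto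
    then show False using A PQ by blast
  qed
  moreover obtain u where u: "w = (1 - u) *\<^sub>R x + u *\<^sub>R y" using w(3) by (auto simp: in_segment)
  ultimately have "u \<noteq> 0" by auto
  \<comment> \<open>The line through \<open>x\<close> and the crossing point \<open>w\<close> contains \<open>y\<close>.\<close>
  have "y = (1 - 1 / u) *\<^sub>R x + (1 / u) *\<^sub>R w" using \<open>u \<noteq> 0\<close> unfolding u by (simp add: algebra_simps)
  then have "y \<in> affine hull {x, w}" unfolding affine_hull_2 by (intro CollectI exI[of _ "1 - 1/u"] exI[of _ "1/u"] conjI) auto
  moreover have "affine hull {x, w} \<subseteq> affine hull (insert x (P \<inter> Q))" using PQ by (intro hull_mono) auto
  ultimately have "y \<in> affine hull (insert x (P \<inter> Q))" by blast
  then have "y \<in> bad" unfolding bad_def using PQ(1,2) by (intro UN_I[of "(P, Q)"]) auto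
  then show False using y(3) by simp
qed

end

section \<open>Elementwise constants and means\<close>

text \<open>
  \<open>1 - d \<lambda>\<^sub>p\<close> is one at the barycenter of the facet opposite to \<open>p\<close> and zero at the barycenters
  of the other facets: it is the local Crouzeix--Raviart basis function.
\<close>
lemma (in full_simplex) affine_facet_interpolation:
  "a + b \<bullet> x = (\<Sum>p\<in>V. (a + b \<bullet> barycenter (opp T p)) * (1 - real DIM('a) * bary T p x))"
proof -
  let ?d = "real DIM('a)"
  define h where "h y = a + b \<bullet> y" for y
  define H where "H = (\<Sum>q\<in>V. h q)"
  have hx: "h y = (\<Sum>q\<in>V. bary T q y * h q)" for y
  proof -
    have "(\<Sum>q\<in>V. bary T q y * h q) = (\<Sum>q\<in>V. bary T q y) * a + b \<bullet> (\<Sum>q\<in>V. bary T q y *\<^sub>R q)"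
      by (simp add: h_def distrib_left sum.distrib sum_distrib_right inner_sum_right)
    then show ?thesis using sum_bary[of y] sum_bary_scaleR[of y] by (simp add: h_def)
  qed
  have hb: "h (barycenter (opp T p)) = (H - h p) / ?d" if p: "p \<in> V" for p
  proof -
    have "h (barycenter (opp T p)) = (\<Sum>q\<in>V - {p}. h q / ?d)"
      by (subst hx) (use p V(1) in \<open>simp add: sum.remove[OF V(1) p] bary_barycenter_opp\<close>)
    then show ?thesis using sum.remove[OF V(1) p, of h] by (simp add: H_def sum_divide_distrib[symmetric])
  qed
  have "(\<Sum>p\<in>V. h (barycenter (opp T p)) * (1 - ?d * bary T p x))
      = (\<Sum>p\<in>V. H / ?d - h p / ?d - H * bary T p x + bary T p x * h p)"
    by (intro sum.cong refl) (simp add: hb field_simps)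
  also have "\<dots> = (real (card V) * H / ?d - H / ?d - H * (\<Sum>p\<in>V. bary T p x)) + h x"
    by (subst (2) hx) (simp add: sum.distrib sum_subtractf sum_divide_distrib[symmetric] sum_distrib_left H_def[symmetric])
  also have "\<dots> = h x" using V(2) by (simp add: sum_bary field_simps)
  finally show ?thesis by (simp add: h_def)
qed

definition apex :: "'a::euclidean_space set \<Rightarrow> 'a set \<Rightarrow> 'a" where
  "apex T S = (THE p. p \<in> verts T \<and> opp T p = S)"

lemma (in full_simplex) apex_opp: "p \<in> V \<Longrightarrow> apex T (opp T p) = p"
  unfolding apex_def using opp_inject by (intro the_equality) auto

lemma grad_eqI: "(\<phi> has_derivative (\<lambda>h. D \<bullet> h)) (at x) \<Longrightarrow> grad \<phi> x = D"
proof -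
  assume "(\<phi> has_derivative (\<lambda>h. D \<bullet> h)) (at x)"
  then have "frechet_derivative \<phi> (at x) = (\<lambda>h. D \<bullet> h)" by (rule frechet_derivative_at[symmetric])
  then show ?thesis by (simp add: grad_def vec_eq_iff inner_axis)
qed

lemma C1_imp_C1_pair: assumes "\<phi> \<in> C1" shows "C1_pair \<phi> (grad \<phi>)"
proof -
  have "(\<phi> has_derivative (\<lambda>h. grad \<phi> x \<bullet> h)) (at x)" for x
  proof -
    have "\<phi> differentiable (at x)" using assms by (simp add: C1_def)
    then have d: "(\<phi> has_derivative frechet_derivative \<phi> (at x)) (at x)" by (simp add: frechet_derivative_works)
    then have lin: "linear (frechet_derivative \<phi> (at x))" by (rule has_derivative_linear)
    have "frechet_derivative \<phi> (at x) h = grad \<phi> x \<bullet> h" for h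
    proof -
      have "frechet_derivative \<phi> (at x) h = frechet_derivative \<phi> (at x) (\<Sum>i\<in>UNIV. h $ i *\<^sub>R axis i 1)"
        using basis_expansion[of h] by (simp add: scalar_mult_eq_scaleR)
      also have "\<dots> = (\<Sum>i\<in>UNIV. h $ i * frechet_derivative \<phi> (at x) (axis i 1))"
        using lin by (simp add: linear_sum linear_scale)
      finally show ?thesis by (simp add: grad_def inner_vec_def mult.commute)
    qed
    then have "frechet_derivative \<phi> (at x) = (\<lambda>h. grad \<phi> x \<bullet> h)" by auto
    with d show ?thesis by simp
  qed
  then show ?thesis using assms by (simp add: C1_pair_def C1_def)
qed

lemma C1_pair_imp_C1: assumes "C1_pair \<phi> D" shows "\<phi> \<in> C1" "grad \<phi> = D"
proof -
  show g: "grad \<phi> = D"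
    by (rule ext, rule grad_eqI) (use assms in \<open>simp add: C1_pair_def\<close>)
  show "\<phi> \<in> C1" using assms by (auto simp: C1_def g C1_pair_def differentiable_def)
qed

lemma bump_test_function:
  fixes x0 :: "real^'n"
  assumes "cball x0 r \<subseteq> \<Omega>" "r > 0"
  shows "bump x0 r \<in> test_functions \<Omega>"
proof -
  have "{x. bump x0 r x \<noteq> 0} \<subseteq> cball x0 r"
  proof
    fix x assume "x \<in> {x. bump x0 r x \<noteq> 0}"
    then show "x \<in> cball x0 r" using bump_zero[of r x x0] assms(2) by (force simp: dist_norm norm_minus_commute)
  qed
  then have s: "closure {x. bump x0 r x \<noteq> 0} \<subseteq> cball x0 r" by (rule closure_minimal) simp
  then have "compact (closure {x. bump x0 r x \<noteq> 0})"
    using bounded_subset[OF bounded_cball s] by (simp add: compact_eq_bounded_closed)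
  moreover have "bump x0 r \<in> C1" using C1_pair_bump[of x0 r] C1_pair_imp_C1 by blast
  ultimately show ?thesis using s assms by (auto simp: test_functions_def)
qed

context mesh
begin

abbreviation "\<F> \<equiv> mesh_facets \<T>"
abbreviation "vol T \<equiv> measure lborel T"

lemma facet_sum:
  fixes h :: "real^'n \<Rightarrow> 'b::comm_monoid_add"
  assumes T: "T \<in> \<T>"
  shows "(\<Sum>p\<in>verts T. h p) = (\<Sum>S\<in>\<F>. if T \<in> els S then h (apex T S) else 0)"
proof -
  interpret full_simplex T by (rule element_simplex[OF T])
  have e: "T \<in> els S \<longleftrightarrow> S \<in> opp T ` V" for S using els_opp[of T S] T by auto
  have "S \<in> \<F>" if "T \<in> els S" for S using mesh_facets_iff[of S] that by auto
  then have im: "{S\<in>\<F>. T \<in> els S} = opp T ` V" using e by auto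
  have "(\<Sum>S\<in>\<F>. if T \<in> els S then h (apex T S) else 0) = (\<Sum>S\<in>{S\<in>\<F>. T \<in> els S}. h (apex T S))"
    by (rule sum.inter_filter[OF finite_mesh_facets, symmetric])
  also have "\<dots> = (\<Sum>p\<in>V. h p)" unfolding im
    by (subst sum.reindex) (auto simp: inj_on_def opp_inject apex_opp)
  finally show ?thesis ..
qed

lemma facet_double_sum:
  fixes h :: "(real^'n) set \<Rightarrow> real^'n \<Rightarrow> real"
  shows "(\<Sum>T\<in>\<T>. \<Sum>p\<in>verts T. h T p) = (\<Sum>S\<in>\<F>. \<Sum>T\<in>els S. h T (apex T S))"
proof -
  have "(\<Sum>T\<in>\<T>. \<Sum>p\<in>verts T. h T p) = (\<Sum>T\<in>\<T>. \<Sum>S\<in>\<F>. if T \<in> els S then h T (apex T S) else 0)"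
    by (intro sum.cong refl facet_sum)
  also have "\<dots> = (\<Sum>S\<in>\<F>. \<Sum>T\<in>\<T>. if T \<in> els S then h T (apex T S) else 0)" by (rule sum.swap)
  also have "\<dots> = (\<Sum>S\<in>\<F>. \<Sum>T\<in>els S. h T (apex T S))"
  proof (rule sum.cong[OF refl])
    fix S
    have "{T\<in>\<T>. T \<in> els S} = els S" by (auto simp: els_def)
    then show "(\<Sum>T\<in>\<T>. if T \<in> els S then h T (apex T S) else 0) = (\<Sum>T\<in>els S. h T (apex T S))"
      using sum.inter_filter[OF fin, of "\<lambda>T. h T (apex T S)" "\<lambda>T. T \<in> els S"] by simp
  qed
  finally show ?thesis .
qed

lemma apex_props: assumes "T \<in> els S" shows "T \<in> \<T>" "apex T S \<in> verts T" "opp T (apex T S) = S"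
proof -
  obtain p where p: "T \<in> \<T>" "p \<in> verts T" "S = opp T p" using assms els_opp by blast
  then show "T \<in> \<T>" "apex T S \<in> verts T" "opp T (apex T S) = S"
    using full_simplex.apex_opp[OF element_simplex[OF p(1)] p(2)] by auto
qed

lemma barycenter_rel_interior: assumes "S \<in> \<F>" shows "barycenter S \<in> rel_interior S"
proof -
  obtain T where T: "T \<in> els S" using assms mesh_facets_iff by blast
  show ?thesis
    using full_simplex.barycenter_in_rel_interior[OF element_simplex[OF apex_props(1)[OF T]] apex_props(2)[OF T]] apex_props(3)[OF T] by simp
qed

lemma elem_mean_pw: "elem_mean \<T> g = pw \<T> (\<lambda>T _. (LINT y|lebesgue_on (interior T). g y) /\<^sub>R measure lebesgue (interior T))"
  by (rule ext) (simp add: elem_mean_def pw_def)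

lemma elem_mean_affine:
  fixes a b :: "(real^'n) set \<Rightarrow> _"
  assumes q: "\<And>T x. T \<in> \<T> \<Longrightarrow> x \<in> interior T \<Longrightarrow> q x = a T + b T \<bullet> x"
  shows "elem_mean \<T> q = pw \<T> (\<lambda>T _. a T + b T \<bullet> barycenter T)"
  unfolding elem_mean_pw
proof (rule pw_cong)
  fix T x assume T: "T \<in> \<T>"
  interpret full_simplex T by (rule element_simplex[OF T])
  have "(LINT y|lebesgue_on (interior T). q y) = (LINT y:T|lborel. a T + b T \<bullet> y)"
    by (rule interior_mean_integral[OF T]) (auto intro!: set_integrable_continuous continuous_intros q[OF T])
  then show "(LINT y|lebesgue_on (interior T). q y) /\<^sub>R measure lebesgue (interior T) = a T + b T \<bullet> barycenter T"
    using measure_pos integral_affine by (simp add: measure_interior[OF T])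
qed

lemma elem_mean_affine_vector:
  fixes a :: "(real^'n) set \<Rightarrow> real^'n" and b :: "(real^'n) set \<Rightarrow> real"
  assumes q: "\<And>T x. T \<in> \<T> \<Longrightarrow> x \<in> interior T \<Longrightarrow> q x = a T + b T *\<^sub>R x"
  shows "elem_mean \<T> q = pw \<T> (\<lambda>T _. a T + b T *\<^sub>R barycenter T)"
  unfolding elem_mean_pw
proof (rule pw_cong)
  fix T x assume T: "T \<in> \<T>"
  interpret full_simplex T by (rule element_simplex[OF T])
  let ?I = "LINT y:T|lborel. a T + b T *\<^sub>R y"
  have int: "set_integrable lborel T (\<lambda>y. a T + b T *\<^sub>R y)" by (intro set_integrable_continuous continuous_intros)
  have I: "(LINT y|lebesgue_on (interior T). q y) = ?I"
    by (rule interior_mean_integral[OF T int q[OF T]])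
  have "?I \<bullet> h = (vol T *\<^sub>R (a T + b T *\<^sub>R barycenter T)) \<bullet> h" for h
  proof -
    have "?I \<bullet> h = (LINT y|lborel. (indicat_real T y *\<^sub>R (a T + b T *\<^sub>R y)) \<bullet> h)"
      unfolding set_lebesgue_integral_def using int by (intro integral_inner_left[symmetric]) (simp add: set_integrable_def)
    also have "\<dots> = (LINT y:T|lborel. (a T \<bullet> h) + (b T *\<^sub>R h) \<bullet> y)"
      unfolding set_lebesgue_integral_def by (intro Bochner_Integration.integral_cong refl) (simp add: inner_simps inner_commute)
    also have "\<dots> = vol T * ((a T \<bullet> h) + (b T *\<^sub>R h) \<bullet> barycenter T)" by (rule integral_affine)
    finally show ?thesis by (simp add: inner_simps inner_commute)
  qed
  then have "?I = vol T *\<^sub>R (a T + b T *\<^sub>R barycenter T)" by (metis vector_eq_rdot)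
  then show "(LINT y|lebesgue_on (interior T). q y) /\<^sub>R measure lebesgue (interior T) = a T + b T *\<^sub>R barycenter T"
    unfolding I using measure_pos by (simp add: measure_interior[OF T])
qed

lemma P0_iff: "z \<in> P0 \<T> \<longleftrightarrow> (\<exists>\<zeta>. z = pw \<T> (\<lambda>T _. \<zeta> T))"
proof
  assume "z \<in> P0 \<T>"
  then obtain \<zeta> where "\<forall>T\<in>\<T>. \<forall>x\<in>interior T. z x = \<zeta> T" and "\<forall>x. x \<notin> mesh_int \<T> \<longrightarrow> z x = 0"
    unfolding P0_def by (auto simp: bchoice_iff)
  then show "\<exists>\<zeta>. z = pw \<T> (\<lambda>T _. \<zeta> T)" by (intro exI[of _ \<zeta>] pw_eqI) auto
qed (auto simp: P0_def pw_in pw_out)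

lemma P0_integral:
  fixes h :: "real^'n \<Rightarrow> real"
  assumes eq: "\<And>T x. T \<in> \<T> \<Longrightarrow> x \<in> interior T \<Longrightarrow> h x = k T" and zero: "\<And>x. x \<notin> mesh_int \<T> \<Longrightarrow> h x = 0"
  shows "(LINT x|lebesgue_on \<Omega>. h x) = (\<Sum>T\<in>\<T>. vol T * k T)"
proof -
  have "(LINT x|lebesgue_on \<Omega>. h x) = (\<Sum>T\<in>\<T>. LINT x:T|lborel. k T)"
  proof (rule pw_integral(1))
    show "set_integrable lborel T (\<lambda>x. k T)" if "T \<in> \<T>" for T
      by (rule full_simplex.set_integrable_continuous[OF element_simplex[OF that]]) (rule continuous_on_const)
  qed (rule eq zero; assumption)+
  also have "\<dots> = (\<Sum>T\<in>\<T>. vol T * k T)"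
  proof (intro sum.cong refl)
    fix T assume T: "T \<in> \<T>"
    interpret full_simplex T by (rule element_simplex[OF T])
    show "(LINT x:T|lborel. k T) = vol T * k T" using integral_affine[of "k T" 0] by simp
  qed
  finally show ?thesis .
qed

lemma ip_pw: "ip \<Omega> (pw \<T> (\<lambda>T _. \<zeta> T)) (pw \<T> (\<lambda>T _. w T)) = (\<Sum>T\<in>\<T>. vol T * (\<zeta> T \<bullet> w T))"
  unfolding ip_def by (rule P0_integral) (simp_all add: pw_in pw_out)

section \<open>Crouzeix--Raviart functions as facet coefficients\<close>

text \<open>
  \<open>crf c\<close> is the Crouzeix--Raviart function with value \<open>c S\<close> at the barycenter of \<open>S\<close>;
  \<open>cr_local c T\<close> is its branch on \<open>T\<close>, \<open>shape_grad T S\<close> the gradient on \<open>T\<close> of the basis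
  function of \<open>S\<close>, and \<open>cr_grad T c\<close> the gradient of the branch.
\<close>
definition "cr_local c T x = (\<Sum>p\<in>verts T. c (opp T p) * (1 - real CARD('n) * bary T p x))" for c :: "(real^'n) set \<Rightarrow> real"
definition "crf c = pw \<T> (cr_local c)"
definition "shape_grad T S = (if T \<in> els S then (- real CARD('n)) *\<^sub>R bgrad T (apex T S) else 0)"
definition "cr_grad T c = (\<Sum>S\<in>\<F>. c S *\<^sub>R shape_grad T S)" for c :: "(real^'n) set \<Rightarrow> real"
definition "facet_value q S = skel_val \<T> q (barycenter S)" for q :: "real^'n \<Rightarrow> real"

lemma cr_grad_eq: assumes T: "T \<in> \<T>" shows "cr_grad T c = (\<Sum>p\<in>verts T. (c (opp T p) * (- real CARD('n))) *\<^sub>R bgrad T p)"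
proof -
  have "cr_grad T c = (\<Sum>S\<in>\<F>. if T \<in> els S then (\<lambda>p. (c (opp T p) * (- real CARD('n))) *\<^sub>R bgrad T p) (apex T S) else 0)"
    unfolding cr_grad_def shape_grad_def by (intro sum.cong refl) (auto simp: apex_props)
  then show ?thesis using facet_sum[OF T, of "\<lambda>p. (c (opp T p) * (- real CARD('n))) *\<^sub>R bgrad T p"] by simp
qed

lemma cr_local_affine: assumes T: "T \<in> \<T>" shows "cr_local c T x = cr_local c T 0 + cr_grad T c \<bullet> x"
  unfolding cr_local_def cr_grad_eq[OF T] inner_sum_left sum.distrib[symmetric]
  by (intro sum.cong refl) (subst bary_from_0, simp add: algebra_simps)

lemma cr_local_cont: "T \<in> \<T> \<Longrightarrow> isCont (cr_local c T) x"
  unfolding cr_local_def by (intro continuous_intros) (simp add: bary_def)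

lemma cr_local_barycenter: assumes T: "T \<in> els S" shows "cr_local c T (barycenter S) = c S"
proof -
  note a = apex_props[OF T]
  interpret full_simplex T by (rule element_simplex[OF a(1)])
  have "cr_local c T (barycenter (opp T (apex T S))) = (\<Sum>p\<in>V. if p = apex T S then c (opp T p) else 0)"
    unfolding cr_local_def by (intro sum.cong refl) (simp add: bary_barycenter_opp[OF a(2)])
  then show ?thesis using a V(1) by simp
qed

lemma cr_local_mean: assumes T: "T \<in> \<T>" shows "cr_local c T (barycenter T) = (\<Sum>p\<in>verts T. c (opp T p)) / (real CARD('n) + 1)"
proof -
  interpret full_simplex T by (rule element_simplex[OF T])
  have "cr_local c T (barycenter T) = (\<Sum>p\<in>V. c (opp T p) * (1 / (real CARD('n) + 1)))"
    unfolding cr_local_def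
  proof (intro sum.cong refl)
    fix p assume "p \<in> V"
    have "real CARD('n) + 1 \<noteq> 0" by linarith
    then show "c (opp T p) * (1 - real CARD('n) * bary T p (barycenter T)) = c (opp T p) * (1 / (real CARD('n) + 1))"
      using bary_barycenter[OF \<open>p \<in> V\<close>] by (simp add: field_simps)
  qed
  then show ?thesis by (simp add: sum_divide_distrib[symmetric])
qed

lemma crf_in: "T \<in> \<T> \<Longrightarrow> x \<in> interior T \<Longrightarrow> crf c x = cr_local c T x" and crf_out: "x \<notin> mesh_int \<T> \<Longrightarrow> crf c x = 0"
  by (simp_all add: crf_def pw_in pw_out)

lemma crf_facet_value: "S \<in> \<F> \<Longrightarrow> facet_value (crf c) S = c S"
  unfolding facet_value_def crf_def
  by (rule pw_limit(2)) (auto simp: cr_local_barycenter barycenter_rel_interior apex_props intro: cr_local_cont)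

lemma crf_CR: "crf c \<in> CR \<Omega> \<T>"
proof -
  have "\<exists>l. (crf c \<longlongrightarrow> l) (at (barycenter S) within mesh_int \<T>)" if "S \<in> \<F>" for S
    unfolding crf_def using that
    by (intro exI[of _ "c S"] pw_limit(1)[of S]) (auto simp: cr_local_barycenter barycenter_rel_interior apex_props intro: cr_local_cont)
  moreover have "\<exists>a b. \<forall>x\<in>interior T. crf c x = a + b \<bullet> x" if "T \<in> \<T>" for T
    using crf_in[OF that] cr_local_affine[OF that] by metis
  ultimately show ?thesis by (auto simp: CR_def crf_out)
qed

lemma crf_cong: "(\<And>S. S \<in> \<F> \<Longrightarrow> c S = c' S) \<Longrightarrow> crf c = crf c'"
proof -
  assume c: "\<And>S. S \<in> \<F> \<Longrightarrow> c S = c' S"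
  have "opp T p \<in> \<F>" if "T \<in> \<T>" "p \<in> verts T" for T p using that mesh_facets_eq by blast
  then show ?thesis unfolding crf_def by (intro pw_cong) (auto simp: cr_local_def c intro!: sum.cong)
qed

text \<open>
  At an interior barycenter the branches from both sides agree, since the one-sided limits exist
  and equal the common limit; at a boundary facet there is one branch only. Affine functions are
  determined by their values at the facet barycenters.
\<close>
lemma CR_repr: assumes q: "q \<in> CR \<Omega> \<T>" shows "q = crf (facet_value q)"
proof -
  obtain a b where ab: "\<And>T x. T \<in> \<T> \<Longrightarrow> x \<in> interior T \<Longrightarrow> q x = a T + b T \<bullet> x"
    using q unfolding CR_def by (auto simp: bchoice_iff)
  have qpw: "q = pw \<T> (\<lambda>T x. a T + b T \<bullet> x)" using q ab by (intro pw_eqI) (auto simp: CR_def)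
  have cont: "isCont (\<lambda>x. a T + b T \<bullet> x) x" for T x by (intro continuous_intros)
  have val: "a T + b T \<bullet> barycenter S = facet_value q S" if T: "T \<in> els S" for T S
  proof -
    have S: "S \<in> \<F>" using T mesh_facets_iff by blast
    note x = barycenter_rel_interior[OF S]
    have "\<exists>l. \<forall>T'\<in>els S. a T' + b T' \<bullet> barycenter S = l"
    proof (cases "S \<in> bdry_facets \<Omega> \<T>")
      case True
      then show ?thesis using bdry_facet_element by (metis singletonD)
    next
      case False
      then obtain l where l: "(q \<longlongrightarrow> l) (at (barycenter S) within mesh_int \<T>)"
        using q S unfolding CR_def by blast
      then show ?thesis
        using pw_limit_unique[where F="\<lambda>T x. a T + b T \<bullet> x", OF _ x cont l[unfolded qpw]] by blast
    qed
    then obtain l where l: "\<And>T'. T' \<in> els S \<Longrightarrow> a T' + b T' \<bullet> barycenter S = l" by blast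
    have "facet_value q S = l" unfolding facet_value_def qpw by (rule pw_limit(2)[OF S x cont l])
    then show ?thesis using l[OF T] by simp
  qed
  show ?thesis unfolding crf_def
  proof (rule pw_eqI)
    fix T x assume T: "T \<in> \<T>" and x: "x \<in> interior T"
    interpret full_simplex T by (rule element_simplex[OF T])
    have "opp T p \<in> \<F> \<and> T \<in> els (opp T p)" if "p \<in> V" for p using that T els_opp mesh_facets_eq by blast
    then show "q x = cr_local (facet_value q) T x"
      unfolding ab[OF T x] cr_local_def by (subst affine_facet_interpolation) (auto simp: val intro!: sum.cong)
  qed (use q in \<open>simp add: CR_def\<close>)
qed

lemma cr_basis_eq: assumes S: "S \<in> \<F>" shows "cr_basis \<Omega> \<T> S = crf (\<lambda>S'. if S' = S then 1 else 0)"
  unfolding cr_basis_def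
proof (rule the_equality)
  show "crf (\<lambda>S'. if S' = S then 1 else 0) \<in> CR \<Omega> \<T> \<and>
     (\<forall>S'\<in>\<F>. skel_val \<T> (crf (\<lambda>S'. if S' = S then 1 else 0)) (barycenter S') = (if S' = S then 1 else 0))"
    using crf_CR crf_facet_value[unfolded facet_value_def] by simp
  fix \<phi> assume \<phi>: "\<phi> \<in> CR \<Omega> \<T> \<and> (\<forall>S'\<in>\<F>. skel_val \<T> \<phi> (barycenter S') = (if S' = S then 1 else 0))"
  then have "\<phi> = crf (facet_value \<phi>)" using CR_repr by blast
  also have "\<dots> = crf (\<lambda>S'. if S' = S then 1 else 0)" by (rule crf_cong) (use \<phi> in \<open>simp add: facet_value_def\<close>)
  finally show "\<phi> = crf (\<lambda>S'. if S' = S then 1 else 0)" .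
qed

lemma cr_interpolant_CR: "cr_interpolant \<Omega> \<T> q \<in> CR \<Omega> \<T>"
proof -
  define a where "a S = (LINT s|facet_measure S. facet_trace \<Omega> S q s) / measure (facet_measure S) S" for S
  have "cr_interpolant \<Omega> \<T> q = crf a"
  proof (rule ext)
    fix x
    have "cr_interpolant \<Omega> \<T> q x = (\<Sum>S\<in>\<F>. a S * crf (\<lambda>S'. if S' = S then 1 else 0) x)"
      unfolding cr_interpolant_def a_def by (intro sum.cong refl) (simp add: cr_basis_eq)
    also have "\<dots> = crf a x"
    proof (cases "x \<in> mesh_int \<T>")
      case True
      then obtain T where T: "T \<in> \<T>" "x \<in> interior T" by (auto simp: mesh_int_def)
      have op: "opp T p \<in> \<F>" if "p \<in> verts T" for p using that T mesh_facets_eq by blast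
      have "(\<Sum>S\<in>\<F>. a S * crf (\<lambda>S'. if S' = S then 1 else 0) x)
         = (\<Sum>S\<in>\<F>. \<Sum>p\<in>verts T. (if opp T p = S then a S else 0) * (1 - real CARD('n) * bary T p x))"
        by (intro sum.cong refl) (auto simp: crf_in[OF T] cr_local_def sum_distrib_left intro!: sum.cong)
      also have "\<dots> = (\<Sum>p\<in>verts T. \<Sum>S\<in>\<F>. (if opp T p = S then a S else 0) * (1 - real CARD('n) * bary T p x))"
        by (rule sum.swap)
      also have "\<dots> = cr_local a T x" unfolding cr_local_def
        using op finite_mesh_facets by (intro sum.cong refl) (simp add: sum_distrib_right[symmetric])
      finally show ?thesis by (simp add: crf_in[OF T])
    qed (simp add: crf_out)
    finally show "cr_interpolant \<Omega> \<T> q x = crf a x" .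
  qed
  then show ?thesis using crf_CR by simp
qed

lemma elem_grad_crf: "elem_grad \<T> (crf c) = pw \<T> (\<lambda>T _. cr_grad T c)"
proof (rule pw_eqI)
  fix T x assume T: "T \<in> \<T>" and x: "x \<in> interior T"
  have "(cr_local c T has_derivative (\<lambda>h. cr_grad T c \<bullet> h)) (at x)"
  proof -
    have e: "cr_local c T = (\<lambda>y. cr_local c T 0 + cr_grad T c \<bullet> y)" by (rule ext) (rule cr_local_affine[OF T])
    show ?thesis by (subst e) (auto intro!: derivative_eq_intros)
  qed
  then have "(crf c has_derivative (\<lambda>h. cr_grad T c \<bullet> h)) (at x)"
    by (rule has_derivative_transform_within_open[OF _ open_interior x]) (simp add: crf_in[OF T])
  then have "grad (crf c) x = cr_grad T c" by (rule grad_eqI)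
  then show "elem_grad \<T> (crf c) x = cr_grad T c" using T x by (auto simp: elem_grad_def mesh_int_def)
qed (simp add: elem_grad_def)

lemma elem_mean_crf: "elem_mean \<T> (crf c) = pw \<T> (\<lambda>T _. (\<Sum>p\<in>verts T. c (opp T p)) / (real CARD('n) + 1))"
proof -
  have "elem_mean \<T> (crf c) = pw \<T> (\<lambda>T _. cr_local c T 0 + cr_grad T c \<bullet> barycenter T)"
    by (rule elem_mean_affine) (simp only: crf_in cr_local_affine[symmetric])
  also have "\<dots> = pw \<T> (\<lambda>T _. (\<Sum>p\<in>verts T. c (opp T p)) / (real CARD('n) + 1))"
    by (rule pw_cong) (simp add: cr_local_affine[symmetric] cr_local_mean)
  finally show ?thesis .
qed

definition "area S = measure (facet_measure S) S"

lemma bdry_facet_integral: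
  assumes S: "S \<in> bdry_facets \<Omega> \<T>" and h: "\<And>x. x \<in> rel_interior S \<Longrightarrow> h x = a + b \<bullet> x"
  shows "(LINT x|facet_measure S. h x) = area S * (a + b \<bullet> barycenter S)"
proof -
  obtain T p where T: "T \<in> \<T>" "p \<in> verts T" "S = opp T p" using bdry_facet_element[OF S] by metis
  interpret full_simplex T by (rule element_simplex[OF T(1)])
  show ?thesis using facet_integral_affine[OF T(2) DIM2, of h a b] h measure_facet_measure(1)[OF T(2) DIM2] T(3)
    by (simp add: area_def)
qed

lemma area_pos: "S \<in> \<F> \<Longrightarrow> area S > 0"
proof -
  assume "S \<in> \<F>"
  then obtain T p where T: "T \<in> \<T>" "p \<in> verts T" "S = opp T p" unfolding mesh_facets_eq by blast
  interpret full_simplex T by (rule element_simplex[OF T(1)])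
  show ?thesis using facet_area_pos[OF T(2)] measure_facet_measure(1)[OF T(2) DIM2] T(3) by (simp add: area_def)
qed

lemma bdry_facets_sub: "bdry_facets \<Omega> \<T> \<subseteq> \<F>" by (auto simp: bdry_facets_def)

lemma crf_skel:
  assumes S: "els S = {T}" and x: "x \<in> rel_interior S"
  shows "skel_val \<T> (crf c) x = cr_local c T 0 + cr_grad T c \<bullet> x"
proof -
  have T: "T \<in> \<T>" using S by (auto simp: els_def)
  have "skel_val \<T> (crf c) x = cr_local c T x" unfolding crf_def
    by (rule pw_limit(2)[OF _ x]) (use S T in \<open>auto simp: mesh_facets_iff intro: cr_local_cont\<close>)
  then show ?thesis using cr_local_affine[OF T, of c x] by simp
qed

lemma cr_facet_mean_crf: assumes S: "S \<in> bdry_facets \<Omega> \<T>" shows "cr_facet_mean \<T> (crf c) S x = c S"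
proof -
  obtain T p where T: "els S = {T}" "T \<in> \<T>" "p \<in> verts T" "S = opp T p" using bdry_facet_element[OF S] by metis
  have "(LINT x|facet_measure S. skel_val \<T> (crf c) x) = area S * (cr_local c T 0 + cr_grad T c \<bullet> barycenter S)"
    by (rule bdry_facet_integral[OF S crf_skel[OF T(1)]])
  also have "cr_local c T 0 + cr_grad T c \<bullet> barycenter S = c S" using cr_local_affine[OF T(2), of c "barycenter S"] cr_local_barycenter[of T S c] T(1) by simp
  finally show ?thesis using area_pos[of S] S bdry_facets_sub by (auto simp: cr_facet_mean_def facet_mean_def area_def)
qed

section \<open>Raviart--Thomas fields as element means and fluxes\<close>

text \<open>
  \<open>rtf \<zeta> \<gamma>\<close> has mean \<open>\<zeta> T\<close> and divergence \<open>\<gamma> T\<close> on \<open>T\<close>; every elementwise field of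
  Raviart--Thomas form is of this kind. \<open>flux \<zeta> \<gamma> S\<close> is its total flux through \<open>S\<close> out of the
  elements at \<open>S\<close>; at an interior facet this is the jump of the normal component times \<open>|S|\<close>.
  \<open>load \<gamma> S\<close> is the integral of \<open>\<gamma>\<close> against the basis function of \<open>S\<close>.
\<close>
definition "rtf \<zeta> \<gamma> = pw \<T> (\<lambda>T x. \<zeta> T + (\<gamma> T / real CARD('n)) *\<^sub>R (x - barycenter T))" for \<zeta> :: "(real^'n) set \<Rightarrow> real^'n" and \<gamma> :: "(real^'n) set \<Rightarrow> real"
definition "load \<gamma> S = (\<Sum>T\<in>els S. vol T * \<gamma> T / (real CARD('n) + 1))" for \<gamma> :: "(real^'n) set \<Rightarrow> real"
definition "flux \<zeta> \<gamma> S = (\<Sum>T\<in>\<T>. vol T * (\<zeta> T \<bullet> shape_grad T S)) + load \<gamma> S"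

lemma flux_eq: "flux \<zeta> \<gamma> S = (\<Sum>T\<in>els S. vol T * (\<gamma> T / (real CARD('n) + 1) - real CARD('n) * (bgrad T (apex T S) \<bullet> \<zeta> T)))"
proof -
  have "(\<Sum>T\<in>\<T>. vol T * (\<zeta> T \<bullet> shape_grad T S)) = (\<Sum>T\<in>\<T>. if T \<in> els S then vol T * (- real CARD('n) * (bgrad T (apex T S) \<bullet> \<zeta> T)) else 0)"
    by (intro sum.cong refl) (simp add: shape_grad_def inner_commute)
  also have "\<dots> = (\<Sum>T\<in>{T\<in>\<T>. T \<in> els S}. vol T * (- real CARD('n) * (bgrad T (apex T S) \<bullet> \<zeta> T)))"
    by (rule sum.inter_filter[OF fin, symmetric])
  also have "{T\<in>\<T>. T \<in> els S} = els S" by (auto simp: els_def)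
  finally show ?thesis unfolding flux_def load_def
    by (simp add: sum.distrib[symmetric] right_diff_distrib)
qed

lemma rtf_mean: "elem_mean \<T> (rtf \<zeta> \<gamma>) = pw \<T> (\<lambda>T _. \<zeta> T)"
proof -
  have "elem_mean \<T> (rtf \<zeta> \<gamma>) = pw \<T> (\<lambda>T _. (\<zeta> T - (\<gamma> T / real CARD('n)) *\<^sub>R barycenter T) + (\<gamma> T / real CARD('n)) *\<^sub>R barycenter T)"
    by (rule elem_mean_affine_vector) (simp add: rtf_def pw_in algebra_simps)
  then show ?thesis by simp
qed

lemma rtf_inject: "pw \<T> (\<lambda>T _. \<zeta> T) = pw \<T> (\<lambda>T _. \<zeta>' T) \<Longrightarrow> rtf \<zeta> \<gamma> = rtf \<zeta>' \<gamma>" for \<zeta> :: "(real^'n) set \<Rightarrow> real^'n"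
  unfolding rtf_def pw_eq_iff by simp

text \<open>
  At a facet, \<open>|S| n = - d |T| \<nabla>\<lambda>\<^sub>p\<close>, and \<open>\<nabla>\<lambda>\<^sub>p \<bullet> (x - x\<^sub>T) = - 1 / (d + 1)\<close> because \<open>\<lambda>\<^sub>p\<close> is
  zero on \<open>S\<close> and \<open>1 / (d + 1)\<close> at the barycenter of \<open>T\<close>.
\<close>
lemma rtf_normal_flux:
  assumes S: "S \<in> bdry_facets \<Omega> \<T>" and x: "x \<in> rel_interior S"
  shows "area S * normal_flux \<Omega> \<T> (rtf \<zeta> \<gamma>) S x = flux \<zeta> \<gamma> S"
proof -
  obtain T p where T: "els S = {T}" "T \<in> \<T>" "p \<in> verts T" "S = opp T p" using bdry_facet_element[OF S] by metis
  interpret full_simplex T by (rule element_simplex[OF T(2)])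
  have ap: "apex T S = p" using apex_opp T by simp
  let ?g = "bgrad T p"
  have g: "norm ?g > 0" using bgrad_nonzero[OF T(3)] by simp
  have ar: "area S = real CARD('n) * vol T * norm ?g"
    using measure_facet_measure(1)[OF T(3) DIM2] T(4) by (simp add: area_def facet_area_def)
  have "skel_val \<T> (rtf \<zeta> \<gamma>) x = \<zeta> T + (\<gamma> T / real CARD('n)) *\<^sub>R (x - barycenter T)" unfolding rtf_def
    by (rule pw_limit(2)[OF _ x]) (use T in \<open>auto simp: mesh_facets_iff intro!: continuous_intros\<close>)
  moreover have "bary T p x = 0" using x T(4) rel_interior_opp_iff[OF T(3)] by simp
  then have "?g \<bullet> (x - barycenter T) = - (1 / (real CARD('n) + 1))"
    unfolding bary_diff[symmetric] using bary_barycenter[OF T(3)] by simp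
  ultimately have nf: "normal_flux \<Omega> \<T> (rtf \<zeta> \<gamma>) S x = - (?g \<bullet> \<zeta> T - (\<gamma> T / real CARD('n)) * (1 / (real CARD('n) + 1))) / norm ?g"
    unfolding normal_flux_def outer_normal_eq[OF T(1,3,4)]
    by (simp add: inner_add_left inner_commute[of _ "?g"] inner_add_right) (simp add: diff_divide_distrib)
  have c: "n * A * k * (- (B - X / n * (1 / Y)) / k) = A * (X / Y - n * B)" if "n > 0" "k > 0" for n A k B X Y :: real
  proof -
    have "n * A * k * (Z / k) = A * (n * Z)" for Z using that by simp
    moreover have "n * - (B - X / n * (1 / Y)) = X / Y - n * B" using that by (simp add: right_diff_distrib)
    ultimately show ?thesis by (simp only:)
  qed
  have "area S * normal_flux \<Omega> \<T> (rtf \<zeta> \<gamma>) S x = vol T * (\<gamma> T / (real CARD('n) + 1) - real CARD('n) * (?g \<bullet> \<zeta> T))"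
    unfolding ar nf using g by (intro c) auto
  then show ?thesis unfolding flux_eq T(1) by (simp add: ap)
qed

text \<open>
  The mean of \<open>\<phi>\<close> over \<open>S\<close>; the choice of the element is irrelevant by \<open>fmean_shared_facet\<close>.
\<close>
definition "facet_fmean S \<phi> = (let T = (SOME T. T \<in> els S) in fmean T (apex T S) \<phi> (grad \<phi>))"

lemma facet_fmean_eq: assumes T: "T \<in> els S" and \<phi>: "\<phi> \<in> C1" shows "fmean T (apex T S) \<phi> (grad \<phi>) = facet_fmean S \<phi>"
proof -
  define T' where "T' = (SOME T. T \<in> els S)"
  have T': "T' \<in> els S" unfolding T'_def using T by (rule someI)
  note a = apex_props[OF T] and a' = apex_props[OF T']
  have "fmean T (apex T S) \<phi> (grad \<phi>) = fmean T' (apex T' S) \<phi> (grad \<phi>)"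
    by (rule fmean_shared_facet[OF element_simplex[OF a(1)] element_simplex[OF a'(1)] a(2) a'(2)]) (use a a' C1_imp_C1_pair[OF \<phi>] in auto)
  then show ?thesis by (simp add: facet_fmean_def T'_def Let_def)
qed

lemma ip_integral:
  fixes v :: "real^'n \<Rightarrow> 'b::real_inner"
  assumes v: "\<And>T. T \<in> \<T> \<Longrightarrow> continuous_on T (F T)" and \<phi>: "continuous_on UNIV \<phi>"
  shows "ip \<Omega> (pw \<T> F) \<phi> = (\<Sum>T\<in>\<T>. LINT x:T|lborel. F T x \<bullet> \<phi> x)"
  unfolding ip_def
proof (rule pw_integral(1))
  show "set_integrable lborel T (\<lambda>x. F T x \<bullet> \<phi> x)" if "T \<in> \<T>" for T
    using v[OF that] continuous_on_subset[OF \<phi> subset_UNIV]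
    by (intro full_simplex.set_integrable_continuous[OF element_simplex[OF that]] continuous_intros)
qed (simp_all add: pw_in pw_out)

text \<open>
  Integration by parts on every element; the contributions of the elements at a facet share the
  same facet mean, and their coefficients add up to the flux.
\<close>
lemma weak_divergence_identity:
  assumes \<phi>: "\<phi> \<in> C1"
  shows "ip \<Omega> (rtf \<zeta> \<gamma>) (grad \<phi>) + ip \<Omega> (pw \<T> (\<lambda>T _. \<gamma> T)) \<phi> = (\<Sum>S\<in>\<F>. flux \<zeta> \<gamma> S * facet_fmean S \<phi>)"
proof -
  note C = C1_imp_C1_pair[OF \<phi>]
  have "ip \<Omega> (rtf \<zeta> \<gamma>) (grad \<phi>) = (\<Sum>T\<in>\<T>. LINT x:T|lborel. (\<zeta> T + (\<gamma> T / real CARD('n)) *\<^sub>R (x - barycenter T)) \<bullet> grad \<phi> x)"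
    unfolding rtf_def by (rule ip_integral) (auto intro!: continuous_intros C1_pair_grad_continuous[OF C])
  moreover have "ip \<Omega> (pw \<T> (\<lambda>T _. \<gamma> T)) \<phi> = (\<Sum>T\<in>\<T>. LINT x:T|lborel. \<gamma> T \<bullet> \<phi> x)"
    by (rule ip_integral) (auto intro!: continuous_intros C1_pair_continuous[OF C])
  ultimately have "ip \<Omega> (rtf \<zeta> \<gamma>) (grad \<phi>) + ip \<Omega> (pw \<T> (\<lambda>T _. \<gamma> T)) \<phi>
     = (\<Sum>T\<in>\<T>. (LINT x:T|lborel. (\<zeta> T + (\<gamma> T / real CARD('n)) *\<^sub>R (x - barycenter T)) \<bullet> grad \<phi> x) + (LINT x:T|lborel. \<gamma> T \<bullet> \<phi> x))"
    by (simp add: sum.distrib)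
  also have "\<dots> = (\<Sum>T\<in>\<T>. \<Sum>p\<in>verts T. vol T * (\<gamma> T / (real CARD('n) + 1) - real CARD('n) * (bgrad T p \<bullet> \<zeta> T)) * fmean T p \<phi> (grad \<phi>))"
  proof (intro sum.cong refl)
    fix T assume T: "T \<in> \<T>"
    interpret full_simplex T by (rule element_simplex[OF T])
    have "(LINT x:T|lborel. (\<zeta> T + (\<gamma> T / real CARD('n)) *\<^sub>R (x - barycenter T)) \<bullet> grad \<phi> x) + (LINT x:T|lborel. \<gamma> T \<bullet> \<phi> x)
      = (LINT x:T|lborel. (\<zeta> T + (\<gamma> T / real CARD('n)) *\<^sub>R (x - barycenter T)) \<bullet> grad \<phi> x + \<gamma> T * \<phi> x)"
      by (subst set_integral_add(2))
        (auto intro!: set_integrable_continuous continuous_intros C1_pair_continuous[OF C] C1_pair_grad_continuous[OF C])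
    then show "(LINT x:T|lborel. (\<zeta> T + (\<gamma> T / real CARD('n)) *\<^sub>R (x - barycenter T)) \<bullet> grad \<phi> x) + (LINT x:T|lborel. \<gamma> T \<bullet> \<phi> x)
       = (\<Sum>p\<in>V. vol T * (\<gamma> T / (real CARD('n) + 1) - real CARD('n) * (bgrad T p \<bullet> \<zeta> T)) * fmean T p \<phi> (grad \<phi>))"
      using divergence_decomposition[OF C, of "\<zeta> T" "\<gamma> T"] by simp
  qed
  also have "\<dots> = (\<Sum>S\<in>\<F>. \<Sum>T\<in>els S. vol T * (\<gamma> T / (real CARD('n) + 1) - real CARD('n) * (bgrad T (apex T S) \<bullet> \<zeta> T)) * fmean T (apex T S) \<phi> (grad \<phi>))"
    by (rule facet_double_sum)
  also have "\<dots> = (\<Sum>S\<in>\<F>. flux \<zeta> \<gamma> S * facet_fmean S \<phi>)"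
    unfolding flux_eq sum_distrib_right by (intro sum.cong refl) (simp add: facet_fmean_eq[OF _ \<phi>])
  finally show ?thesis .
qed

lemma facet_fmean_zero: assumes S: "S \<in> \<F>" and \<phi>: "\<phi> \<in> C1" and z: "\<And>x. x \<in> S \<Longrightarrow> \<phi> x = 0" shows "facet_fmean S \<phi> = 0"
proof -
  obtain T where T: "T \<in> els S" using S mesh_facets_iff by blast
  note a = apex_props[OF T]
  interpret full_simplex T by (rule element_simplex[OF a(1)])
  show ?thesis using facet_fmean_eq[OF T \<phi>] fmean_zero[OF a(2) C1_imp_C1_pair[OF \<phi>]] z a(3) by simp
qed

text \<open>
  Interior facets do not contribute by assumption, and on boundary facets the test function
  vanishes.
\<close>
lemma has_weak_div_rtf:
  assumes "\<And>S. S \<in> \<F> - bdry_facets \<Omega> \<T> \<Longrightarrow> flux \<zeta> \<gamma> S = 0"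
  shows "has_weak_div \<Omega> (rtf \<zeta> \<gamma>) (pw \<T> (\<lambda>T _. \<gamma> T))"
  unfolding has_weak_div_def
proof
  fix \<phi> assume "\<phi> \<in> test_functions \<Omega>"
  then have \<phi>: "\<phi> \<in> C1" "closure {x. \<phi> x \<noteq> 0} \<subseteq> \<Omega>" by (auto simp: test_functions_def)
  have "flux \<zeta> \<gamma> S * facet_fmean S \<phi> = 0" if S: "S \<in> \<F>" for S
  proof (cases "S \<in> bdry_facets \<Omega> \<T>")
    case True
    have "\<phi> x = 0" if "x \<in> S" for x
    proof (rule ccontr)
      assume "\<phi> x \<noteq> 0"
      then have "x \<in> \<Omega>" using \<phi>(2) closure_subset[of "{x. \<phi> x \<noteq> 0}"] by auto
      moreover have "x \<in> frontier \<Omega>" using True that by (auto simp: bdry_facets_def)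
      ultimately show False using opn by (simp add: frontier_def interior_open)
    qed
    then show ?thesis using facet_fmean_zero[OF S \<phi>(1)] by simp
  qed (use assms S in simp)
  then have "(\<Sum>S\<in>\<F>. flux \<zeta> \<gamma> S * facet_fmean S \<phi>) = 0" by (intro sum.neutral) blast
  then show "ip \<Omega> (rtf \<zeta> \<gamma>) (grad \<phi>) = - ip \<Omega> (pw \<T> (\<lambda>T _. \<gamma> T)) \<phi>"
    using weak_divergence_identity[OF \<phi>(1), of \<zeta> \<gamma>] by simp
qed

text \<open>
  A bump inside \<open>T\<close> has zero mean on every facet and so compares the two divergences on \<open>T\<close>. A
  bump at the barycenter of an interior facet, too small to reach any other facet, then isolates
  the flux through that facet.
\<close>
lemma has_weak_div_rtfD:
  assumes w: "has_weak_div \<Omega> (rtf \<zeta> \<gamma>) (pw \<T> (\<lambda>T _. f T))"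
  shows "T \<in> \<T> \<Longrightarrow> \<gamma> T = f T" "S \<in> \<F> - bdry_facets \<Omega> \<T> \<Longrightarrow> flux \<zeta> \<gamma> S = 0"
proof -
  have id: "ip \<Omega> (pw \<T> (\<lambda>T _. \<gamma> T)) \<phi> - ip \<Omega> (pw \<T> (\<lambda>T _. f T)) \<phi> = (\<Sum>S\<in>\<F>. flux \<zeta> \<gamma> S * facet_fmean S \<phi>)"
    if "\<phi> \<in> test_functions \<Omega>" for \<phi>
  proof -
    have "\<phi> \<in> C1" using that by (simp add: test_functions_def)
    then show ?thesis using weak_divergence_identity[of \<phi> \<zeta> \<gamma>] w that by (simp add: has_weak_div_def)
  qed
  show g: "\<gamma> T = f T" if T: "T \<in> \<T>" for T
  proof -
    interpret full_simplex T by (rule element_simplex[OF T])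
    obtain r where r: "r > 0" "cball (barycenter T) r \<subseteq> interior T"
      using barycenter_in_interior open_contains_cball[of "interior T"] by auto
    let ?\<phi> = "bump (barycenter T) r"
    have t: "?\<phi> \<in> test_functions \<Omega>" using r interior_subset_Omega[OF T] by (intro bump_test_function) auto
    then have \<phi>: "?\<phi> \<in> C1" by (simp add: test_functions_def)
    have out: "?\<phi> x = 0" if "x \<notin> interior T" for x
      using bump_zero[of r x "barycenter T"] r that by (force simp: dist_norm norm_minus_commute subset_iff)
    have "facet_fmean S ?\<phi> = 0" if S: "S \<in> \<F>" for S
    proof (rule facet_fmean_zero[OF S \<phi>])
      fix x assume x: "x \<in> S"
      obtain T' where T': "T' \<in> els S" using S mesh_facets_iff by blast
      note a = apex_props[OF T']
      interpret T': full_simplex T' by (rule element_simplex[OF a(1)])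
      have xT': "x \<in> T'" "bary T' (apex T' S) x = 0" using T'.opp_mem_iff[OF a(2)] a(3) x by auto
      have "x \<notin> interior T"
      proof
        assume xi: "x \<in> interior T"
        then have "T = T'" by (rule interior_disjoint[OF T a(1) _ xT'(1)])
        then show False using xi xT'(2) a(2) T'.interior_iff by force
      qed
      then show "?\<phi> x = 0" by (rule out)
    qed
    then have "ip \<Omega> (pw \<T> (\<lambda>T _. \<gamma> T)) ?\<phi> - ip \<Omega> (pw \<T> (\<lambda>T _. f T)) ?\<phi> = 0" using id[OF t] by simp
    moreover have "ip \<Omega> (pw \<T> (\<lambda>T _. h T)) ?\<phi> = h T * (LINT x:T|lborel. ?\<phi> x)" for h :: "(real^'n) set \<Rightarrow> real"
    proof -
      have "ip \<Omega> (pw \<T> (\<lambda>T _. h T)) ?\<phi> = (\<Sum>T'\<in>\<T>. LINT x:T'|lborel. h T' \<bullet> ?\<phi> x)"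
        by (rule ip_integral) (auto intro!: continuous_intros C1_pair_continuous[OF C1_imp_C1_pair[OF \<phi>]])
      also have "\<dots> = (\<Sum>T'\<in>\<T>. if T' = T then h T * (LINT x:T|lborel. ?\<phi> x) else 0)"
      proof (intro sum.cong refl)
        fix T' assume T': "T' \<in> \<T>"
        show "(LINT x:T'|lborel. h T' \<bullet> ?\<phi> x) = (if T' = T then h T * (LINT x:T|lborel. ?\<phi> x) else 0)"
        proof (cases "T' = T")
          case False
          then have "indicat_real T' x *\<^sub>R (h T' \<bullet> ?\<phi> x) = 0" for x
            using out[of x] interior_disjoint[OF T T', of x] by (cases "x \<in> T'") auto
          then have "(LINT x:T'|lborel. h T' \<bullet> ?\<phi> x) = 0" unfolding set_lebesgue_integral_def by (simp only: integral_zero)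
          then show ?thesis using False by simp
        qed simp
      qed
      finally show ?thesis using T fin by simp
    qed
    moreover have "(LINT x:T|lborel. ?\<phi> x) > 0"
      using r barycenter_in_interior interior_subset[of T]
      by (intro integral_pos[of _ "barycenter T"] C1_pair_continuous[OF C1_imp_C1_pair[OF \<phi>]]) (auto simp: bump_nonneg intro!: bump_pos)
    ultimately show ?thesis by (auto simp: left_diff_distrib[symmetric])
  qed
  show "flux \<zeta> \<gamma> S = 0" if S: "S \<in> \<F> - bdry_facets \<Omega> \<T>"
  proof -
    let ?x = "barycenter S"
    have SF: "S \<in> \<F>" using S by simp
    note x = barycenter_rel_interior[OF SF]
    have xO: "?x \<in> \<Omega>" using interior_facet_elements[OF S] x by blast
    \<comment> \<open>If the barycenter of \<open>S\<close> were on another facet \<open>S'\<close>, an element at \<open>S'\<close> would also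
      have \<open>S\<close> as a facet, on whose relative interior the coordinate belonging to \<open>S'\<close> is
      positive.\<close>
    have notin: "?x \<notin> S'" if S': "S' \<in> \<F>" "S' \<noteq> S" for S'
    proof
      assume xS': "?x \<in> S'"
      obtain T0 where T0: "T0 \<in> els S" using SF mesh_facets_iff by blast
      obtain T' where T': "T' \<in> els S'" using S' mesh_facets_iff by blast
      note a' = apex_props[OF T']
      interpret T': full_simplex T' by (rule element_simplex[OF a'(1)])
      have b: "?x \<in> T'" "bary T' (apex T' S') ?x = 0" using T'.opp_mem_iff[OF a'(2)] a'(3) xS' by auto
      have TS: "T' \<in> els S" by (rule facet_of_containing[OF T0 x a'(1) b(1)])
      note a = apex_props[OF TS]
      have "apex T' S \<noteq> apex T' S'" using a(3) a'(3) S'(2) by metis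
      moreover have "?x \<in> rel_interior (opp T' (apex T' S))" using x a(3) by simp
      then have "\<forall>q\<in>T'.V - {apex T' S}. 0 < bary T' q ?x" using T'.rel_interior_opp_iff[OF a(2)] by blast
      ultimately have "0 < bary T' (apex T' S') ?x" using a'(2) by simp
      then show False using b by simp
    qed
    have cl: "closed (\<Union>(\<F> - {S}))"
    proof (rule closed_Union)
      show "finite (\<F> - {S})" using finite_mesh_facets by simp
      show "\<forall>S'\<in>\<F> - {S}. closed S'"
      proof
        fix S' assume "S' \<in> \<F> - {S}"
        then obtain T' where T': "T' \<in> els S'" using mesh_facets_iff by blast
        note a' = apex_props[OF T']
        show "closed S'" using full_simplex.opp_closed[OF element_simplex[OF a'(1)] a'(2)] a'(3) by simp
      qed
    qed
    have "open (\<Omega> - \<Union>(\<F> - {S}))" using opn cl by (rule open_Diff)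
    moreover have "?x \<in> \<Omega> - \<Union>(\<F> - {S})" using xO notin by blast
    ultimately obtain r where r: "r > 0" "cball ?x r \<subseteq> \<Omega> - \<Union>(\<F> - {S})" by (meson open_contains_cball)
    let ?\<phi> = "bump ?x r"
    have t: "?\<phi> \<in> test_functions \<Omega>" using r by (intro bump_test_function) auto
    then have \<phi>: "?\<phi> \<in> C1" by (simp add: test_functions_def)
    have z: "facet_fmean S' ?\<phi> = 0" if S': "S' \<in> \<F>" "S' \<noteq> S" for S'
    proof (rule facet_fmean_zero[OF S'(1) \<phi>])
      fix y assume "y \<in> S'"
      then have "y \<notin> cball ?x r" using r(2) S' by blast
      then show "?\<phi> y = 0" using r(1) by (intro bump_zero) (auto simp: dist_norm norm_minus_commute)
    qed
    have "(\<Sum>S'\<in>\<F>. flux \<zeta> \<gamma> S' * facet_fmean S' ?\<phi>) = (\<Sum>S'\<in>\<F>. if S' = S then flux \<zeta> \<gamma> S * facet_fmean S ?\<phi> else 0)"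
      by (intro sum.cong refl) (use z in auto)
    also have "\<dots> = flux \<zeta> \<gamma> S * facet_fmean S ?\<phi>" using SF finite_mesh_facets by simp
    finally have "flux \<zeta> \<gamma> S * facet_fmean S ?\<phi> = ip \<Omega> (pw \<T> (\<lambda>T _. \<gamma> T)) ?\<phi> - ip \<Omega> (pw \<T> (\<lambda>T _. f T)) ?\<phi>"
      using id[OF t] by simp
    also have "pw \<T> (\<lambda>T _. \<gamma> T) = pw \<T> (\<lambda>T _. f T)" by (rule pw_cong) (simp add: g)
    finally have "flux \<zeta> \<gamma> S * facet_fmean S ?\<phi> = 0" by simp
    moreover have "facet_fmean S ?\<phi> > 0"
    proof -
      obtain T where T: "T \<in> els S" using SF mesh_facets_iff by blast
      note a = apex_props[OF T]
      interpret full_simplex T by (rule element_simplex[OF a(1)])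
      have "?x \<in> opp T (apex T S)" using x rel_interior_subset a(3) by blast
      then show ?thesis using fmean_bump_pos[OF a(2) _ r(1) C1_imp_C1_pair[OF \<phi>]] facet_fmean_eq[OF T \<phi>] by simp
    qed
    ultimately show ?thesis by simp
  qed
qed

lemma RT0_repr: assumes v: "v \<in> RT0 \<Omega> \<T>" obtains \<zeta> \<gamma> where "v = rtf \<zeta> \<gamma>"
proof -
  obtain a b where ab: "\<And>T x. T \<in> \<T> \<Longrightarrow> x \<in> interior T \<Longrightarrow> v x = a T + b T *\<^sub>R x"
    using v unfolding RT0_def by (auto simp: bchoice_iff)
  have "v = rtf (\<lambda>T. a T + b T *\<^sub>R barycenter T) (\<lambda>T. real CARD('n) * b T)"
    unfolding rtf_def using v ab by (intro pw_eqI) (auto simp: RT0_def algebra_simps)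
  then show ?thesis using that by blast
qed

lemma rtf_L2: "L2 (lebesgue_on \<Omega>) (rtf \<zeta> \<gamma>)" and pw_const_L2: "L2 (lebesgue_on \<Omega>) (pw \<T> (\<lambda>T _. \<gamma> T :: real))"
proof -
  have L2I: "L2 (lebesgue_on \<Omega>) (pw \<T> F)" if F: "\<And>T. T \<in> \<T> \<Longrightarrow> continuous_on T (F T)"
    for F :: "(real^'n) set \<Rightarrow> real^'n \<Rightarrow> 'b::euclidean_space"
  proof -
    have s: "set_integrable lborel T (F T)" if "T \<in> \<T>" for T
      by (rule full_simplex.set_integrable_continuous[OF element_simplex[OF that] F[OF that]])
    have s2: "set_integrable lborel T (\<lambda>x. (norm (F T x))\<^sup>2)" if "T \<in> \<T>" for T
      using F[OF that] by (intro full_simplex.set_integrable_continuous[OF element_simplex[OF that]] continuous_intros)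
    have "pw \<T> F \<in> borel_measurable (lebesgue_on \<Omega>)"
      using pw_integral(2)[of F "pw \<T> F"] s by (auto simp: pw_in pw_out)
    moreover have "integrable (lebesgue_on \<Omega>) (\<lambda>x. (norm (pw \<T> F x))\<^sup>2)"
      using s2 by (intro pw_integral(2)[of "\<lambda>T x. (norm (F T x))\<^sup>2"]) (auto simp: pw_in pw_out)
    ultimately show ?thesis by (simp add: L2_def)
  qed
  show "L2 (lebesgue_on \<Omega>) (rtf \<zeta> \<gamma>)" unfolding rtf_def by (rule L2I) (intro continuous_intros)
  show "L2 (lebesgue_on \<Omega>) (pw \<T> (\<lambda>T _. \<gamma> T :: real))" by (rule L2I) (intro continuous_intros)
qed

lemma rtf_RT0: assumes "\<And>S. S \<in> \<F> - bdry_facets \<Omega> \<T> \<Longrightarrow> flux \<zeta> \<gamma> S = 0" shows "rtf \<zeta> \<gamma> \<in> RT0 \<Omega> \<T>"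
proof -
  have "rtf \<zeta> \<gamma> \<in> Hdiv \<Omega>" unfolding Hdiv_def using rtf_L2 pw_const_L2 has_weak_div_rtf[OF assms] by blast
  moreover have "\<exists>a b. \<forall>x\<in>interior T. rtf \<zeta> \<gamma> x = a + b *\<^sub>R x" if "T \<in> \<T>" for T
    by (intro exI[of _ "\<zeta> T - (\<gamma> T / real CARD('n)) *\<^sub>R barycenter T"] exI[of _ "\<gamma> T / real CARD('n)"]) (simp add: rtf_def pw_in[OF that] algebra_simps)
  ultimately show ?thesis by (auto simp: RT0_def rtf_def pw_out)
qed

lemma K_star_iff:
  assumes SC: "\<S>\<^sub>C \<subseteq> bdry_facets \<Omega> \<T>"
  shows "v \<in> K_star \<Omega> \<T> \<S>\<^sub>C (pw \<T> (\<lambda>T _. f T)) (\<lambda>S x. a S) (\<lambda>S x. b S) \<longleftrightarrow>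
    (\<exists>\<zeta>. v = rtf \<zeta> f \<and> (\<forall>S\<in>\<F> - bdry_facets \<Omega> \<T>. flux \<zeta> f S = 0) \<and>
      (\<forall>S\<in>\<S>\<^sub>C. area S * a S \<le> flux \<zeta> f S \<and> flux \<zeta> f S \<le> area S * b S))"
    (is "?l \<longleftrightarrow> ?r")
proof -
  have nf: "(\<forall>x\<in>rel_interior S. a S \<le> normal_flux \<Omega> \<T> (rtf \<zeta> f) S x \<and> normal_flux \<Omega> \<T> (rtf \<zeta> f) S x \<le> b S) \<longleftrightarrow>
      area S * a S \<le> flux \<zeta> f S \<and> flux \<zeta> f S \<le> area S * b S" if "S \<in> \<S>\<^sub>C" for S \<zeta>
  proof -
    have S: "S \<in> bdry_facets \<Omega> \<T>" "S \<in> \<F>" using that SC bdry_facets_sub by auto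
    note ap = area_pos[OF S(2)]
    have "a S \<le> normal_flux \<Omega> \<T> (rtf \<zeta> f) S x \<and> normal_flux \<Omega> \<T> (rtf \<zeta> f) S x \<le> b S \<longleftrightarrow>
      area S * a S \<le> flux \<zeta> f S \<and> flux \<zeta> f S \<le> area S * b S" if "x \<in> rel_interior S" for x
      unfolding rtf_normal_flux[OF S(1) that, symmetric] using ap by simp
    then show ?thesis using barycenter_rel_interior[OF S(2)] by blast
  qed
  show ?thesis
  proof
    assume v: ?l
    then have "v \<in> RT0 \<Omega> \<T>" by (simp add: K_star_def)
    then obtain \<zeta> \<gamma> where vr: "v = rtf \<zeta> \<gamma>" by (rule RT0_repr)
    have "has_weak_div \<Omega> (rtf \<zeta> \<gamma>) (pw \<T> (\<lambda>T _. f T))" using v vr by (simp add: K_star_def)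
    note w = has_weak_div_rtfD[OF this]
    have vf: "v = rtf \<zeta> f" unfolding vr rtf_def by (rule pw_cong) (simp add: w(1))
    have "flux \<zeta> \<gamma> S = flux \<zeta> f S" for S unfolding flux_eq by (intro sum.cong refl) (simp add: w(1) els_def)
    then have "\<forall>S\<in>\<F> - bdry_facets \<Omega> \<T>. flux \<zeta> f S = 0" using w(2) by simp
    moreover have "\<forall>S\<in>\<S>\<^sub>C. area S * a S \<le> flux \<zeta> f S \<and> flux \<zeta> f S \<le> area S * b S"
      using v nf[of _ \<zeta>] vf by (auto simp: K_star_def)
    ultimately show ?r using vf by blast
  next
    assume ?r
    then obtain \<zeta> where z: "v = rtf \<zeta> f" "\<forall>S\<in>\<F> - bdry_facets \<Omega> \<T>. flux \<zeta> f S = 0"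
      "\<forall>S\<in>\<S>\<^sub>C. area S * a S \<le> flux \<zeta> f S \<and> flux \<zeta> f S \<le> area S * b S" by blast
    then have "v \<in> RT0 \<Omega> \<T>" "has_weak_div \<Omega> v (pw \<T> (\<lambda>T _. f T))" using rtf_RT0 has_weak_div_rtf by auto
    then show ?l using z nf by (simp add: K_star_def)
  qed
qed

section \<open>Gradients control differences of coefficients\<close>

text \<open>
  Within an element the coefficients differ by at most the gradient times the diameter. Any two
  facets are linked by a chain of elements in which neighbours share a facet.
\<close>
lemma oscillation_bound:
  "\<exists>C. \<forall>c. \<forall>S\<in>\<F>. \<forall>S'\<in>\<F>. \<bar>c S - c S'\<bar> \<le> C * (\<Sum>T\<in>\<T>. norm (cr_grad T c))"
proof -
  let ?G = "\<lambda>c. \<Sum>T\<in>\<T>. norm (cr_grad T c)"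
  have G: "norm (cr_grad T c) \<le> ?G c" if "T \<in> \<T>" for T c using that fin by (intro member_le_sum) auto
  have G0: "0 \<le> ?G c" for c by (rule sum_nonneg) simp
  have one: "\<exists>C\<ge>0. \<forall>c. \<forall>S S'. T \<in> els S \<and> T \<in> els S' \<longrightarrow> \<bar>c S - c S'\<bar> \<le> C * ?G c" if T: "T \<in> \<T>" for T
  proof -
    interpret full_simplex T by (rule element_simplex[OF T])
    obtain B where B: "\<forall>x\<in>T. norm x \<le> B" "B > 0" using bounded unfolding bounded_pos by auto
    have "\<bar>c S - c S'\<bar> \<le> (2 * B) * ?G c" if S: "T \<in> els S" "T \<in> els S'" for c S S'
    proof -
      have "barycenter S \<in> T" "barycenter S' \<in> T"
        using S barycenter_rel_interior facet_mem els_facet(2) mesh_facets_iff by blast+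
      then have n: "norm (barycenter S - barycenter S') \<le> 2 * B"
        using norm_triangle_ineq4[of "barycenter S" "barycenter S'"] bspec[OF B(1), of "barycenter S"] bspec[OF B(1), of "barycenter S'"]
        by linarith
      have "c S - c S' = cr_grad T c \<bullet> (barycenter S - barycenter S')"
        using cr_local_barycenter[OF S(1), of c] cr_local_barycenter[OF S(2), of c] cr_local_affine[OF T, of c "barycenter S"] cr_local_affine[OF T, of c "barycenter S'"]
        by (simp add: inner_diff_right)
      then have "\<bar>c S - c S'\<bar> \<le> norm (cr_grad T c) * norm (barycenter S - barycenter S')"
        using Cauchy_Schwarz_ineq2 by metis
      also have "\<dots> \<le> ?G c * (2 * B)" by (rule mult_mono[OF G[OF T] n G0]) simp
      finally show ?thesis by (simp add: mult.commute)
    qed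
    then show ?thesis using B(2) by (intro exI[of _ "2 * B"]) auto
  qed
  obtain T0 where T0: "T0 \<in> \<T>" using ne cover closure_subset[of \<Omega>] by blast
  have chain: "\<exists>C\<ge>0. \<forall>c. \<forall>S S'. T0 \<in> els S \<and> T \<in> els S' \<longrightarrow> \<bar>c S - c S'\<bar> \<le> C * ?G c" if "(T0, T) \<in> adj\<^sup>*" for T
    using that
  proof (induction rule: rtrancl_induct)
    case base
    show ?case by (rule one[OF T0])
  next
    case (step A B)
    obtain C where C: "C \<ge> 0" "\<And>c S S'. T0 \<in> els S \<Longrightarrow> A \<in> els S' \<Longrightarrow> \<bar>c S - c S'\<bar> \<le> C * ?G c" using step.IH by blast
    obtain S0 where S0: "A \<in> els S0" "B \<in> els S0" "B \<in> \<T>" using step.hyps(2) by (auto simp: adj_def els_def)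
    obtain C' where C': "C' \<ge> 0" "\<And>c S S'. B \<in> els S \<Longrightarrow> B \<in> els S' \<Longrightarrow> \<bar>c S - c S'\<bar> \<le> C' * ?G c" using one[OF S0(3)] by blast
    have "\<bar>c S - c S'\<bar> \<le> (C + C') * ?G c" if "T0 \<in> els S" "B \<in> els S'" for c S S'
      using C(2)[OF that(1) S0(1), of c] C'(2)[OF S0(2) that(2), of c] by (simp add: distrib_right)
    then show ?case using C(1) C'(1) by (intro exI[of _ "C + C'"]) auto
  qed
  have "\<forall>T\<in>\<T>. \<exists>C\<ge>0. \<forall>c. \<forall>S S'. T0 \<in> els S \<and> T \<in> els S' \<longrightarrow> \<bar>c S - c S'\<bar> \<le> C * ?G c"
    using chain elements_connected[OF T0] by blast
  then obtain C where C: "\<And>T. T \<in> \<T> \<Longrightarrow> C T \<ge> 0"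
    "\<And>T c S S'. T \<in> \<T> \<Longrightarrow> T0 \<in> els S \<Longrightarrow> T \<in> els S' \<Longrightarrow> \<bar>c S - c S'\<bar> \<le> C T * ?G c" by metis
  obtain p0 where p0: "p0 \<in> verts T0" using full_simplex.other_vertex[OF element_simplex[OF T0]] by metis
  have S0: "T0 \<in> els (opp T0 p0)" using els_opp T0 p0 by blast
  define K where "K = (\<Sum>T\<in>\<T>. C T)"
  have CK: "C T \<le> K" if "T \<in> \<T>" for T unfolding K_def using that fin C(1) by (intro member_le_sum) auto
  have b: "\<bar>c (opp T0 p0) - c S\<bar> \<le> K * ?G c" if S: "S \<in> \<F>" for c S
  proof -
    obtain T where T: "T \<in> els S" using S mesh_facets_iff by blast
    then have "T \<in> \<T>" by (simp add: els_def)
    then have "\<bar>c (opp T0 p0) - c S\<bar> \<le> C T * ?G c" using C(2)[OF _ S0 T] by blast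
    also have "\<dots> \<le> K * ?G c" by (rule mult_right_mono[OF CK[OF \<open>T \<in> \<T>\<close>] G0])
    finally show ?thesis .
  qed
  have "\<bar>c S - c S'\<bar> \<le> (2 * K) * ?G c" if "S \<in> \<F>" "S' \<in> \<F>" for c S S'
    using b[OF that(1), of c] b[OF that(2), of c] by linarith
  then show ?thesis by blast
qed

lemma sum_shape_grad_zero: assumes T: "T \<in> \<T>" shows "(\<Sum>S\<in>\<F>. shape_grad T S) = 0"
proof -
  interpret full_simplex T by (rule element_simplex[OF T])
  have "cr_grad T (\<lambda>_. 1) = (- real CARD('n)) *\<^sub>R (\<Sum>p\<in>V. bgrad T p)" unfolding cr_grad_eq[OF T] by (simp add: scaleR_sum_right sum_negf)
  then show ?thesis by (simp add: cr_grad_def sum_bgrad)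
qed

end

section \<open>The discrete primal and dual problems\<close>

text \<open>
  After projection the data enter only through one matrix and one source value per element and,
  on the boundary facets, the bounds on the flux and the Dirichlet value at the barycenter.
\<close>
locale discrete_problem = mesh \<Omega> \<T> for \<Omega> :: "(real^'n) set" and \<T> :: "(real^'n) set set" +
  fixes \<S>\<^sub>D \<S>\<^sub>C :: "(real^'n) set set" and K :: "(real^'n) set \<Rightarrow> real^'n^'n" and f :: "(real^'n) set \<Rightarrow> real"
    and \<alpha> \<beta> pd :: "(real^'n) set \<Rightarrow> real" and k0 k1 :: real
  assumes bdry: "\<S>\<^sub>D \<union> \<S>\<^sub>C = bdry_facets \<Omega> \<T>" "\<S>\<^sub>D \<inter> \<S>\<^sub>C = {}"
    and K_sym: "\<And>T. T \<in> \<T> \<Longrightarrow> transpose (K T) = K T" and k01: "0 < k0" "k0 \<le> k1"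
    and K_lower: "\<And>T \<xi>. T \<in> \<T> \<Longrightarrow> k0 * (norm \<xi>)\<^sup>2 \<le> \<xi> \<bullet> (K T *v \<xi>)"
    and K_upper: "\<And>T \<xi>. T \<in> \<T> \<Longrightarrow> \<xi> \<bullet> (K T *v \<xi>) \<le> k1 * (norm \<xi>)\<^sup>2"
begin

definition "K_half T x = mat_sqrt (K T) *v x"
definition "K_half_inv T x = matrix_inv (mat_sqrt (K T)) *v x"

abbreviation "\<I> \<equiv> \<F> - bdry_facets \<Omega> \<T>"

lemma facets_split: "\<I> \<union> \<S>\<^sub>D \<union> \<S>\<^sub>C = \<F>" using bdry bdry_facets_sub by auto

lemma SDC_bdry: "S \<in> \<S>\<^sub>D \<Longrightarrow> S \<in> bdry_facets \<Omega> \<T>" "S \<in> \<S>\<^sub>C \<Longrightarrow> S \<in> bdry_facets \<Omega> \<T>"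
  using bdry by auto

lemma facets_nonempty: "\<F> \<noteq> {}"
proof -
  obtain T where T: "T \<in> \<T>" using ne cover closure_subset[of \<Omega>] by blast
  obtain p where "p \<in> verts T" using full_simplex.other_vertex[OF element_simplex[OF T]] by metis
  then show ?thesis using T mesh_facets_eq by blast
qed

sublocale fd: finite_duality \<T> \<I> \<S>\<^sub>D \<S>\<^sub>C "\<lambda>T. measure lborel T" shape_grad K_half K_half_inv "load f"
  "\<lambda>S. area S * \<alpha> S" "\<lambda>S. area S * \<beta> S" pd
proof (rule finite_duality.intro)
  have sub: "\<S>\<^sub>D \<subseteq> \<F>" "\<S>\<^sub>C \<subseteq> \<F>" using facets_split by auto
  show "finite \<T>" "finite \<I>" "finite \<S>\<^sub>D" "finite \<S>\<^sub>C"
    using fin finite_mesh_facets finite_subset[OF sub(1)] finite_subset[OF sub(2)] by auto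
  show "\<I> \<inter> \<S>\<^sub>D = {}" "\<I> \<inter> \<S>\<^sub>C = {}" "\<S>\<^sub>D \<inter> \<S>\<^sub>C = {}" using bdry by auto
  show "\<I> \<union> \<S>\<^sub>D \<union> \<S>\<^sub>C \<noteq> {}" unfolding facets_split by (rule facets_nonempty)
  fix T assume T: "T \<in> \<T>"
  show "0 < measure lborel T" by (rule full_simplex.measure_pos[OF element_simplex[OF T]])
  show "linear (K_half T)" "linear (K_half_inv T)" unfolding K_half_def K_half_inv_def by (rule matrix_vector_mul_linear)+
  note m = mat_sqrt_properties[OF K_sym[OF T] k01 K_lower[OF T] K_upper[OF T]]
  fix x y
  show "K_half T (K_half_inv T x) = x" "K_half_inv T (K_half T x) = x" "x \<bullet> K_half T y = K_half T x \<bullet> y"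
    unfolding K_half_def K_half_inv_def by (rule m(3), rule m(4), rule m(1))
next
  fix T assume T: "T \<in> \<T>"
  show "(\<Sum>S\<in>\<I> \<union> \<S>\<^sub>D \<union> \<S>\<^sub>C. shape_grad T S) = 0" unfolding facets_split by (rule sum_shape_grad_zero[OF T])
next
  show "\<exists>C. \<forall>c. \<forall>S\<in>\<I> \<union> \<S>\<^sub>D \<union> \<S>\<^sub>C. \<forall>S'\<in>\<I> \<union> \<S>\<^sub>D \<union> \<S>\<^sub>C. \<bar>c S - c S'\<bar> \<le> C * (\<Sum>e\<in>\<T>. norm (\<Sum>S\<in>\<I> \<union> \<S>\<^sub>D \<union> \<S>\<^sub>C. c S *\<^sub>R shape_grad e S))"
    unfolding facets_split using oscillation_bound unfolding cr_grad_def .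
qed

lemma K_half_squared: "T \<in> \<T> \<Longrightarrow> K_half T (K_half T x) = K T *v x"
  using mat_sqrt_properties(2)[OF K_sym k01 K_lower K_upper] by (simp add: K_half_def)

lemma fd_L: "fd.L T c = cr_grad T c" by (simp add: fd.L_def cr_grad_def facets_split)
lemma fd_R: "fd.R \<zeta> S = flux \<zeta> f S" by (simp add: fd.R_def flux_def)

abbreviation "Kh \<equiv> pw \<T> (\<lambda>T _. K T)"
abbreviation "fh \<equiv> pw \<T> (\<lambda>T _. f T)"
abbreviation "ah \<equiv> (\<lambda>S (x::real^'n). \<alpha> S)"
abbreviation "bh \<equiv> (\<lambda>S (x::real^'n). \<beta> S)"
abbreviation "ph \<equiv> crf pd"
abbreviation "KS \<equiv> K_star \<Omega> \<T> \<S>\<^sub>C fh ah bh"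
abbreviation "KC \<equiv> K_cr \<Omega> \<T> \<S>\<^sub>D ph"
abbreviation "Drt \<equiv> D_rt \<Omega> \<T> \<S>\<^sub>D \<S>\<^sub>C Kh fh ah bh ph"
abbreviation "Icr \<equiv> I_cr \<Omega> \<T> \<S>\<^sub>D \<S>\<^sub>C Kh fh ah bh ph"

lemma KS_iff: "v \<in> KS \<longleftrightarrow> (\<exists>\<zeta>. v = rtf \<zeta> f \<and> fd.zfeas \<zeta>)"
  using K_star_iff[of \<S>\<^sub>C v f \<alpha> \<beta>] bdry by (auto simp: fd.zfeas_def fd_R)

lemma zfeas_cong: "pw \<T> (\<lambda>T _. \<zeta> T) = pw \<T> (\<lambda>T _. \<zeta>' T) \<Longrightarrow> fd.zfeas \<zeta> = fd.zfeas \<zeta>'" for \<zeta> \<zeta>' :: "(real^'n) set \<Rightarrow> real^'n"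
proof -
  assume e: "pw \<T> (\<lambda>T _. \<zeta> T) = pw \<T> (\<lambda>T _. \<zeta>' T)"
  have "\<zeta> T = \<zeta>' T" if T: "T \<in> \<T>" for T
    using e T full_simplex.interior_nonempty[OF element_simplex[OF T]] unfolding pw_eq_iff by blast
  then have "fd.R \<zeta> S = fd.R \<zeta>' S" for S unfolding fd.R_def by simp
  then show ?thesis by (simp add: fd.zfeas_def)
qed

text \<open>
  The Raviart--Thomas field in the admissible set is determined by its element means, so that
  the supremum over all fields with given means is over at most one element.
\<close>
lemma KS_mean: assumes v: "v \<in> KS" and m: "elem_mean \<T> v = pw \<T> (\<lambda>T _. \<zeta> T)" shows "v = rtf \<zeta> f" "fd.zfeas \<zeta>"
proof -
  obtain \<zeta>' where z: "v = rtf \<zeta>' f" "fd.zfeas \<zeta>'" using v KS_iff by blast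
  have e: "pw \<T> (\<lambda>T _. \<zeta>' T) = pw \<T> (\<lambda>T _. \<zeta> T)" using m unfolding z(1) rtf_mean .
  show "v = rtf \<zeta> f" unfolding z(1) by (rule rtf_inject[OF e])
  show "fd.zfeas \<zeta>" using z(2) zfeas_cong[OF e] by simp
qed

lemma rtf_KS: "rtf \<zeta> f \<in> KS \<longleftrightarrow> fd.zfeas \<zeta>"
  using KS_iff KS_mean(2)[of "rtf \<zeta> f" \<zeta>] rtf_mean by blast

lemma dirichlet_term: "facet_ip \<S>\<^sub>D (\<lambda>S. skel_val \<T> ph) (normal_flux \<Omega> \<T> (rtf \<zeta> f)) = (\<Sum>S\<in>\<S>\<^sub>D. pd S * fd.R \<zeta> S)"
  unfolding facet_ip_def fd_R
proof (intro sum.cong refl)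
  fix S assume S0: "S \<in> \<S>\<^sub>D"
  note S = SDC_bdry(1)[OF S0]
  have SF: "S \<in> \<F>" using S bdry_facets_sub by blast
  obtain T p where T: "els S = {T}" "T \<in> \<T>" "p \<in> verts T" "S = opp T p" using bdry_facet_element[OF S] by metis
  define k where "k = flux \<zeta> f S / area S"
  have k: "normal_flux \<Omega> \<T> (rtf \<zeta> f) S x = k" if "x \<in> rel_interior S" for x
    using rtf_normal_flux[OF S that, of \<zeta> f] area_pos[OF SF] by (simp add: k_def field_simps)
  have "(LINT x|facet_measure S. skel_val \<T> ph x * normal_flux \<Omega> \<T> (rtf \<zeta> f) S x)
     = area S * (k * cr_local pd T 0 + (k *\<^sub>R cr_grad T pd) \<bullet> barycenter S)"
    by (rule bdry_facet_integral[OF S]) (simp add: k crf_skel[OF T(1)] algebra_simps)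
  also have "\<dots> = area S * k * (cr_local pd T 0 + cr_grad T pd \<bullet> barycenter S)" by (simp add: algebra_simps)
  also have "cr_local pd T 0 + cr_grad T pd \<bullet> barycenter S = pd S"
    using cr_local_affine[OF T(2), of pd "barycenter S"] cr_local_barycenter[of T S pd] T(1) by simp
  also have "area S * k = flux \<zeta> f S" using area_pos[OF SF] by (simp add: k_def)
  finally show "(LINT x|facet_measure S. skel_val \<T> ph x * normal_flux \<Omega> \<T> (rtf \<zeta> f) S x) = pd S * flux \<zeta> f S"
    by simp
qed

lemma D_value: assumes z: "fd.zfeas \<zeta>" shows "Drt (rtf \<zeta> f) = ereal (fd.dual_value \<zeta>)"
proof -
  have "(LINT x|lebesgue_on \<Omega>. (norm (matrix_inv (mat_sqrt (Kh x)) *v elem_mean \<T> (rtf \<zeta> f) x))\<^sup>2) = (\<Sum>T\<in>\<T>. vol T * (norm (K_half_inv T (\<zeta> T)))\<^sup>2)"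
    unfolding rtf_mean by (rule P0_integral) (simp_all add: pw_in pw_out K_half_inv_def)
  then show ?thesis using z by (simp add: D_rt_def rtf_KS dirichlet_term fd.dual_value_def)
qed

lemma D_outside: "v \<notin> KS \<Longrightarrow> Drt v = - \<infinity>" by (simp add: D_rt_def)

lemma facet_ip_bdry:
  assumes "\<And>S x. S \<in> \<S>\<^sub>C \<Longrightarrow> x \<in> rel_interior S \<Longrightarrow> g S x * h S x = k S"
  shows "facet_ip \<S>\<^sub>C g h = (\<Sum>S\<in>\<S>\<^sub>C. area S * k S)"
  unfolding facet_ip_def
proof (intro sum.cong refl)
  fix S assume S: "S \<in> \<S>\<^sub>C"
  show "(LINT x|facet_measure S. g S x * h S x) = area S * k S"
    using bdry_facet_integral[OF SDC_bdry(2)[OF S], of "\<lambda>x. g S x * h S x" "k S" 0] assms[OF S] by simp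
qed

lemma crf_KC: "crf c \<in> KC \<longleftrightarrow> fd.cfeas c"
proof -
  have "S \<in> \<S>\<^sub>D \<Longrightarrow> S \<in> \<F>" for S using SDC_bdry bdry_facets_sub by blast
  then show ?thesis using crf_CR crf_facet_value[unfolded facet_value_def] by (auto simp: K_cr_def fd.cfeas_def)
qed

lemma load_term: "ip \<Omega> fh (elem_mean \<T> (crf c)) = (\<Sum>S\<in>\<I> \<union> \<S>\<^sub>D \<union> \<S>\<^sub>C. load f S * c S)"
proof -
  have "ip \<Omega> fh (elem_mean \<T> (crf c)) = (\<Sum>T\<in>\<T>. vol T * (f T * ((\<Sum>p\<in>verts T. c (opp T p)) / (real CARD('n) + 1))))"
    unfolding elem_mean_crf ip_pw by simp
  also have "\<dots> = (\<Sum>T\<in>\<T>. \<Sum>p\<in>verts T. vol T * f T / (real CARD('n) + 1) * c (opp T p))"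
    by (simp add: sum_distrib_left sum_divide_distrib mult_ac)
  also have "\<dots> = (\<Sum>S\<in>\<F>. \<Sum>T\<in>els S. vol T * f T / (real CARD('n) + 1) * c (opp T (apex T S)))"
    by (rule facet_double_sum)
  also have "\<dots> = (\<Sum>S\<in>\<F>. load f S * c S)"
    unfolding load_def sum_distrib_right by (intro sum.cong refl) (simp add: apex_props)
  finally show ?thesis by (simp add: facets_split)
qed

lemma SC_terms:
  "facet_ip \<S>\<^sub>C bh (pos_part (cr_facet_mean \<T> (crf c))) - facet_ip \<S>\<^sub>C ah (neg_part (cr_facet_mean \<T> (crf c))) = (\<Sum>S\<in>\<S>\<^sub>C. fd.\<psi> S (c S))"
proof -
  have "facet_ip \<S>\<^sub>C bh (pos_part (cr_facet_mean \<T> (crf c))) = (\<Sum>S\<in>\<S>\<^sub>C. area S * (\<beta> S * max 0 (c S)))"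
    by (rule facet_ip_bdry) (simp add: pos_part_def cr_facet_mean_crf[OF SDC_bdry(2)])
  moreover have "facet_ip \<S>\<^sub>C ah (neg_part (cr_facet_mean \<T> (crf c))) = (\<Sum>S\<in>\<S>\<^sub>C. area S * (\<alpha> S * max 0 (- c S)))"
    by (rule facet_ip_bdry) (simp add: neg_part_def cr_facet_mean_crf[OF SDC_bdry(2)])
  ultimately show ?thesis by (simp add: fd.\<psi>_def sum_subtractf mult_ac)
qed

lemma F_value: "F_h \<Omega> \<T> \<S>\<^sub>D \<S>\<^sub>C fh ah bh ph (crf c) =
  ereal (- (\<Sum>S\<in>\<I> \<union> \<S>\<^sub>D \<union> \<S>\<^sub>C. load f S * c S) + (\<Sum>S\<in>\<S>\<^sub>C. fd.\<psi> S (c S))) + (if fd.cfeas c then 0 else \<infinity>)"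
proof -
  have "- ip \<Omega> fh (elem_mean \<T> (crf c)) + facet_ip \<S>\<^sub>C bh (pos_part (cr_facet_mean \<T> (crf c)))
     - facet_ip \<S>\<^sub>C ah (neg_part (cr_facet_mean \<T> (crf c)))
    = - (\<Sum>S\<in>\<I> \<union> \<S>\<^sub>D \<union> \<S>\<^sub>C. load f S * c S) + (\<Sum>S\<in>\<S>\<^sub>C. fd.\<psi> S (c S))"
    using SC_terms[of c] load_term[of c] by linarith
  then show ?thesis unfolding F_h_def crf_KC by simp
qed

lemma G_value: "G_h \<Omega> Kh (pw \<T> (\<lambda>T _. w T)) = (\<Sum>T\<in>\<T>. vol T * (norm (K_half T (w T)))\<^sup>2) / 2"
proof -
  have "(LINT x|lebesgue_on \<Omega>. (norm (mat_sqrt (Kh x) *v pw \<T> (\<lambda>T _. w T) x))\<^sup>2) = (\<Sum>T\<in>\<T>. vol T * (norm (K_half T (w T)))\<^sup>2)"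
    by (rule P0_integral) (simp_all add: pw_in pw_out K_half_def)
  then show ?thesis by (simp add: G_h_def)
qed

lemma I_value: "Icr (crf c) = (if fd.cfeas c then ereal (fd.J c) else \<infinity>)"
  unfolding I_cr_def F_value elem_grad_crf G_value by (simp add: fd.J_def fd_L)

lemma I_argmin_iff: "is_arg_min Icr (\<lambda>q. q \<in> CR \<Omega> \<T>) p \<and> p \<in> KC \<longleftrightarrow> (\<exists>c. p = crf c \<and> fd.minimizer c)"
proof
  assume a: "is_arg_min Icr (\<lambda>q. q \<in> CR \<Omega> \<T>) p \<and> p \<in> KC"
  then have pc: "p = crf (facet_value p)" using CR_repr by (simp add: is_arg_min_def)
  define c where "c = facet_value p"
  have p: "p = crf c" using pc by (simp add: c_def)
  have cf: "fd.cfeas c" using a crf_KC p by simp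
  have "fd.J c \<le> fd.J c'" if c': "fd.cfeas c'" for c'
  proof -
    have "\<not> Icr (crf c') < Icr (crf c)" using a p crf_CR by (auto simp: is_arg_min_def)
    then show ?thesis using cf c' by (simp add: I_value)
  qed
  then show "\<exists>c. p = crf c \<and> fd.minimizer c" using p cf by (auto simp: fd.minimizer_def)
next
  assume "\<exists>c. p = crf c \<and> fd.minimizer c"
  then obtain c where c: "p = crf c" "fd.minimizer c" by blast
  then have cf: "fd.cfeas c" by (simp add: fd.minimizer_def)
  have "\<not> Icr q < Icr p" if q: "q \<in> CR \<Omega> \<T>" for q
  proof -
    obtain c' where c': "q = crf c'" using CR_repr[OF q] by blast
    show ?thesis unfolding c(1) c' I_value using c(2) by (simp add: fd.minimizer_def not_less)
  qed
  then show "is_arg_min Icr (\<lambda>q. q \<in> CR \<Omega> \<T>) p \<and> p \<in> KC"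
    using c crf_CR crf_KC cf by (auto simp: is_arg_min_def)
qed

lemma uminus_pw: "(\<lambda>x. - pw \<T> (\<lambda>T _. \<zeta> T) x) = pw \<T> (\<lambda>T _. - \<zeta> T)" for \<zeta> :: "(real^'n) set \<Rightarrow> real^'n"
  by (rule ext) (simp add: pw_def sum_negf)

lemma G_conj_value: "G_conj \<Omega> \<T> Kh (\<lambda>x. - pw \<T> (\<lambda>T _. \<zeta> T) x) = ereal ((\<Sum>T\<in>\<T>. vol T * (norm (K_half_inv T (\<zeta> T)))\<^sup>2) / 2)"
  unfolding G_conj_def uminus_pw
proof (rule SUP_eqI)
  fix w :: "real^'n \<Rightarrow> real^'n" assume "w \<in> P0 \<T>"
  then obtain w' where w: "w = pw \<T> (\<lambda>T _. w' T)" using P0_iff by blast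
  show "ereal (ip \<Omega> (pw \<T> (\<lambda>T _. - \<zeta> T)) w - G_h \<Omega> Kh w) \<le> ereal ((\<Sum>T\<in>\<T>. vol T * (norm (K_half_inv T (\<zeta> T)))\<^sup>2) / 2)"
    unfolding w ip_pw G_value using fd.conjugate_bound[of \<zeta> w'] by simp
next
  fix y assume y: "\<And>w. w \<in> P0 \<T> \<Longrightarrow> ereal (ip \<Omega> (pw \<T> (\<lambda>T _. - \<zeta> T)) w - G_h \<Omega> Kh w) \<le> y"
  have "pw \<T> (\<lambda>T _. - K_half_inv T (K_half_inv T (\<zeta> T))) \<in> P0 \<T>"
    unfolding P0_iff by (rule exI[of _ "\<lambda>T. - K_half_inv T (K_half_inv T (\<zeta> T))"]) (rule refl)
  from y[OF this] show "ereal ((\<Sum>T\<in>\<T>. vol T * (norm (K_half_inv T (\<zeta> T)))\<^sup>2) / 2) \<le> y"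
    unfolding ip_pw G_value fd.conjugate_attained .
qed

lemma F_conj_term:
  "ereal (ip \<Omega> (pw \<T> (\<lambda>T _. \<zeta> T)) (elem_grad \<T> (crf c))) - F_h \<Omega> \<T> \<S>\<^sub>D \<S>\<^sub>C fh ah bh ph (crf c)
    = (if fd.cfeas c then ereal (fd.H \<zeta> c) else - \<infinity>)"
  unfolding F_value elem_grad_crf ip_pw fd.H_def using fd.summation_by_parts[of \<zeta> c] by (simp add: fd_L)

text \<open>
  Conjugating in the facet coefficients turns the admissibility of the dual field into the
  effective domain: the supremum is attained for admissible means and infinite otherwise.
\<close>
lemma F_conj_value:
  "F_conj \<Omega> \<T> \<S>\<^sub>D \<S>\<^sub>C fh ah bh ph (pw \<T> (\<lambda>T _. \<zeta> T)) = (if fd.zfeas \<zeta> then ereal (\<Sum>S\<in>\<S>\<^sub>D. pd S * fd.R \<zeta> S) else \<infinity>)"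
proof (cases "fd.zfeas \<zeta>")
  case True
  have "F_conj \<Omega> \<T> \<S>\<^sub>D \<S>\<^sub>C fh ah bh ph (pw \<T> (\<lambda>T _. \<zeta> T)) = ereal (\<Sum>S\<in>\<S>\<^sub>D. pd S * fd.R \<zeta> S)"
    unfolding F_conj_def
  proof (rule SUP_eqI)
    fix q assume "q \<in> CR \<Omega> \<T>"
    then obtain c where q: "q = crf c" using CR_repr by blast
    show "ereal (ip \<Omega> (pw \<T> (\<lambda>T _. \<zeta> T)) (elem_grad \<T> q)) - F_h \<Omega> \<T> \<S>\<^sub>D \<S>\<^sub>C fh ah bh ph q \<le> ereal (\<Sum>S\<in>\<S>\<^sub>D. pd S * fd.R \<zeta> S)"
      unfolding q F_conj_term using fd.H_le[OF True] by simp
  next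
    fix y assume y: "\<And>q. q \<in> CR \<Omega> \<T> \<Longrightarrow> ereal (ip \<Omega> (pw \<T> (\<lambda>T _. \<zeta> T)) (elem_grad \<T> q)) - F_h \<Omega> \<T> \<S>\<^sub>D \<S>\<^sub>C fh ah bh ph q \<le> y"
    obtain c where c: "fd.cfeas c" "fd.H \<zeta> c = (\<Sum>S\<in>\<S>\<^sub>D. pd S * fd.R \<zeta> S)" by (rule fd.H_attained[OF True])
    show "ereal (\<Sum>S\<in>\<S>\<^sub>D. pd S * fd.R \<zeta> S) \<le> y"
      using y[OF crf_CR[of c]] unfolding F_conj_term using c by simp
  qed
  then show ?thesis using True by simp
next
  case False
  have "F_conj \<Omega> \<T> \<S>\<^sub>D \<S>\<^sub>C fh ah bh ph (pw \<T> (\<lambda>T _. \<zeta> T)) = \<infinity>"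
  proof (rule ereal_top)
    fix B :: real
    obtain c where c: "fd.cfeas c" "B \<le> fd.H \<zeta> c" using fd.H_unbounded[OF False] by blast
    have "ereal (ip \<Omega> (pw \<T> (\<lambda>T _. \<zeta> T)) (elem_grad \<T> (crf c))) - F_h \<Omega> \<T> \<S>\<^sub>D \<S>\<^sub>C fh ah bh ph (crf c)
       \<le> F_conj \<Omega> \<T> \<S>\<^sub>D \<S>\<^sub>C fh ah bh ph (pw \<T> (\<lambda>T _. \<zeta> T))"
      unfolding F_conj_def by (rule SUP_upper[OF crf_CR])
    then show "ereal B \<le> F_conj \<Omega> \<T> \<S>\<^sub>D \<S>\<^sub>C fh ah bh ph (pw \<T> (\<lambda>T _. \<zeta> T))"
      unfolding F_conj_term using c by (simp add: order_trans[of "ereal B" "ereal (fd.H \<zeta> c)"])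
  qed
  then show ?thesis using False by simp
qed

text \<open>
  For admissible element means both sides are the dual energy of the one field with these means,
  and for all others both are minus infinity.
\<close>
theorem fenchel_predual:
  assumes z: "z \<in> P0 \<T>"
  shows "- G_conj \<Omega> \<T> Kh (\<lambda>x. - z x) - F_conj \<Omega> \<T> \<S>\<^sub>D \<S>\<^sub>C fh ah bh ph z = (SUP v\<in>{v \<in> RT0 \<Omega> \<T>. elem_mean \<T> v = z}. Drt v)"
proof -
  obtain \<zeta> where zz: "z = pw \<T> (\<lambda>T _. \<zeta> T)" using z P0_iff by blast
  show ?thesis
  proof (cases "fd.zfeas \<zeta>")
    case True
    have "(SUP v\<in>{v \<in> RT0 \<Omega> \<T>. elem_mean \<T> v = z}. Drt v) = ereal (fd.dual_value \<zeta>)"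
    proof (rule SUP_eqI)
      fix v assume v: "v \<in> {v \<in> RT0 \<Omega> \<T>. elem_mean \<T> v = z}"
      show "Drt v \<le> ereal (fd.dual_value \<zeta>)"
      proof (cases "v \<in> KS")
        case v2: True
        then have "v = rtf \<zeta> f" using KS_mean(1)[of v \<zeta>] v zz by simp
        then show ?thesis using D_value[OF True] by simp
      qed (simp add: D_outside)
    next
      fix y assume y: "\<And>v. v \<in> {v \<in> RT0 \<Omega> \<T>. elem_mean \<T> v = z} \<Longrightarrow> Drt v \<le> y"
      have "rtf \<zeta> f \<in> KS" using rtf_KS True by simp
      then have "rtf \<zeta> f \<in> {v \<in> RT0 \<Omega> \<T>. elem_mean \<T> v = z}" using rtf_mean zz by (simp add: K_star_def)
      from y[OF this] show "ereal (fd.dual_value \<zeta>) \<le> y" using D_value[OF True] by simp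
    qed
    then show ?thesis unfolding zz G_conj_value F_conj_value using True by (simp add: fd.dual_value_def)
  next
    case False
    have "Drt v = - \<infinity>" if "v \<in> {v \<in> RT0 \<Omega> \<T>. elem_mean \<T> v = z}" for v
      using that KS_mean(2)[of v \<zeta>] False zz D_outside by blast
    then have "(SUP v\<in>{v \<in> RT0 \<Omega> \<T>. elem_mean \<T> v = z}. Drt v) = - \<infinity>"
      by (intro SUP_eqI) auto
    then show ?thesis unfolding zz G_conj_value F_conj_value using False by simp
  qed
qed

text \<open>
  The field of a minimizer \<open>c\<close> has no duality gap with \<open>c\<close>. A maximizer then has no gap with \<open>c\<close>
  either, and a vanishing gap determines its element means.
\<close>
lemma D_argmax_iff:
  assumes c: "fd.minimizer c" and ne: "KS \<noteq> {}"
  shows "is_arg_max Drt (\<lambda>v. v \<in> KS) u \<longleftrightarrow> u = rtf (\<lambda>T. - (K T *v cr_grad T c)) f"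
    "Drt (rtf (\<lambda>T. - (K T *v cr_grad T c)) f) = ereal (fd.J c)"
    "fd.zfeas (\<lambda>T. - (K T *v cr_grad T c))"
proof -
  obtain \<zeta>0 where z0: "fd.zfeas \<zeta>0" using ne KS_iff by blast
  have ab: "area S * \<alpha> S \<le> area S * \<beta> S" if "S \<in> \<S>\<^sub>C" for S using z0 that by (force simp: fd.zfeas_def)
  define \<zeta> where "\<zeta> = (\<lambda>T. - K_half T (K_half T (fd.L T c)))"
  have "pw \<T> (\<lambda>T _. \<zeta> T) = pw \<T> (\<lambda>T _. - (K T *v cr_grad T c))"
    by (rule pw_cong) (simp add: \<zeta>_def K_half_squared fd_L)
  note e = this[symmetric]
  have eq: "rtf (\<lambda>T. - (K T *v cr_grad T c)) f = rtf \<zeta> f" by (rule rtf_inject[OF e])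
  have zeq: "fd.zfeas (\<lambda>T. - (K T *v cr_grad T c)) = fd.zfeas \<zeta>" by (rule zfeas_cong[OF e])
  have zf: "fd.zfeas \<zeta>" and J: "fd.J c = fd.dual_value \<zeta>"
    unfolding \<zeta>_def by (rule fd.minimizer_optimality[OF c ab], simp)+
  have cf: "fd.cfeas c" using c by (simp add: fd.minimizer_def)
  show "fd.zfeas (\<lambda>T. - (K T *v cr_grad T c))" using zeq zf by simp
  show "Drt (rtf (\<lambda>T. - (K T *v cr_grad T c)) f) = ereal (fd.J c)" unfolding eq D_value[OF zf] J ..
  show "is_arg_max Drt (\<lambda>v. v \<in> KS) u \<longleftrightarrow> u = rtf (\<lambda>T. - (K T *v cr_grad T c)) f"
  proof
    assume u: "is_arg_max Drt (\<lambda>v. v \<in> KS) u"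
    then obtain \<zeta>' where z': "u = rtf \<zeta>' f" "fd.zfeas \<zeta>'" using KS_iff by (auto simp: is_arg_max_def)
    have "\<not> Drt u < Drt (rtf \<zeta> f)" using u rtf_KS zf by (auto simp: is_arg_max_def)
    then have "fd.J c \<le> fd.dual_value \<zeta>'" using D_value[OF zf] D_value[OF z'(2)] z'(1) J by simp
    then have "\<forall>T\<in>\<T>. \<zeta>' T = \<zeta> T" using fd.zero_gap(1)[OF cf z'(2)] by (simp add: \<zeta>_def)
    then have "pw \<T> (\<lambda>T _. \<zeta>' T) = pw \<T> (\<lambda>T _. \<zeta> T)" by (intro pw_cong) auto
    then show "u = rtf (\<lambda>T. - (K T *v cr_grad T c)) f" unfolding eq z'(1) by (rule rtf_inject)
  next
    assume u: "u = rtf (\<lambda>T. - (K T *v cr_grad T c)) f"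
    have "\<not> Drt u < Drt v" if v: "v \<in> KS" for v
    proof -
      obtain \<zeta>' where z': "v = rtf \<zeta>' f" "fd.zfeas \<zeta>'" using v KS_iff by blast
      then show ?thesis using fd.weak_duality[OF cf z'(2)] D_value[OF z'(2)] D_value[OF zf] J u eq by simp
    qed
    then show "is_arg_max Drt (\<lambda>v. v \<in> KS) u" using u eq rtf_KS zf by (auto simp: is_arg_max_def)
  qed
qed

theorem strong_duality:
  assumes ne: "KS \<noteq> {}"
  shows "\<exists>!u. is_arg_max Drt (\<lambda>v. v \<in> KS) u"
    and "\<exists>p\<in>KC. is_arg_min Icr (\<lambda>q. q \<in> CR \<Omega> \<T>) p"
    and "\<S>\<^sub>D \<noteq> {} \<Longrightarrow> \<exists>!p. p \<in> KC \<and> is_arg_min Icr (\<lambda>q. q \<in> CR \<Omega> \<T>) p"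
    and "is_arg_max Drt (\<lambda>v. v \<in> KS) u \<Longrightarrow> p \<in> KC \<Longrightarrow> is_arg_min Icr (\<lambda>q. q \<in> CR \<Omega> \<T>) p \<Longrightarrow>
      Icr p = Drt u \<and> elem_mean \<T> u = (\<lambda>x. - (Kh x *v elem_grad \<T> p x)) \<and>
      facet_ip \<S>\<^sub>C (normal_flux \<Omega> \<T> u) (cr_facet_mean \<T> p)
        = facet_ip \<S>\<^sub>C bh (pos_part (cr_facet_mean \<T> p)) - facet_ip \<S>\<^sub>C ah (neg_part (cr_facet_mean \<T> p))"
proof -
  obtain \<zeta>0 where z0: "fd.zfeas \<zeta>0" using ne KS_iff by blast
  obtain c where c: "fd.minimizer c" by (rule fd.minimizer_exists[OF z0])
  show "\<exists>!u. is_arg_max Drt (\<lambda>v. v \<in> KS) u" using D_argmax_iff(1)[OF c ne] by auto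
  show "\<exists>p\<in>KC. is_arg_min Icr (\<lambda>q. q \<in> CR \<Omega> \<T>) p" using I_argmin_iff c by blast
  show "\<exists>!p. p \<in> KC \<and> is_arg_min Icr (\<lambda>q. q \<in> CR \<Omega> \<T>) p" if SD: "\<S>\<^sub>D \<noteq> {}"
  proof (rule ex1I[of _ "crf c"])
    show "crf c \<in> KC \<and> is_arg_min Icr (\<lambda>q. q \<in> CR \<Omega> \<T>) (crf c)" using I_argmin_iff c by blast
    fix p assume "p \<in> KC \<and> is_arg_min Icr (\<lambda>q. q \<in> CR \<Omega> \<T>) p"
    then obtain c' where c': "p = crf c'" "fd.minimizer c'" using I_argmin_iff by blast
    have "c' S = c S" if "S \<in> \<F>" for S
      using fd.minimizer_unique[OF c'(2) c z0 SD] that unfolding facets_split by blast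
    then show "p = crf c" unfolding c'(1) by (rule crf_cong)
  qed
  show "Icr p = Drt u \<and> elem_mean \<T> u = (\<lambda>x. - (Kh x *v elem_grad \<T> p x)) \<and>
      facet_ip \<S>\<^sub>C (normal_flux \<Omega> \<T> u) (cr_facet_mean \<T> p)
        = facet_ip \<S>\<^sub>C bh (pos_part (cr_facet_mean \<T> p)) - facet_ip \<S>\<^sub>C ah (neg_part (cr_facet_mean \<T> p))"
    if u: "is_arg_max Drt (\<lambda>v. v \<in> KS) u" and p: "p \<in> KC" "is_arg_min Icr (\<lambda>q. q \<in> CR \<Omega> \<T>) p"
  proof -
    obtain c where c: "p = crf c" "fd.minimizer c" using I_argmin_iff p by blast
    define \<zeta> where "\<zeta> = (\<lambda>T. - (K T *v cr_grad T c))"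
    note D = D_argmax_iff[OF c(2) ne, folded \<zeta>_def]
    have ur: "u = rtf \<zeta> f" using u D(1) by simp
    have cf: "fd.cfeas c" using c(2) by (simp add: fd.minimizer_def)
    have 1: "Icr p = Drt u" unfolding c(1) ur I_value D(2) using cf by simp
    have 2: "elem_mean \<T> u = (\<lambda>x. - (Kh x *v elem_grad \<T> p x))"
      unfolding ur rtf_mean c(1) elem_grad_crf
      by (rule pw_eqI[symmetric]) (simp_all add: pw_in pw_out \<zeta>_def)
    have "fd.J c \<le> fd.dual_value \<zeta>" using D(2) D_value[OF D(3)] by simp
    \<comment> \<open>Complementarity at each contact facet, the second consequence of a vanishing gap.\<close>
    then have gap: "\<forall>S\<in>\<S>\<^sub>C. fd.\<psi> S (c S) = fd.R \<zeta> S * c S" by (rule fd.zero_gap(2)[OF cf D(3)])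
    have "facet_ip \<S>\<^sub>C (normal_flux \<Omega> \<T> u) (cr_facet_mean \<T> p) = (\<Sum>S\<in>\<S>\<^sub>C. area S * (flux \<zeta> f S / area S * c S))"
    proof (rule facet_ip_bdry)
      fix S x assume S: "S \<in> \<S>\<^sub>C" and x: "x \<in> rel_interior S"
      note Sb = SDC_bdry(2)[OF S]
      have "S \<in> \<F>" using Sb bdry_facets_sub by blast
      then have "normal_flux \<Omega> \<T> u S x = flux \<zeta> f S / area S"
        unfolding ur using rtf_normal_flux[OF Sb x, of \<zeta> f] area_pos[of S] by (simp add: field_simps)
      then show "normal_flux \<Omega> \<T> u S x * cr_facet_mean \<T> p S x = flux \<zeta> f S / area S * c S"
        unfolding c(1) cr_facet_mean_crf[OF Sb] by simp
    qed
    also have "\<dots> = (\<Sum>S\<in>\<S>\<^sub>C. fd.\<psi> S (c S))"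
    proof (intro sum.cong refl)
      fix S assume S: "S \<in> \<S>\<^sub>C"
      then have "area S \<noteq> 0" using area_pos[of S] SDC_bdry(2) bdry_facets_sub by force
      then show "area S * (flux \<zeta> f S / area S * c S) = fd.\<psi> S (c S)" using gap S by (simp add: fd_R)
    qed
    finally show ?thesis using 1 2 SC_terms[of c] c(1) by simp
  qed
qed

end

section \<open>Element means of the coefficient matrix\<close>

text \<open>
  Symmetry and the bounds are linear conditions on the matrix, so they survive averaging. The
  mean is meaningful because the upper bound on the form bounds all entries.
\<close>
lemma matrix_mean_properties:
  fixes K :: "real^'n \<Rightarrow> real^'n^'n"
  assumes m: "K \<in> borel_measurable (lebesgue_on \<Omega>)" and U: "open U" "bounded U" "U \<subseteq> \<Omega>" "measure lebesgue U > 0"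
    and sym: "\<forall>x\<in>\<Omega>. transpose (K x) = K x" and k: "0 < k0"
    and bd: "\<forall>x\<in>\<Omega>. \<forall>\<xi>. k0 * (norm \<xi>)\<^sup>2 \<le> \<xi> \<bullet> (K x *v \<xi>) \<and> \<xi> \<bullet> (K x *v \<xi>) \<le> k1 * (norm \<xi>)\<^sup>2"
  defines "A \<equiv> (LINT y|lebesgue_on U. K y) /\<^sub>R measure lebesgue U"
  shows "transpose A = A" "k0 * (norm \<xi>)\<^sup>2 \<le> \<xi> \<bullet> (A *v \<xi>)" "\<xi> \<bullet> (A *v \<xi>) \<le> k1 * (norm \<xi>)\<^sup>2"
proof -
  let ?M = "lebesgue_on U"
  have Us: "U \<in> sets lebesgue" using U(1) by simp
  have fmU: "emeasure lebesgue U < \<infinity>" using emeasure_bounded_finite[OF U(2)] U(1) by simp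
  interpret finite_measure ?M
    using Us fmU by (intro finite_measureI) (simp add: emeasure_restrict_space space_restrict_space less_top[symmetric])
  have mU: "K \<in> borel_measurable ?M" by (rule measurable_restrict_mono[OF m U(3)])
  \<comment> \<open>Off-diagonal entries are bounded by the diagonal through the Cauchy--Schwarz
    inequality.\<close>
  have entry: "\<bar>K x $ i $ j\<bar> \<le> k1" if x: "x \<in> U" for x i j
  proof -
    have x': "x \<in> \<Omega>" using x U by blast
    have psd: "0 \<le> \<xi> \<bullet> (K x *v \<xi>)" for \<xi>
      using bd x' k by (meson mult_nonneg_nonneg order_trans less_imp_le zero_le_power2)
    have dg: "axis i 1 \<bullet> (K x *v axis i 1) \<le> k1" for i
      using bspec[OF bd x'] by (metis mult.right_neutral norm_axis_1 one_power2)
    have k1: "0 \<le> k1" using psd[of "axis i 1"] dg[of i] by linarith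
    have "(axis i 1 \<bullet> (K x *v axis j 1))\<^sup>2 \<le> (axis i 1 \<bullet> (K x *v axis i 1)) * (axis j 1 \<bullet> (K x *v axis j 1))"
    proof (rule psd_Cauchy_Schwarz)
      show "linear ((*v) (K x))" by simp
      show "u \<bullet> (K x *v w) = (K x *v u) \<bullet> w" for u w
        using inner_matrix_vector_transpose[of u "K x" w] sym x' by simp
    qed (rule psd)
    also have "\<dots> \<le> k1 * k1" by (rule mult_mono[OF dg dg k1 psd])
    also have "\<dots> = k1\<^sup>2" by (simp add: power2_eq_square)
    also have "axis i 1 \<bullet> (K x *v axis j 1) = K x $ i $ j"
      by (simp add: matrix_vector_mult_basis column_def inner_axis')
    finally have "\<bar>K x $ i $ j\<bar> \<le> \<bar>k1\<bar>" by (simp add: abs_le_square_iff)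
    then show ?thesis using k1 by simp
  qed
  have nb: "norm (K x) \<le> real CARD('n) * (real CARD('n) * k1)" if x: "x \<in> U" for x
  proof -
    have "norm (K x) \<le> (\<Sum>i\<in>UNIV. norm (K x $ i))" by (subst norm_vec_def) (rule L2_set_le_sum, simp)
    also have "\<dots> \<le> (\<Sum>i\<in>(UNIV::'n set). real CARD('n) * k1)"
    proof (rule sum_mono)
      fix i
      have "norm (K x $ i) \<le> (\<Sum>j\<in>UNIV. \<bar>K x $ i $ j\<bar>)" by (rule norm_le_l1_cart)
      also have "\<dots> \<le> (\<Sum>j\<in>(UNIV::'n set). k1)" by (intro sum_mono entry[OF x])
      finally show "norm (K x $ i) \<le> real CARD('n) * k1" by simp
    qed
    finally show ?thesis by simp
  qed
  have sp: "space ?M = U" by (simp add: space_restrict_space)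
  have int: "integrable ?M K"
    by (rule integrable_const_bound[OF AE_I2 mU]) (use nb sp in auto)
  have val: "u \<bullet> (A *v w) = (LINT y|?M. u \<bullet> (K y *v w)) / measure lebesgue U"
    and vint: "integrable ?M (\<lambda>y. u \<bullet> (K y *v w))" for u w
  proof -
    have "linear (\<lambda>B :: real^'n^'n. u \<bullet> (B *v w))"
      by (intro linearI) (simp_all add: matrix_vector_mult_add_rdistrib inner_add_right scaleR_matrix_vector_assoc[symmetric])
    then have bl: "bounded_linear (\<lambda>B :: real^'n^'n. u \<bullet> (B *v w))" by (simp add: linear_conv_bounded_linear)
    show "integrable ?M (\<lambda>y. u \<bullet> (K y *v w))" by (rule integrable_bounded_linear[OF bl int])
    show "u \<bullet> (A *v w) = (LINT y|?M. u \<bullet> (K y *v w)) / measure lebesgue U"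
      using integral_bounded_linear[OF bl int]
      by (simp add: A_def scaleR_matrix_vector_assoc[symmetric] divide_inverse mult.commute)
  qed
  have mm: "measure ?M (space ?M) = measure lebesgue U"
    using Us by (simp add: sp measure_restrict_space)
  have "u \<bullet> (A *v w) = u \<bullet> (transpose A *v w)" for u w
  proof -
    have "u \<bullet> (A *v w) = w \<bullet> (A *v u)"
      unfolding val
    proof (intro arg_cong2[of _ _ _ _ "(/)"] Bochner_Integration.integral_cong refl)
      fix y assume "y \<in> space ?M"
      then have "y \<in> \<Omega>" using sp U by auto
      then show "u \<bullet> (K y *v w) = w \<bullet> (K y *v u)"
        using inner_matrix_vector_transpose[of u "K y" w] sym by (simp add: inner_commute)
    qed
    also have "\<dots> = u \<bullet> (transpose A *v w)"
      using inner_matrix_vector_transpose[of w A u] by (simp add: inner_commute)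
    finally show ?thesis .
  qed
  then have "A *v w = transpose A *v w" for w by (metis vector_eq_ldot)
  then show "transpose A = A" by (simp add: matrix_eq)
  have "(LINT y|?M. k0 * (norm \<xi>)\<^sup>2) \<le> (LINT y|?M. \<xi> \<bullet> (K y *v \<xi>))"
    by (rule integral_mono[OF _ vint]) (use bd sp U in auto)
  then show "k0 * (norm \<xi>)\<^sup>2 \<le> \<xi> \<bullet> (A *v \<xi>)" unfolding val using mm U(4) by (simp add: field_simps)
  have "(LINT y|?M. \<xi> \<bullet> (K y *v \<xi>)) \<le> (LINT y|?M. k1 * (norm \<xi>)\<^sup>2)"
    by (rule integral_mono[OF vint]) (use bd sp U in auto)
  then show "\<xi> \<bullet> (A *v \<xi>) \<le> k1 * (norm \<xi>)\<^sup>2" unfolding val using mm U(4) by (simp add: field_simps)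
qed

section \<open>Discrete strong duality\<close>

theorem theorem5p3:
  fixes \<Omega> \<Gamma>\<^sub>D \<Gamma>\<^sub>C :: "(real^'n) set"
    and \<T> \<S>\<^sub>D \<S>\<^sub>C :: "(real^'n) set set"
    and f pD phat fh pDh :: "real^'n \<Rightarrow> real"
    and \<alpha> \<beta> :: "real^'n \<Rightarrow> real"
    and \<alpha>h \<beta>h :: "(real^'n) set \<Rightarrow> real^'n \<Rightarrow> real"
    and K Kh :: "real^'n \<Rightarrow> real^'n^'n"
    and k0 k1 :: real
    and Kstar :: "(real^'n \<Rightarrow> real^'n) set"
    and Kset :: "(real^'n \<Rightarrow> real) set"
    and D :: "(real^'n \<Rightarrow> real^'n) \<Rightarrow> ereal"
    and I :: "(real^'n \<Rightarrow> real) \<Rightarrow> ereal"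
  assumes dim: "CARD('n) = 2 \<or> CARD('n) = 3"
    and domain: "polyhedral_lipschitz_domain \<Omega>"
    and bdry_open: "openin (top_of_set (frontier \<Omega>)) \<Gamma>\<^sub>D" "openin (top_of_set (frontier \<Omega>)) \<Gamma>\<^sub>C"
    and bdry_disjoint: "\<Gamma>\<^sub>D \<inter> \<Gamma>\<^sub>C = {}"
    and bdry_cover: "frontier \<Omega> = closure \<Gamma>\<^sub>D \<union> closure \<Gamma>\<^sub>C"
    and mesh: "conforming_mesh \<Omega> \<T>"
    and mesh_bdry: "\<forall>S\<in>bdry_facets \<Omega> \<T>. (S \<subseteq> closure \<Gamma>\<^sub>D) \<noteq> (S \<subseteq> closure \<Gamma>\<^sub>C)"
    and SD: "\<S>\<^sub>D = bdry_facets_in \<Omega> \<T> \<Gamma>\<^sub>D"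
    and SC: "\<S>\<^sub>C = bdry_facets_in \<Omega> \<T> \<Gamma>\<^sub>C"
    and f_L2: "L2 (lebesgue_on \<Omega>) f"
    and phat: "phat \<in> H1 \<Omega>" "\<forall>S\<in>\<S>\<^sub>D. has_facet_trace \<Omega> S phat pD"
    and K_meas: "K \<in> borel_measurable (lebesgue_on \<Omega>)"
    and K_sym: "\<forall>x\<in>\<Omega>. transpose (K x) = K x"
    and K_bounds: "0 < k0" "k0 < k1"
      "\<forall>x\<in>\<Omega>. \<forall>\<xi>. k0 * (norm \<xi>)\<^sup>2 \<le> \<xi> \<bullet> (K x *v \<xi>) \<and> \<xi> \<bullet> (K x *v \<xi>) \<le> k1 * (norm \<xi>)\<^sup>2"
    and \<alpha>\<beta>_L2: "\<forall>S\<in>\<S>\<^sub>C. L2 (facet_measure S) \<alpha> \<and> L2 (facet_measure S) \<beta>"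
    and \<alpha>_le_\<beta>: "\<forall>S\<in>\<S>\<^sub>C. AE x in facet_measure S. \<alpha> x \<le> \<beta> x"
    and compat: "\<Gamma>\<^sub>D = {} \<longrightarrow>
      (\<Sum>S\<in>\<S>\<^sub>C. LINT x|facet_measure S. \<alpha> x) \<le> (LINT x|lebesgue_on \<Omega>. f x) \<and>
      (LINT x|lebesgue_on \<Omega>. f x) \<le> (\<Sum>S\<in>\<S>\<^sub>C. LINT x|facet_measure S. \<beta> x)"
    and Kh: "Kh = elem_mean \<T> K"
    and fh: "fh = elem_mean \<T> f"
    and \<alpha>h: "\<alpha>h = facet_mean \<alpha>"
    and \<beta>h: "\<beta>h = facet_mean \<beta>"
    and pDh: "pDh = cr_interpolant \<Omega> \<T> phat"
    and Kstar: "Kstar = K_star \<Omega> \<T> \<S>\<^sub>C fh \<alpha>h \<beta>h"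
    and Kset: "Kset = K_cr \<Omega> \<T> \<S>\<^sub>D pDh"
    and D: "D = D_rt \<Omega> \<T> \<S>\<^sub>D \<S>\<^sub>C Kh fh \<alpha>h \<beta>h pDh"
    and I: "I = I_cr \<Omega> \<T> \<S>\<^sub>D \<S>\<^sub>C Kh fh \<alpha>h \<beta>h pDh"
    and Kstar_ne: "Kstar \<noteq> {}"
  shows
    "(\<exists>!u. is_arg_max D (\<lambda>v. v \<in> Kstar) u)
     \<and>
     (\<forall>z\<in>P0 \<T>. - G_conj \<Omega> \<T> Kh (\<lambda>x. - z x) - F_conj \<Omega> \<T> \<S>\<^sub>D \<S>\<^sub>C fh \<alpha>h \<beta>h pDh z
                = (SUP v\<in>{v \<in> RT0 \<Omega> \<T>. elem_mean \<T> v = z}. D v))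
     \<and>
     (\<exists>p\<in>Kset. is_arg_min I (\<lambda>q. q \<in> CR \<Omega> \<T>) p)
     \<and>
     (bdry_area \<Omega> \<T> \<Gamma>\<^sub>D > 0 \<longrightarrow> (\<exists>!p. p \<in> Kset \<and> is_arg_min I (\<lambda>q. q \<in> CR \<Omega> \<T>) p))
     \<and>
     (\<forall>u p. is_arg_max D (\<lambda>v. v \<in> Kstar) u \<and> p \<in> Kset \<and> is_arg_min I (\<lambda>q. q \<in> CR \<Omega> \<T>) p \<longrightarrow>
        I p = D u \<and>
        elem_mean \<T> u = (\<lambda>x. - (Kh x *v elem_grad \<T> p x)) \<and>
        facet_ip \<S>\<^sub>C (normal_flux \<Omega> \<T> u) (cr_facet_mean \<T> p)
          = facet_ip \<S>\<^sub>C \<beta>h (pos_part (cr_facet_mean \<T> p))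
            - facet_ip \<S>\<^sub>C \<alpha>h (neg_part (cr_facet_mean \<T> p)))"
proof -
  have \<Omega>: "open \<Omega>" "connected \<Omega>" "\<Omega> \<noteq> {}" "bounded \<Omega>" "lipschitz_boundary \<Omega>"
    using domain by (auto simp: polyhedral_lipschitz_domain_def)
  interpret mesh \<Omega> \<T>
  proof
    show "CARD('n) \<ge> 2" using dim by auto
    show "interior (closure \<Omega>) = \<Omega>" by (rule lipschitz_boundary_interior_closure[OF \<Omega>(1,5)])
  qed (use \<Omega> mesh in auto)
  define KT where "KT T = (LINT y|lebesgue_on (interior T). K y) /\<^sub>R measure lebesgue (interior T)" for T
  define fT where "fT T = (LINT y|lebesgue_on (interior T). f y) /\<^sub>R measure lebesgue (interior T)" for T
  define a where "a S = (LINT s|facet_measure S. \<alpha> s) / measure (facet_measure S) S" for S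
  define b where "b S = (LINT s|facet_measure S. \<beta> s) / measure (facet_measure S) S" for S
  define pd where "pd = facet_value pDh"
  have Kh': "Kh = pw \<T> (\<lambda>T _. KT T)" and fh': "fh = pw \<T> (\<lambda>T _. fT T)"
    unfolding Kh fh elem_mean_pw KT_def fT_def by (rule refl)+
  have ah': "\<alpha>h = (\<lambda>S x. a S)" and bh': "\<beta>h = (\<lambda>S x. b S)"
    by (intro ext; simp add: \<alpha>h \<beta>h facet_mean_def a_def b_def)+
  have ph': "pDh = crf pd" unfolding pd_def by (rule CR_repr) (simp add: pDh cr_interpolant_CR)
  have disj: "\<S>\<^sub>D \<union> \<S>\<^sub>C = bdry_facets \<Omega> \<T>" "\<S>\<^sub>D \<inter> \<S>\<^sub>C = {}"
    using mesh_bdry by (auto simp: SD SC bdry_facets_in_def)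
  have Kprops: "transpose (KT T) = KT T" "k0 * (norm \<xi>)\<^sup>2 \<le> \<xi> \<bullet> (KT T *v \<xi>)" "\<xi> \<bullet> (KT T *v \<xi>) \<le> k1 * (norm \<xi>)\<^sup>2"
    if T: "T \<in> \<T>" for T \<xi>
  proof -
    interpret full_simplex T by (rule element_simplex[OF T])
    have b: "bounded (interior T)" by (rule bounded_subset[OF bounded interior_subset])
    have m: "measure lebesgue (interior T) > 0" using measure_interior[OF T] measure_pos by simp
    note P = matrix_mean_properties[OF K_meas open_interior b interior_subset_Omega[OF T] m K_sym K_bounds(1,3), folded KT_def]
    show "transpose (KT T) = KT T" "k0 * (norm \<xi>)\<^sup>2 \<le> \<xi> \<bullet> (KT T *v \<xi>)" "\<xi> \<bullet> (KT T *v \<xi>) \<le> k1 * (norm \<xi>)\<^sup>2"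
      by (rule P)+
  qed
  interpret P: discrete_problem \<Omega> \<T> \<S>\<^sub>D \<S>\<^sub>C KT fT a b pd k0 k1
    by unfold_locales (use disj Kprops K_bounds in auto)
  \<comment> \<open>If all boundary facets lie in the closure of \<open>\<Gamma>\<^sub>C\<close>, none of them meets the disjoint and
    relatively open set \<open>\<Gamma>\<^sub>D\<close>, whose area is then zero.\<close>
  have SD_ne: "\<S>\<^sub>D \<noteq> {}" if pos: "bdry_area \<Omega> \<T> \<Gamma>\<^sub>D > 0"
  proof
    assume empty: "\<S>\<^sub>D = {}"
    have "measure (facet_measure S) \<Gamma>\<^sub>D = 0" if S: "S \<in> bdry_facets \<Omega> \<T>" for S
    proof -
      have "S \<in> \<S>\<^sub>C" using disj(1) empty S by auto
      then have SC': "S \<subseteq> closure \<Gamma>\<^sub>C" by (simp add: SC bdry_facets_in_def)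
      have Sf: "S \<subseteq> frontier \<Omega>" using S by (simp add: bdry_facets_def)
      obtain U where U: "open U" "\<Gamma>\<^sub>D = frontier \<Omega> \<inter> U" using bdry_open(1) by (auto simp: openin_open)
      have "\<Gamma>\<^sub>C \<subseteq> frontier \<Omega>" using bdry_open(2) by (auto simp: openin_open)
      then have "U \<inter> \<Gamma>\<^sub>C = {}" using U(2) bdry_disjoint by blast
      then have "U \<inter> closure \<Gamma>\<^sub>C = {}" using open_Int_closure_eq_empty[OF U(1)] by simp
      then have disjS: "S \<inter> \<Gamma>\<^sub>D = {}" using SC' U(2) by blast
      obtain T p where T: "T \<in> \<T>" "p \<in> verts T" "S = opp T p" using bdry_facet_element[OF S] by metis
      show ?thesis
        using full_simplex.measure_facet_measure(2)[OF element_simplex[OF T(1)] T(2) DIM2, of \<Gamma>\<^sub>D] disjS T(3) by simp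
    qed
    then have "bdry_area \<Omega> \<T> \<Gamma>\<^sub>D = 0" by (simp add: bdry_area_def)
    then show False using pos by simp
  qed
  note eqs = Kstar Kset D I Kh' fh' ah' bh' ph'
  have KS_ne: "P.KS \<noteq> {}" using Kstar_ne unfolding eqs .
  note sd = P.strong_duality[OF KS_ne]
  show ?thesis
    unfolding eqs
  proof (intro conjI impI allI)
    show "\<exists>!u. is_arg_max P.Drt (\<lambda>v. v \<in> P.KS) u" by (rule sd(1))
    show "\<forall>z\<in>P0 \<T>. - G_conj \<Omega> \<T> P.Kh (\<lambda>x. - z x) - F_conj \<Omega> \<T> \<S>\<^sub>D \<S>\<^sub>C P.fh P.ah P.bh P.ph z
        = (SUP v\<in>{v \<in> RT0 \<Omega> \<T>. elem_mean \<T> v = z}. P.Drt v)"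
      using P.fenchel_predual by blast
    show "\<exists>p\<in>P.KC. is_arg_min P.Icr (\<lambda>q. q \<in> CR \<Omega> \<T>) p" by (rule sd(2))
    show "\<exists>!p. p \<in> P.KC \<and> is_arg_min P.Icr (\<lambda>q. q \<in> CR \<Omega> \<T>) p" if "0 < bdry_area \<Omega> \<T> \<Gamma>\<^sub>D"
      by (rule sd(3)[OF SD_ne[OF that]])
  next
    fix u p
    assume up: "is_arg_max P.Drt (\<lambda>v. v \<in> P.KS) u \<and> p \<in> P.KC \<and> is_arg_min P.Icr (\<lambda>q. q \<in> CR \<Omega> \<T>) p"
    note s = sd(4)[OF up[THEN conjunct1] up[THEN conjunct2, THEN conjunct1] up[THEN conjunct2, THEN conjunct2]]
    show "P.Icr p = P.Drt u" by (rule s[THEN conjunct1])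
    show "elem_mean \<T> u = (\<lambda>x. - (P.Kh x *v elem_grad \<T> p x))" by (rule s[THEN conjunct2, THEN conjunct1])
    show "facet_ip \<S>\<^sub>C (normal_flux \<Omega> \<T> u) (cr_facet_mean \<T> p)
        = facet_ip \<S>\<^sub>C P.bh (pos_part (cr_facet_mean \<T> p)) - facet_ip \<S>\<^sub>C P.ah (neg_part (cr_facet_mean \<T> p))"
      by (rule s[THEN conjunct2, THEN conjunct2])
  qed
qed

end
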